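(* Let $(M,\nabla,\langle\cdot,\cdot\rangle)$ be an affine-Riemann manifold whose difference tensor satisfies $D(\gamma)=0$. Then, for every $k\ge1$, $(T^kM,J_k,g_k)$ is locally conformally balanced.
   Context: An affine-Riemann manifold $(M,\nabla,\langle\cdot,\cdot\rangle)$ is a manifold with a flat torsionless connection $\nabla$ and a Riemannian metric. $D$ is the Levi-Civita connection of the metric; the difference tensor is $\gamma_XY=D_XY-\nabla_XY$; $D(\gamma)$ is its covariant derivative. Canonical sequence: for a vector field $X$ on $M$, $X^h$ is the horizontal lift to $TM$ with respect to $\nabla$ and $X^v$ the vertical lift; $\pi_1:TM\to M$ is the projection. On $TM$: $J_1X^h=X^v$, $J_1X^v=-X^h$; $g_1(X^h,Y^h)=g_1(X^v,Y^v)=\langle X,Y\rangle\circ\pi_1$, $g_1(X^h,Y^v)=0$; $\nabla^1_{X^h}Y^h=(\nabla_XY)^h$, $\nabla^1_{X^h}Y^v=(\nabla_XY)^v$, $\nabla^1_{X^v}Y^h=\nabla^1_{X^v}Y^v=0$. Then $(TM,J_1,g_1)$ is Hermitian and $\nabla^1$ is flat torsionless. Inductively, with $T^1M=TM$, $T^kM=T(T^{k-1}M)$, applying the construction to $(T^{k-1}M,\nabla^{k-1},g_{k-1})$ gives $(J_k,g_k,\nabla^k)$ on $T^kM$. For a Hermitian manifold $(N,J,g)$ with Levi-Civita connection $\nabla^{LC}$: $\omega=g(J\cdot,\cdot)$, $d^*\omega(\cdot)=-\sum_i(\nabla^{LC}_{E_i}\omega)(E_i,\cdot)$ for a local $g$-orthonormal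 frame, Lee form $\theta=-d^*\omega\circ J$; it is locally conformally balanced if $d\theta=0$. *)

theory Defs
  imports "HOL-Analysis.Analysis" "HOL-Library.Function_Algebras"
begin

section \<open>Smooth functions on open subsets of Euclidean space\<close>

text \<open>
  Euclidean \<open>n\<close>-space is the library's \<^const>\<open>Euclidean_space\<close>, i.e. the functions
  \<open>nat \<Rightarrow> real\<close> that vanish from \<open>n\<close> on. A numerical dimension (instead of a type-indexed one) is
  needed because the dimension of the iterated tangent bundles varies with a natural number.
\<close>

definition pderiv_at :: "nat \<Rightarrow> ((nat \<Rightarrow> real) \<Rightarrow> real) \<Rightarrow> (nat \<Rightarrow> real) \<Rightarrow> real" where
  "pderiv_at a f x = deriv (\<lambda>t. f (x(a := t))) (x a)"

primrec Ck_on :: "nat \<Rightarrow> nat \<Rightarrow> (nat \<Rightarrow> real) set \<Rightarrow> ((nat \<Rightarrow> real) \<Rightarrow> real) \<Rightarrow> bool" where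
  "Ck_on n 0 U f \<longleftrightarrow> continuous_map (subtopology (Euclidean_space n) U) euclideanreal f"
| "Ck_on n (Suc k) U f \<longleftrightarrow>
     continuous_map (subtopology (Euclidean_space n) U) euclideanreal f \<and>
     (\<forall>a<n. (\<forall>x\<in>U. (\<lambda>t. f (x(a := t))) differentiable (at (x a))) \<and> Ck_on n k U (pderiv_at a f))"

definition smooth_real_on :: "nat \<Rightarrow> (nat \<Rightarrow> real) set \<Rightarrow> ((nat \<Rightarrow> real) \<Rightarrow> real) \<Rightarrow> bool" where
  "smooth_real_on n U f \<longleftrightarrow> (\<forall>k. Ck_on n k U f)"


section \<open>Smooth manifolds\<close>

text \<open>A manifold is given by a smooth atlas whose charts are indexed by a set in a type \<open>'i\<close>.\<close>

record ('p, 'i) manifold =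
  mtop :: "'p topology"
  mdim :: nat
  charts :: "'i set"
  cdom :: "'i \<Rightarrow> 'p set"
  coord :: "'i \<Rightarrow> 'p \<Rightarrow> nat \<Rightarrow> real"

definition cinv :: "('p, 'i) manifold \<Rightarrow> 'i \<Rightarrow> (nat \<Rightarrow> real) \<Rightarrow> 'p" where
  "cinv M i = inv_into (cdom M i) (coord M i)"

definition second_countable_space :: "'p topology \<Rightarrow> bool" where
  "second_countable_space T \<longleftrightarrow>
     (\<exists>\<B>. countable \<B> \<and> (\<forall>V\<in>\<B>. openin T V) \<and>
          (\<forall>U x. openin T U \<and> x \<in> U \<longrightarrow> (\<exists>V\<in>\<B>. x \<in> V \<and> V \<subseteq> U)))"

definition smooth_manifold :: "('p, 'i) manifold \<Rightarrow> bool" where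
  "smooth_manifold M \<longleftrightarrow>
     Hausdorff_space (mtop M) \<and> second_countable_space (mtop M) \<and>
     topspace (mtop M) = (\<Union>i\<in>charts M. cdom M i) \<and>
     (\<forall>i\<in>charts M.
        openin (mtop M) (cdom M i) \<and>
        openin (Euclidean_space (mdim M)) (coord M i ` cdom M i) \<and>
        homeomorphic_map (subtopology (mtop M) (cdom M i))
          (subtopology (Euclidean_space (mdim M)) (coord M i ` cdom M i)) (coord M i)) \<and>
     (\<forall>i\<in>charts M. \<forall>j\<in>charts M. \<forall>k<mdim M.
        smooth_real_on (mdim M) (coord M i ` (cdom M i \<inter> cdom M j)) (\<lambda>x. coord M j (cinv M i x) k))"

definition charts_at :: "('p, 'i) manifold \<Rightarrow> 'p \<Rightarrow> 'i set" where
  "charts_at M p = {i \<in> charts M. p \<in> cdom M i}"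

definition smooth_fun :: "('p, 'i) manifold \<Rightarrow> 'p set \<Rightarrow> ('p \<Rightarrow> real) \<Rightarrow> bool" where
  "smooth_fun M U f \<longleftrightarrow>
     (\<forall>i\<in>charts M. smooth_real_on (mdim M) (coord M i ` (U \<inter> cdom M i)) (\<lambda>x. f (cinv M i x)))"


section \<open>Tangent vectors and vector fields\<close>

text \<open>
  A tangent vector at \<open>p\<close> is the family of its components in all charts around \<open>p\<close>; components in
  different charts are related by the Jacobian matrix of the transition map. All other entries are
  zero, so that \<open>tangent_space M p\<close> is a vector space under the pointwise operations.
\<close>

type_synonym 'i tvec = "'i \<Rightarrow> nat \<Rightarrow> real"
type_synonym ('p, 'i) field = "'p \<Rightarrow> 'i tvec"

definition tscale :: "real \<Rightarrow> 'i tvec \<Rightarrow> 'i tvec" where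
  "tscale c v = (\<lambda>i k. c * v i k)"

definition jacobian :: "('p, 'i) manifold \<Rightarrow> 'i \<Rightarrow> 'i \<Rightarrow> 'p \<Rightarrow> nat \<Rightarrow> nat \<Rightarrow> real" where
  "jacobian M i j p k a = pderiv_at a (\<lambda>x. coord M j (cinv M i x) k) (coord M i p)"

definition tangent_space :: "('p, 'i) manifold \<Rightarrow> 'p \<Rightarrow> 'i tvec set" where
  "tangent_space M p =
     {v. (\<forall>i. i \<notin> charts_at M p \<longrightarrow> v i = 0) \<and>
         (\<forall>i. \<forall>k\<ge>mdim M. v i k = 0) \<and>
         (\<forall>i\<in>charts_at M p. \<forall>j\<in>charts_at M p. \<forall>k<mdim M.
            v j k = (\<Sum>a<mdim M. jacobian M i j p k a * v i a))}"

text \<open>The derivative of \<open>f\<close> along a tangent vector at \<open>p\<close>, computed in some chart around \<open>p\<close>.\<close>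

definition dirder :: "('p, 'i) manifold \<Rightarrow> 'p \<Rightarrow> 'i tvec \<Rightarrow> ('p \<Rightarrow> real) \<Rightarrow> real" where
  "dirder M p v f =
     (let i = (SOME i. i \<in> charts_at M p)
      in \<Sum>a<mdim M. v i a * pderiv_at a (\<lambda>x. f (cinv M i x)) (coord M i p))"

definition vfield :: "('p, 'i) manifold \<Rightarrow> 'p set \<Rightarrow> ('p, 'i) field \<Rightarrow> bool" where
  "vfield M U X \<longleftrightarrow>
     (\<forall>p\<in>U. X p \<in> tangent_space M p) \<and>
     (\<forall>i\<in>charts M. \<forall>k<mdim M.
        smooth_real_on (mdim M) (coord M i ` (U \<inter> cdom M i)) (\<lambda>x. X (cinv M i x) i k))"

definition fscale :: "('p \<Rightarrow> real) \<Rightarrow> ('p, 'i) field \<Rightarrow> ('p, 'i) field" where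
  "fscale f X = (\<lambda>p. tscale (f p) (X p))"

definition bracket :: "('p, 'i) manifold \<Rightarrow> ('p, 'i) field \<Rightarrow> ('p, 'i) field \<Rightarrow> ('p, 'i) field" where
  "bracket M X Y = (\<lambda>p i k.
     if i \<in> charts_at M p \<and> k < mdim M
     then dirder M p (X p) (\<lambda>q. Y q i k) - dirder M p (Y p) (\<lambda>q. X q i k) else 0)"

definition coord_field :: "('p, 'i) manifold \<Rightarrow> 'i \<Rightarrow> nat \<Rightarrow> ('p, 'i) field" where
  "coord_field M i a = (\<lambda>p j k. if j \<in> charts_at M p \<and> k < mdim M then jacobian M i j p k a else 0)"


section \<open>Connections and metrics\<close>

text \<open>
  A connection acts on vector fields defined on open subsets, compatibly with restriction (the last
  clause); every connection on the module of global vector fields extends uniquely to such an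
  operator. Its values on arguments that are not smooth vector fields near the point are irrelevant.
\<close>

type_synonym ('p, 'i) conn = "('p, 'i) field \<Rightarrow> ('p, 'i) field \<Rightarrow> ('p, 'i) field"
type_synonym ('p, 'i) metric = "'p \<Rightarrow> 'i tvec \<Rightarrow> 'i tvec \<Rightarrow> real"
type_synonym ('p, 'i) endo = "'p \<Rightarrow> 'i tvec \<Rightarrow> 'i tvec"

definition connection :: "('p, 'i) manifold \<Rightarrow> ('p, 'i) conn \<Rightarrow> bool" where
  "connection M nab \<longleftrightarrow>
     (\<forall>U X X' Y Y' f.
        openin (mtop M) U \<and> vfield M U X \<and> vfield M U X' \<and> vfield M U Y \<and> vfield M U Y' \<and>
        smooth_fun M U f \<longrightarrow>
        vfield M U (nab X Y) \<and>
        (\<forall>p\<in>U. nab (X + X') Y p = nab X Y p + nab X' Y p) \<and>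
        (\<forall>p\<in>U. nab (fscale f X) Y p = tscale (f p) (nab X Y p)) \<and>
        (\<forall>p\<in>U. nab X (Y + Y') p = nab X Y p + nab X Y' p) \<and>
        (\<forall>p\<in>U. nab X (fscale f Y) p =
                  tscale (dirder M p (X p) f) (Y p) + tscale (f p) (nab X Y p)) \<and>
        ((\<forall>p\<in>U. X p = X' p \<and> Y p = Y' p) \<longrightarrow> (\<forall>p\<in>U. nab X Y p = nab X' Y' p)))"

definition torsionless :: "('p, 'i) manifold \<Rightarrow> ('p, 'i) conn \<Rightarrow> bool" where
  "torsionless M nab \<longleftrightarrow>
     (\<forall>U X Y. openin (mtop M) U \<and> vfield M U X \<and> vfield M U Y \<longrightarrow>
        (\<forall>p\<in>U. nab X Y p - nab Y X p = bracket M X Y p))"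

definition flat :: "('p, 'i) manifold \<Rightarrow> ('p, 'i) conn \<Rightarrow> bool" where
  "flat M nab \<longleftrightarrow>
     (\<forall>U X Y Z. openin (mtop M) U \<and> vfield M U X \<and> vfield M U Y \<and> vfield M U Z \<longrightarrow>
        (\<forall>p\<in>U. nab X (nab Y Z) p - nab Y (nab X Z) p - nab (bracket M X Y) Z p = 0))"

definition riemannian_metric :: "('p, 'i) manifold \<Rightarrow> ('p, 'i) metric \<Rightarrow> bool" where
  "riemannian_metric M g \<longleftrightarrow>
     (\<forall>p\<in>topspace (mtop M). \<forall>u\<in>tangent_space M p.
        (u \<noteq> 0 \<longrightarrow> g p u u > 0) \<and>
        (\<forall>v\<in>tangent_space M p. g p u v = g p v u \<and>
           (\<forall>c. g p (tscale c u) v = c * g p u v) \<and>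
           (\<forall>w\<in>tangent_space M p. g p (u + v) w = g p u w + g p v w))) \<and>
     (\<forall>U X Y. openin (mtop M) U \<and> vfield M U X \<and> vfield M U Y \<longrightarrow>
        smooth_fun M U (\<lambda>p. g p (X p) (Y p)))"

definition metric_connection ::
  "('p, 'i) manifold \<Rightarrow> ('p, 'i) metric \<Rightarrow> ('p, 'i) conn \<Rightarrow> bool" where
  "metric_connection M g D \<longleftrightarrow>
     (\<forall>U X Y Z. openin (mtop M) U \<and> vfield M U X \<and> vfield M U Y \<and> vfield M U Z \<longrightarrow>
        (\<forall>p\<in>U. dirder M p (X p) (\<lambda>q. g q (Y q) (Z q)) = g p (D X Y p) (Z p) + g p (Y p) (D X Z p)))"

definition levi_civita :: "('p, 'i) manifold \<Rightarrow> ('p, 'i) metric \<Rightarrow> ('p, 'i) conn \<Rightarrow> bool" where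
  "levi_civita M g D \<longleftrightarrow> connection M D \<and> torsionless M D \<and> metric_connection M g D"

definition affine_riemann_manifold ::
  "('p, 'i) manifold \<Rightarrow> ('p, 'i) conn \<Rightarrow> ('p, 'i) metric \<Rightarrow> bool" where
  "affine_riemann_manifold M nab g \<longleftrightarrow>
     smooth_manifold M \<and> connection M nab \<and> flat M nab \<and> torsionless M nab \<and> riemannian_metric M g"

definition difference_tensor ::
  "('p, 'i) conn \<Rightarrow> ('p, 'i) conn \<Rightarrow> ('p, 'i) field \<Rightarrow> ('p, 'i) field \<Rightarrow> ('p, 'i) field" where
  "difference_tensor D nab X Y = D X Y - nab X Y"

definition cov_deriv_21 ::
  "('p, 'i) conn \<Rightarrow> (('p, 'i) field \<Rightarrow> ('p, 'i) field \<Rightarrow> ('p, 'i) field) \<Rightarrow>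
   ('p, 'i) field \<Rightarrow> ('p, 'i) field \<Rightarrow> ('p, 'i) field \<Rightarrow> ('p, 'i) field" where
  "cov_deriv_21 D S X Y Z = D X (S Y Z) - S (D X Y) Z - S Y (D X Z)"

definition parallel_21 ::
  "('p, 'i) manifold \<Rightarrow> ('p, 'i) conn \<Rightarrow>
   (('p, 'i) field \<Rightarrow> ('p, 'i) field \<Rightarrow> ('p, 'i) field) \<Rightarrow> bool" where
  "parallel_21 M D S \<longleftrightarrow>
     (\<forall>U X Y Z. openin (mtop M) U \<and> vfield M U X \<and> vfield M U Y \<and> vfield M U Z \<longrightarrow>
        (\<forall>p\<in>U. cov_deriv_21 D S X Y Z p = 0))"


section \<open>Hermitian manifolds and the Lee form\<close>

definition apply_endo :: "('p, 'i) endo \<Rightarrow> ('p, 'i) field \<Rightarrow> ('p, 'i) field" where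
  "apply_endo J X = (\<lambda>p. J p (X p))"

definition almost_complex :: "('p, 'i) manifold \<Rightarrow> ('p, 'i) endo \<Rightarrow> bool" where
  "almost_complex M J \<longleftrightarrow>
     (\<forall>p\<in>topspace (mtop M). \<forall>u\<in>tangent_space M p.
        J p u \<in> tangent_space M p \<and> J p (J p u) = - u \<and>
        (\<forall>c. J p (tscale c u) = tscale c (J p u)) \<and>
        (\<forall>v\<in>tangent_space M p. J p (u + v) = J p u + J p v)) \<and>
     (\<forall>U X. openin (mtop M) U \<and> vfield M U X \<longrightarrow> vfield M U (apply_endo J X))"

definition nijenhuis ::
  "('p, 'i) manifold \<Rightarrow> ('p, 'i) endo \<Rightarrow> ('p, 'i) field \<Rightarrow> ('p, 'i) field \<Rightarrow> ('p, 'i) field" where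
  "nijenhuis M J X Y =
     bracket M (apply_endo J X) (apply_endo J Y)
     - apply_endo J (bracket M (apply_endo J X) Y)
     - apply_endo J (bracket M X (apply_endo J Y))
     - bracket M X Y"

definition complex_structure :: "('p, 'i) manifold \<Rightarrow> ('p, 'i) endo \<Rightarrow> bool" where
  "complex_structure M J \<longleftrightarrow> almost_complex M J \<and>
     (\<forall>U X Y. openin (mtop M) U \<and> vfield M U X \<and> vfield M U Y \<longrightarrow>
        (\<forall>p\<in>U. nijenhuis M J X Y p = 0))"

definition hermitian_manifold ::
  "('p, 'i) manifold \<Rightarrow> ('p, 'i) endo \<Rightarrow> ('p, 'i) metric \<Rightarrow> bool" where
  "hermitian_manifold M J g \<longleftrightarrow>
     smooth_manifold M \<and> complex_structure M J \<and> riemannian_metric M g \<and>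
     (\<forall>p\<in>topspace (mtop M). \<forall>u\<in>tangent_space M p. \<forall>v\<in>tangent_space M p.
        g p (J p u) (J p v) = g p u v)"

definition fundamental_form ::
  "('p, 'i) endo \<Rightarrow> ('p, 'i) metric \<Rightarrow> ('p, 'i) field \<Rightarrow> ('p, 'i) field \<Rightarrow> 'p \<Rightarrow> real" where
  "fundamental_form J g X Y = (\<lambda>p. g p (J p (X p)) (Y p))"

definition cov_deriv_20 ::
  "('p, 'i) manifold \<Rightarrow> ('p, 'i) conn \<Rightarrow> (('p, 'i) field \<Rightarrow> ('p, 'i) field \<Rightarrow> 'p \<Rightarrow> real) \<Rightarrow>
   ('p, 'i) field \<Rightarrow> ('p, 'i) field \<Rightarrow> ('p, 'i) field \<Rightarrow> 'p \<Rightarrow> real" where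
  "cov_deriv_20 M D w X Y Z =
     (\<lambda>p. dirder M p (X p) (w Y Z) - w (D X Y) Z p - w Y (D X Z) p)"

definition orthonormal_frame ::
  "('p, 'i) manifold \<Rightarrow> ('p, 'i) metric \<Rightarrow> 'p set \<Rightarrow> (nat \<Rightarrow> ('p, 'i) field) \<Rightarrow> bool" where
  "orthonormal_frame M g U E \<longleftrightarrow>
     openin (mtop M) U \<and> (\<forall>a<mdim M. vfield M U (E a)) \<and>
     (\<forall>p\<in>U. \<forall>a<mdim M. \<forall>b<mdim M. g p (E a p) (E b p) = (if a = b then 1 else 0))"

text \<open>
  The value at \<open>p\<close> is computed with some orthonormal frame around \<open>p\<close>. One-forms are represented as
  operators on (locally defined) vector fields.
\<close>

definition codifferential ::
  "('p, 'i) manifold \<Rightarrow> ('p, 'i) metric \<Rightarrow> ('p, 'i) conn \<Rightarrow>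
   (('p, 'i) field \<Rightarrow> ('p, 'i) field \<Rightarrow> 'p \<Rightarrow> real) \<Rightarrow> ('p, 'i) field \<Rightarrow> 'p \<Rightarrow> real" where
  "codifferential M g D w Z p =
     (let E = (SOME E. \<exists>U. p \<in> U \<and> orthonormal_frame M g U E)
      in - (\<Sum>a<mdim M. cov_deriv_20 M D w (E a) (E a) Z p))"

definition lee_form ::
  "('p, 'i) manifold \<Rightarrow> ('p, 'i) endo \<Rightarrow> ('p, 'i) metric \<Rightarrow> ('p, 'i) conn \<Rightarrow>
   ('p, 'i) field \<Rightarrow> 'p \<Rightarrow> real" where
  "lee_form M J g D X p = - codifferential M g D (fundamental_form J g) (apply_endo J X) p"

definition ext_deriv1 ::
  "('p, 'i) manifold \<Rightarrow> (('p, 'i) field \<Rightarrow> 'p \<Rightarrow> real) \<Rightarrow>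
   ('p, 'i) field \<Rightarrow> ('p, 'i) field \<Rightarrow> 'p \<Rightarrow> real" where
  "ext_deriv1 M \<theta> X Y p = dirder M p (X p) (\<theta> Y) - dirder M p (Y p) (\<theta> X) - \<theta> (bracket M X Y) p"

definition closed_1form :: "('p, 'i) manifold \<Rightarrow> (('p, 'i) field \<Rightarrow> 'p \<Rightarrow> real) \<Rightarrow> bool" where
  "closed_1form M \<theta> \<longleftrightarrow>
     (\<forall>U X Y. openin (mtop M) U \<and> vfield M U X \<and> vfield M U Y \<longrightarrow> (\<forall>p\<in>U. ext_deriv1 M \<theta> X Y p = 0))"

definition locally_conformally_balanced ::
  "('p, 'i) manifold \<Rightarrow> ('p, 'i) endo \<Rightarrow> ('p, 'i) metric \<Rightarrow> bool" where
  "locally_conformally_balanced M J g \<longleftrightarrow>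
     hermitian_manifold M J g \<and> (\<exists>D. levi_civita M g D \<and> closed_1form M (lee_form M J g D))"


section \<open>The tangent bundle\<close>

text \<open>
  \<open>Tan p v\<close> is the tangent vector \<open>v\<close> attached to the point \<open>p\<close>. The point type is recursive so that
  all iterated tangent bundles of a manifold live in one type; the type \<open>'a\<close> of the points \<open>Base x\<close>
  is arbitrary, hence so is the underlying set of a manifold with points of this type.
\<close>

datatype ('a, 'i) tpoint = Base 'a | Tan (tbase: "('a, 'i) tpoint") (tfib: "'i \<Rightarrow> nat \<Rightarrow> real")

type_synonym ('a, 'i) tmanifold = "(('a, 'i) tpoint, 'i) manifold"
type_synonym ('a, 'i) tfield = "(('a, 'i) tpoint, 'i) field"
type_synonym ('a, 'i) tconn = "(('a, 'i) tpoint, 'i) conn"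
type_synonym ('a, 'i) tmetric = "(('a, 'i) tpoint, 'i) metric"
type_synonym ('a, 'i) tendo = "(('a, 'i) tpoint, 'i) endo"

definition bundle_over :: "('a, 'i) tmanifold \<Rightarrow> ('a, 'i) tpoint set \<Rightarrow> ('a, 'i) tpoint set" where
  "bundle_over M U = {Tan p v | p v. p \<in> U \<and> v \<in> tangent_space M p}"

text \<open>
  The chart of the tangent bundle induced by chart \<open>i\<close>: the first \<open>mdim M\<close> coordinates are those of
  the base point, the next \<open>mdim M\<close> the components of the vector.
\<close>

definition tcoord :: "('a, 'i) tmanifold \<Rightarrow> 'i \<Rightarrow> ('a, 'i) tpoint \<Rightarrow> nat \<Rightarrow> real" where
  "tcoord M i \<xi> k =
     (if k < mdim M then coord M i (tbase \<xi>) k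
      else if k < 2 * mdim M then tfib \<xi> i (k - mdim M) else 0)"

definition tangent_bundle :: "('a, 'i) tmanifold \<Rightarrow> ('a, 'i) tmanifold" where
  "tangent_bundle M =
     \<lparr> mtop = topology_generated_by
         {{\<xi> \<in> bundle_over M (cdom M i). tcoord M i \<xi> \<in> V} | i V.
            i \<in> charts M \<and> openin (Euclidean_space (2 * mdim M)) V},
       mdim = 2 * mdim M,
       charts = charts M,
       cdom = (\<lambda>i. bundle_over M (cdom M i)),
       coord = tcoord M \<rparr>"

definition christoffel ::
  "('p, 'i) manifold \<Rightarrow> ('p, 'i) conn \<Rightarrow> 'i \<Rightarrow> nat \<Rightarrow> nat \<Rightarrow> nat \<Rightarrow> 'p \<Rightarrow> real" where
  "christoffel M nab i a b k p = nab (coord_field M i a) (coord_field M i b) p i k"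

text \<open>
  Components with respect to \<open>tcoord\<close>: the vertical lift of \<open>u\<close> at \<open>Tan p v\<close> is \<open>(0, u)\<close>, the
  horizontal lift is \<open>(u, - \<Gamma>(u, v))\<close>.
\<close>

definition vert_at :: "('a, 'i) tmanifold \<Rightarrow> ('a, 'i) tpoint \<Rightarrow> 'i tvec \<Rightarrow> 'i tvec" where
  "vert_at M \<xi> u = (\<lambda>i k.
     if i \<in> charts_at M (tbase \<xi>) \<and> mdim M \<le> k \<and> k < 2 * mdim M then u i (k - mdim M) else 0)"

definition gamma_at ::
  "('a, 'i) tmanifold \<Rightarrow> ('a, 'i) tconn \<Rightarrow> 'i \<Rightarrow> ('a, 'i) tpoint \<Rightarrow> 'i tvec \<Rightarrow> 'i tvec \<Rightarrow> nat \<Rightarrow> real" where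
  "gamma_at M nab i p u v k =
     (\<Sum>a<mdim M. \<Sum>b<mdim M. christoffel M nab i a b k p * u i a * v i b)"

definition hor_at ::
  "('a, 'i) tmanifold \<Rightarrow> ('a, 'i) tconn \<Rightarrow> ('a, 'i) tpoint \<Rightarrow> 'i tvec \<Rightarrow> 'i tvec" where
  "hor_at M nab \<xi> u = (\<lambda>i k.
     if i \<in> charts_at M (tbase \<xi>) \<and> k < mdim M then u i k
     else if i \<in> charts_at M (tbase \<xi>) \<and> k < 2 * mdim M
       then - gamma_at M nab i (tbase \<xi>) u (tfib \<xi>) (k - mdim M)
     else 0)"

definition vert_lift :: "('a, 'i) tmanifold \<Rightarrow> ('a, 'i) tfield \<Rightarrow> ('a, 'i) tfield" where
  "vert_lift M X = (\<lambda>\<xi>. vert_at M \<xi> (X (tbase \<xi>)))"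

definition hor_lift ::
  "('a, 'i) tmanifold \<Rightarrow> ('a, 'i) tconn \<Rightarrow> ('a, 'i) tfield \<Rightarrow> ('a, 'i) tfield" where
  "hor_lift M nab X = (\<lambda>\<xi>. hor_at M nab \<xi> (X (tbase \<xi>)))"

text \<open>
  A tangent vector \<open>w\<close> of the bundle at \<open>\<xi>\<close> is the sum of the horizontal lift of \<open>hor_part\<close> (its
  image under the differential of the projection) and the vertical lift of \<open>vert_part\<close> (its image
  under the connector).
\<close>

definition hor_part :: "('a, 'i) tmanifold \<Rightarrow> 'i tvec \<Rightarrow> 'i tvec" where
  "hor_part M w = (\<lambda>i k. if k < mdim M then w i k else 0)"

definition vert_part ::
  "('a, 'i) tmanifold \<Rightarrow> ('a, 'i) tconn \<Rightarrow> ('a, 'i) tpoint \<Rightarrow> 'i tvec \<Rightarrow> 'i tvec" where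
  "vert_part M nab \<xi> w = (\<lambda>i k.
     if i \<in> charts_at M (tbase \<xi>) \<and> k < mdim M
     then w i (mdim M + k) + gamma_at M nab i (tbase \<xi>) (hor_part M w) (tfib \<xi>) k else 0)"


section \<open>The canonical sequence\<close>

text \<open>
  The complex structure and the metric are the (bi)linear extensions of their values on horizontal
  and vertical lifts, via the decomposition \<open>w = hor_at (hor_part w) + vert_at (vert_part w)\<close>; see
  the lemmas below. The connection is the one determined by its values on lifts: lifts of local
  fields span every tangent space of the bundle, so any two connections satisfying the four
  equations agree on all smooth vector fields.
\<close>

definition lift_J :: "('a, 'i) tmanifold \<Rightarrow> ('a, 'i) tconn \<Rightarrow> ('a, 'i) tendo" where
  "lift_J M nab \<xi> w = vert_at M \<xi> (hor_part M w) - hor_at M nab \<xi> (vert_part M nab \<xi> w)"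

definition lift_metric ::
  "('a, 'i) tmanifold \<Rightarrow> ('a, 'i) tconn \<Rightarrow> ('a, 'i) tmetric \<Rightarrow> ('a, 'i) tmetric" where
  "lift_metric M nab g \<xi> w w' =
     g (tbase \<xi>) (hor_part M w) (hor_part M w')
     + g (tbase \<xi>) (vert_part M nab \<xi> w) (vert_part M nab \<xi> w')"

definition canonical_conn ::
  "('a, 'i) tmanifold \<Rightarrow> ('a, 'i) tconn \<Rightarrow> ('a, 'i) tconn \<Rightarrow> bool" where
  "canonical_conn M nab nab1 \<longleftrightarrow>
     connection (tangent_bundle M) nab1 \<and>
     (\<forall>U X Y. openin (mtop M) U \<and> vfield M U X \<and> vfield M U Y \<longrightarrow>
        (\<forall>\<xi>\<in>bundle_over M U.
           nab1 (hor_lift M nab X) (hor_lift M nab Y) \<xi> = hor_lift M nab (nab X Y) \<xi> \<and>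
           nab1 (hor_lift M nab X) (vert_lift M Y) \<xi> = vert_lift M (nab X Y) \<xi> \<and>
           nab1 (vert_lift M X) (hor_lift M nab Y) \<xi> = 0 \<and>
           nab1 (vert_lift M X) (vert_lift M Y) \<xi> = 0))"

definition lift_conn :: "('a, 'i) tmanifold \<Rightarrow> ('a, 'i) tconn \<Rightarrow> ('a, 'i) tconn" where
  "lift_conn M nab = (SOME nab1. canonical_conn M nab nab1)"

primrec iter_tangent :: "('a, 'i) tmanifold \<Rightarrow> nat \<Rightarrow> ('a, 'i) tmanifold" where
  "iter_tangent M 0 = M"
| "iter_tangent M (Suc k) = tangent_bundle (iter_tangent M k)"

primrec iter_conn :: "('a, 'i) tmanifold \<Rightarrow> ('a, 'i) tconn \<Rightarrow> nat \<Rightarrow> ('a, 'i) tconn" where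
  "iter_conn M nab 0 = nab"
| "iter_conn M nab (Suc k) = lift_conn (iter_tangent M k) (iter_conn M nab k)"

primrec iter_metric ::
  "('a, 'i) tmanifold \<Rightarrow> ('a, 'i) tconn \<Rightarrow> ('a, 'i) tmetric \<Rightarrow> nat \<Rightarrow> ('a, 'i) tmetric" where
  "iter_metric M nab g 0 = g"
| "iter_metric M nab g (Suc k) =
     lift_metric (iter_tangent M k) (iter_conn M nab k) (iter_metric M nab g k)"

text \<open>Only meaningful for \<open>k \<ge> 1\<close>.\<close>

definition iter_J :: "('a, 'i) tmanifold \<Rightarrow> ('a, 'i) tconn \<Rightarrow> nat \<Rightarrow> ('a, 'i) tendo" where
  "iter_J M nab k = lift_J (iter_tangent M (k - 1)) (iter_conn M nab (k - 1))"


subsection \<open>The defining equations on lifts\<close>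

lemma tangent_space_zero: "0 \<in> tangent_space M p"
  by (simp add: tangent_space_def)

lemma hor_vert_decomposition:
  assumes "\<And>i. i \<notin> charts_at M (tbase \<xi>) \<Longrightarrow> w i = 0" "\<And>i k. k \<ge> 2 * mdim M \<Longrightarrow> w i k = 0"
  shows "w = hor_at M nab \<xi> (hor_part M w) + vert_at M \<xi> (vert_part M nab \<xi> w)"
  using assms by (auto simp: fun_eq_iff hor_at_def vert_at_def hor_part_def vert_part_def)

lemma parts_hor_at:
  assumes "u \<in> tangent_space M (tbase \<xi>)"
  shows "hor_part M (hor_at M nab \<xi> u) = u" "vert_part M nab \<xi> (hor_at M nab \<xi> u) = 0"
proof -
  show *: "hor_part M (hor_at M nab \<xi> u) = u"
    using assms by (auto simp: fun_eq_iff hor_part_def hor_at_def tangent_space_def)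
  show "vert_part M nab \<xi> (hor_at M nab \<xi> u) = 0"
    unfolding vert_part_def * by (auto simp: fun_eq_iff hor_at_def)
qed

lemma parts_vert_at:
  assumes "u \<in> tangent_space M (tbase \<xi>)"
  shows "hor_part M (vert_at M \<xi> u) = 0" "vert_part M nab \<xi> (vert_at M \<xi> u) = u"
proof -
  show *: "hor_part M (vert_at M \<xi> u) = 0"
    by (auto simp: fun_eq_iff hor_part_def vert_at_def)
  show "vert_part M nab \<xi> (vert_at M \<xi> u) = u"
    unfolding vert_part_def * using assms
    by (auto simp: fun_eq_iff vert_at_def gamma_at_def tangent_space_def)
qed

lemma lift_J_lifts:
  assumes "X (tbase \<xi>) \<in> tangent_space M (tbase \<xi>)"
  shows "lift_J M nab \<xi> (hor_lift M nab X \<xi>) = vert_lift M X \<xi>"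
    and "lift_J M nab \<xi> (vert_lift M X \<xi>) = - hor_lift M nab X \<xi>"
  unfolding lift_J_def hor_lift_def vert_lift_def parts_hor_at[OF assms] parts_vert_at[OF assms]
  by (auto simp: fun_eq_iff hor_at_def vert_at_def gamma_at_def)

lemma lift_metric_lifts:
  fixes M :: "('a, 'i) tmanifold"
  assumes "riemannian_metric M g" "tbase \<xi> \<in> topspace (mtop M)"
    and X: "X (tbase \<xi>) \<in> tangent_space M (tbase \<xi>)"
    and Y: "Y (tbase \<xi>) \<in> tangent_space M (tbase \<xi>)"
  shows "lift_metric M nab g \<xi> (hor_lift M nab X \<xi>) (hor_lift M nab Y \<xi>)
           = g (tbase \<xi>) (X (tbase \<xi>)) (Y (tbase \<xi>))"
    and "lift_metric M nab g \<xi> (vert_lift M X \<xi>) (vert_lift M Y \<xi>)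
           = g (tbase \<xi>) (X (tbase \<xi>)) (Y (tbase \<xi>))"
    and "lift_metric M nab g \<xi> (hor_lift M nab X \<xi>) (vert_lift M Y \<xi>) = 0"
proof -
  have z: "g (tbase \<xi>) 0 v = 0" "g (tbase \<xi>) v 0 = 0" if v: "v \<in> tangent_space M (tbase \<xi>)" for v
  proof -
    note g = conjunct1[OF assms(1)[unfolded riemannian_metric_def], THEN bspec, OF assms(2),
        THEN bspec, OF tangent_space_zero, THEN conjunct2, THEN bspec, OF v]
    have "g (tbase \<xi>) (tscale 0 0) v = 0"
      using g[THEN conjunct2, THEN conjunct1, THEN spec, of 0] by simp
    moreover have "tscale 0 0 = (0 :: 'i tvec)"
      by (simp add: fun_eq_iff tscale_def)
    ultimately show "g (tbase \<xi>) 0 v = 0" by simp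
    with g[THEN conjunct1] show "g (tbase \<xi>) v 0 = 0" by simp
  qed
  show "lift_metric M nab g \<xi> (hor_lift M nab X \<xi>) (hor_lift M nab Y \<xi>)
           = g (tbase \<xi>) (X (tbase \<xi>)) (Y (tbase \<xi>))"
    "lift_metric M nab g \<xi> (vert_lift M X \<xi>) (vert_lift M Y \<xi>)
           = g (tbase \<xi>) (X (tbase \<xi>)) (Y (tbase \<xi>))"
    "lift_metric M nab g \<xi> (hor_lift M nab X \<xi>) (vert_lift M Y \<xi>) = 0"
    unfolding lift_metric_def hor_lift_def vert_lift_def
      parts_hor_at[OF X] parts_vert_at[OF X] parts_hor_at[OF Y] parts_vert_at[OF Y]
    by (simp_all add: z[OF X] z[OF Y] z[OF tangent_space_zero])
qed

end

theory Submission
  imports Defs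
begin

text \<open>
  Let \<open>C = \<nabla>g\<close>. Since \<open>D = \<nabla> + \<gamma>\<close> with
  \<open>2 g(\<gamma>(u, v), w) = C(u, v, w) + C(v, u, w) - C(w, u, v)\<close>, everything is governed by two traces of
  \<open>C\<close> over orthonormal bases \<open>e\<close>: the first Koszul form \<open>\<alpha>(u) = 1/2 \<Sum> C(u, e, e)\<close> and the
  divergence \<open>\<beta>(u) = \<Sum> C(e, e, u)\<close>. If a Hermitian structure \<open>J\<close> is \<open>\<nabla>\<close>-parallel, as \<open>J\<^sub>k\<close> is
  for \<open>\<nabla>\<^sup>k\<close>, its Lee form is \<open>\<alpha> - \<beta>\<close>. On the tangent bundle,
  \<open>C\<^sub>1(u, v, w) = C(hu, hv, hw) + C(hu, vv, vw)\<close> with \<open>h\<close> and \<open>v\<close> the horizontal and vertical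
  parts, whence \<open>\<alpha>\<^sub>1 = 2 \<pi>\<^sup>*\<alpha>\<close> and \<open>\<beta>\<^sub>1 = \<pi>\<^sup>*\<beta>\<close>; so closedness of \<open>\<alpha>\<close> and \<open>\<beta>\<close> propagates
  through the canonical sequence. On \<open>M\<close> itself \<open>D\<gamma> = 0\<close> makes \<open>C\<close>, \<open>\<alpha>\<close> and \<open>\<beta>\<close> parallel for
  \<open>D\<close>, hence closed.

  A vector field on the bundle is a pair of vector fields along the projection, its horizontal and
  its vertical part; the canonical connection differentiates both of them with the pullback of
  \<open>\<nabla>\<close>. As the vertical part is itself the pullback derivative of the tautological section, flatness
  of the pullback yields not only flatness but also vanishing torsion.
\<close>


section \<open>Calculus on open subsets of Euclidean space\<close>

subsection \<open>Cubes and continuity\<close>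

definition cube :: "nat \<Rightarrow> (nat \<Rightarrow> real) \<Rightarrow> real \<Rightarrow> (nat \<Rightarrow> real) set" where
  "cube n x d = {y. (\<forall>i\<ge>n. y i = 0) \<and> (\<forall>i<n. \<bar>y i - x i\<bar> < d)}"

lemma cube_mono: "c \<le> d \<Longrightarrow> cube n x c \<subseteq> cube n x d"
  by (fastforce simp: cube_def)

lemma Euclidean_space_eq_top_of_set: "Euclidean_space n = top_of_set {x. \<forall>i\<ge>n. x i = 0}"
  by (simp add: Euclidean_space_def euclidean_product_topology)

lemma openin_Euclidean_space_eq_0: "openin (Euclidean_space n) U \<Longrightarrow> x \<in> U \<Longrightarrow> i \<ge> n \<Longrightarrow> x i = 0"
  using openin_subset[of "Euclidean_space n" U] by (auto simp: topspace_Euclidean_space)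

lemma open_contains_cube:
  assumes "open T" "x \<in> T" and x: "\<And>i. i \<ge> n \<Longrightarrow> x i = 0"
  shows "\<exists>d>0. cube n x d \<subseteq> T"
proof -
  have "openin (product_topology (\<lambda>i::nat. euclidean :: real topology) UNIV) T"
    using assms(1) by (simp add: euclidean_product_topology)
  then obtain X where X: "x \<in> Pi\<^sub>E UNIV X" "\<And>i. open (X i)" "Pi\<^sub>E UNIV X \<subseteq> T"
    using product_topology_open_contains_basis[of "\<lambda>i. euclidean" UNIV T x] \<open>x \<in> T\<close>
    by (metis open_openin)
  have "\<exists>e>0. ball (x i) e \<subseteq> X i" for i
    using X(1,2) by (metis PiE_mem UNIV_I open_contains_ball)
  then obtain e where e: "\<And>i. e i > 0" "\<And>i. ball (x i) (e i) \<subseteq> X i" by metis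
  define d where "d = Min (insert 1 (e ` {..<n}))"
  have "d > 0" using e(1) unfolding d_def by (subst Min_gr_iff) auto
  moreover have "cube n x d \<subseteq> T"
  proof
    fix y assume y: "y \<in> cube n x d"
    have "y i \<in> X i" for i
    proof (cases "i < n")
      case True
      then have "d \<le> e i" unfolding d_def by (intro Min_le) auto
      moreover have "\<bar>y i - x i\<bar> < d" using y True by (simp add: cube_def)
      ultimately have "y i \<in> ball (x i) (e i)" by (simp add: dist_real_def abs_minus_commute)
      with e(2) show ?thesis by blast
    next
      case False
      with y x have "y i = x i" by (simp add: cube_def)
      with X(1) show ?thesis by auto
    qed
    with X(3) show "y \<in> T" by auto
  qed
  ultimately show ?thesis by blast
qed

lemma openin_cube: "openin (Euclidean_space n) (cube n x d)"
proof -
  have "open {y::nat \<Rightarrow> real. \<forall>i\<in>{..<n}. y (id i) \<in> ball (x i) d}"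
    by (rule product_topology_basis') auto
  moreover have "cube n x d = {y. \<forall>i\<ge>n. y i = 0} \<inter> {y. \<forall>i\<in>{..<n}. y (id i) \<in> ball (x i) d}"
    by (auto simp: cube_def dist_real_def abs_minus_commute)
  ultimately show ?thesis by (auto simp: Euclidean_space_eq_top_of_set openin_open)
qed

lemma openin_Euclidean_space_iff_cube:
  "openin (Euclidean_space n) U \<longleftrightarrow> U \<subseteq> {x. \<forall>i\<ge>n. x i = 0} \<and> (\<forall>x\<in>U. \<exists>d>0. cube n x d \<subseteq> U)"
proof (intro iffI conjI ballI)
  assume "openin (Euclidean_space n) U"
  then obtain T where T: "open T" "U = {x. \<forall>i\<ge>n. x i = 0} \<inter> T"
    by (auto simp: Euclidean_space_eq_top_of_set openin_open)
  from T(2) show "U \<subseteq> {x. \<forall>i\<ge>n. x i = 0}" by simp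
  fix x assume "x \<in> U"
  with T(2) have "x \<in> T" "\<And>i. i \<ge> n \<Longrightarrow> x i = 0" by simp_all
  then obtain d where "d > 0" "cube n x d \<subseteq> T" using open_contains_cube[OF T(1)] by metis
  then show "\<exists>d>0. cube n x d \<subseteq> U" unfolding T(2) by (auto simp: cube_def intro!: exI[of _ d])
next
  assume cubes: "U \<subseteq> {x. \<forall>i\<ge>n. x i = 0} \<and> (\<forall>x\<in>U. \<exists>d>0. cube n x d \<subseteq> U)"
  show "openin (Euclidean_space n) U"
  proof (subst openin_subopen, intro ballI)
    fix x assume x: "x \<in> U"
    with cubes obtain d where d: "d > 0" "cube n x d \<subseteq> U" by blast
    have "x \<in> cube n x d" using cubes x d(1) by (auto simp: cube_def)
    with d(2) show "\<exists>T. openin (Euclidean_space n) T \<and> x \<in> T \<and> T \<subseteq> U"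
      by (intro exI[of _ "cube n x d"] conjI openin_cube)
  qed
qed

lemma openin_contains_cube:
  assumes "openin (Euclidean_space n) U" "x \<in> U"
  obtains d where "d > 0" "cube n x d \<subseteq> U"
  using assms by (auto simp: openin_Euclidean_space_iff_cube)

lemma subtopology_Euclidean_space:
  assumes "openin (Euclidean_space n) U"
  shows "subtopology (Euclidean_space n) U = top_of_set U"
  using openin_subset[OF assms]
  by (simp add: topspace_Euclidean_space Euclidean_space_eq_top_of_set subtopology_subtopology Int_absorb1)

lemma continuous_map_Euclidean_subspace:
  "openin (Euclidean_space n) U \<Longrightarrow>
   continuous_map (subtopology (Euclidean_space n) U) euclideanreal f \<longleftrightarrow> continuous_on U f"
  by (simp add: subtopology_Euclidean_space)

lemma openin_Euclidean_space_preimage: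
  assumes "openin (Euclidean_space n) U" "continuous_on U f" "open T"
  shows "openin (Euclidean_space n) (U \<inter> f -` T)"
proof -
  have "openin (subtopology (Euclidean_space n) U) (U \<inter> f -` T)"
    using assms by (simp add: subtopology_Euclidean_space continuous_openin_preimage_gen)
  with assms(1) show ?thesis using openin_trans_full by metis
qed

lemma continuous_on_cube:
  fixes f :: "(nat \<Rightarrow> real) \<Rightarrow> real"
  assumes "openin (Euclidean_space n) U" "continuous_on U f" "x \<in> U" "e > 0"
  obtains d where "d > 0" "cube n x d \<subseteq> U" "\<And>y. y \<in> cube n x d \<Longrightarrow> \<bar>f y - f x\<bar> < e"
proof -
  have "x \<in> U \<inter> f -` ball (f x) e" using assms(3,4) by simp
  with openin_Euclidean_space_preimage[OF assms(1,2)]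
  obtain d where "d > 0" "cube n x d \<subseteq> U \<inter> f -` ball (f x) e"
    using openin_contains_cube open_ball by metis
  then show ?thesis by (intro that[of d]) (auto simp: dist_real_def abs_minus_commute)
qed

lemma continuous_on_local_openin:
  assumes U: "openin (Euclidean_space n) U"
    and local: "\<And>x. x \<in> U \<Longrightarrow> \<exists>V. openin (Euclidean_space n) V \<and> x \<in> V \<and> continuous_on V f"
  shows "continuous_on U f"
  unfolding continuous_on_eq_continuous_within
proof
  fix x assume "x \<in> U"
  then obtain V where V: "openin (Euclidean_space n) V" "x \<in> V" "continuous_on V f" using local by blast
  then obtain T where T: "open T" "V = {x. \<forall>i\<ge>n. x i = 0} \<inter> T"
    by (auto simp: Euclidean_space_eq_top_of_set openin_open)
  have "continuous (at x within V) f" using V by (auto simp: continuous_on_eq_continuous_within)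
  then have "continuous (at x within (U \<inter> T)) f"
    by (rule continuous_within_subset) (use T openin_Euclidean_space_eq_0[OF U] in auto)
  moreover have "at x within (U \<inter> T) = at x within U"
    by (rule at_within_nhd[of _ T]) (use T V in auto)
  ultimately show "continuous (at x within U) f" by simp
qed


subsection \<open>Partial derivatives\<close>

abbreviation has_pderiv :: "nat \<Rightarrow> ((nat \<Rightarrow> real) \<Rightarrow> real) \<Rightarrow> real \<Rightarrow> (nat \<Rightarrow> real) \<Rightarrow> bool" where
  "has_pderiv a f D x \<equiv> ((\<lambda>t. f (x(a := t))) has_real_derivative D) (at (x a))"

lemma has_pderiv_imp_pderiv_at: "has_pderiv a f D x \<Longrightarrow> pderiv_at a f x = D"
  by (simp add: pderiv_at_def DERIV_imp_deriv)

lemma has_pderiv_pderiv_at_iff: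
  "has_pderiv a f (pderiv_at a f x) x \<longleftrightarrow> (\<lambda>t. f (x(a := t))) differentiable (at (x a))"
  by (simp add: pderiv_at_def DERIV_deriv_iff_real_differentiable)

lemma eventually_fun_upd_in:
  assumes "openin (Euclidean_space n) U" "x \<in> U" "a < n"
  shows "\<forall>\<^sub>F t in nhds (x a). x(a := t) \<in> U"
proof -
  obtain d where d: "d > 0" "cube n x d \<subseteq> U" by (rule openin_contains_cube[OF assms(1,2)])
  have "\<forall>\<^sub>F t in nhds (x a). dist t (x a) < d"
    using d(1) by (auto simp: eventually_nhds_metric)
  then show ?thesis
  proof eventually_elim
    case (elim t)
    then have "x(a := t) \<in> cube n x d"
      using openin_Euclidean_space_eq_0[OF assms(1,2)] assms(3) d(1) by (auto simp: cube_def dist_real_def)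
    with d(2) show ?case by blast
  qed
qed

context
  fixes n a U x and f g :: "(nat \<Rightarrow> real) \<Rightarrow> real"
  assumes U: "openin (Euclidean_space n) U" "x \<in> U" "a < n" and eq: "\<And>y. y \<in> U \<Longrightarrow> f y = g y"
begin

lemma eventually_partial_eq: "\<forall>\<^sub>F t in nhds (x a). f (x(a := t)) = g (x(a := t))"
  by (rule eventually_mono[OF eventually_fun_upd_in[OF U]]) (rule eq)

lemma pderiv_at_cong: "pderiv_at a f x = pderiv_at a g x"
  unfolding pderiv_at_def by (rule deriv_cong_ev[OF eventually_partial_eq refl])

lemma has_pderiv_transform: "has_pderiv a f D x \<Longrightarrow> has_pderiv a g D x"
  by (rule iffD1[OF DERIV_cong_ev[OF refl eventually_partial_eq refl]])

end


subsection \<open>Continuously differentiable functions\<close>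

context
  fixes n U assumes U: "openin (Euclidean_space n) U"
begin

lemma Ck_on_0_iff: "Ck_on n 0 U f \<longleftrightarrow> continuous_on U f"
  by (simp add: continuous_map_Euclidean_subspace[OF U])

lemma Ck_on_Suc_iff:
  "Ck_on n (Suc k) U f \<longleftrightarrow> continuous_on U f \<and>
     (\<forall>a<n. (\<forall>x\<in>U. has_pderiv a f (pderiv_at a f x) x) \<and> Ck_on n k U (pderiv_at a f))"
  by (simp add: continuous_map_Euclidean_subspace[OF U] has_pderiv_pderiv_at_iff)

lemma Ck_on_continuous: "Ck_on n k U f \<Longrightarrow> continuous_on U f"
  by (cases k) (simp_all only: Ck_on_0_iff Ck_on_Suc_iff)

lemma Ck_on_has_pderiv: "Ck_on n (Suc k) U f \<Longrightarrow> x \<in> U \<Longrightarrow> a < n \<Longrightarrow> has_pderiv a f (pderiv_at a f x) x"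
  unfolding Ck_on_Suc_iff by blast

lemma Ck_on_cong:
  assumes "\<And>y. y \<in> U \<Longrightarrow> f y = g y" "Ck_on n k U f"
  shows "Ck_on n k U g"
  using assms
proof (induction k arbitrary: f g)
  case 0
  then show ?case unfolding Ck_on_0_iff by (simp cong: continuous_on_cong)
next
  case (Suc k)
  note f = Suc.prems(2)[unfolded Ck_on_Suc_iff]
  have "continuous_on U g" using f Suc.prems(1) by (simp cong: continuous_on_cong)
  moreover have pderiv: "pderiv_at a f x = pderiv_at a g x" if "a < n" "x \<in> U" for a x
    by (rule pderiv_at_cong[OF U that(2,1) Suc.prems(1)])
  moreover have "has_pderiv a g (pderiv_at a g x) x" if "a < n" "x \<in> U" for a x
    using has_pderiv_transform[OF U that(2,1) Suc.prems(1) Ck_on_has_pderiv[OF Suc.prems(2) that(2,1)]]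
    unfolding pderiv[OF that] .
  moreover have "Ck_on n k U (pderiv_at a g)" if "a < n" for a
    by (rule Suc.IH[of "pderiv_at a f"]) (use f that pderiv in blast)+
  ultimately show ?case unfolding Ck_on_Suc_iff by blast
qed

lemma Ck_on_SucI:
  assumes "continuous_on U f" and "\<And>a x. a < n \<Longrightarrow> x \<in> U \<Longrightarrow> has_pderiv a f (f' a x) x"
    and "\<And>a. a < n \<Longrightarrow> Ck_on n k U (f' a)"
  shows "Ck_on n (Suc k) U f"
proof -
  have pderiv: "f' a x = pderiv_at a f x" if "a < n" "x \<in> U" for a x
    using has_pderiv_imp_pderiv_at[OF assms(2)[OF that]] by simp
  then have "Ck_on n k U (pderiv_at a f)" if "a < n" for a
    using that by (intro Ck_on_cong[OF _ assms(3)[OF that]]) auto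
  then show ?thesis using assms(1,2) pderiv unfolding Ck_on_Suc_iff by auto
qed

lemma Ck_on_Suc_imp: "Ck_on n (Suc k) U f \<Longrightarrow> Ck_on n k U f"
  by (induction k arbitrary: f) auto

lemma Ck_on_const: "Ck_on n k U (\<lambda>x. c)"
proof (induction k arbitrary: c)
  case 0
  show ?case unfolding Ck_on_0_iff by (rule continuous_on_const)
next
  case (Suc k)
  show ?case by (rule Ck_on_SucI[where f' = "\<lambda>a x. 0"]) (auto intro: Suc.IH)
qed

lemma Ck_on_coordinate: "Ck_on n k U (\<lambda>x. x b)"
proof -
  have cont: "continuous_on U (\<lambda>x. x b)"
    by (rule continuous_on_subset[OF continuous_on_product_coordinates]) auto
  show ?thesis
  proof (cases k)
    case 0
    with cont show ?thesis by (simp only: Ck_on_0_iff)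
  next
    case (Suc l)
    have "has_pderiv a (\<lambda>x. x b) (if a = b then 1 else 0) x" for a x by auto
    with cont show ?thesis
      unfolding Suc by (intro Ck_on_SucI[where f' = "\<lambda>a x. if a = b then 1 else 0"] Ck_on_const)
  qed
qed

lemma Ck_on_add:
  assumes "Ck_on n k U f" "Ck_on n k U g"
  shows "Ck_on n k U (\<lambda>x. f x + g x)"
  using assms
proof (induction k arbitrary: f g)
  case 0
  then show ?case unfolding Ck_on_0_iff by (rule continuous_on_add)
next
  case (Suc k)
  show ?case
  proof (rule Ck_on_SucI)
    show "continuous_on U (\<lambda>x. f x + g x)"
      by (intro continuous_on_add Suc.prems[THEN Ck_on_continuous])
    show "has_pderiv a (\<lambda>x. f x + g x) (pderiv_at a f x + pderiv_at a g x) x" if "a < n" "x \<in> U" for a x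
      by (intro DERIV_add Suc.prems[THEN Ck_on_has_pderiv, OF that(2,1)])
    show "Ck_on n k U (\<lambda>x. pderiv_at a f x + pderiv_at a g x)" if "a < n" for a
      using Suc.prems that by (intro Suc.IH) auto
  qed
qed

lemma Ck_on_mult:
  assumes "Ck_on n k U f" "Ck_on n k U g"
  shows "Ck_on n k U (\<lambda>x. f x * g x)"
  using assms
proof (induction k arbitrary: f g)
  case 0
  then show ?case unfolding Ck_on_0_iff by (rule continuous_on_mult)
next
  case (Suc k)
  show ?case
  proof (rule Ck_on_SucI)
    show "continuous_on U (\<lambda>x. f x * g x)"
      by (intro continuous_on_mult Suc.prems[THEN Ck_on_continuous])
    show "has_pderiv a (\<lambda>x. f x * g x) (pderiv_at a f x * g x + pderiv_at a g x * f x) x" if "a < n" "x \<in> U"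
      for a x
      by (rule DERIV_cong[OF DERIV_mult[OF Suc.prems[THEN Ck_on_has_pderiv, OF that(2,1)]]]) simp
    show "Ck_on n k U (\<lambda>x. pderiv_at a f x * g x + pderiv_at a g x * f x)" if "a < n" for a
      using Suc.prems that Suc.prems[THEN Ck_on_Suc_imp]
      by (intro Ck_on_add Suc.IH) auto
  qed
qed

lemma Ck_on_sum:
  assumes "\<And>a. a \<in> A \<Longrightarrow> Ck_on n k U (f a)"
  shows "Ck_on n k U (\<lambda>x. \<Sum>a\<in>A. f a x)"
  using assms by (induction A rule: infinite_finite_induct) (auto intro: Ck_on_add Ck_on_const)

lemma Ck_on_inverse_sqrt:
  assumes "Ck_on n k U f" and pos: "\<And>x. x \<in> U \<Longrightarrow> f x > 0"
  shows "Ck_on n k U (\<lambda>x. 1 / sqrt (f x))"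
  using assms(1)
proof (induction k)
  have cont: "continuous_on U (\<lambda>x. 1 / sqrt (f x))" if "Ck_on n k U f" for k
    using Ck_on_continuous[OF that] pos by (force intro!: continuous_intros)
  {
    case 0
    show ?case using cont[OF 0] by (simp only: Ck_on_0_iff)
  next
    case (Suc k)
    let ?r = "\<lambda>x. 1 / sqrt (f x)"
    show ?case
    proof (rule Ck_on_SucI[OF cont[OF Suc.prems]])
      show "has_pderiv a ?r ((- 1 / 2) * pderiv_at a f x * (?r x * (?r x * ?r x))) x" if "a < n" "x \<in> U"
        for a x
      proof -
        have "((\<lambda>y. 1 / sqrt y) has_real_derivative (- 1 / 2) * (?r x * (?r x * ?r x)))
            (at (f (x(a := x a))))"
          using pos[OF that(2)] by (auto intro!: derivative_eq_intros simp: field_simps)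
        from DERIV_chain2[OF this Ck_on_has_pderiv[OF Suc.prems that(2,1)]]
        show ?thesis by (rule DERIV_cong) simp
      qed
      show "Ck_on n k U (\<lambda>x. (- 1 / 2) * pderiv_at a f x * (?r x * (?r x * ?r x)))" if "a < n" for a
        using Suc that Ck_on_Suc_imp[OF Suc.prems] by (intro Ck_on_mult Ck_on_const) auto
    qed
  }
qed

end

lemma Ck_on_subset:
  assumes "V \<subseteq> U" "Ck_on n k U f"
  shows "Ck_on n k V f"
  using assms(2)
  by (induction k arbitrary: f)
     (use assms(1) in \<open>auto intro: continuous_map_from_subtopology_mono\<close>)

lemma Ck_on_local:
  assumes U: "openin (Euclidean_space n) U"
    and local: "\<And>x. x \<in> U \<Longrightarrow> \<exists>V. openin (Euclidean_space n) V \<and> x \<in> V \<and> Ck_on n k V f"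
  shows "Ck_on n k U f"
  using local
proof (induction k arbitrary: f)
  have cont: "continuous_on U f"
    if "\<And>x. x \<in> U \<Longrightarrow> \<exists>V. openin (Euclidean_space n) V \<and> x \<in> V \<and> Ck_on n k V f" for k f
    by (rule continuous_on_local_openin[OF U]) (use that Ck_on_continuous in metis)
  {
    case 0
    show ?case using cont[OF 0] by (simp only: Ck_on_0_iff[OF U])
  next
    case (Suc k)
    have "Ck_on n k U (pderiv_at a f)" if "a < n" for a
      using Suc.prems that by (intro Suc.IH) fastforce
    moreover have "has_pderiv a f (pderiv_at a f x) x" if "a < n" "x \<in> U" for a x
      using Suc.prems[OF that(2)] Ck_on_has_pderiv that(1) by metis
    ultimately show ?case using cont[OF Suc.prems] unfolding Ck_on_Suc_iff[OF U] by blast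
  }
qed


subsection \<open>The chain rule\<close>

lemma mean_value_closed_segment:
  fixes f f' :: "real \<Rightarrow> real"
  assumes "\<And>t. t \<in> closed_segment a b \<Longrightarrow> (f has_real_derivative f' t) (at t)"
  shows "\<exists>t\<in>closed_segment a b. f b - f a = f' t * (b - a)"
proof (cases a b rule: linorder_cases)
  case less
  with assms obtain t where "a < t" "t < b" "f b - f a = (b - a) * f' t"
    using MVT2[of a b f f'] by (auto simp: closed_segment_eq_real_ivl)
  then show ?thesis by (intro bexI[of _ t]) (auto simp: closed_segment_eq_real_ivl)
next
  case greater
  with assms obtain t where "b < t" "t < a" "f a - f b = (a - b) * f' t"
    using MVT2[of b a f f'] by (auto simp: closed_segment_eq_real_ivl)
  then show ?thesis
    by (intro bexI[of _ t]) (auto simp: closed_segment_eq_real_ivl algebra_simps)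
qed auto

lemma mean_value_coordinate:
  assumes U: "openin (Euclidean_space n) U" and f: "Ck_on n 1 U f" and a: "a < n"
    and segment: "\<And>t. t \<in> closed_segment (x a) b \<Longrightarrow> x(a := t) \<in> U"
  shows "\<exists>t\<in>closed_segment (x a) b. f (x(a := b)) - f x = pderiv_at a f (x(a := t)) * (b - x a)"
proof -
  have "((\<lambda>t. f (x(a := t))) has_real_derivative pderiv_at a f (x(a := t))) (at t)"
    if "t \<in> closed_segment (x a) b" for t
    using Ck_on_has_pderiv[OF U f[unfolded One_nat_def] segment[OF that] a] by simp
  from mean_value_closed_segment[of "x a" b, OF this] show ?thesis by simp
qed

text \<open>
  The coefficients are partial derivatives at intermediate points of a path that moves from
  \<open>x\<close> to \<open>y\<close> one coordinate at a time.
\<close>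

lemma C1_Caratheodory:
  assumes U: "openin (Euclidean_space n) U" and f: "Ck_on n 1 U f" and x: "x \<in> U"
  obtains d A where "d > 0"
    "\<And>y. y \<in> cube n x d \<Longrightarrow> f y - f x = (\<Sum>a<n. A a y * (y a - x a))"
    "\<And>a e. a < n \<Longrightarrow> e > 0 \<Longrightarrow> \<exists>c>0. \<forall>y\<in>cube n x c. \<bar>A a y - pderiv_at a f x\<bar> < e"
proof -
  obtain d where d: "d > 0" "cube n x d \<subseteq> U" by (rule openin_contains_cube[OF U x])
  have x0: "x i = 0" if "i \<ge> n" for i by (rule openin_Euclidean_space_eq_0[OF U x that])
  define path where "path a y = (\<lambda>i. if i < a then y i else x i)" for a and y :: "nat \<Rightarrow> real"
  have in_cube: "(path a y)(a := t) \<in> cube n x c"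
    if "y \<in> cube n x c" "a < n" "t \<in> closed_segment (x a) (y a)" for a y t c
    using that x0 segment_bound(1)[OF that(3)] by (fastforce simp: cube_def path_def)
  have "\<exists>t\<in>closed_segment (x a) (y a).
      f (path (Suc a) y) - f (path a y) = pderiv_at a f ((path a y)(a := t)) * (y a - x a)"
    if a: "a < n" and y: "y \<in> cube n x d" for a y
  proof -
    have "\<exists>t\<in>closed_segment (path a y a) (y a). f ((path a y)(a := y a)) - f (path a y) =
        pderiv_at a f ((path a y)(a := t)) * (y a - path a y a)"
      by (rule mean_value_coordinate[OF U f a]) (use in_cube[OF y a] d(2) in \<open>auto simp: path_def\<close>)
    moreover have "(path a y)(a := y a) = path (Suc a) y" "path a y a = x a"
      by (auto simp: path_def less_Suc_eq)
    ultimately show ?thesis by simp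
  qed
  then obtain \<tau> where \<tau>: "\<And>a y. a < n \<Longrightarrow> y \<in> cube n x d \<Longrightarrow> \<tau> a y \<in> closed_segment (x a) (y a)"
    "\<And>a y. a < n \<Longrightarrow> y \<in> cube n x d \<Longrightarrow>
      f (path (Suc a) y) - f (path a y) = pderiv_at a f ((path a y)(a := \<tau> a y)) * (y a - x a)" by metis
  show ?thesis
  proof (rule that[OF d(1), of "\<lambda>a y. pderiv_at a f ((path a y)(a := \<tau> a y))"])
    fix y assume y: "y \<in> cube n x d"
    then have "path n y = y" "path 0 y = x" using x0 by (auto simp: path_def cube_def fun_eq_iff)
    then have "f y - f x = (\<Sum>a<n. f (path (Suc a) y) - f (path a y))"
      using sum_lessThan_telescope[of "\<lambda>a. f (path a y)" n] by simp
    with \<tau>(2) y show "f y - f x = (\<Sum>a<n. pderiv_at a f ((path a y)(a := \<tau> a y)) * (y a - x a))" by simp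
  next
    fix a and e :: real assume a: "a < n" and e: "e > 0"
    have "continuous_on U (pderiv_at a f)" using f a Ck_on_continuous[OF U, of 0] by auto
    then obtain c where c: "c > 0" "\<And>y. y \<in> cube n x c \<Longrightarrow> \<bar>pderiv_at a f y - pderiv_at a f x\<bar> < e"
      using continuous_on_cube[OF U _ x e] by metis
    have "(path a y)(a := \<tau> a y) \<in> cube n x c" if "y \<in> cube n x (min c d)" for y
      using that cube_mono[of "min c d" c n x] cube_mono[of "min c d" d n x] by (intro in_cube \<tau>(1) a) auto
    with c d(1) show "\<exists>c>0. \<forall>y\<in>cube n x c. \<bar>pderiv_at a f ((path a y)(a := \<tau> a y)) - pderiv_at a f x\<bar> < e"
      by (intro exI[of _ "min c d"]) auto
  qed
qed

lemma C1_chain_rule: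
  fixes \<phi> :: "real \<Rightarrow> nat \<Rightarrow> real"
  assumes U: "openin (Euclidean_space n) U" and f: "Ck_on n 1 U f" and x: "\<phi> t0 \<in> U"
    and \<phi>: "\<And>a. a < n \<Longrightarrow> ((\<lambda>t. \<phi> t a) has_real_derivative \<phi>' a) (at t0)"
    and \<phi>_eq_0: "\<And>t i. i \<ge> n \<Longrightarrow> \<phi> t i = 0"
  shows "((\<lambda>t. f (\<phi> t)) has_real_derivative (\<Sum>a<n. pderiv_at a f (\<phi> t0) * \<phi>' a)) (at t0)"
proof -
  obtain d A where d: "d > 0"
    and diff: "\<And>y. y \<in> cube n (\<phi> t0) d \<Longrightarrow> f y - f (\<phi> t0) = (\<Sum>a<n. A a y * (y a - \<phi> t0 a))"
    and A: "\<And>a e. a < n \<Longrightarrow> e > 0 \<Longrightarrow> \<exists>c>0. \<forall>y\<in>cube n (\<phi> t0) c. \<bar>A a y - pderiv_at a f (\<phi> t0)\<bar> < e"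
    by (rule C1_Caratheodory[OF U f x]) blast
  have in_cube: "\<forall>\<^sub>F t in at t0. \<phi> t \<in> cube n (\<phi> t0) c" if "c > 0" for c
  proof -
    have "\<forall>\<^sub>F t in at t0. \<bar>\<phi> t i - \<phi> t0 i\<bar> < c" if "i < n" for i
      using tendstoD[OF isContD[OF DERIV_isCont[OF \<phi>[OF that]]] \<open>c > 0\<close>] by (simp add: dist_real_def)
    then have "\<forall>\<^sub>F t in at t0. \<forall>i\<in>{..<n}. \<bar>\<phi> t i - \<phi> t0 i\<bar> < c"
      by (intro eventually_ball_finite) auto
    then show ?thesis by (rule eventually_mono) (simp add: cube_def \<phi>_eq_0)
  qed
  have "((\<lambda>t. A a (\<phi> t)) \<longlongrightarrow> pderiv_at a f (\<phi> t0)) (at t0)" if "a < n" for a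
  proof (rule tendstoI)
    fix e :: real assume "e > 0"
    from A[OF that this] obtain c where c: "c > 0" "\<forall>y\<in>cube n (\<phi> t0) c. \<bar>A a y - pderiv_at a f (\<phi> t0)\<bar> < e"
      by blast
    show "\<forall>\<^sub>F t in at t0. dist (A a (\<phi> t)) (pderiv_at a f (\<phi> t0)) < e"
      by (rule eventually_mono[OF in_cube[OF c(1)]]) (use c(2) in \<open>simp add: dist_real_def\<close>)
  qed
  then have "((\<lambda>t. \<Sum>a<n. A a (\<phi> t) * ((\<phi> t a - \<phi> t0 a) / (t - t0))) \<longlongrightarrow> (\<Sum>a<n. pderiv_at a f (\<phi> t0) * \<phi>' a))
      (at t0)"
    using \<phi> by (intro tendsto_sum tendsto_mult) (auto simp: has_field_derivative_iff)
  moreover have "\<forall>\<^sub>F t in at t0. (\<Sum>a<n. A a (\<phi> t) * ((\<phi> t a - \<phi> t0 a) / (t - t0))) =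
      (f (\<phi> t) - f (\<phi> t0)) / (t - t0)"
    using in_cube[OF d] by (rule eventually_mono) (simp add: diff sum_divide_distrib)
  ultimately show ?thesis
    unfolding has_field_derivative_iff by (rule Lim_transform_eventually)
qed

lemma Ck_on_comp:
  assumes U: "openin (Euclidean_space n) U" and V: "openin (Euclidean_space m) V"
    and "Ck_on n k U f" and "\<And>a. a < n \<Longrightarrow> Ck_on m k V (\<lambda>x. \<phi> x a)"
    and \<phi>_eq_0: "\<And>x i. i \<ge> n \<Longrightarrow> \<phi> x i = 0" and \<phi>: "\<And>x. x \<in> V \<Longrightarrow> \<phi> x \<in> U"
  shows "Ck_on m k V (\<lambda>x. f (\<phi> x))"
  using assms(3,4)
proof (induction k arbitrary: f)
  have cont: "continuous_on V (\<lambda>x. f (\<phi> x))"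
    if "Ck_on n k U f" "\<And>a. a < n \<Longrightarrow> Ck_on m k V (\<lambda>x. \<phi> x a)" for k f
  proof (rule continuous_on_compose2[OF Ck_on_continuous[OF U that(1)]])
    have "continuous_on V (\<lambda>x. \<phi> x i)" for i
      using Ck_on_continuous[OF V that(2)] \<phi>_eq_0 by (cases "i < n") auto
    then show "continuous_on V \<phi>" by (rule continuous_on_coordinatewise_then_product)
  qed (use \<phi> in auto)
  {
    case 0
    show ?case using cont[OF 0] by (simp only: Ck_on_0_iff[OF V])
  next
    case (Suc k)
    have f1: "Ck_on n 1 U f"
      using Suc.prems(1) Ck_on_continuous[OF U, of k]
      by (simp del: Ck_on.simps add: Ck_on_Suc_iff[OF U] Ck_on_0_iff[OF U])
    show ?case
    proof (rule Ck_on_SucI[OF V cont[OF Suc.prems]])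
      fix b assume b: "b < m"
      show "has_pderiv b (\<lambda>x. f (\<phi> x)) (\<Sum>a<n. pderiv_at a f (\<phi> x) * pderiv_at b (\<lambda>x. \<phi> x a) x) x"
        if "x \<in> V" for x
        using C1_chain_rule[OF U f1, of "\<lambda>t. \<phi> (x(b := t))" "x b" "\<lambda>a. pderiv_at b (\<lambda>x. \<phi> x a) x"]
          Ck_on_has_pderiv[OF V Suc.prems(2) that b] \<phi>[OF that] \<phi>_eq_0 by simp
      have "Ck_on m k V (\<lambda>x. pderiv_at a f (\<phi> x))" if "a < n" for a
        by (rule Suc.IH[of "pderiv_at a f", OF _ Ck_on_Suc_imp[OF V Suc.prems(2)]])
           (use Suc.prems(1) that in auto)
      moreover have "Ck_on m k V (pderiv_at b (\<lambda>x. \<phi> x a))" if "a < n" for a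
        using Suc.prems(2)[OF that] b by simp
      ultimately show "Ck_on m k V (\<lambda>x. \<Sum>a<n. pderiv_at a f (\<phi> x) * pderiv_at b (\<lambda>x. \<phi> x a) x)"
        by (auto intro!: Ck_on_sum[OF V] Ck_on_mult[OF V])
    qed
  }
qed


subsection \<open>Symmetry of second partial derivatives\<close>

lemma double_difference_mean_value:
  fixes f f\<^sub>1 f\<^sub>1\<^sub>2 :: "real \<Rightarrow> real \<Rightarrow> real"
  assumes h: "h > 0"
    and f\<^sub>1: "\<And>s t. s \<in> {a..a + h} \<Longrightarrow> t \<in> {b..b + h} \<Longrightarrow> ((\<lambda>s. f s t) has_real_derivative f\<^sub>1 s t) (at s)"
    and f\<^sub>1\<^sub>2: "\<And>s t. s \<in> {a..a + h} \<Longrightarrow> t \<in> {b..b + h} \<Longrightarrow>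
      ((\<lambda>t. f\<^sub>1 s t) has_real_derivative f\<^sub>1\<^sub>2 s t) (at t)"
  obtains s t where "s \<in> {a..a + h}" "t \<in> {b..b + h}"
    "f (a + h) (b + h) - f (a + h) b - f a (b + h) + f a b = h * (h * f\<^sub>1\<^sub>2 s t)"
proof -
  have "\<exists>s. a < s \<and> s < a + h \<and> (f (a + h) (b + h) - f (a + h) b) - (f a (b + h) - f a b)
      = (a + h - a) * (f\<^sub>1 s (b + h) - f\<^sub>1 s b)"
    by (rule MVT2) (use h in \<open>auto intro!: DERIV_diff f\<^sub>1\<close>)
  then obtain s where s: "a < s" "s < a + h"
    "f (a + h) (b + h) - f (a + h) b - f a (b + h) + f a b = h * (f\<^sub>1 s (b + h) - f\<^sub>1 s b)"
    by (auto simp: algebra_simps)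
  have "\<exists>t. b < t \<and> t < b + h \<and> f\<^sub>1 s (b + h) - f\<^sub>1 s b = (b + h - b) * f\<^sub>1\<^sub>2 s t"
    by (rule MVT2) (use h s in \<open>auto intro!: f\<^sub>1\<^sub>2\<close>)
  then obtain t where "b < t" "t < b + h" "f\<^sub>1 s (b + h) - f\<^sub>1 s b = h * f\<^sub>1\<^sub>2 s t" by auto
  with s show ?thesis by (intro that[of s t]) auto
qed

lemma C2_mixed_partials_meet:
  assumes U: "openin (Euclidean_space n) U" and f: "Ck_on n 2 U f" and x: "x \<in> U"
    and ab: "a < n" "b < n" "a \<noteq> b" and d: "d > 0" "cube n x d \<subseteq> U"
  obtains y z where "y \<in> cube n x d" "z \<in> cube n x d"
    "pderiv_at b (pderiv_at a f) y = pderiv_at a (pderiv_at b f) z"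
proof -
  define P where "P s t = x(a := s, b := t)" for s t
  have P_upd: "(P s t)(a := s') = P s' t" "(P s t)(b := t') = P s t'" "P s t a = s" "P s t b = t"
    for s t s' t'
    using ab(3) by (auto simp: P_def fun_eq_iff)
  have P_cube: "P s t \<in> cube n x d" if "s \<in> {x a..x a + d / 2}" "t \<in> {x b..x b + d / 2}" for s t
    using that ab d(1) openin_Euclidean_space_eq_0[OF U x] by (auto simp: P_def cube_def)
  have f2: "Ck_on n (Suc (Suc 0)) U f" using f by (simp add: numeral_2_eq_2 del: Ck_on.simps)
  have f1: "Ck_on n (Suc 0) U (pderiv_at c f)" if "c < n" for c
    using f2 that by (simp add: Ck_on_Suc_iff[OF U, of "Suc 0"] del: Ck_on.simps)
  have deriv: "((\<lambda>s. g (P s t)) has_real_derivative pderiv_at a g (P s t)) (at s)"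
    "((\<lambda>t. g (P s t)) has_real_derivative pderiv_at b g (P s t)) (at t)"
    if "Ck_on n (Suc k) U g" "s \<in> {x a..x a + d / 2}" "t \<in> {x b..x b + d / 2}" for g k s t
    using Ck_on_has_pderiv[OF U that(1) subsetD[OF d(2) P_cube[OF that(2,3)]] ab(1)]
      Ck_on_has_pderiv[OF U that(1) subsetD[OF d(2) P_cube[OF that(2,3)]] ab(2)]
    by (simp_all add: P_upd)
  obtain s t where st: "s \<in> {x a..x a + d / 2}" "t \<in> {x b..x b + d / 2}"
    "f (P (x a + d / 2) (x b + d / 2)) - f (P (x a + d / 2) (x b)) - f (P (x a) (x b + d / 2))
    + f (P (x a) (x b))
      = d / 2 * (d / 2 * pderiv_at b (pderiv_at a f) (P s t))"
    by (rule double_difference_mean_value[of "d / 2" "x a" "x b" "\<lambda>s t. f (P s t)"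
        "\<lambda>s t. pderiv_at a f (P s t)"])
       (use d(1) deriv(1)[OF f2] deriv(2)[OF f1[OF ab(1)]] in auto)
  obtain t' s' where st': "t' \<in> {x b..x b + d / 2}" "s' \<in> {x a..x a + d / 2}"
    "f (P (x a + d / 2) (x b + d / 2)) - f (P (x a) (x b + d / 2)) - f (P (x a + d / 2) (x b))
    + f (P (x a) (x b))
      = d / 2 * (d / 2 * pderiv_at a (pderiv_at b f) (P s' t'))"
    by (rule double_difference_mean_value[of "d / 2" "x b" "x a" "\<lambda>t s. f (P s t)"
        "\<lambda>t s. pderiv_at b f (P s t)"])
       (use d(1) deriv(2)[OF f2] deriv(1)[OF f1[OF ab(2)]] in auto)
  have "d / 2 * (d / 2 * pderiv_at b (pderiv_at a f) (P s t)) =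
      d / 2 * (d / 2 * pderiv_at a (pderiv_at b f) (P s' t'))"
    using st(3) st'(3) by linarith
  then show ?thesis using d(1) by (intro that[OF P_cube[OF st(1,2)] P_cube[OF st'(2,1)]]) simp
qed

lemma C2_mixed_partials:
  assumes U: "openin (Euclidean_space n) U" and f: "Ck_on n 2 U f" and x: "x \<in> U"
    and ab: "a < n" "b < n"
  shows "pderiv_at a (pderiv_at b f) x = pderiv_at b (pderiv_at a f) x"
proof (cases "a = b")
  case False
  have cont: "continuous_on U (pderiv_at c (pderiv_at c' f))" if "c < n" "c' < n" for c c'
    using f that Ck_on_continuous[OF U, of 0] by (auto simp: numeral_2_eq_2)
  have "\<bar>pderiv_at a (pderiv_at b f) x - pderiv_at b (pderiv_at a f) x\<bar> \<le> e" if "e > 0" for e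
  proof -
    have "e / 2 > 0" using that by simp
    obtain c where c: "c > 0" "cube n x c \<subseteq> U"
      "\<And>y. y \<in> cube n x c \<Longrightarrow> \<bar>pderiv_at a (pderiv_at b f) y - pderiv_at a (pderiv_at b f) x\<bar> < e / 2"
      using continuous_on_cube[OF U cont[OF ab] x \<open>e / 2 > 0\<close>] by metis
    obtain d where d: "d > 0"
      "\<And>y. y \<in> cube n x d \<Longrightarrow> \<bar>pderiv_at b (pderiv_at a f) y - pderiv_at b (pderiv_at a f) x\<bar> < e / 2"
      using continuous_on_cube[OF U cont[OF ab(2,1)] x \<open>e / 2 > 0\<close>] by metis
    have "min c d > 0" "cube n x (min c d) \<subseteq> U" using c(1,2) d(1) cube_mono[of "min c d" c n x] by auto
    then obtain y z where "y \<in> cube n x (min c d)" "z \<in> cube n x (min c d)"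
      "pderiv_at b (pderiv_at a f) y = pderiv_at a (pderiv_at b f) z"
      by (rule C2_mixed_partials_meet[OF U f x ab False]) blast
    then have "y \<in> cube n x d" "z \<in> cube n x c" "pderiv_at b (pderiv_at a f) y =
        pderiv_at a (pderiv_at b f) z"
      using cube_mono[of "min c d" c n x] cube_mono[of "min c d" d n x] by auto
    from d(2)[OF this(1)] c(3)[OF this(2)] this(3) show ?thesis by linarith
  qed
  then have "\<bar>pderiv_at a (pderiv_at b f) x - pderiv_at b (pderiv_at a f) x\<bar> \<le> 0"
    by (rule field_le_epsilon) simp
  then show ?thesis by simp
qed simp


subsection \<open>Smooth functions\<close>

lemma smooth_real_on_Ck: "smooth_real_on n U f \<Longrightarrow> Ck_on n k U f"
  by (simp add: smooth_real_on_def)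

lemma smooth_real_on_subset: "V \<subseteq> U \<Longrightarrow> smooth_real_on n U f \<Longrightarrow> smooth_real_on n V f"
  by (auto simp: smooth_real_on_def intro: Ck_on_subset)

lemma smooth_real_on_local:
  assumes "openin (Euclidean_space n) U"
    "\<And>x. x \<in> U \<Longrightarrow> \<exists>V. openin (Euclidean_space n) V \<and> x \<in> V \<and> smooth_real_on n V f"
  shows "smooth_real_on n U f"
  unfolding smooth_real_on_def by (intro allI Ck_on_local[OF assms(1)]) (meson assms(2) smooth_real_on_def)

lemma smooth_real_on_pderiv: "smooth_real_on n U f \<Longrightarrow> a < n \<Longrightarrow> smooth_real_on n U (pderiv_at a f)"
  unfolding smooth_real_on_def by (meson Ck_on.simps(2))

lemma smooth_real_on_cong:
  assumes "openin (Euclidean_space n) U" "smooth_real_on n U f" "\<And>y. y \<in> U \<Longrightarrow> f y = g y"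
  shows "smooth_real_on n U g"
  using assms Ck_on_cong unfolding smooth_real_on_def by metis

lemma smooth_real_on_comp:
  assumes "openin (Euclidean_space n) U" "openin (Euclidean_space m) V"
    "smooth_real_on n U f" "\<And>a. a < n \<Longrightarrow> smooth_real_on m V (\<lambda>x. \<phi> x a)"
    "\<And>x i. i \<ge> n \<Longrightarrow> \<phi> x i = 0" "\<And>x. x \<in> V \<Longrightarrow> \<phi> x \<in> U"
  shows "smooth_real_on m V (\<lambda>x. f (\<phi> x))"
  unfolding smooth_real_on_def
  by (intro allI Ck_on_comp[OF assms(1,2) smooth_real_on_Ck[OF assms(3)] smooth_real_on_Ck[OF assms(4)]
      assms(5,6)])


section \<open>Smooth functions on a manifold\<close>

lemma sum_fun_apply: "(\<Sum>a\<in>A. f a) x = (\<Sum>a\<in>A. f a x)"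
  by (induction A rule: infinite_finite_induct) auto

lemma eventually_nhdsinI: "openin X U \<Longrightarrow> p \<in> U \<Longrightarrow> (\<And>q. q \<in> U \<Longrightarrow> P q) \<Longrightarrow> eventually P (nhdsin X p)"
  unfolding eventually_nhdsin by blast

lemma eventually_nhdsinE:
  assumes "eventually P (nhdsin X p)" "p \<in> topspace X"
  obtains U where "openin X U" "p \<in> U" "\<And>q. q \<in> U \<Longrightarrow> P q"
  using assms unfolding eventually_nhdsin by blast

interpretation tvec: vector_space tscale
  by unfold_locales (simp_all add: tscale_def fun_eq_iff algebra_simps)

lemma tscale_apply: "tscale c u i k = c * u i k"
  by (simp add: tscale_def)

lemma fscale_apply: "fscale f X p = tscale (f p) (X p)"
  by (simp add: fscale_def)

definition smooth_at :: "('p, 'i) manifold \<Rightarrow> ('p \<Rightarrow> real) \<Rightarrow> 'p \<Rightarrow> bool" where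
  "smooth_at M f p \<longleftrightarrow> (\<exists>U. openin (mtop M) U \<and> p \<in> U \<and> smooth_fun M U f)"

definition chart_pderiv :: "('p, 'i) manifold \<Rightarrow> 'i \<Rightarrow> nat \<Rightarrow> ('p \<Rightarrow> real) \<Rightarrow> 'p \<Rightarrow> real" where
  "chart_pderiv M i a f p = pderiv_at a (\<lambda>x. f (cinv M i x)) (coord M i p)"

lemma jacobian_eq_chart_pderiv: "jacobian M i j p k a = chart_pderiv M i a (\<lambda>q. coord M j q k) p"
  by (simp add: jacobian_def chart_pderiv_def)

locale smooth_mfd =
  fixes M :: "('p, 'i) manifold"
  assumes smooth: "smooth_manifold M"
begin

abbreviation n :: nat where "n \<equiv> mdim M"

abbreviation near :: "'p \<Rightarrow> 'p filter" where "near p \<equiv> nhdsin (mtop M) p"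


subsection \<open>Charts\<close>

lemma openin_cdom: "i \<in> charts M \<Longrightarrow> openin (mtop M) (cdom M i)"
  using smooth by (auto simp: smooth_manifold_def)

lemma charts_at_iff: "i \<in> charts_at M p \<longleftrightarrow> i \<in> charts M \<and> p \<in> cdom M i"
  by (auto simp: charts_at_def)

lemma topspace_iff_charts_at: "p \<in> topspace (mtop M) \<longleftrightarrow> (\<exists>i. i \<in> charts_at M p)"
  using smooth by (auto simp: smooth_manifold_def charts_at_def)

lemma charts_at_imp_topspace: "i \<in> charts_at M p \<Longrightarrow> p \<in> topspace (mtop M)"
  by (auto simp: topspace_iff_charts_at)

lemma openin_imp_topspace: "openin (mtop M) U \<Longrightarrow> p \<in> U \<Longrightarrow> p \<in> topspace (mtop M)"
  using openin_subset by blast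

lemma openin_ex_chart: "openin (mtop M) U \<Longrightarrow> p \<in> U \<Longrightarrow> \<exists>i. i \<in> charts_at M p"
  using openin_imp_topspace topspace_iff_charts_at by blast

lemma eventually_near_charts_at: "i \<in> charts_at M p \<Longrightarrow> \<forall>\<^sub>F q in near p. i \<in> charts_at M q"
  by (intro eventually_nhdsinI[OF openin_cdom[of i]]) (auto simp: charts_at_iff)

lemma homeomorphic_map_coord:
  assumes "i \<in> charts M"
  shows "homeomorphic_map (subtopology (mtop M) (cdom M i))
          (subtopology (Euclidean_space n) (coord M i ` cdom M i)) (coord M i)"
  using smooth assms by (auto simp: smooth_manifold_def)

lemma openin_coord_cdom: "i \<in> charts M \<Longrightarrow> openin (Euclidean_space n) (coord M i ` cdom M i)"
  using smooth by (auto simp: smooth_manifold_def)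

lemma coord_eq_0: "i \<in> charts_at M p \<Longrightarrow> k \<ge> n \<Longrightarrow> coord M i p k = 0"
  using openin_Euclidean_space_eq_0[OF openin_coord_cdom] by (auto simp: charts_at_iff)

lemma topspace_subtopology_cdom: "i \<in> charts M \<Longrightarrow> topspace (subtopology (mtop M) (cdom M i)) = cdom M i"
  using openin_subset[OF openin_cdom] by auto

lemma inj_on_coord: "i \<in> charts M \<Longrightarrow> inj_on (coord M i) (cdom M i)"
  using homeomorphic_map_coord topspace_subtopology_cdom by (metis homeomorphic_imp_injective_map)

lemma cinv_coord: "i \<in> charts_at M p \<Longrightarrow> cinv M i (coord M i p) = p"
  using inj_on_coord by (auto simp: charts_at_iff cinv_def)

lemma coord_cinv: "x \<in> coord M i ` cdom M i \<Longrightarrow> coord M i (cinv M i x) = x"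
  by (simp add: cinv_def f_inv_into_f)

lemma openin_coord_Int:
  assumes i: "i \<in> charts M" and U: "openin (mtop M) U"
  shows "openin (Euclidean_space n) (coord M i ` (U \<inter> cdom M i))"
proof -
  have "openin (subtopology (mtop M) (cdom M i)) (U \<inter> cdom M i)"
    using U by (simp add: openin_subtopology_Int)
  then have "openin (subtopology (Euclidean_space n) (coord M i ` cdom M i)) (coord M i ` (U \<inter> cdom M i))"
    using homeomorphic_imp_open_map[OF homeomorphic_map_coord[OF i]] by (auto simp: open_map_def)
  then show ?thesis using openin_coord_cdom[OF i] openin_trans_full by metis
qed

lemma openin_coord_preimage:
  assumes i: "i \<in> charts M" and W: "openin (Euclidean_space n) W"
  shows "openin (mtop M) {p \<in> cdom M i. coord M i p \<in> W}"
proof -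
  have "continuous_map (subtopology (mtop M) (cdom M i)) (Euclidean_space n) (coord M i)"
    using homeomorphic_imp_continuous_map[OF homeomorphic_map_coord[OF i]]
    by (simp add: continuous_map_in_subtopology)
  from openin_continuous_map_preimage[OF this W]
  have "openin (subtopology (mtop M) (cdom M i)) {p \<in> cdom M i. coord M i p \<in> W}"
    by (simp only: topspace_subtopology_cdom[OF i])
  then show ?thesis using openin_cdom[OF i] openin_trans_full by metis
qed

definition transition :: "'i \<Rightarrow> 'i \<Rightarrow> (nat \<Rightarrow> real) \<Rightarrow> nat \<Rightarrow> real" where
  "transition i j x k = (if k < n then coord M j (cinv M i x) k else 0)"

lemma transition_eq:
  "i \<in> charts M \<Longrightarrow> j \<in> charts M \<Longrightarrow> x \<in> coord M i ` (cdom M i \<inter> cdom M j) \<Longrightarrow>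
   transition i j x = coord M j (cinv M i x)"
  by (auto simp: transition_def fun_eq_iff cinv_coord charts_at_iff coord_eq_0)

lemma smooth_transition:
  assumes "i \<in> charts M" "j \<in> charts M"
  shows "smooth_real_on n (coord M i ` (cdom M i \<inter> cdom M j)) (\<lambda>x. transition i j x k)"
proof (cases "k < n")
  case True
  then show ?thesis using smooth assms by (simp add: smooth_manifold_def transition_def)
next
  case False
  have "openin (Euclidean_space n) (coord M i ` (cdom M j \<inter> cdom M i))"
    by (rule openin_coord_Int[OF assms(1) openin_cdom[OF assms(2)]])
  with False show ?thesis by (auto simp: transition_def smooth_real_on_def Int_commute intro: Ck_on_const)
qed


subsection \<open>Germs of smooth functions\<close>

lemma smooth_funI_chart:
  assumes i: "i \<in> charts M" and U: "openin (mtop M) U" "U \<subseteq> cdom M i"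
    and f: "smooth_real_on n (coord M i ` U) (\<lambda>x. f (cinv M i x))"
  shows "smooth_fun M U f"
  unfolding smooth_fun_def
proof
  fix j assume j: "j \<in> charts M"
  let ?V = "coord M j ` (U \<inter> cdom M j)"
  have V: "openin (Euclidean_space n) ?V" by (rule openin_coord_Int[OF j U(1)])
  have transition: "transition j i x = coord M i (cinv M j x)" if "x \<in> ?V" for x
    by (rule transition_eq[OF j i]) (use that U(2) in auto)
  have image: "coord M i ` (U \<inter> cdom M i) = coord M i ` U" using U(2) by (simp add: Int_absorb2)
  have "smooth_real_on n ?V (\<lambda>x. f (cinv M i (transition j i x)))"
  proof (rule smooth_real_on_comp[OF openin_coord_Int[OF i U(1), unfolded image] V f])
    show "smooth_real_on n ?V (\<lambda>x. transition j i x a)" for a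
      by (rule smooth_real_on_subset[OF _ smooth_transition[OF j i]]) (use U(2) in auto)
    show "transition j i x \<in> coord M i ` U" if "x \<in> ?V" for x
      unfolding transition[OF that] using that j by (auto simp: cinv_coord charts_at_iff)
  qed (simp add: transition_def)
  then show "smooth_real_on n ?V (\<lambda>x. f (cinv M j x))"
  proof (rule smooth_real_on_cong[OF V])
    fix x assume x: "x \<in> ?V"
    show "f (cinv M i (transition j i x)) = f (cinv M j x)"
      unfolding transition[OF x] using x U(2) i j by (auto simp: cinv_coord charts_at_iff)
  qed
qed

lemma smooth_atD_chart:
  assumes "smooth_at M f p" "i \<in> charts_at M p"
  obtains W where "openin (Euclidean_space n) W" "coord M i p \<in> W" "W \<subseteq> coord M i ` cdom M i"
    "smooth_real_on n W (\<lambda>x. f (cinv M i x))"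
proof -
  obtain U where U: "openin (mtop M) U" "p \<in> U" "smooth_fun M U f"
    using assms(1) by (auto simp: smooth_at_def)
  show ?thesis
    by (rule that[of "coord M i ` (U \<inter> cdom M i)"])
       (use U assms(2) openin_coord_Int in \<open>auto simp: charts_at_iff smooth_fun_def\<close>)
qed

lemma smooth_atI_chart:
  assumes i: "i \<in> charts_at M p" and W: "openin (Euclidean_space n) W" "coord M i p \<in> W"
    and f: "smooth_real_on n W (\<lambda>x. f (cinv M i x))"
  shows "smooth_at M f p"
proof -
  let ?U = "{q \<in> cdom M i. coord M i q \<in> W}"
  have U: "openin (mtop M) ?U" using i W by (intro openin_coord_preimage) (auto simp: charts_at_iff)
  have "smooth_fun M ?U f"
    using i U by (intro smooth_funI_chart[of i] smooth_real_on_subset[OF _ f]) (auto simp: charts_at_iff)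
  with U i W show ?thesis unfolding smooth_at_def by (intro exI[of _ ?U]) (auto simp: charts_at_iff)
qed

lemma smooth_at_imp_topspace: "smooth_at M f p \<Longrightarrow> p \<in> topspace (mtop M)"
  unfolding smooth_at_def using openin_imp_topspace by blast

lemma smooth_fun_iff_smooth_at:
  assumes U: "openin (mtop M) U"
  shows "smooth_fun M U f \<longleftrightarrow> (\<forall>p\<in>U. smooth_at M f p)"
proof
  show "smooth_fun M U f \<Longrightarrow> \<forall>p\<in>U. smooth_at M f p" using U by (auto simp: smooth_at_def)
  assume smooth_at: "\<forall>p\<in>U. smooth_at M f p"
  show "smooth_fun M U f"
    unfolding smooth_fun_def
  proof (intro ballI smooth_real_on_local[OF openin_coord_Int[OF _ U]])
    fix i x assume i: "i \<in> charts M" and "x \<in> coord M i ` (U \<inter> cdom M i)"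
    then obtain p where "x = coord M i p" "p \<in> U" "p \<in> cdom M i" by auto
    with smooth_at i smooth_atD_chart[of f p i]
    show "\<exists>V. openin (Euclidean_space n) V \<and> x \<in> V \<and> smooth_real_on n V (\<lambda>x. f (cinv M i x))"
      by (metis charts_at_iff)
  qed auto
qed

lemma smooth_at_cong:
  assumes eq: "\<forall>\<^sub>F q in near p. f q = g q" and f: "smooth_at M f p"
  shows "smooth_at M g p"
proof -
  obtain i where i: "i \<in> charts_at M p" using smooth_at_imp_topspace[OF f] topspace_iff_charts_at by blast
  obtain U where U: "openin (mtop M) U" "p \<in> U" "\<And>q. q \<in> U \<Longrightarrow> f q = g q"
    using eventually_nhdsinE[OF eq smooth_at_imp_topspace[OF f]] by metis
  obtain W where W: "openin (Euclidean_space n) W" "coord M i p \<in> W"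
      "smooth_real_on n W (\<lambda>x. f (cinv M i x))"
    by (rule smooth_atD_chart[OF f i])
  let ?V = "W \<inter> coord M i ` (U \<inter> cdom M i)"
  have V: "openin (Euclidean_space n) ?V"
    using W(1) U(1) i by (intro openin_Int openin_coord_Int) (auto simp: charts_at_iff)
  have "smooth_real_on n ?V (\<lambda>x. g (cinv M i x))"
    by (rule smooth_real_on_cong[OF V smooth_real_on_subset[OF Int_lower1 W(3)]])
       (use U(3) i in \<open>auto simp: cinv_coord charts_at_iff\<close>)
  then show ?thesis
    by (rule smooth_atI_chart[OF i V, rotated]) (use W(2) U(2) i in \<open>auto simp: charts_at_iff\<close>)
qed

lemma smooth_at_binop:
  assumes f: "smooth_at M f p" and g: "smooth_at M g p"
    and op: "\<And>W f g. openin (Euclidean_space n) W \<Longrightarrow> smooth_real_on n W f \<Longrightarrow> smooth_real_on n W g \<Longrightarrow>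
       smooth_real_on n W (\<lambda>x. h (f x) (g x))"
  shows "smooth_at M (\<lambda>q. h (f q) (g q)) p"
proof -
  obtain i where i: "i \<in> charts_at M p" using smooth_at_imp_topspace[OF f] topspace_iff_charts_at by blast
  obtain W where W: "openin (Euclidean_space n) W" "coord M i p \<in> W"
      "smooth_real_on n W (\<lambda>x. f (cinv M i x))"
    by (rule smooth_atD_chart[OF f i])
  obtain W' where W': "openin (Euclidean_space n) W'" "coord M i p \<in> W'"
      "smooth_real_on n W' (\<lambda>x. g (cinv M i x))"
    by (rule smooth_atD_chart[OF g i])
  show ?thesis
  proof (rule smooth_atI_chart[OF i, of "W \<inter> W'"])
    show "smooth_real_on n (W \<inter> W') (\<lambda>x. h (f (cinv M i x)) (g (cinv M i x)))"
      using W W' by (intro op openin_Int)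
          (auto intro: smooth_real_on_subset[of _ W] smooth_real_on_subset[of _ W'])
  qed (use W W' in auto)
qed

lemma smooth_at_add: "smooth_at M f p \<Longrightarrow> smooth_at M g p \<Longrightarrow> smooth_at M (\<lambda>q. f q + g q) p"
  by (rule smooth_at_binop[where h="(+)"]) (auto simp: smooth_real_on_def intro: Ck_on_add)

lemma smooth_at_mult: "smooth_at M f p \<Longrightarrow> smooth_at M g p \<Longrightarrow> smooth_at M (\<lambda>q. f q * g q) p"
  by (rule smooth_at_binop[where h="(*)"]) (auto simp: smooth_real_on_def intro: Ck_on_mult)

lemma smooth_at_const:
  assumes "p \<in> topspace (mtop M)"
  shows "smooth_at M (\<lambda>q. c) p"
proof -
  obtain i where "i \<in> charts_at M p" using assms topspace_iff_charts_at by blast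
  then show ?thesis
    by (intro smooth_atI_chart[of i p "coord M i ` cdom M i"])
       (auto simp: charts_at_iff smooth_real_on_def intro!: Ck_on_const openin_coord_cdom)
qed

lemma smooth_fun_const: "openin (mtop M) U \<Longrightarrow> smooth_fun M U (\<lambda>q. c)"
  by (auto simp: smooth_fun_iff_smooth_at intro: smooth_at_const openin_imp_topspace)

lemma smooth_at_minus: "smooth_at M f p \<Longrightarrow> smooth_at M (\<lambda>q. - f q) p"
  using smooth_at_mult[OF smooth_at_const, of p f "-1"] smooth_at_imp_topspace by simp

lemma smooth_at_diff: "smooth_at M f p \<Longrightarrow> smooth_at M g p \<Longrightarrow> smooth_at M (\<lambda>q. f q - g q) p"
  using smooth_at_add[OF _ smooth_at_minus] by simp

lemma smooth_at_sum:
  "p \<in> topspace (mtop M) \<Longrightarrow> (\<And>a. a \<in> A \<Longrightarrow> smooth_at M (f a) p) \<Longrightarrow> smooth_at M (\<lambda>q. \<Sum>a\<in>A. f a q) p"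
  by (induction A rule: infinite_finite_induct) (auto intro: smooth_at_add smooth_at_const)

lemma smooth_at_coord:
  assumes i: "i \<in> charts_at M p"
  shows "smooth_at M (\<lambda>q. coord M i q k) p"
proof -
  have W: "openin (Euclidean_space n) (coord M i ` cdom M i)"
    using i by (simp add: charts_at_iff openin_coord_cdom)
  have "smooth_real_on n (coord M i ` cdom M i) (\<lambda>x. coord M i (cinv M i x) k)"
    by (rule smooth_real_on_cong[OF W, of "\<lambda>x. x k"])
       (simp_all add: smooth_real_on_def Ck_on_coordinate[OF W] coord_cinv)
  then show ?thesis by (rule smooth_atI_chart[OF i W, rotated]) (use i in \<open>simp add: charts_at_iff\<close>)
qed

lemma smooth_at_inverse_sqrt:
  assumes f: "smooth_at M f p" and pos: "\<forall>\<^sub>F q in near p. f q > 0"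
  shows "smooth_at M (\<lambda>q. 1 / sqrt (f q)) p"
proof -
  obtain i where i: "i \<in> charts_at M p" using smooth_at_imp_topspace[OF f] topspace_iff_charts_at by blast
  obtain W where W: "openin (Euclidean_space n) W" "coord M i p \<in> W"
      "smooth_real_on n W (\<lambda>x. f (cinv M i x))"
    by (rule smooth_atD_chart[OF f i])
  obtain U where U: "openin (mtop M) U" "p \<in> U" "\<And>q. q \<in> U \<Longrightarrow> f q > 0"
    using eventually_nhdsinE[OF pos smooth_at_imp_topspace[OF f]] by metis
  let ?V = "W \<inter> coord M i ` (U \<inter> cdom M i)"
  have V: "openin (Euclidean_space n) ?V"
    using W(1) U(1) i by (intro openin_Int openin_coord_Int) (auto simp: charts_at_iff)
  have "Ck_on n k ?V (\<lambda>x. 1 / sqrt (f (cinv M i x)))" for k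
  proof (rule Ck_on_inverse_sqrt[OF V])
    show "Ck_on n k ?V (\<lambda>x. f (cinv M i x))"
      by (rule Ck_on_subset[OF Int_lower1 smooth_real_on_Ck[OF W(3)]])
    show "f (cinv M i x) > 0" if "x \<in> ?V" for x
      using that U(3) i by (auto simp: charts_at_iff cinv_coord)
  qed
  then show ?thesis
    by (intro smooth_atI_chart[OF i V]) (use W(2) U(2) i in \<open>auto simp: charts_at_iff smooth_real_on_def\<close>)
qed

lemma smooth_at_chart_pderiv:
  assumes f: "smooth_at M f p" and i: "i \<in> charts_at M p" and a: "a < n"
  shows "smooth_at M (chart_pderiv M i a f) p"
proof -
  obtain W where W: "openin (Euclidean_space n) W" "coord M i p \<in> W" "W \<subseteq> coord M i ` cdom M i"
    "smooth_real_on n W (\<lambda>x. f (cinv M i x))" by (rule smooth_atD_chart[OF f i])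
  have "pderiv_at a (\<lambda>x. f (cinv M i x)) y = chart_pderiv M i a f (cinv M i y)" if "y \<in> W" for y
    using that W(3) coord_cinv[of y i] by (auto simp: chart_pderiv_def)
  then have "smooth_real_on n W (\<lambda>x. chart_pderiv M i a f (cinv M i x))"
    by (rule smooth_real_on_cong[OF W(1) smooth_real_on_pderiv[OF W(4) a]])
  then show ?thesis by (rule smooth_atI_chart[OF i W(1,2)])
qed


subsection \<open>Partial derivatives in a chart\<close>

lemma chart_pderiv_has_derivative:
  assumes f: "smooth_at M f p" and i: "i \<in> charts_at M p" and a: "a < n"
  shows "has_pderiv a (\<lambda>x. f (cinv M i x)) (chart_pderiv M i a f p) (coord M i p)"
proof -
  obtain W where W: "openin (Euclidean_space n) W" "coord M i p \<in> W"
      "smooth_real_on n W (\<lambda>x. f (cinv M i x))"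
    by (rule smooth_atD_chart[OF f i])
  from Ck_on_has_pderiv[OF W(1) smooth_real_on_Ck[OF W(3)] W(2) a] show ?thesis unfolding chart_pderiv_def .
qed

lemma chart_pderivI:
  "has_pderiv a (\<lambda>x. f (cinv M i x)) D (coord M i p) \<Longrightarrow> chart_pderiv M i a f p = D"
  unfolding chart_pderiv_def by (rule has_pderiv_imp_pderiv_at)

lemma chart_pderiv_add:
  "smooth_at M f p \<Longrightarrow> smooth_at M g p \<Longrightarrow> i \<in> charts_at M p \<Longrightarrow> a < n \<Longrightarrow>
   chart_pderiv M i a (\<lambda>q. f q + g q) p = chart_pderiv M i a f p + chart_pderiv M i a g p"
  by (rule chart_pderivI[OF DERIV_add[OF chart_pderiv_has_derivative chart_pderiv_has_derivative]])

lemma chart_pderiv_mult: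
  "smooth_at M f p \<Longrightarrow> smooth_at M g p \<Longrightarrow> i \<in> charts_at M p \<Longrightarrow> a < n \<Longrightarrow>
   chart_pderiv M i a (\<lambda>q. f q * g q) p = chart_pderiv M i a f p * g p + f p * chart_pderiv M i a g p"
  by (rule chart_pderivI,
      rule DERIV_cong[OF DERIV_mult[OF chart_pderiv_has_derivative chart_pderiv_has_derivative]])
     (auto simp: cinv_coord)

lemma chart_pderiv_const: "chart_pderiv M i a (\<lambda>q. c) p = 0"
  by (rule chart_pderivI) simp

lemma chart_pderiv_cong:
  assumes eq: "\<forall>\<^sub>F q in near p. f q = g q" and i: "i \<in> charts_at M p" and a: "a < n"
  shows "chart_pderiv M i a f p = chart_pderiv M i a g p"
proof -
  obtain U where U: "openin (mtop M) U" "p \<in> U" "\<And>q. q \<in> U \<Longrightarrow> f q = g q"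
    using eventually_nhdsinE[OF eq charts_at_imp_topspace[OF i]] by metis
  then have "openin (Euclidean_space n) (coord M i ` (U \<inter> cdom M i))"
    using i by (intro openin_coord_Int) (auto simp: charts_at_iff)
  then show ?thesis
    unfolding chart_pderiv_def by (rule pderiv_at_cong) (use U i a in \<open>auto simp: charts_at_iff cinv_coord\<close>)
qed

lemma chart_pderiv_coord:
  assumes i: "i \<in> charts_at M p" and "a < n"
  shows "chart_pderiv M i a (\<lambda>q. coord M i q b) p = (if a = b then 1 else 0)"
proof -
  have "openin (Euclidean_space n) (coord M i ` cdom M i)"
    using i by (simp add: charts_at_iff openin_coord_cdom)
  then have "chart_pderiv M i a (\<lambda>q. coord M i q b) p = pderiv_at a (\<lambda>x. x b) (coord M i p)"
    unfolding chart_pderiv_def by (rule pderiv_at_cong) (use assms in \<open>auto simp: charts_at_iff coord_cinv\<close>)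
  also have "\<dots> = (if a = b then 1 else 0)" by (auto simp: pderiv_at_def)
  finally show ?thesis .
qed

lemma chart_pderiv_commute:
  assumes f: "smooth_at M f p" and i: "i \<in> charts_at M p" and ab: "a < n" "b < n"
  shows "chart_pderiv M i a (chart_pderiv M i b f) p = chart_pderiv M i b (chart_pderiv M i a f) p"
proof -
  obtain W where W: "openin (Euclidean_space n) W" "coord M i p \<in> W" "W \<subseteq> coord M i ` cdom M i"
    "smooth_real_on n W (\<lambda>x. f (cinv M i x))" by (rule smooth_atD_chart[OF f i])
  have second: "chart_pderiv M i a (chart_pderiv M i b f) p
      = pderiv_at a (pderiv_at b (\<lambda>x. f (cinv M i x))) (coord M i p)" if "a < n" for a b
    unfolding chart_pderiv_def[of M i a]
    by (rule pderiv_at_cong[OF W(1,2) that]) (use W(3) coord_cinv[of _ i] in \<open>auto simp: chart_pderiv_def\<close>)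
  show ?thesis
    unfolding second[OF ab(1)] second[OF ab(2)]
    by (rule C2_mixed_partials[OF W(1) smooth_real_on_Ck[OF W(4)] W(2) ab])
qed

lemma chart_pderiv_change:
  assumes f: "smooth_at M f p" and i: "i \<in> charts_at M p" and j: "j \<in> charts_at M p" and a: "a < n"
  shows "chart_pderiv M i a f p = (\<Sum>b<n. jacobian M i j p b a * chart_pderiv M j b f p)"
proof -
  obtain W where W: "openin (Euclidean_space n) W" "coord M j p \<in> W"
      "smooth_real_on n W (\<lambda>x. f (cinv M j x))"
    by (rule smooth_atD_chart[OF f j])
  have ic: "i \<in> charts M" "j \<in> charts M" using i j by (auto simp: charts_at_iff)
  let ?O = "coord M i ` (cdom M i \<inter> cdom M j)"
  have open_O: "openin (Euclidean_space n) ?O"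
    using openin_coord_Int[OF ic(1) openin_cdom[OF ic(2)]] by (simp add: Int_commute)
  have p: "coord M i p \<in> ?O" using i j by (auto simp: charts_at_iff)
  have at_p: "transition i j (coord M i p) = coord M j p"
    by (simp add: transition_eq[OF ic p] cinv_coord[OF i])
  let ?\<phi> = "\<lambda>s. transition i j ((coord M i p)(a := s))"
  have "((\<lambda>s. f (cinv M j (?\<phi> s))) has_real_derivative
     (\<Sum>b<n. pderiv_at b (\<lambda>x. f (cinv M j x)) (?\<phi> (coord M i p a)) * jacobian M i j p b a))
     (at (coord M i p a))"
  proof (rule C1_chain_rule[OF W(1) smooth_real_on_Ck[OF W(3)]])
    show "?\<phi> (coord M i p a) \<in> W" using W(2) by (simp add: at_p)
    show "((\<lambda>s. ?\<phi> s b) has_real_derivative jacobian M i j p b a) (at (coord M i p a))" if "b < n" for b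
      using chart_pderiv_has_derivative[OF smooth_at_coord[OF j] i a, of b] that
      by (simp add: jacobian_eq_chart_pderiv transition_def)
  qed (simp add: transition_def)
  then have "has_pderiv a (\<lambda>x. f (cinv M j (transition i j x)))
     (\<Sum>b<n. jacobian M i j p b a * chart_pderiv M j b f p) (coord M i p)"
    by (simp add: at_p chart_pderiv_def mult.commute)
  then have "has_pderiv a (\<lambda>x. f (cinv M i x)) (\<Sum>b<n. jacobian M i j p b a * chart_pderiv M j b f p)
      (coord M i p)"
    by (rule has_pderiv_transform[OF open_O p a, rotated])
       (use i j in \<open>auto simp: transition_eq[OF ic] cinv_coord charts_at_iff\<close>)
  then show ?thesis by (rule chart_pderivI)
qed

lemma smooth_at_jacobian:
  "i \<in> charts_at M p \<Longrightarrow> j \<in> charts_at M p \<Longrightarrow> a < n \<Longrightarrow> smooth_at M (\<lambda>q. jacobian M i j q k a) p"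
  unfolding jacobian_eq_chart_pderiv by (intro smooth_at_chart_pderiv smooth_at_coord)

lemma jacobian_self: "i \<in> charts_at M p \<Longrightarrow> a < n \<Longrightarrow> jacobian M i i p k a = (if k = a then 1 else 0)"
  unfolding jacobian_eq_chart_pderiv using chart_pderiv_coord by auto

lemma jacobian_cocycle:
  assumes "i \<in> charts_at M p" "j \<in> charts_at M p" "l \<in> charts_at M p" "a < n"
  shows "jacobian M i l p k a = (\<Sum>b<n. jacobian M j l p k b * jacobian M i j p b a)"
  unfolding jacobian_eq_chart_pderiv[of M i l]
      chart_pderiv_change[OF smooth_at_coord[OF assms(3)] assms(1,2,4)]
  by (simp add: jacobian_eq_chart_pderiv mult.commute)

end


section \<open>Tangent vectors and vector fields\<close>

lemma vfield_tangent: "vfield M U X \<Longrightarrow> p \<in> U \<Longrightarrow> X p \<in> tangent_space M p"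
  by (simp add: vfield_def)

lemma vfield_subset: "V \<subseteq> U \<Longrightarrow> vfield M U X \<Longrightarrow> vfield M V X"
  unfolding vfield_def by (meson Int_mono image_mono order_refl smooth_real_on_subset subset_eq)

context smooth_mfd
begin

subsection \<open>Tangent spaces\<close>

lemma tangent_spaceI:
  assumes "\<And>i. i \<notin> charts_at M p \<Longrightarrow> u i = 0" "\<And>i k. k \<ge> n \<Longrightarrow> u i k = 0"
    "\<And>i j k. i \<in> charts_at M p \<Longrightarrow> j \<in> charts_at M p \<Longrightarrow> k < n \<Longrightarrow>
       u j k = (\<Sum>a<n. jacobian M i j p k a * u i a)"
  shows "u \<in> tangent_space M p"
  unfolding tangent_space_def using assms(1,2) by (auto intro: assms(3) simp del: fun_eq_iff)

lemma tangent_transform: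
  "u \<in> tangent_space M p \<Longrightarrow> i \<in> charts_at M p \<Longrightarrow> j \<in> charts_at M p \<Longrightarrow> k < n \<Longrightarrow>
   u j k = (\<Sum>a<n. jacobian M i j p k a * u i a)"
  by (simp add: tangent_space_def)

lemma tangent_outside: "u \<in> tangent_space M p \<Longrightarrow> i \<notin> charts_at M p \<Longrightarrow> u i = 0"
  by (simp add: tangent_space_def)

lemma tangent_beyond: "u \<in> tangent_space M p \<Longrightarrow> k \<ge> n \<Longrightarrow> u i k = 0"
  by (simp add: tangent_space_def)

lemma subspace_tangent_space: "tvec.subspace (tangent_space M p)"
  unfolding tvec.subspace_def
proof (intro conjI ballI allI)
  fix u v c assume u: "u \<in> tangent_space M p"
  show "tscale c u \<in> tangent_space M p"
  proof (rule tangent_spaceI)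
    fix i j k assume ijk: "i \<in> charts_at M p" "j \<in> charts_at M p" "k < n"
    show "tscale c u j k = (\<Sum>a<n. jacobian M i j p k a * tscale c u i a)"
      unfolding tscale_def tangent_transform[OF u ijk] by (simp add: sum_distrib_left mult_ac)
  qed (use u in \<open>auto simp: tangent_outside tangent_beyond tscale_def\<close>)
  assume v: "v \<in> tangent_space M p"
  show "u + v \<in> tangent_space M p"
  proof (rule tangent_spaceI)
    fix i j k assume ijk: "i \<in> charts_at M p" "j \<in> charts_at M p" "k < n"
    show "(u + v) j k = (\<Sum>a<n. jacobian M i j p k a * (u + v) i a)"
      unfolding plus_fun_apply tangent_transform[OF u ijk] tangent_transform[OF v ijk]
      by (simp add: sum.distrib distrib_left)
  qed (use u v in \<open>auto simp: tangent_outside tangent_beyond\<close>)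
qed (rule tangent_space_zero)

lemmas tangent_add = tvec.subspace_add[OF subspace_tangent_space]
  and tangent_scale = tvec.subspace_scale[OF subspace_tangent_space]
  and tangent_minus = tvec.subspace_neg[OF subspace_tangent_space]
  and tangent_diff = tvec.subspace_diff[OF subspace_tangent_space]
  and tangent_sum = tvec.subspace_sum[OF subspace_tangent_space]

lemma tangent_eqI:
  assumes u: "u \<in> tangent_space M p" and v: "v \<in> tangent_space M p" and i: "i \<in> charts_at M p"
    and eq: "\<And>k. k < n \<Longrightarrow> u i k = v i k"
  shows "u = v"
proof (intro ext)
  fix j k
  show "u j k = v j k"
  proof (cases "j \<in> charts_at M p \<and> k < n")
    case True
    then show ?thesis using tangent_transform[OF u i, of j k] tangent_transform[OF v i, of j k] eq by simp
  next
    case False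
    then show ?thesis using u v by (auto simp: tangent_outside tangent_beyond not_less)
  qed
qed

lemma coord_field_tangent:
  assumes "i \<in> charts_at M p" "a < n"
  shows "coord_field M i a p \<in> tangent_space M p"
proof (rule tangent_spaceI)
  fix j l k assume "j \<in> charts_at M p" "l \<in> charts_at M p" "k < n"
  then show "coord_field M i a p l k = (\<Sum>b<n. jacobian M j l p k b * coord_field M i a p j b)"
    using jacobian_cocycle[OF assms(1) _ _ assms(2), of j l k] by (simp add: coord_field_def)
qed (auto simp: coord_field_def fun_eq_iff)

lemma coord_field_self:
  "i \<in> charts_at M p \<Longrightarrow> a < n \<Longrightarrow> k < n \<Longrightarrow> coord_field M i a p i k = (if k = a then 1 else 0)"
  by (simp add: coord_field_def jacobian_self)

lemma coord_field_comb:
  assumes i: "i \<in> charts_at M p"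
  shows "(\<Sum>a<n. tscale (c a) (coord_field M i a p)) \<in> tangent_space M p"
    and "k < n \<Longrightarrow> (\<Sum>a<n. tscale (c a) (coord_field M i a p)) i k = c k"
proof -
  show "(\<Sum>a<n. tscale (c a) (coord_field M i a p)) \<in> tangent_space M p"
    by (intro tangent_sum tangent_scale coord_field_tangent i) simp
  show "(\<Sum>a<n. tscale (c a) (coord_field M i a p)) i k = c k" if "k < n"
    using that by (simp add: sum_fun_apply tscale_def coord_field_self[OF i] if_distrib cong: if_cong)
qed

lemma tangent_expand:
  assumes u: "u \<in> tangent_space M p" and i: "i \<in> charts_at M p"
  shows "u = (\<Sum>a<n. tscale (u i a) (coord_field M i a p))"
  by (rule tangent_eqI[OF u coord_field_comb(1)[OF i] i]) (simp add: coord_field_comb(2)[OF i])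


subsection \<open>Directional derivatives\<close>

lemma dirder_some_chart:
  assumes "p \<in> topspace (mtop M)"
  obtains i where "i \<in> charts_at M p" "\<And>u f. dirder M p u f = (\<Sum>a<n. u i a * chart_pderiv M i a f p)"
proof (rule that[of "SOME i. i \<in> charts_at M p"])
  show "(SOME i. i \<in> charts_at M p) \<in> charts_at M p"
    using assms unfolding topspace_iff_charts_at by (rule someI_ex)
qed (simp add: dirder_def chart_pderiv_def Let_def)

lemma dirder_chart:
  assumes u: "u \<in> tangent_space M p" and f: "smooth_at M f p" and i: "i \<in> charts_at M p"
  shows "dirder M p u f = (\<Sum>a<n. u i a * chart_pderiv M i a f p)"
proof -
  obtain j where j: "j \<in> charts_at M p" "dirder M p u f = (\<Sum>a<n. u j a * chart_pderiv M j a f p)"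
    by (rule dirder_some_chart[OF charts_at_imp_topspace[OF i]]) blast
  have "(\<Sum>a<n. u i a * chart_pderiv M i a f p)
      = (\<Sum>a<n. \<Sum>b<n. u i a * (jacobian M i j p b a * chart_pderiv M j b f p))"
    by (simp add: chart_pderiv_change[OF f i j(1)] sum_distrib_left)
  also have "\<dots> = (\<Sum>b<n. (\<Sum>a<n. jacobian M i j p b a * u i a) * chart_pderiv M j b f p)"
    by (subst sum.swap) (simp add: sum_distrib_right sum_distrib_left mult_ac)
  also have "\<dots> = dirder M p u f" by (simp add: j(2) tangent_transform[OF u i j(1)])
  finally show ?thesis by simp
qed

lemma dirder_cong:
  assumes eq: "\<forall>\<^sub>F q in near p. f q = g q" and p: "p \<in> topspace (mtop M)"
  shows "dirder M p u f = dirder M p u g"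
proof -
  obtain i where "i \<in> charts_at M p" "\<And>f. dirder M p u f = (\<Sum>a<n. u i a * chart_pderiv M i a f p)"
    by (rule dirder_some_chart[OF p]) blast
  then show ?thesis by (simp add: chart_pderiv_cong[OF eq])
qed

lemma dirder_add:
  assumes f: "smooth_at M f p" and g: "smooth_at M g p"
  shows "dirder M p u (\<lambda>q. f q + g q) = dirder M p u f + dirder M p u g"
proof -
  obtain i where "i \<in> charts_at M p" "\<And>f. dirder M p u f = (\<Sum>a<n. u i a * chart_pderiv M i a f p)"
    by (rule dirder_some_chart[OF smooth_at_imp_topspace[OF f]]) blast
  then show ?thesis by (simp add: chart_pderiv_add[OF f g] distrib_left sum.distrib)
qed

lemma dirder_mult:
  assumes f: "smooth_at M f p" and g: "smooth_at M g p"
  shows "dirder M p u (\<lambda>q. f q * g q) = dirder M p u f * g p + f p * dirder M p u g"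
proof -
  obtain i where "i \<in> charts_at M p" "\<And>f. dirder M p u f = (\<Sum>a<n. u i a * chart_pderiv M i a f p)"
    by (rule dirder_some_chart[OF smooth_at_imp_topspace[OF f]]) blast
  then show ?thesis
    by (simp add: chart_pderiv_mult[OF f g] distrib_left sum.distrib sum_distrib_left sum_distrib_right
        mult_ac)
qed

lemma dirder_const: "dirder M p u (\<lambda>q. c) = 0"
  using chart_pderiv_const[of _ _ c p] by (simp add: dirder_def chart_pderiv_def Let_def)

lemma dirder_sum:
  assumes p: "p \<in> topspace (mtop M)" and "\<And>b. b \<in> B \<Longrightarrow> smooth_at M (f b) p"
  shows "dirder M p u (\<lambda>q. \<Sum>b\<in>B. f b q) = (\<Sum>b\<in>B. dirder M p u (f b))"
  using assms(2)
  by (induction B rule: infinite_finite_induct) (simp_all add: dirder_const dirder_add smooth_at_sum[OF p])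

lemma dirder_sum_mult:
  assumes p: "p \<in> topspace (mtop M)"
    and f: "\<And>b. b \<in> B \<Longrightarrow> smooth_at M (f b) p" and h: "\<And>b. b \<in> B \<Longrightarrow> smooth_at M (h b) p"
  shows "dirder M p u (\<lambda>q. \<Sum>b\<in>B. f b q * h b q)
    = (\<Sum>b\<in>B. dirder M p u (f b) * h b p) + (\<Sum>b\<in>B. f b p * dirder M p u (h b))"
  using dirder_sum[OF p, of B "\<lambda>b q. f b q * h b q" u] f h
  by (simp add: smooth_at_mult dirder_mult sum.distrib)

lemma dirder_plus_vec: "dirder M p (u + v) f = dirder M p u f + dirder M p v f"
  by (simp add: dirder_def Let_def distrib_right sum.distrib)

lemma dirder_scale_vec: "dirder M p (tscale c u) f = c * dirder M p u f"
  by (simp add: dirder_def Let_def tscale_def sum_distrib_left mult_ac)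

lemma dirder_coord_field:
  "smooth_at M f p \<Longrightarrow> i \<in> charts_at M p \<Longrightarrow> a < n \<Longrightarrow> dirder M p (coord_field M i a p) f =
  chart_pderiv M i a f p"
  using dirder_chart[OF coord_field_tangent, of i p a f i]
  by (simp add: coord_field_self if_distrib[of "\<lambda>x. x * _"] cong: if_cong)

lemma dirder_coord:
  assumes u: "u \<in> tangent_space M p" and i: "i \<in> charts_at M p" and "k < n"
  shows "dirder M p u (\<lambda>q. coord M i q k) = u i k"
  unfolding dirder_chart[OF u smooth_at_coord[OF i] i] using \<open>k < n\<close>
  by (simp add: chart_pderiv_coord[OF i] if_distrib cong: if_cong)


subsection \<open>Vector fields\<close>

lemma vfield_smooth_at:
  assumes U: "openin (mtop M) U" and X: "vfield M U X" and p: "p \<in> U" and i: "i \<in> charts_at M p"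
    and k: "k < n"
  shows "smooth_at M (\<lambda>q. X q i k) p"
  by (rule smooth_atI_chart[OF i openin_coord_Int[OF _ U]])
     (use X p i k in \<open>auto simp: vfield_def charts_at_iff\<close>)

lemma vfieldI:
  assumes U: "openin (mtop M) U" and X: "\<And>p. p \<in> U \<Longrightarrow> X p \<in> tangent_space M p"
    and smooth: "\<And>p. p \<in> U \<Longrightarrow> \<exists>i\<in>charts_at M p. \<forall>k<n. smooth_at M (\<lambda>q. X q i k) p"
  shows "vfield M U X"
  unfolding vfield_def
proof (intro conjI ballI allI impI X)
  fix j k assume j: "j \<in> charts M" and k: "k < n"
  have "smooth_at M (\<lambda>q. X q j k) p" if p: "p \<in> U \<inter> cdom M j" for p
  proof -
    obtain i where i: "i \<in> charts_at M p" "\<And>k. k < n \<Longrightarrow> smooth_at M (\<lambda>q. X q i k) p" using smooth p by blast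
    have jp: "j \<in> charts_at M p" using j p by (auto simp: charts_at_iff)
    have "\<forall>\<^sub>F q in near p. q \<in> U" using p by (intro eventually_nhdsinI[OF U]) auto
    then have "\<forall>\<^sub>F q in near p. (\<Sum>a<n. jacobian M i j q k a * X q i a) = X q j k"
      using eventually_near_charts_at[OF i(1)] eventually_near_charts_at[OF jp]
      by eventually_elim (simp add: tangent_transform[OF X _ _ k])
    then show ?thesis
      by (rule smooth_at_cong)
         (intro smooth_at_sum smooth_at_mult smooth_at_jacobian i jp charts_at_imp_topspace[OF jp], auto
         intro: i)
  qed
  moreover have "openin (mtop M) (U \<inter> cdom M j)" using U openin_cdom[OF j] by auto
  ultimately have "smooth_fun M (U \<inter> cdom M j) (\<lambda>q. X q j k)" by (simp add: smooth_fun_iff_smooth_at)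
  then show "smooth_real_on n (coord M j ` (U \<inter> cdom M j)) (\<lambda>x. X (cinv M j x) j k)"
    using j by (auto simp: smooth_fun_def)
qed

lemma vfield_pointwise:
  assumes U: "openin (mtop M) U" and tangent: "\<And>p. p \<in> U \<Longrightarrow> X p \<in> tangent_space M p"
    and smooth: "\<And>p i k. p \<in> U \<Longrightarrow> i \<in> charts_at M p \<Longrightarrow> k < n \<Longrightarrow> smooth_at M (\<lambda>q. X q i k) p"
  shows "vfield M U X"
  using openin_ex_chart[OF U] smooth by (intro vfieldI[OF U tangent]) blast+

lemma vfield_add:
  assumes U: "openin (mtop M) U" and X: "vfield M U X" and Y: "vfield M U Y"
  shows "vfield M U (X + Y)"
proof (rule vfield_pointwise[OF U])
  show "(X + Y) p \<in> tangent_space M p" if "p \<in> U" for p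
    unfolding plus_fun_apply[of X Y p]
    by (intro tangent_add vfield_tangent[OF X that] vfield_tangent[OF Y that])
  show "smooth_at M (\<lambda>q. (X + Y) q i k) p" if "p \<in> U" "i \<in> charts_at M p" "k < n" for p i k
    unfolding plus_fun_apply
    by (intro smooth_at_add vfield_smooth_at[OF U X that] vfield_smooth_at[OF U Y that])
qed

lemma vfield_fscale:
  assumes U: "openin (mtop M) U" and f: "smooth_fun M U f" and X: "vfield M U X"
  shows "vfield M U (fscale f X)"
proof (rule vfield_pointwise[OF U])
  show "fscale f X p \<in> tangent_space M p" if "p \<in> U" for p
    unfolding fscale_apply by (rule tangent_scale[OF vfield_tangent[OF X that]])
  show "smooth_at M (\<lambda>q. fscale f X q i k) p" if "p \<in> U" "i \<in> charts_at M p" "k < n" for p i k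
    unfolding fscale_apply tscale_apply
    using f that(1) by (intro smooth_at_mult vfield_smooth_at[OF U X that])
        (simp add: smooth_fun_iff_smooth_at[OF U])
qed

lemma vfield_zero: "openin (mtop M) U \<Longrightarrow> vfield M U 0"
  by (rule vfield_pointwise) (auto simp: tangent_space_zero intro: smooth_at_const charts_at_imp_topspace)

lemma vfield_minus:
  assumes U: "openin (mtop M) U" and X: "vfield M U X"
  shows "vfield M U (- X)"
proof -
  have "fscale (\<lambda>p. -1) X = - X" by (simp add: fun_eq_iff fscale_def)
  with vfield_fscale[OF U smooth_fun_const[OF U] X, of "-1"] show ?thesis by simp
qed

lemma vfield_diff:
  "openin (mtop M) U \<Longrightarrow> vfield M U X \<Longrightarrow> vfield M U Y \<Longrightarrow> vfield M U (X - Y)"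
  using vfield_add[OF _ _ vfield_minus, of U X Y] by simp

lemma vfield_sum:
  "openin (mtop M) U \<Longrightarrow> (\<And>a. a \<in> A \<Longrightarrow> vfield M U (X a)) \<Longrightarrow> vfield M U (\<Sum>a\<in>A. X a)"
  by (induction A rule: infinite_finite_induct) (auto intro: vfield_add vfield_zero)

lemma vfield_cong:
  assumes U: "openin (mtop M) U" and X: "vfield M U X" and eq: "\<And>p. p \<in> U \<Longrightarrow> X p = Y p"
  shows "vfield M U Y"
proof (rule vfield_pointwise[OF U])
  fix p i k assume p: "p \<in> U" and "i \<in> charts_at M p" "k < n"
  then have "smooth_at M (\<lambda>q. X q i k) p" by (rule vfield_smooth_at[OF U X])
  then show "smooth_at M (\<lambda>q. Y q i k) p"
    by (rule smooth_at_cong[rotated]) (auto intro: eventually_nhdsinI[OF U p] simp: eq)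
qed (use vfield_tangent[OF X] eq in force)

lemma coord_field_vfield:
  assumes i: "i \<in> charts M" and a: "a < n"
  shows "vfield M (cdom M i) (coord_field M i a)"
proof (rule vfieldI[OF openin_cdom[OF i]])
  fix p assume "p \<in> cdom M i"
  then have ip: "i \<in> charts_at M p" using i by (auto simp: charts_at_iff)
  show "coord_field M i a p \<in> tangent_space M p" by (rule coord_field_tangent[OF ip a])
  have "smooth_at M (\<lambda>q. coord_field M i a q i k) p" if "k < n" for k
  proof (rule smooth_at_cong)
    show "\<forall>\<^sub>F q in near p. (if k = a then 1 else 0) = coord_field M i a q i k"
      by (rule eventually_mono[OF eventually_near_charts_at[OF ip]]) (simp add: coord_field_self a that)
  qed (rule smooth_at_const[OF charts_at_imp_topspace[OF ip]])
  with ip show "\<exists>i'\<in>charts_at M p. \<forall>k<n. smooth_at M (\<lambda>q. coord_field M i a q i' k) p" by blast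
qed

lemma tangent_extend:
  assumes u: "u \<in> tangent_space M p" and i: "i \<in> charts_at M p"
  obtains X where "vfield M (cdom M i) X" "X p = u"
proof (rule that[of "\<Sum>a<n. fscale (\<lambda>q. u i a) (coord_field M i a)"])
  have ic: "i \<in> charts M" using i by (simp add: charts_at_iff)
  note U = openin_cdom[OF ic]
  show "vfield M (cdom M i) (\<Sum>a<n. fscale (\<lambda>q. u i a) (coord_field M i a))"
    by (intro vfield_sum[OF U] vfield_fscale[OF U] coord_field_vfield[OF ic] smooth_fun_const[OF U]) simp
  show "(\<Sum>a<n. fscale (\<lambda>q. u i a) (coord_field M i a)) p = u"
    using tangent_expand[OF u i] by (simp add: sum_fun_apply fscale_def)
qed

lemma dirder_vfield_chart:
  assumes U: "openin (mtop M) U" and X: "vfield M U X" and f: "\<And>q. q \<in> U \<Longrightarrow> smooth_at M f q"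
    and p: "p \<in> U" and i: "i \<in> charts_at M p"
  shows "\<forall>\<^sub>F q in near p. (\<Sum>a<n. X q i a * chart_pderiv M i a f q) = dirder M q (X q) f"
proof -
  have "\<forall>\<^sub>F q in near p. q \<in> U" by (rule eventually_nhdsinI[OF U p])
  then show ?thesis
    using eventually_near_charts_at[OF i] by eventually_elim (simp add: dirder_chart vfield_tangent[OF X] f)
qed

lemma smooth_at_dirder:
  assumes U: "openin (mtop M) U" and X: "vfield M U X" and f: "\<And>q. q \<in> U \<Longrightarrow> smooth_at M f q" and p: "p \<in> U"
  shows "smooth_at M (\<lambda>q. dirder M q (X q) f) p"
proof -
  obtain i where i: "i \<in> charts_at M p" using openin_ex_chart[OF U p] ..
  show ?thesis
    by (rule smooth_at_cong[OF dirder_vfield_chart[OF U X f p i]])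
       (auto intro!: smooth_at_sum charts_at_imp_topspace[OF i] smooth_at_mult vfield_smooth_at[OF U X p i]
         smooth_at_chart_pderiv[OF f[OF p] i])
qed


subsection \<open>The Lie bracket\<close>

lemma bracket_apply:
  "i \<in> charts_at M p \<Longrightarrow> k < n \<Longrightarrow>
   bracket M X Y p i k = dirder M p (X p) (\<lambda>q. Y q i k) - dirder M p (Y p) (\<lambda>q. X q i k)"
  by (simp add: bracket_def)

lemma dirder_commutator:
  assumes U: "openin (mtop M) U" and X: "vfield M U X" and Y: "vfield M U Y"
    and f: "\<And>q. q \<in> U \<Longrightarrow> smooth_at M f q" and p: "p \<in> U" and i: "i \<in> charts_at M p"
  shows "dirder M p (X p) (\<lambda>q. dirder M q (Y q) f) - dirder M p (Y p) (\<lambda>q. dirder M q (X q) f)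
     = (\<Sum>b<n. bracket M X Y p i b * chart_pderiv M i b f p)"
proof -
  note top = charts_at_imp_topspace[OF i] and smooth_pderiv = smooth_at_chart_pderiv[OF f[OF p] i]
  have second: "dirder M p (X p) (\<lambda>q. dirder M q (Y q) f)
      = (\<Sum>b<n. dirder M p (X p) (\<lambda>q. Y q i b) * chart_pderiv M i b f p)
      + (\<Sum>b<n. \<Sum>a<n. X p i a * Y p i b * chart_pderiv M i a (chart_pderiv M i b f) p)"
    if X: "vfield M U X" and Y: "vfield M U Y" for X Y
  proof -
    have "dirder M p (X p) (\<lambda>q. dirder M q (Y q) f)
        = dirder M p (X p) (\<lambda>q. \<Sum>b<n. Y q i b * chart_pderiv M i b f q)"
      by (rule dirder_cong[OF dirder_vfield_chart[OF U Y f p i] top, symmetric])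
    also have "\<dots> = (\<Sum>b<n. dirder M p (X p) (\<lambda>q. Y q i b) * chart_pderiv M i b f p)
        + (\<Sum>b<n. Y p i b * dirder M p (X p) (chart_pderiv M i b f))"
      by (rule dirder_sum_mult[OF top]) (auto intro: vfield_smooth_at[OF U Y p i] smooth_pderiv)
    finally show ?thesis
      by (simp add: dirder_chart[OF vfield_tangent[OF X p] smooth_pderiv i] sum_distrib_left mult_ac)
  qed
  have "(\<Sum>b<n. \<Sum>a<n. Y p i a * X p i b * chart_pderiv M i a (chart_pderiv M i b f) p)
      = (\<Sum>b<n. \<Sum>a<n. X p i a * Y p i b * chart_pderiv M i a (chart_pderiv M i b f) p)"
    by (subst sum.swap) (simp add: chart_pderiv_commute[OF f[OF p] i] mult_ac)
  then show ?thesis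
    by (simp add: second[OF X Y] second[OF Y X] bracket_apply[OF i] left_diff_distrib sum_subtractf)
qed

lemma bracket_vfield:
  assumes U: "openin (mtop M) U" and X: "vfield M U X" and Y: "vfield M U Y"
  shows "vfield M U (bracket M X Y)"
proof (rule vfield_pointwise[OF U])
  fix p assume p: "p \<in> U"
  show "bracket M X Y p \<in> tangent_space M p"
  proof (rule tangent_spaceI)
    fix i j k assume i: "i \<in> charts_at M p" and j: "j \<in> charts_at M p" and k: "k < n"
    let ?V = "U \<inter> cdom M j" and ?f = "\<lambda>q. coord M j q k"
    have jc: "j \<in> charts M" using j by (simp add: charts_at_iff)
    have V: "openin (mtop M) ?V" using U openin_cdom[OF jc] by blast
    have pV: "p \<in> ?V" using p j by (simp add: charts_at_iff)
    have XV: "vfield M ?V X" and YV: "vfield M ?V Y" by (auto intro: vfield_subset[OF Int_lower1] X Y)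
    have jq: "j \<in> charts_at M q" if "q \<in> ?V" for q using that jc by (simp add: charts_at_iff)
    have component: "dirder M p (Z p) (\<lambda>q. W q j k) = dirder M p (Z p) (\<lambda>q. dirder M q (W q) ?f)"
      if "vfield M ?V W" for Z W
      by (rule dirder_cong[OF eventually_nhdsinI[OF V pV] openin_imp_topspace[OF U p]])
         (simp add: dirder_coord[OF vfield_tangent[OF that] jq k])
    have "bracket M X Y p j k =
        dirder M p (X p) (\<lambda>q. dirder M q (Y q) ?f) - dirder M p (Y p) (\<lambda>q. dirder M q (X q) ?f)"
      unfolding bracket_apply[OF j k] component[OF XV] component[OF YV] ..
    also have "\<dots> = (\<Sum>a<n. bracket M X Y p i a * chart_pderiv M i a ?f p)"
      by (rule dirder_commutator[OF V XV YV smooth_at_coord[OF jq] pV i])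
    finally show "bracket M X Y p j k = (\<Sum>a<n. jacobian M i j p k a * bracket M X Y p i a)"
      by (simp add: jacobian_eq_chart_pderiv mult.commute)
  qed (auto simp: bracket_def fun_eq_iff)
next
  fix p i k assume p: "p \<in> U" and i: "i \<in> charts_at M p" and k: "k < n"
  let ?V = "U \<inter> cdom M i"
  have ic: "i \<in> charts M" using i by (simp add: charts_at_iff)
  have V: "openin (mtop M) ?V" using U openin_cdom[OF ic] by blast
  have pV: "p \<in> ?V" using p i by (simp add: charts_at_iff)
  have XV: "vfield M ?V X" and YV: "vfield M ?V Y" by (auto intro: vfield_subset[OF Int_lower1] X Y)
  have iq: "i \<in> charts_at M q" if "q \<in> ?V" for q using that ic by (simp add: charts_at_iff)
  have "smooth_at M (\<lambda>q. dirder M q (X q) (\<lambda>q. Y q i k) - dirder M q (Y q) (\<lambda>q. X q i k)) p"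
    by (intro smooth_at_diff smooth_at_dirder[OF V XV vfield_smooth_at[OF V YV _ iq k] pV]
        smooth_at_dirder[OF V YV vfield_smooth_at[OF V XV _ iq k] pV])
  then show "smooth_at M (\<lambda>q. bracket M X Y q i k) p"
    by (rule smooth_at_cong[rotated])
       (auto intro: eventually_mono[OF eventually_near_charts_at[OF i]] simp: bracket_apply k)
qed

lemma dirder_bracket:
  assumes U: "openin (mtop M) U" and X: "vfield M U X" and Y: "vfield M U Y"
    and f: "\<And>q. q \<in> U \<Longrightarrow> smooth_at M f q" and p: "p \<in> U"
  shows "dirder M p (bracket M X Y p) f
    = dirder M p (X p) (\<lambda>q. dirder M q (Y q) f) - dirder M p (Y p) (\<lambda>q. dirder M q (X q) f)"
proof -
  obtain i where i: "i \<in> charts_at M p" using openin_ex_chart[OF U p] ..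
  show ?thesis
    by (rule trans[OF dirder_chart[OF vfield_tangent[OF bracket_vfield[OF U X Y] p] f[OF p] i]
          dirder_commutator[OF U X Y f p i, symmetric]])
qed

lemma bracket_coord_field:
  assumes i: "i \<in> charts_at M p" and "a < n" "b < n"
  shows "bracket M (coord_field M i a) (coord_field M i b) p = 0"
proof -
  have ic: "i \<in> charts M" "p \<in> cdom M i" using i by (simp_all add: charts_at_iff)
  have derivative_eq_0: "dirder M p u (\<lambda>q. coord_field M i a q i k) = 0" if "a < n" "k < n" for u a k
  proof -
    have "\<forall>\<^sub>F q in near p. coord_field M i a q i k = (if k = a then 1 else 0)"
      by (rule eventually_mono[OF eventually_near_charts_at[OF i]]) (simp add: coord_field_self that)
    from dirder_cong[OF this charts_at_imp_topspace[OF i]] show ?thesis by (simp only: dirder_const)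
  qed
  have "bracket M (coord_field M i a) (coord_field M i b) p \<in> tangent_space M p"
    by (rule vfield_tangent[OF bracket_vfield[OF openin_cdom[OF ic(1)] coord_field_vfield[OF ic(1)]
        coord_field_vfield[OF ic(1)]] ic(2)])
       (rule assms)+
  then show ?thesis
    by (rule tangent_eqI[OF _ tangent_space_zero i])
       (use assms in \<open>simp add: bracket_apply derivative_eq_0\<close>)
qed

end


section \<open>Connections\<close>

definition conn_matrix ::
  "('p, 'i) manifold \<Rightarrow> ('p, 'i) conn \<Rightarrow> 'i \<Rightarrow> 'p \<Rightarrow> 'i tvec \<Rightarrow> nat \<Rightarrow> nat \<Rightarrow> real" where
  "conn_matrix M nab i p u k b = (\<Sum>a<mdim M. christoffel M nab i a b k p * u i a)"

definition parallel_endo :: "('p, 'i) manifold \<Rightarrow> ('p, 'i) conn \<Rightarrow> ('p, 'i) endo \<Rightarrow> bool" where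
  "parallel_endo M nab J \<longleftrightarrow>
     (\<forall>U X Y. openin (mtop M) U \<and> vfield M U X \<and> vfield M U Y \<longrightarrow>
        (\<forall>p\<in>U. nab X (apply_endo J Y) p = J p (nab X Y p)))"

definition vfield_generators :: "('p, 'i) manifold \<Rightarrow> 'p set \<Rightarrow> nat \<Rightarrow> (nat \<Rightarrow> ('p, 'i) field) \<Rightarrow> bool" where
  "vfield_generators M U m E \<longleftrightarrow> (\<forall>a<m. vfield M U (E a)) \<and>
     (\<forall>X. vfield M U X \<longrightarrow>
        (\<exists>f. (\<forall>a<m. smooth_fun M U (f a)) \<and> (\<forall>q\<in>U. X q = (\<Sum>a<m. tscale (f a q) (E a q)))))"

lemma conn_matrix_add: "conn_matrix M nab i p (u + v) k b =
    conn_matrix M nab i p u k b + conn_matrix M nab i p v k b"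
  by (simp add: conn_matrix_def distrib_left sum.distrib)

lemma conn_matrix_scale: "conn_matrix M nab i p (tscale c u) k b = c * conn_matrix M nab i p u k b"
  by (simp add: conn_matrix_def tscale_def sum_distrib_left mult_ac)

lemma apply_endo_apply: "apply_endo J X p = J p (X p)"
  by (simp add: apply_endo_def)

lemma connectionI:
  assumes "\<And>U X Y. openin (mtop M) U \<Longrightarrow> vfield M U X \<Longrightarrow> vfield M U Y \<Longrightarrow> vfield M U (nab X Y)"
    and "\<And>U X X' Y p. openin (mtop M) U \<Longrightarrow> vfield M U X \<Longrightarrow> vfield M U X' \<Longrightarrow> vfield M U Y \<Longrightarrow> p \<in> U \<Longrightarrow>
      nab (X + X') Y p = nab X Y p + nab X' Y p"
    and "\<And>U X Y f p. openin (mtop M) U \<Longrightarrow> vfield M U X \<Longrightarrow> vfield M U Y \<Longrightarrow> smooth_fun M U f \<Longrightarrow> p \<in> U \<Longrightarrow>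
      nab (fscale f X) Y p = tscale (f p) (nab X Y p)"
    and "\<And>U X Y Y' p. openin (mtop M) U \<Longrightarrow> vfield M U X \<Longrightarrow> vfield M U Y \<Longrightarrow> vfield M U Y' \<Longrightarrow> p \<in> U \<Longrightarrow>
      nab X (Y + Y') p = nab X Y p + nab X Y' p"
    and "\<And>U X Y f p. openin (mtop M) U \<Longrightarrow> vfield M U X \<Longrightarrow> vfield M U Y \<Longrightarrow> smooth_fun M U f \<Longrightarrow> p \<in> U \<Longrightarrow>
      nab X (fscale f Y) p = tscale (dirder M p (X p) f) (Y p) + tscale (f p) (nab X Y p)"
    and "\<And>U X X' Y Y' p. openin (mtop M) U \<Longrightarrow> vfield M U X \<Longrightarrow> vfield M U X' \<Longrightarrow> vfield M U Y \<Longrightarrow> vfield M U Y' \<Longrightarrow>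
      (\<And>q. q \<in> U \<Longrightarrow> X q = X' q) \<Longrightarrow> (\<And>q. q \<in> U \<Longrightarrow> Y q = Y' q) \<Longrightarrow> p \<in> U \<Longrightarrow> nab X Y p = nab X' Y' p"
  shows "connection M nab"
  unfolding connection_def
  by (intro allI impI conjI ballI; elim conjE) (auto intro: assms)

locale connection_mfd = smooth_mfd M for M :: "('p, 'i) manifold" +
  fixes nab :: "('p, 'i) conn"
  assumes connection: "connection M nab"
begin

lemma nab_vfield:
  "openin (mtop M) U \<Longrightarrow> vfield M U X \<Longrightarrow> vfield M U Y \<Longrightarrow> vfield M U (nab X Y)"
  using connection[unfolded connection_def, rule_format, of U X X Y Y "\<lambda>q. 0"] smooth_fun_const by blast

lemma nab_add_left:
  "openin (mtop M) U \<Longrightarrow> vfield M U X \<Longrightarrow> vfield M U X' \<Longrightarrow> vfield M U Y \<Longrightarrow> p \<in> U \<Longrightarrow>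
   nab (X + X') Y p = nab X Y p + nab X' Y p"
  using connection[unfolded connection_def, rule_format, of U X X' Y Y "\<lambda>q. 0"] smooth_fun_const by blast

lemma nab_add_right:
  "openin (mtop M) U \<Longrightarrow> vfield M U X \<Longrightarrow> vfield M U Y \<Longrightarrow> vfield M U Y' \<Longrightarrow> p \<in> U \<Longrightarrow>
   nab X (Y + Y') p = nab X Y p + nab X Y' p"
  using connection[unfolded connection_def, rule_format, of U X X Y Y' "\<lambda>q. 0"] smooth_fun_const by blast

lemma nab_scale_left:
  "openin (mtop M) U \<Longrightarrow> vfield M U X \<Longrightarrow> vfield M U Y \<Longrightarrow> smooth_fun M U f \<Longrightarrow> p \<in> U \<Longrightarrow>
   nab (fscale f X) Y p = tscale (f p) (nab X Y p)"
  using connection[unfolded connection_def, rule_format, of U X X Y Y f] by blast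

lemma nab_leibniz:
  "openin (mtop M) U \<Longrightarrow> vfield M U X \<Longrightarrow> vfield M U Y \<Longrightarrow> smooth_fun M U f \<Longrightarrow> p \<in> U \<Longrightarrow>
   nab X (fscale f Y) p = tscale (dirder M p (X p) f) (Y p) + tscale (f p) (nab X Y p)"
  using connection[unfolded connection_def, rule_format, of U X X Y Y f] by blast

lemma nab_cong:
  assumes "openin (mtop M) U" "vfield M U X" "vfield M U X'" "vfield M U Y" "vfield M U Y'"
    and "\<And>q. q \<in> U \<Longrightarrow> X q = X' q" "\<And>q. q \<in> U \<Longrightarrow> Y q = Y' q" and "p \<in> U"
  shows "nab X Y p = nab X' Y' p"
  using connection[unfolded connection_def, rule_format, of U X X' Y Y' "\<lambda>q. 0"] smooth_fun_const assms
  by blast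

lemma nab_zero_left: "openin (mtop M) U \<Longrightarrow> vfield M U Y \<Longrightarrow> p \<in> U \<Longrightarrow> nab 0 Y p = 0"
  using nab_add_left[of U 0 0 Y p] vfield_zero by simp

lemma nab_zero_right: "openin (mtop M) U \<Longrightarrow> vfield M U X \<Longrightarrow> p \<in> U \<Longrightarrow> nab X 0 p = 0"
  using nab_add_right[of U X 0 0 p] vfield_zero by simp

lemma nab_sum_left:
  assumes U: "openin (mtop M) U" "p \<in> U" and Y: "vfield M U Y" and "\<And>a. a \<in> A \<Longrightarrow> vfield M U (X a)"
  shows "nab (\<Sum>a\<in>A. X a) Y p = (\<Sum>a\<in>A. nab (X a) Y p)"
  using assms(4)
proof (induction A rule: infinite_finite_induct)
  case (insert x F)
  then have "nab (X x + sum X F) Y p = nab (X x) Y p + nab (sum X F) Y p"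
    by (intro nab_add_left[OF U(1) _ vfield_sum[OF U(1)] Y U(2)]) auto
  moreover have "nab (sum X F) Y p = (\<Sum>a\<in>F. nab (X a) Y p)" using insert by blast
  ultimately show ?case unfolding sum.insert[OF insert.hyps] by (simp only:)
qed (auto simp: nab_zero_left[OF U(1) Y U(2)])

lemma nab_sum_right:
  assumes U: "openin (mtop M) U" "p \<in> U" and X: "vfield M U X" and "\<And>b. b \<in> B \<Longrightarrow> vfield M U (Y b)"
  shows "nab X (\<Sum>b\<in>B. Y b) p = (\<Sum>b\<in>B. nab X (Y b) p)"
  using assms(4)
proof (induction B rule: infinite_finite_induct)
  case (insert y F)
  then have "nab X (Y y + sum Y F) p = nab X (Y y) p + nab X (sum Y F) p"
    by (intro nab_add_right[OF U(1) X _ vfield_sum[OF U(1)] U(2)]) auto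
  moreover have "nab X (sum Y F) p = (\<Sum>b\<in>F. nab X (Y b) p)" using insert by blast
  ultimately show ?case unfolding sum.insert[OF insert.hyps] by (simp only:)
qed (auto simp: nab_zero_right[OF U(1) X U(2)])

lemma nab_comb_left:
  assumes U: "openin (mtop M) U" "p \<in> U" and X: "vfield M U X" and Y: "vfield M U Y"
    and E: "\<And>a. a < m \<Longrightarrow> vfield M U (E a)" and f: "\<And>a. a < m \<Longrightarrow> smooth_fun M U (f a)"
    and comb: "\<And>q. q \<in> U \<Longrightarrow> X q = (\<Sum>a<m. tscale (f a q) (E a q))"
  shows "nab X Y p = (\<Sum>a<m. tscale (f a p) (nab (E a) Y p))"
proof -
  have terms: "vfield M U (fscale (f a) (E a))" if "a \<in> {..<m}" for a
    using vfield_fscale[OF U(1) f E] that by simp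
  have "nab X Y p = nab (\<Sum>a<m. fscale (f a) (E a)) Y p"
    by (rule nab_cong[OF U(1) X vfield_sum[OF U(1) terms] Y Y _ refl U(2)])
       (simp_all add: comb sum_fun_apply fscale_apply)
  also have "\<dots> = (\<Sum>a<m. nab (fscale (f a) (E a)) Y p)" by (rule nab_sum_left[OF U Y terms])
  also have "\<dots> = (\<Sum>a<m. tscale (f a p) (nab (E a) Y p))"
    by (intro sum.cong refl nab_scale_left[OF U(1) E Y f U(2)]) simp_all
  finally show ?thesis .
qed

lemma nab_comb_right:
  assumes U: "openin (mtop M) U" "p \<in> U" and X: "vfield M U X" and Y: "vfield M U Y"
    and E: "\<And>b. b < m \<Longrightarrow> vfield M U (E b)" and f: "\<And>b. b < m \<Longrightarrow> smooth_fun M U (f b)"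
    and comb: "\<And>q. q \<in> U \<Longrightarrow> Y q = (\<Sum>b<m. tscale (f b q) (E b q))"
  shows "nab X Y p = (\<Sum>b<m. tscale (dirder M p (X p) (f b)) (E b p) + tscale (f b p) (nab X (E b) p))"
proof -
  have terms: "vfield M U (fscale (f b) (E b))" if "b \<in> {..<m}" for b
    using vfield_fscale[OF U(1) f E] that by simp
  have "nab X Y p = nab X (\<Sum>b<m. fscale (f b) (E b)) p"
    by (rule nab_cong[OF U(1) X X Y vfield_sum[OF U(1) terms] refl _ U(2)])
       (simp_all add: comb sum_fun_apply fscale_apply)
  also have "\<dots> = (\<Sum>b<m. nab X (fscale (f b) (E b)) p)" by (rule nab_sum_right[OF U X terms])
  also have "\<dots> = (\<Sum>b<m. tscale (dirder M p (X p) (f b)) (E b p) + tscale (f b p) (nab X (E b) p))"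
    by (intro sum.cong refl nab_leibniz[OF U(1) X E f U(2)]) simp_all
  finally show ?thesis .
qed

lemma connection_eq_on_generators:
  assumes nab': "connection M nab'" and U: "openin (mtop M) U" "p \<in> U" and E: "vfield_generators M U m E"
    and eq: "\<And>a b. a < m \<Longrightarrow> b < m \<Longrightarrow> nab (E a) (E b) p = nab' (E a) (E b) p"
    and X: "vfield M U X" and Y: "vfield M U Y"
  shows "nab X Y p = nab' X Y p"
proof -
  interpret nab': connection_mfd M nab' by unfold_locales (rule nab')
  have Ev: "vfield M U (E a)" if "a < m" for a using E that by (simp add: vfield_generators_def)
  obtain f where f: "\<And>a. a < m \<Longrightarrow> smooth_fun M U (f a)" "\<And>q. q \<in> U \<Longrightarrow> X q = (\<Sum>a<m. tscale (f a q) (E a q))"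
    using E X unfolding vfield_generators_def by metis
  obtain h where h: "\<And>a. a < m \<Longrightarrow> smooth_fun M U (h a)" "\<And>q. q \<in> U \<Longrightarrow> Y q = (\<Sum>a<m. tscale (h a q) (E a q))"
    using E Y unfolding vfield_generators_def by metis
  have "nab (E a) Y p = nab' (E a) Y p" if a: "a < m" for a
  proof -
    have "nab (E a) Y p =
        (\<Sum>b<m. tscale (dirder M p (E a p) (h b)) (E b p) + tscale (h b p) (nab (E a) (E b) p))"
      by (rule nab_comb_right[OF U Ev[OF a] Y Ev h])
    also have "\<dots> = (\<Sum>b<m. tscale (dirder M p (E a p) (h b)) (E b p) + tscale (h b p) (nab' (E a) (E b) p))"
      by (simp add: eq[OF a])
    also have "\<dots> = nab' (E a) Y p" by (rule nab'.nab_comb_right[OF U Ev[OF a] Y Ev h, symmetric])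
    finally show ?thesis .
  qed
  then have "(\<Sum>a<m. tscale (f a p) (nab (E a) Y p)) = (\<Sum>a<m. tscale (f a p) (nab' (E a) Y p))" by simp
  then show ?thesis
    by (simp only: nab_comb_left[OF U X Y Ev f] nab'.nab_comb_left[OF U X Y Ev f])
qed

end

subsection \<open>Connections in a chart\<close>

context smooth_mfd
begin

lemma smooth_fun_component:
  assumes U: "openin (mtop M) U" "U \<subseteq> cdom M i" and i: "i \<in> charts M" and X: "vfield M U X" and "a < n"
  shows "smooth_fun M U (\<lambda>q. X q i a)"
  unfolding smooth_fun_iff_smooth_at[OF U(1)]
  using U(2) i \<open>a < n\<close> by (auto intro!: vfield_smooth_at[OF U(1) X] simp: charts_at_iff)

lemma vfield_expand:
  assumes "U \<subseteq> cdom M i" "i \<in> charts M" "vfield M U X" "q \<in> U"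
  shows "X q = (\<Sum>a<n. tscale (X q i a) (coord_field M i a q))"
  using assms by (intro tangent_expand vfield_tangent) (auto simp: charts_at_iff)

end

context connection_mfd
begin

lemma nab_expand:
  assumes U: "openin (mtop M) U" "p \<in> U" and X: "vfield M U X" and Y: "vfield M U Y"
    and i: "i \<in> charts_at M p"
  shows "nab X Y p = (\<Sum>a<n. tscale (X p i a) (nab (coord_field M i a) Y p))"
    and "nab X Y p = (\<Sum>b<n. tscale (dirder M p (X p) (\<lambda>q. Y q i b)) (coord_field M i b p)
      + tscale (Y p i b) (nab X (coord_field M i b) p))"
proof -
  have ic: "i \<in> charts M" using i by (simp add: charts_at_iff)
  let ?V = "U \<inter> cdom M i"
  have V: "openin (mtop M) ?V" "p \<in> ?V" using U openin_cdom[OF ic] i by (auto simp: charts_at_iff)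
  have XV: "vfield M ?V X" and YV: "vfield M ?V Y" by (auto intro: vfield_subset[OF Int_lower1] X Y)
  have E: "vfield M ?V (coord_field M i a)" if "a < n" for a
    by (rule vfield_subset[OF Int_lower2 coord_field_vfield[OF ic that]])
  note component = smooth_fun_component[OF V(1) Int_lower2 ic] and expand = vfield_expand[OF Int_lower2 ic]
  show "nab X Y p = (\<Sum>a<n. tscale (X p i a) (nab (coord_field M i a) Y p))"
    by (rule nab_comb_left[OF V XV YV E component[OF XV] expand[OF XV]])
  show "nab X Y p = (\<Sum>b<n. tscale (dirder M p (X p) (\<lambda>q. Y q i b)) (coord_field M i b p)
      + tscale (Y p i b) (nab X (coord_field M i b) p))"
    by (rule nab_comb_right[OF V XV YV E component[OF YV] expand[OF YV]])
qed

lemma nab_coord_field: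
  assumes U: "openin (mtop M) U" "p \<in> U" and X: "vfield M U X" and i: "i \<in> charts_at M p" and b: "b < n"
  shows "nab X (coord_field M i b) p i k = conn_matrix M nab i p (X p) k b"
proof -
  let ?V = "U \<inter> cdom M i"
  have ic: "i \<in> charts M" using i by (simp add: charts_at_iff)
  have V: "openin (mtop M) ?V" "p \<in> ?V" using U openin_cdom[OF ic] i by (auto simp: charts_at_iff)
  show ?thesis
    unfolding nab_expand(1)[OF V vfield_subset[OF Int_lower1 X]
        vfield_subset[OF Int_lower2 coord_field_vfield[OF ic b]] i]
    by (simp add: sum_fun_apply tscale_apply conn_matrix_def christoffel_def mult.commute)
qed

lemma nab_apply:
  assumes U: "openin (mtop M) U" "p \<in> U" and X: "vfield M U X" and Y: "vfield M U Y"
    and i: "i \<in> charts_at M p" and k: "k < n"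
  shows "nab X Y p i k = dirder M p (X p) (\<lambda>q. Y q i k) + (\<Sum>b<n. conn_matrix M nab i p (X p) k b * Y p i b)"
  unfolding nab_expand(2)[OF U X Y i] using k
  by (simp add: sum_fun_apply tscale_apply coord_field_self[OF i] nab_coord_field[OF U X i] sum.distrib
      mult.commute
      if_distrib cong: if_cong)

lemma smooth_at_christoffel:
  assumes i: "i \<in> charts_at M p" and "a < n" "b < n" "k < n"
  shows "smooth_at M (christoffel M nab i a b k) p"
proof -
  have ic: "i \<in> charts M" "p \<in> cdom M i" using i by (simp_all add: charts_at_iff)
  note U = openin_cdom[OF ic(1)] and E = coord_field_vfield[OF ic(1)]
  show ?thesis
    unfolding christoffel_def by (rule vfield_smooth_at[OF U nab_vfield[OF U E E] ic(2) i]) fact+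
qed

end


subsection \<open>Torsionless connections\<close>

locale torsionless_mfd = connection_mfd M nab for M :: "('p, 'i) manifold" and nab +
  assumes torsionless: "torsionless M nab"
begin

lemma bracket_eq_nab:
  "openin (mtop M) U \<Longrightarrow> vfield M U X \<Longrightarrow> vfield M U Y \<Longrightarrow> p \<in> U \<Longrightarrow> bracket M X Y p = nab X Y p - nab Y X p"
  using torsionless unfolding torsionless_def by metis

lemma nab_coord_field_commute:
  assumes i: "i \<in> charts_at M p" and "a < n" "b < n"
  shows "nab (coord_field M i a) (coord_field M i b) p = nab (coord_field M i b) (coord_field M i a) p"
proof -
  have ic: "i \<in> charts M" "p \<in> cdom M i" using i by (simp_all add: charts_at_iff)
  note E = coord_field_vfield[OF ic(1)]
  show ?thesis
    using bracket_eq_nab[OF openin_cdom[OF ic(1)] E E ic(2), of a b] bracket_coord_field[OF assms]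
        assms(2,3)
    by simp
qed

lemma conn_matrix_commute:
  assumes i: "i \<in> charts_at M p"
  shows "(\<Sum>b<n. conn_matrix M nab i p u k b * v i b) = (\<Sum>b<n. conn_matrix M nab i p v k b * u i b)"
  unfolding conn_matrix_def sum_distrib_right
  by (subst sum.swap) (simp add: christoffel_def nab_coord_field_commute[OF i] mult_ac)

lemma parallel_imp_complex_structure:
  assumes ac: "almost_complex M J" and parallel: "parallel_endo M nab J"
  shows "complex_structure M J"
  unfolding complex_structure_def
proof (intro conjI ac allI impI ballI)
  fix U X Y p assume "openin (mtop M) U \<and> vfield M U X \<and> vfield M U Y" and p: "p \<in> U"
  then have U: "openin (mtop M) U" and X: "vfield M U X" and Y: "vfield M U Y" by auto
  have J_vfield: "vfield M U (apply_endo J Z)" if "vfield M U Z" for Z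
    using ac U that unfolding almost_complex_def by blast
  have nab_J: "nab Z (apply_endo J W) p = J p (nab Z W p)" if "vfield M U Z" "vfield M U W" for Z W
    using parallel U that p unfolding parallel_endo_def by blast
  have J: "J p u \<in> tangent_space M p" "J p (J p u) = - u" "J p (tscale c u) = tscale c (J p u)"
    if "u \<in> tangent_space M p" for u c
    using ac that openin_imp_topspace[OF U p] unfolding almost_complex_def by blast+
  have J_add: "J p (u + v) = J p u + J p v" if "u \<in> tangent_space M p" "v \<in> tangent_space M p" for u v
    using ac that openin_imp_topspace[OF U p] unfolding almost_complex_def by blast
  have J_diff: "J p (u - v) = J p u - J p v" if "u \<in> tangent_space M p" "v \<in> tangent_space M p" for u v
    using J_add[OF that(1) tangent_minus[OF that(2)]] J(3)[where c = "-1", OF that(2)] by simp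
  note bracket = bracket_eq_nab[OF U _ _ p] and nab_tangent = vfield_tangent[OF nab_vfield[OF U] p]
  show "nijenhuis M J X Y p = 0"
    by (simp add: nijenhuis_def apply_endo_apply bracket X Y J_vfield nab_J J_diff J(1,2)
        nab_tangent fun_eq_iff)
qed

end


section \<open>Riemannian metrics\<close>

subsection \<open>Linear forms on tangent spaces\<close>

context smooth_mfd
begin

definition linear_at :: "'p \<Rightarrow> ('i tvec \<Rightarrow> real) \<Rightarrow> bool" where
  "linear_at p \<phi> \<longleftrightarrow> (\<forall>u\<in>tangent_space M p. \<forall>v\<in>tangent_space M p. \<phi> (u + v) = \<phi> u + \<phi> v) \<and>
     (\<forall>u\<in>tangent_space M p. \<forall>c. \<phi> (tscale c u) = c * \<phi> u)"

definition bilinear_at :: "'p \<Rightarrow> ('i tvec \<Rightarrow> 'i tvec \<Rightarrow> real) \<Rightarrow> bool" where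
  "bilinear_at p b \<longleftrightarrow> (\<forall>v\<in>tangent_space M p. linear_at p (\<lambda>u. b u v) \<and> linear_at p (b v))"

definition trilinear_at :: "'p \<Rightarrow> ('i tvec \<Rightarrow> 'i tvec \<Rightarrow> 'i tvec \<Rightarrow> real) \<Rightarrow> bool" where
  "trilinear_at p T \<longleftrightarrow> (\<forall>u\<in>tangent_space M p. bilinear_at p (T u) \<and> bilinear_at p (\<lambda>v w. T v w u))"

lemma linear_at_add: "linear_at p \<phi> \<Longrightarrow> u \<in> tangent_space M p \<Longrightarrow> v \<in> tangent_space M p \<Longrightarrow> \<phi> (u + v) = \<phi> u + \<phi> v"
  and linear_at_scale: "linear_at p \<phi> \<Longrightarrow> u \<in> tangent_space M p \<Longrightarrow> \<phi> (tscale c u) = c * \<phi> u"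
  by (auto simp: linear_at_def)

lemma linear_at_zero: "linear_at p \<phi> \<Longrightarrow> \<phi> 0 = 0"
  using linear_at_add[of p \<phi> 0 0] tangent_space_zero[of M p] by auto

lemma linear_at_minus: "linear_at p \<phi> \<Longrightarrow> u \<in> tangent_space M p \<Longrightarrow> \<phi> (- u) = - \<phi> u"
  using linear_at_scale[of p \<phi> u "-1"] by simp

lemma linear_at_diff: "linear_at p \<phi> \<Longrightarrow> u \<in> tangent_space M p \<Longrightarrow> v \<in> tangent_space M p \<Longrightarrow> \<phi> (u - v) =
    \<phi> u - \<phi> v"
  using linear_at_add[of p \<phi> u "- v"] linear_at_minus[of p \<phi> v] tangent_minus[of v p]
  by (simp only: add_uminus_conv_diff[symmetric])

lemma linear_at_sum:
  assumes "linear_at p \<phi>" "\<And>a. a \<in> A \<Longrightarrow> u a \<in> tangent_space M p"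
  shows "\<phi> (\<Sum>a\<in>A. u a) = (\<Sum>a\<in>A. \<phi> (u a))"
  using assms(2)
proof (induction A rule: infinite_finite_induct)
  case (insert x F)
  then have "\<phi> (u x + sum u F) = \<phi> (u x) + \<phi> (sum u F)"
    by (intro linear_at_add[OF assms(1)] tangent_sum) auto
  with insert show ?case by (simp only: sum.insert[OF insert.hyps]) auto
qed (auto simp: linear_at_zero[OF assms(1)])

lemma linear_at_comb:
  assumes "linear_at p \<phi>" "\<And>a. a \<in> A \<Longrightarrow> u a \<in> tangent_space M p"
  shows "\<phi> (\<Sum>a\<in>A. tscale (c a) (u a)) = (\<Sum>a\<in>A. c a * \<phi> (u a))"
  using linear_at_sum[OF assms(1), of A "\<lambda>a. tscale (c a) (u a)"] assms(2)
  by (simp add: tangent_scale linear_at_scale[OF assms(1)])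

lemma linear_at_chart:
  assumes \<phi>: "linear_at p \<phi>" and u: "u \<in> tangent_space M p" and i: "i \<in> charts_at M p"
  shows "\<phi> u = (\<Sum>a<n. u i a * \<phi> (coord_field M i a p))"
proof -
  have "\<phi> u = \<phi> (\<Sum>a<n. tscale (u i a) (coord_field M i a p))" using tangent_expand[OF u i] by simp
  also have "\<dots> = (\<Sum>a<n. u i a * \<phi> (coord_field M i a p))"
    by (rule linear_at_comb[OF \<phi>]) (simp add: coord_field_tangent[OF i])
  finally show ?thesis .
qed

lemma linear_at_plus_fun: "linear_at p \<phi> \<Longrightarrow> linear_at p \<psi> \<Longrightarrow> linear_at p (\<lambda>u. \<phi> u + \<psi> u)"
  by (simp add: linear_at_def distrib_left)

lemma linear_at_times_fun: "linear_at p \<phi> \<Longrightarrow> linear_at p (\<lambda>u. r * \<phi> u)"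
  by (simp add: linear_at_def distrib_left)

lemma linear_at_sum_fun: "(\<And>a. a \<in> A \<Longrightarrow> linear_at p (\<phi> a)) \<Longrightarrow> linear_at p (\<lambda>u. \<Sum>a\<in>A. \<phi> a u)"
  by (simp add: linear_at_def sum.distrib sum_distrib_left)

lemma bilinear_atD:
  assumes "bilinear_at p b" "v \<in> tangent_space M p"
  shows "linear_at p (\<lambda>u. b u v)" "linear_at p (b v)"
  using assms by (auto simp: bilinear_at_def)

lemma trilinear_atD:
  assumes "trilinear_at p T" "u \<in> tangent_space M p"
  shows "bilinear_at p (T u)" "bilinear_at p (\<lambda>v w. T v w u)"
  using assms by (auto simp: trilinear_at_def)

lemma bilinear_at_comb:
  assumes b: "bilinear_at p b"
    and u: "\<And>a. a \<in> A \<Longrightarrow> u a \<in> tangent_space M p" and v: "\<And>c. c \<in> C \<Longrightarrow> v c \<in> tangent_space M p"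
  shows "b (\<Sum>a\<in>A. tscale (r a) (u a)) (\<Sum>c\<in>C. tscale (s c) (v c)) = (\<Sum>a\<in>A. \<Sum>c\<in>C. r a * s c * b (u a) (v c))"
proof -
  have "(\<Sum>c\<in>C. tscale (s c) (v c)) \<in> tangent_space M p" by (intro tangent_sum tangent_scale v)
  then show ?thesis
    by (simp add: linear_at_comb[OF bilinear_atD(1)[OF b] u] linear_at_comb[OF bilinear_atD(2)[OF b u] v]
        sum_distrib_left mult.assoc)
qed

end


subsection \<open>Orthonormal families\<close>

locale riemannian_mfd = smooth_mfd M for M :: "('p, 'i) manifold" +
  fixes g :: "('p, 'i) metric"
  assumes metric: "riemannian_metric M g"
begin

lemma g_pos: "p \<in> topspace (mtop M) \<Longrightarrow> u \<in> tangent_space M p \<Longrightarrow> u \<noteq> 0 \<Longrightarrow> g p u u > 0"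
  using metric by (simp add: riemannian_metric_def)

lemma g_commute: "p \<in> topspace (mtop M) \<Longrightarrow> u \<in> tangent_space M p \<Longrightarrow> v \<in> tangent_space M p \<Longrightarrow> g p u v = g p v u"
  using metric unfolding riemannian_metric_def by blast

lemma g_linear_left:
  assumes p: "p \<in> topspace (mtop M)" and w: "w \<in> tangent_space M p"
  shows "linear_at p (\<lambda>u. g p u w)"
proof -
  have "\<forall>v\<in>tangent_space M p. g p u v = g p v u \<and> (\<forall>c. g p (tscale c u) v = c * g p u v) \<and>
      (\<forall>w\<in>tangent_space M p. g p (u + v) w = g p u w + g p v w)" if "u \<in> tangent_space M p" for u
    using metric p that unfolding riemannian_metric_def by blast
  with w show ?thesis unfolding linear_at_def by blast
qed

lemma g_linear_right: "p \<in> topspace (mtop M) \<Longrightarrow> w \<in> tangent_space M p \<Longrightarrow> linear_at p (g p w)"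
  using g_linear_left[of p w] g_commute[of p w]
  unfolding linear_at_def by (auto simp: tangent_add tangent_scale)

lemma g_bilinear: "p \<in> topspace (mtop M) \<Longrightarrow> bilinear_at p (g p)"
  by (simp add: bilinear_at_def g_linear_left g_linear_right)

lemma g_smooth_fun: "openin (mtop M) U \<Longrightarrow> vfield M U X \<Longrightarrow> vfield M U Y \<Longrightarrow> smooth_fun M U (\<lambda>p. g p (X p) (Y p))"
  by (rule conjunct2[OF metric[unfolded riemannian_metric_def], rule_format]) simp

lemma g_smooth_at: "openin (mtop M) U \<Longrightarrow> vfield M U X \<Longrightarrow> vfield M U Y \<Longrightarrow> p \<in> U \<Longrightarrow>
    smooth_at M (\<lambda>p. g p (X p) (Y p)) p"
  using g_smooth_fun smooth_fun_iff_smooth_at by blast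

lemma g_eqI:
  assumes p: "p \<in> topspace (mtop M)" and w: "w \<in> tangent_space M p" "w' \<in> tangent_space M p"
    and eq: "\<And>z. z \<in> tangent_space M p \<Longrightarrow> g p w z = g p w' z"
  shows "w = w'"
proof (rule ccontr)
  assume "w \<noteq> w'"
  then have "w - w' \<noteq> 0" by simp
  from g_pos[OF p tangent_diff[OF w] this] show False
    using linear_at_diff[OF g_linear_left[OF p tangent_diff[OF w]] w] eq[OF tangent_diff[OF w]] by simp
qed

definition orthonormal :: "'p \<Rightarrow> nat \<Rightarrow> (nat \<Rightarrow> 'i tvec) \<Rightarrow> bool" where
  "orthonormal p m e \<longleftrightarrow> (\<forall>a<m. e a \<in> tangent_space M p) \<and>
     (\<forall>a<m. \<forall>b<m. g p (e a) (e b) = (if a = b then 1 else 0))"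

lemma orthonormalD:
  assumes "orthonormal p m e"
  shows "a < m \<Longrightarrow> e a \<in> tangent_space M p"
    and "a < m \<Longrightarrow> b < m \<Longrightarrow> g p (e a) (e b) = (if a = b then 1 else 0)"
  using assms unfolding orthonormal_def by blast+

lemma orthonormal_frame_imp_orthonormal:
  "orthonormal_frame M g U E \<Longrightarrow> p \<in> U \<Longrightarrow> orthonormal p n (\<lambda>a. E a p)"
  by (auto simp: orthonormal_frame_def orthonormal_def vfield_tangent)

lemma orthogonal_family_card_le:
  assumes p: "p \<in> topspace (mtop M)" and A: "finite A"
    and v: "\<And>a. a \<in> A \<Longrightarrow> v a \<in> tangent_space M p" "\<And>a. a \<in> A \<Longrightarrow> v a \<noteq> 0"
    and orthogonal: "\<And>a b. a \<in> A \<Longrightarrow> b \<in> A \<Longrightarrow> a \<noteq> b \<Longrightarrow> g p (v a) (v b) = 0"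
  shows "card A \<le> n"
proof -
  have g_self: "g p (v a) (v a) \<noteq> 0" if "a \<in> A" for a using g_pos[OF p] v that by fastforce
  have inj: "inj_on v A" using orthogonal g_self by (metis inj_onI)
  have "tvec.independent (v ` A)"
  proof (rule tvec.independent_if_scalars_zero)
    fix f x assume zero: "(\<Sum>x\<in>v ` A. tscale (f x) x) = 0" and "x \<in> v ` A"
    then obtain a where a: "a \<in> A" "x = v a" by blast
    have "0 = g p (\<Sum>b\<in>A. tscale (f (v b)) (v b)) (v a)"
      using zero linear_at_zero[OF g_linear_left[OF p v(1)[OF a(1)]]] by (simp add: sum.reindex[OF inj])
    also have "\<dots> = (\<Sum>b\<in>A. f (v b) * g p (v b) (v a))"
      by (rule linear_at_comb[OF g_linear_left[OF p v(1)[OF a(1)]] v(1)])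
    also have "\<dots> = (\<Sum>b\<in>A. if b = a then f (v a) * g p (v a) (v a) else 0)"
      by (intro sum.cong) (auto simp: orthogonal a(1))
    finally show "f x = 0" using A a g_self[OF a(1)] by simp
  qed (simp add: A)
  moreover obtain i where i: "i \<in> charts_at M p" using p topspace_iff_charts_at by blast
  have "v ` A \<subseteq> tvec.span ((\<lambda>b. coord_field M i b p) ` {..<n})"
  proof clarify
    fix a assume "a \<in> A"
    then show "v a \<in> tvec.span ((\<lambda>b. coord_field M i b p) ` {..<n})"
      by (subst tangent_expand[OF v(1) i])
         (auto intro!: tvec.span_sum tvec.span_scale intro: tvec.span_base)
  qed
  ultimately have "card (v ` A) \<le> card ((\<lambda>b. coord_field M i b p) ` {..<n})"
    by (intro conjunct2[OF tvec.independent_span_bound]) auto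
  also have "\<dots> \<le> n" using card_image_le[of "{..<n}"] by simp
  finally show ?thesis by (simp add: card_image[OF inj])
qed

definition residual :: "'p \<Rightarrow> nat \<Rightarrow> (nat \<Rightarrow> 'i tvec) \<Rightarrow> 'i tvec \<Rightarrow> 'i tvec" where
  "residual p m e u = u - (\<Sum>b<m. tscale (g p u (e b)) (e b))"

lemma residual_orthogonal:
  assumes p: "p \<in> topspace (mtop M)" and e: "orthonormal p m e" and u: "u \<in> tangent_space M p"
  shows "residual p m e u \<in> tangent_space M p" and "a < m \<Longrightarrow> g p (residual p m e u) (e a) = 0"
proof -
  have projection: "(\<Sum>b<m. tscale (g p u (e b)) (e b)) \<in> tangent_space M p"
    by (intro tangent_sum tangent_scale orthonormalD(1)[OF e]) simp
  with u show "residual p m e u \<in> tangent_space M p" unfolding residual_def by (rule tangent_diff)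
  assume a: "a < m"
  note linear = g_linear_left[OF p orthonormalD(1)[OF e a]]
  have "g p (\<Sum>b<m. tscale (g p u (e b)) (e b)) (e a) = (\<Sum>b<m. g p u (e b) * g p (e b) (e a))"
    by (rule linear_at_comb[OF linear]) (simp add: orthonormalD(1)[OF e])
  also have "\<dots> = g p u (e a)" using a by (simp add: orthonormalD(2)[OF e _ a] if_distrib cong: if_cong)
  finally show "g p (residual p m e u) (e a) = 0"
    unfolding residual_def by (simp add: linear_at_diff[OF linear u projection])
qed

lemma orthonormal_expand:
  assumes p: "p \<in> topspace (mtop M)" and e: "orthonormal p n e" and u: "u \<in> tangent_space M p"
  shows "u = (\<Sum>a<n. tscale (g p u (e a)) (e a))"
proof (rule ccontr)
  assume "u \<noteq> (\<Sum>a<n. tscale (g p u (e a)) (e a))"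
  then have nonzero: "residual p n e u \<noteq> 0" by (simp add: residual_def)
  define v where "v a = (if a < n then e a else residual p n e u)" for a
  note residual = residual_orthogonal[OF p e u]
  have "card {..n} \<le> n"
  proof (rule orthogonal_family_card_le[OF p, of "{..n}" v])
    show "v a \<in> tangent_space M p" for a
      using orthonormalD(1)[OF e] residual(1) by (simp add: v_def)
    show "v a \<noteq> 0" for a
      using orthonormalD(2)[OF e, of a a] linear_at_zero[OF g_linear_left[OF p tangent_space_zero]] nonzero
      by (auto simp: v_def)
    show "g p (v a) (v b) = 0" if "a \<in> {..n}" "b \<in> {..n}" "a \<noteq> b" for a b
      using that orthonormalD[OF e] residual g_commute[OF p residual(1)] by (auto simp: v_def)
  qed simp
  then show False by simp
qed

lemma orthonormal_extend:
  assumes p: "p \<in> topspace (mtop M)" and e: "orthonormal p m e" and w: "w \<in> tangent_space M p" "g p w w = 1"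
    and orthogonal: "\<And>a. a < m \<Longrightarrow> g p w (e a) = 0"
  shows "orthonormal p (Suc m) (e(m := w))"
proof -
  have "g p (e a) w = 0" if "a < m" for a
    using orthogonal[OF that] g_commute[OF p orthonormalD(1)[OF e that] w(1)] by simp
  with e w orthogonal show ?thesis by (auto simp: orthonormal_def less_Suc_eq)
qed


subsection \<open>Orthonormal frames\<close>

text \<open>
  The third clause makes \<open>E 0, \<dots>, E (m - 1)\<close> independent of the coordinate field \<open>m\<close>, so that the
  Gram--Schmidt process can continue.
\<close>

definition triangular_frame :: "'i \<Rightarrow> nat \<Rightarrow> (nat \<Rightarrow> ('p, 'i) field) \<Rightarrow> bool" where
  "triangular_frame i m E \<longleftrightarrow> (\<forall>a<m. vfield M (cdom M i) (E a)) \<and>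
    (\<forall>p\<in>cdom M i. orthonormal p m (\<lambda>a. E a p)) \<and>
    (\<forall>p\<in>cdom M i. \<forall>a<m. \<forall>k. a < k \<and> k < n \<longrightarrow> E a p i k = 0)"

lemma residual_coord_field:
  assumes i: "i \<in> charts M" and m: "m < n" and E: "triangular_frame i m E"
  shows "vfield M (cdom M i) (\<lambda>p. residual p m (\<lambda>a. E a p) (coord_field M i m p))"
    and "p \<in> cdom M i \<Longrightarrow> m \<le> k \<Longrightarrow> k < n \<Longrightarrow>
      residual p m (\<lambda>a. E a p) (coord_field M i m p) i k = (if k = m then 1 else 0)"
proof -
  note U = openin_cdom[OF i] and coord = coord_field_vfield[OF i m]
  have Ev: "vfield M (cdom M i) (E a)" if "a < m" for a using E that by (simp add: triangular_frame_def)
  show "vfield M (cdom M i) (\<lambda>p. residual p m (\<lambda>a. E a p) (coord_field M i m p))"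
  proof (rule vfield_cong[OF U])
    show "vfield M (cdom M i) (coord_field M i m
        - (\<Sum>b<m. fscale (\<lambda>p. g p (coord_field M i m p) (E b p)) (E b)))"
      by (intro vfield_diff[OF U coord] vfield_sum[OF U] vfield_fscale[OF U] g_smooth_fun[OF U coord] Ev)
          auto
  qed (simp add: residual_def sum_fun_apply fscale_apply)
  assume "p \<in> cdom M i" "m \<le> k" "k < n"
  moreover from this have "i \<in> charts_at M p" using i by (simp add: charts_at_iff)
  ultimately show "residual p m (\<lambda>a. E a p) (coord_field M i m p) i k = (if k = m then 1 else 0)"
    using E m by (simp add: residual_def sum_fun_apply tscale_apply coord_field_self triangular_frame_def)
qed

lemma gram_schmidt_step:
  assumes i: "i \<in> charts M" and m: "m < n" and E: "triangular_frame i m E"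
  shows "\<exists>F. triangular_frame i (Suc m) (E(m := F))"
proof -
  let ?R = "\<lambda>p. residual p m (\<lambda>a. E a p) (coord_field M i m p)"
  let ?F = "fscale (\<lambda>p. 1 / sqrt (g p (?R p) (?R p))) ?R"
  note U = openin_cdom[OF i] and R = residual_coord_field(1)[OF assms]
    and R_comp = residual_coord_field(2)[OF assms]
  have Ev: "vfield M (cdom M i) (E a)" if "a < m" for a using E that by (simp add: triangular_frame_def)
  have on: "orthonormal p m (\<lambda>a. E a p)" if "p \<in> cdom M i" for p
    using E that by (simp add: triangular_frame_def)
  note top = openin_imp_topspace[OF U]
  note residual = residual_orthogonal[OF top on vfield_tangent[OF coord_field_vfield[OF i m]]]
  have R_pos: "g p (?R p) (?R p) > 0" if "p \<in> cdom M i" for p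
  proof (rule g_pos[OF top[OF that] vfield_tangent[OF R that]])
    show "?R p \<noteq> 0" using R_comp[OF that order_refl m] by auto
  qed
  have "smooth_at M (\<lambda>p. 1 / sqrt (g p (?R p) (?R p))) p" if "p \<in> cdom M i" for p
    by (rule smooth_at_inverse_sqrt[OF g_smooth_at[OF U R R that] eventually_nhdsinI[OF U that R_pos]])
  then have F: "vfield M (cdom M i) ?F"
    by (intro vfield_fscale[OF U _ R]) (simp add: smooth_fun_iff_smooth_at[OF U])
  have "orthonormal p (Suc m) ((\<lambda>a. E a p)(m := ?F p))" if p: "p \<in> cdom M i" for p
  proof (rule orthonormal_extend[OF top[OF p] on[OF p] vfield_tangent[OF F p]])
    note Rt = residual(1)[OF p p p]
    show "g p (?F p) (?F p) = 1"
      unfolding fscale_apply linear_at_scale[OF g_linear_left[OF top[OF p] tangent_scale[OF Rt]] Rt]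
        linear_at_scale[OF g_linear_right[OF top[OF p] Rt] Rt]
      using R_pos[OF p] by simp
    show "g p (?F p) (E a p) = 0" if "a < m" for a
      unfolding fscale_apply
          linear_at_scale[OF g_linear_left[OF top[OF p] orthonormalD(1)[OF on[OF p] that]] Rt]
      using residual(2)[OF p p p that] by simp
  qed
  moreover have "(\<lambda>a. E a p)(m := ?F p) = (\<lambda>a. (E(m := ?F)) a p)" for p by auto
  moreover have "(E(m := ?F)) a p i k = 0" if "p \<in> cdom M i" "a < Suc m" "a < k" "k < n" for p a k
    using E that R_comp[OF that(1), of k]
    by (auto simp: triangular_frame_def less_Suc_eq fscale_apply tscale_apply)
  ultimately have "triangular_frame i (Suc m) (E(m := ?F))"
    using Ev F by (auto simp: triangular_frame_def less_Suc_eq)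
  then show ?thesis by (rule exI[of _ ?F])
qed

lemma ex_orthonormal_frame:
  assumes i: "i \<in> charts M"
  shows "\<exists>E. orthonormal_frame M g (cdom M i) E"
proof -
  have "\<exists>E. triangular_frame i m E" if "m \<le> n" for m
    using that
  proof (induction m)
    case 0
    show ?case by (simp add: triangular_frame_def orthonormal_def)
  next
    case (Suc m)
    then obtain E where "triangular_frame i m E" by auto
    with Suc.prems obtain F where "triangular_frame i (Suc m) (E(m := F))"
      using gram_schmidt_step[OF i, of m E] by auto
    then show ?case by blast
  qed
  then obtain E where "triangular_frame i n E" by blast
  then have "orthonormal_frame M g (cdom M i) E"
    by (simp add: triangular_frame_def orthonormal_frame_def orthonormal_def openin_cdom[OF i])
  then show ?thesis by blast
qed

lemma orthonormal_frame_near: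
  assumes U: "openin (mtop M) U" and p: "p \<in> U"
  obtains V E where "p \<in> V" "V \<subseteq> U" "orthonormal_frame M g V E"
proof -
  obtain i where i: "i \<in> charts M" "p \<in> cdom M i" using openin_ex_chart[OF U p] charts_at_iff by blast
  obtain E where E: "orthonormal_frame M g (cdom M i) E" using ex_orthonormal_frame[OF i(1)] ..
  have "orthonormal_frame M g (U \<inter> cdom M i) E"
    using E U vfield_subset[OF Int_lower2, of M "cdom M i" "E _" U] by (auto simp: orthonormal_frame_def)
  with p i(2) show ?thesis by (intro that[of "U \<inter> cdom M i"]) auto
qed

lemma ex_orthonormal:
  assumes "p \<in> topspace (mtop M)"
  shows "\<exists>e. orthonormal p n e"
proof -
  obtain V E where "p \<in> V" "orthonormal_frame M g V E"
    by (rule orthonormal_frame_near[OF openin_topspace assms])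
  then show ?thesis using orthonormal_frame_imp_orthonormal by blast
qed


subsection \<open>Traces and the musical isomorphism\<close>

definition metric_trace :: "'p \<Rightarrow> ('i tvec \<Rightarrow> 'i tvec \<Rightarrow> real) \<Rightarrow> real" where
  "metric_trace p b = (let e = SOME e. orthonormal p n e in \<Sum>a<n. b (e a) (e a))"

lemma trace_orthonormal_unique:
  assumes p: "p \<in> topspace (mtop M)" and b: "bilinear_at p b" and e: "orthonormal p n e"
    and f: "orthonormal p n f"
  shows "(\<Sum>a<n. b (f a) (f a)) = (\<Sum>a<n. b (e a) (e a))"
proof -
  note et = orthonormalD(1)[OF e] and ft = orthonormalD(1)[OF f]
  have "b (f a) (f a) = (\<Sum>c<n. g p (f a) (e c) * b (e c) (f a))" if "a < n" for a
    by (subst (1) orthonormal_expand[OF p e ft[OF that]],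
        rule linear_at_comb[OF bilinear_atD(1)[OF b ft[OF that]]])
       (simp add: et)
  then have "(\<Sum>a<n. b (f a) (f a)) = (\<Sum>c<n. \<Sum>a<n. g p (e c) (f a) * b (e c) (f a))"
    by (subst sum.swap) (simp add: g_commute[OF p et ft])
  also have "\<dots> = (\<Sum>c<n. b (e c) (e c))"
  proof (rule sum.cong[OF refl])
    fix c assume "c \<in> {..<n}"
    then have c: "e c \<in> tangent_space M p" using et by simp
    have "(\<Sum>a<n. g p (e c) (f a) * b (e c) (f a)) = b (e c) (\<Sum>a<n. tscale (g p (e c) (f a)) (f a))"
      by (rule linear_at_comb[OF bilinear_atD(2)[OF b c], symmetric]) (simp add: ft)
    then show "(\<Sum>a<n. g p (e c) (f a) * b (e c) (f a)) = b (e c) (e c)"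
      using orthonormal_expand[OF p f c] by simp
  qed
  finally show ?thesis .
qed

lemma metric_trace_eq:
  assumes p: "p \<in> topspace (mtop M)" and b: "bilinear_at p b" and e: "orthonormal p n e"
  shows "metric_trace p b = (\<Sum>a<n. b (e a) (e a))"
proof -
  have "orthonormal p n (SOME e. orthonormal p n e)" using e by (rule someI[of "orthonormal p n"])
  from trace_orthonormal_unique[OF p b e this] show ?thesis by (simp add: metric_trace_def Let_def)
qed

lemma linear_at_metric_trace:
  assumes p: "p \<in> topspace (mtop M)" and T: "trilinear_at p T"
  shows "linear_at p (\<lambda>u. metric_trace p (T u))" "linear_at p (\<lambda>u. metric_trace p (\<lambda>v w. T v w u))"
proof -
  define e where "e = (SOME e. orthonormal p n e)"
  have "orthonormal p n e" unfolding e_def using ex_orthonormal[OF p] by (rule someI_ex)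
  note et = orthonormalD(1)[OF this]
  have "linear_at p (\<lambda>u. T u (e a) (e a))" if "a < n" for a
    using bilinear_atD(1)[OF trilinear_atD(2)[OF T et[OF that]] et[OF that]] .
  then show "linear_at p (\<lambda>u. metric_trace p (T u))"
    unfolding metric_trace_def e_def[symmetric] Let_def by (intro linear_at_sum_fun) simp
  have "linear_at p (T (e a) (e a))" if "a < n" for a
    using bilinear_atD(2)[OF trilinear_atD(1)[OF T et[OF that]] et[OF that]] .
  then show "linear_at p (\<lambda>u. metric_trace p (\<lambda>v w. T v w u))"
    unfolding metric_trace_def e_def[symmetric] Let_def by (intro linear_at_sum_fun) simp
qed

definition sharp :: "'p \<Rightarrow> ('i tvec \<Rightarrow> real) \<Rightarrow> 'i tvec" where
  "sharp p \<phi> = (THE w. w \<in> tangent_space M p \<and> (\<forall>z\<in>tangent_space M p. g p w z = \<phi> z))"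

lemma sharp_orthonormal:
  assumes p: "p \<in> topspace (mtop M)" and \<phi>: "linear_at p \<phi>" and e: "orthonormal p n e"
  shows "sharp p \<phi> = (\<Sum>a<n. tscale (\<phi> (e a)) (e a))" (is "_ = ?w")
    and "sharp p \<phi> \<in> tangent_space M p"
    and "z \<in> tangent_space M p \<Longrightarrow> g p (sharp p \<phi>) z = \<phi> z"
proof -
  have tangent: "?w \<in> tangent_space M p" by (intro tangent_sum tangent_scale orthonormalD(1)[OF e]) simp
  have dual: "g p ?w z = \<phi> z" if z: "z \<in> tangent_space M p" for z
  proof -
    have "g p ?w z = (\<Sum>a<n. \<phi> (e a) * g p (e a) z)"
      by (rule linear_at_comb[OF g_linear_left[OF p z]]) (simp add: orthonormalD(1)[OF e])
    also have "\<dots> = (\<Sum>a<n. g p z (e a) * \<phi> (e a))"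
      by (simp add: g_commute[OF p z orthonormalD(1)[OF e]] mult.commute)
    also have "\<dots> = \<phi> (\<Sum>a<n. tscale (g p z (e a)) (e a))"
      by (rule linear_at_comb[OF \<phi>, symmetric]) (simp add: orthonormalD(1)[OF e])
    finally show ?thesis using orthonormal_expand[OF p e z] by simp
  qed
  show sharp: "sharp p \<phi> = ?w"
    unfolding sharp_def
  proof (rule the_equality)
    show "?w \<in> tangent_space M p \<and> (\<forall>z\<in>tangent_space M p. g p ?w z = \<phi> z)" using tangent dual by blast
    fix w assume w: "w \<in> tangent_space M p \<and> (\<forall>z\<in>tangent_space M p. g p w z = \<phi> z)"
    show "w = ?w" by (rule g_eqI[OF p _ tangent]) (use w in \<open>auto simp: dual\<close>)
  qed
  show "sharp p \<phi> \<in> tangent_space M p" unfolding sharp by (rule tangent)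
  show "z \<in> tangent_space M p \<Longrightarrow> g p (sharp p \<phi>) z = \<phi> z" unfolding sharp by (rule dual)
qed

lemma sharp_tangent: "p \<in> topspace (mtop M) \<Longrightarrow> linear_at p \<phi> \<Longrightarrow> sharp p \<phi> \<in> tangent_space M p"
  using sharp_orthonormal(2) ex_orthonormal by blast

lemma g_sharp:
  "p \<in> topspace (mtop M) \<Longrightarrow> linear_at p \<phi> \<Longrightarrow> z \<in> tangent_space M p \<Longrightarrow> g p (sharp p \<phi>) z = \<phi> z"
  using sharp_orthonormal(3) ex_orthonormal by blast

lemma sharp_vfield:
  assumes U: "openin (mtop M) U" and linear: "\<And>p. p \<in> U \<Longrightarrow> linear_at p (\<alpha> p)"
    and smooth: "\<And>V Z p. openin (mtop M) V \<Longrightarrow> V \<subseteq> U \<Longrightarrow> vfield M V Z \<Longrightarrow> p \<in> V \<Longrightarrow> smooth_at M (\<lambda>q. \<alpha> q (Z q)) p"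
  shows "vfield M U (\<lambda>p. sharp p (\<alpha> p))"
proof (rule vfield_pointwise[OF U])
  fix p assume p: "p \<in> U"
  show "sharp p (\<alpha> p) \<in> tangent_space M p"
    by (rule sharp_tangent[OF openin_imp_topspace[OF U p] linear[OF p]])
  fix i k assume i: "i \<in> charts_at M p" and k: "k < n"
  obtain V E where V: "p \<in> V" "V \<subseteq> U" and E: "orthonormal_frame M g V E"
    by (rule orthonormal_frame_near[OF U p])
  have V_open: "openin (mtop M) V" and Ev: "\<And>a. a < n \<Longrightarrow> vfield M V (E a)"
    using E by (auto simp: orthonormal_frame_def)
  have "\<forall>\<^sub>F q in near p. (\<Sum>a<n. \<alpha> q (E a q) * E a q i k) = sharp q (\<alpha> q) i k"
  proof (rule eventually_nhdsinI[OF V_open V(1)])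
    fix q assume q: "q \<in> V"
    then have "q \<in> U" using V(2) by blast
    show "(\<Sum>a<n. \<alpha> q (E a q) * E a q i k) = sharp q (\<alpha> q) i k"
      by (simp add: sharp_orthonormal(1)[OF openin_imp_topspace[OF V_open q] linear[OF \<open>q \<in> U\<close>]
            orthonormal_frame_imp_orthonormal[OF E q]] sum_fun_apply tscale_apply)
  qed
  then show "smooth_at M (\<lambda>q. sharp q (\<alpha> q) i k) p"
    by (rule smooth_at_cong)
       (auto intro!: smooth_at_sum[OF openin_imp_topspace[OF U p]] smooth_at_mult
       smooth[OF V_open V(2) Ev V(1)]
         vfield_smooth_at[OF V_open Ev V(1) i k])
qed

end


section \<open>The Levi-Civita connection as a perturbation of a torsionless connection\<close>

subsection \<open>The covariant derivative of a metric\<close>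

context smooth_mfd
begin

lemma dirder_sum_sum_mult:
  assumes p: "p \<in> topspace (mtop M)"
    and f: "\<And>b. b \<in> B \<Longrightarrow> smooth_at M (f b) p" and h: "\<And>c. c \<in> C \<Longrightarrow> smooth_at M (h c) p"
    and G: "\<And>b c. b \<in> B \<Longrightarrow> c \<in> C \<Longrightarrow> smooth_at M (G b c) p"
  shows "dirder M p u (\<lambda>q. \<Sum>b\<in>B. \<Sum>c\<in>C. f b q * h c q * G b c q) =
    (\<Sum>b\<in>B. \<Sum>c\<in>C. dirder M p u (f b) * h c p * G b c p + f b p * dirder M p u (h c) * G b c p
       + f b p * h c p * dirder M p u (G b c))"
  by (simp add: dirder_sum[OF p] smooth_at_sum[OF p] smooth_at_mult f h G dirder_mult distrib_right)

lemma bilinear_at_product_rule: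
  assumes b: "bilinear_at p b" and e: "\<And>a. a \<in> A \<Longrightarrow> e a \<in> tangent_space M p"
    and e': "\<And>a. a \<in> A \<Longrightarrow> e' a \<in> tangent_space M p"
  shows "(\<Sum>a\<in>A. \<Sum>c\<in>A. y' a * z c * b (e a) (e c) + y a * z' c * b (e a) (e c) + y a * z c * b' a c)
    - b (\<Sum>a\<in>A. tscale (y' a) (e a) + tscale (y a) (e' a)) (\<Sum>c\<in>A. tscale (z c) (e c))
    - b (\<Sum>a\<in>A. tscale (y a) (e a)) (\<Sum>c\<in>A. tscale (z' c) (e c) + tscale (z c) (e' c))
    = (\<Sum>a\<in>A. \<Sum>c\<in>A. y a * z c * (b' a c - b (e' a) (e c) - b (e a) (e' c)))"
proof -
  have comb: "(\<Sum>a\<in>A. tscale (r a) (e a)) \<in> tangent_space M p"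
      "(\<Sum>a\<in>A. tscale (r a) (e' a)) \<in> tangent_space M p" for r
    by (intro tangent_sum tangent_scale e, simp) (intro tangent_sum tangent_scale e', simp)
  show ?thesis
    by (simp add: sum.distrib linear_at_add[OF bilinear_atD(1)[OF b comb(1)] comb]
        linear_at_add[OF bilinear_atD(2)[OF b comb(1)] comb] bilinear_at_comb[OF b e e]
        bilinear_at_comb[OF b e' e]
        bilinear_at_comb[OF b e e'] sum_subtractf right_diff_distrib)
qed

end

definition metric_form :: "('p, 'i) metric \<Rightarrow> ('p, 'i) field \<Rightarrow> ('p, 'i) field \<Rightarrow> 'p \<Rightarrow> real" where
  "metric_form g Y Z = (\<lambda>p. g p (Y p) (Z p))"

lemma cov_deriv_metric_form:
  "cov_deriv_20 M nab (metric_form g) X Y Z p =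
     dirder M p (X p) (\<lambda>q. g q (Y q) (Z q)) - g p (nab X Y p) (Z p) - g p (Y p) (nab X Z p)"
  by (simp add: cov_deriv_20_def metric_form_def)

definition nabla_metric ::
  "('p, 'i) manifold \<Rightarrow> ('p, 'i) conn \<Rightarrow> ('p, 'i) metric \<Rightarrow> 'p \<Rightarrow> 'i tvec \<Rightarrow> 'i tvec \<Rightarrow> 'i tvec \<Rightarrow> real" where
  "nabla_metric M nab g p u v w =
     (let i = SOME i. i \<in> charts_at M p; E = coord_field M i
      in \<Sum>a<mdim M. \<Sum>b<mdim M. \<Sum>c<mdim M.
           u i a * v i b * w i c * cov_deriv_20 M nab (metric_form g) (E a) (E b) (E c) p)"

locale affine_metric_mfd = torsionless_mfd M nab + riemannian_mfd M g
  for M :: "('p, 'i) manifold" and nab :: "('p, 'i) conn" and g :: "('p, 'i) metric"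
begin

abbreviation "C \<equiv> nabla_metric M nab g"

lemma g_expand:
  assumes i: "i \<in> charts_at M p" and v: "v \<in> tangent_space M p" and w: "w \<in> tangent_space M p"
  shows "g p v w = (\<Sum>b<n. \<Sum>c<n. v i b * w i c * g p (coord_field M i b p) (coord_field M i c p))"
proof -
  have "g p v w = g p (\<Sum>b<n. tscale (v i b) (coord_field M i b p))
      (\<Sum>c<n. tscale (w i c) (coord_field M i c p))"
    using tangent_expand[OF v i] tangent_expand[OF w i] by simp
  also have "\<dots> = (\<Sum>b<n. \<Sum>c<n. v i b * w i c * g p (coord_field M i b p) (coord_field M i c p))"
    by (rule bilinear_at_comb[OF g_bilinear[OF charts_at_imp_topspace[OF i]]])
       (simp_all add: coord_field_tangent[OF i])
  finally show ?thesis .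
qed

lemma smooth_at_g_coord_field:
  assumes i: "i \<in> charts_at M p" and "b < n" "c < n"
  shows "smooth_at M (\<lambda>q. g q (coord_field M i b q) (coord_field M i c q)) p"
proof -
  have ic: "i \<in> charts M" "p \<in> cdom M i" using i by (simp_all add: charts_at_iff)
  show ?thesis
    by (rule g_smooth_at[OF openin_cdom[OF ic(1)] coord_field_vfield[OF ic(1)] coord_field_vfield[OF ic(1)]
        ic(2)]) fact+
qed

lemma cov_deriv_metric_expand_right:
  assumes U: "openin (mtop M) U" "p \<in> U" and X: "vfield M U X" and Y: "vfield M U Y" and Z: "vfield M U Z"
    and i: "i \<in> charts_at M p"
  shows "cov_deriv_20 M nab (metric_form g) X Y Z p = (\<Sum>b<n. \<Sum>c<n. Y p i b * Z p i c *
      cov_deriv_20 M nab (metric_form g) X (coord_field M i b) (coord_field M i c) p)"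
proof -
  let ?E = "coord_field M i"
  have ic: "i \<in> charts M" using i by (simp add: charts_at_iff)
  note top = openin_imp_topspace[OF U]
  have "\<forall>\<^sub>F q in near p. q \<in> U" by (rule eventually_nhdsinI[OF U])
  then have "\<forall>\<^sub>F q in near p. g q (Y q) (Z q) = (\<Sum>b<n. \<Sum>c<n. Y q i b * Z q i c * g q (?E b q) (?E c q))"
    using eventually_near_charts_at[OF i]
    by eventually_elim (rule g_expand[OF _ vfield_tangent[OF Y] vfield_tangent[OF Z]])
  from dirder_cong[OF this top]
  have "dirder M p (X p) (\<lambda>q. g q (Y q) (Z q)) =
      dirder M p (X p) (\<lambda>q. \<Sum>b<n. \<Sum>c<n. Y q i b * Z q i c * g q (?E b q) (?E c q))" .
  also have "\<dots> = (\<Sum>b<n. \<Sum>c<n. dirder M p (X p) (\<lambda>q. Y q i b) * Z p i c * g p (?E b p) (?E c p)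
      + Y p i b * dirder M p (X p) (\<lambda>q. Z q i c) * g p (?E b p) (?E c p)
      + Y p i b * Z p i c * dirder M p (X p) (\<lambda>q. g q (?E b q) (?E c q)))"
    by (rule dirder_sum_sum_mult[OF top])
       (simp_all add: vfield_smooth_at[OF U(1) Y U(2) i] vfield_smooth_at[OF U(1) Z U(2) i]
       smooth_at_g_coord_field[OF i])
  finally have derivative: "dirder M p (X p) (\<lambda>q. g q (Y q) (Z q)) = \<dots>" .
  have nab_E: "nab X (?E b) p \<in> tangent_space M p" if "b < n" for b
  proof -
    have "vfield M (U \<inter> cdom M i) (nab X (?E b))"
      using U openin_cdom[OF ic] coord_field_vfield[OF ic that]
      by (intro nab_vfield vfield_subset[OF Int_lower1 X] vfield_subset[OF Int_lower2]) auto
    then show ?thesis by (rule vfield_tangent) (use U i in \<open>simp add: charts_at_iff\<close>)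
  qed
  have "cov_deriv_20 M nab (metric_form g) X Y Z p = dirder M p (X p) (\<lambda>q. g q (Y q) (Z q))
      - g p (nab X Y p) (\<Sum>c<n. tscale (Z p i c) (?E c p))
      - g p (\<Sum>b<n. tscale (Y p i b) (?E b p)) (nab X Z p)"
    using tangent_expand[OF vfield_tangent[OF Y U(2)] i] tangent_expand[OF vfield_tangent[OF Z U(2)] i]
    by (simp only: cov_deriv_metric_form)
  also have "\<dots> = (\<Sum>b<n. \<Sum>c<n. Y p i b * Z p i c * (dirder M p (X p) (\<lambda>q. g q (?E b q) (?E c q))
      - g p (nab X (?E b) p) (?E c p) - g p (?E b p) (nab X (?E c) p)))"
    unfolding derivative nab_expand(2)[OF U X Y i] nab_expand(2)[OF U X Z i]
    by (rule bilinear_at_product_rule[OF g_bilinear[OF top]])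
       (simp_all add: coord_field_tangent[OF i] nab_E)
  finally show ?thesis by (simp only: cov_deriv_metric_form)
qed

lemma cov_deriv_metric_expand_left:
  assumes U: "openin (mtop M) U" "p \<in> U" and X: "vfield M U X" and i: "i \<in> charts_at M p"
    and bc: "b < n" "c < n"
  shows "cov_deriv_20 M nab (metric_form g) X (coord_field M i b) (coord_field M i c) p = (\<Sum>a<n. X p i a *
      cov_deriv_20 M nab (metric_form g) (coord_field M i a) (coord_field M i b) (coord_field M i c) p)"
proof -
  let ?E = "coord_field M i"
  have ic: "i \<in> charts M" "p \<in> cdom M i" using i by (simp_all add: charts_at_iff)
  note top = openin_imp_topspace[OF U] and E = coord_field_vfield[OF ic(1)] and W = openin_cdom[OF ic(1)]
  have nab_E: "nab (?E a) (?E b) p \<in> tangent_space M p" if "a < n" "b < n" for a b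
    using vfield_tangent[OF nab_vfield[OF W E E] ic(2)] that .
  have nab_X: "nab X (?E b) p = (\<Sum>a<n. tscale (X p i a) (nab (?E a) (?E b) p))" if "b < n" for b
    using nab_expand(1)[of "U \<inter> cdom M i", OF _ _ vfield_subset[OF Int_lower1 X]
        vfield_subset[OF Int_lower2 E[OF that]] i]
      U W ic(2) by auto
  have "g p (nab X (?E b) p) (?E c p) = (\<Sum>a<n. X p i a * g p (nab (?E a) (?E b) p) (?E c p))"
    unfolding nab_X[OF bc(1)]
    by (rule linear_at_comb[OF g_linear_left[OF top]]) (simp_all add: coord_field_tangent[OF i] nab_E bc)
  moreover have "g p (?E b p) (nab X (?E c) p) = (\<Sum>a<n. X p i a * g p (?E b p) (nab (?E a) (?E c) p))"
    unfolding nab_X[OF bc(2)]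
    by (rule linear_at_comb[OF g_linear_right[OF top]]) (simp_all add: coord_field_tangent[OF i] nab_E bc)
  moreover have "dirder M p (X p) (\<lambda>q. g q (?E b q) (?E c q)) =
      (\<Sum>a<n. X p i a * dirder M p (?E a p) (\<lambda>q. g q (?E b q) (?E c q)))"
    using smooth_at_g_coord_field[OF i bc]
    by (simp add: dirder_chart[OF vfield_tangent[OF X U(2)] _ i] dirder_coord_field[OF _ i])
  ultimately show ?thesis
    by (simp add: cov_deriv_metric_form right_diff_distrib sum_subtractf)
qed

lemma cov_deriv_metric_expand:
  assumes U: "openin (mtop M) U" "p \<in> U" and X: "vfield M U X" and Y: "vfield M U Y" and Z: "vfield M U Z"
    and i: "i \<in> charts_at M p"
  shows "cov_deriv_20 M nab (metric_form g) X Y Z p = (\<Sum>a<n. \<Sum>b<n. \<Sum>c<n. X p i a * Y p i b * Z p i c *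
      cov_deriv_20 M nab (metric_form g) (coord_field M i a) (coord_field M i b) (coord_field M i c) p)"
proof -
  let ?C = "\<lambda>a b c. X p i a * Y p i b * Z p i c *
      cov_deriv_20 M nab (metric_form g) (coord_field M i a) (coord_field M i b) (coord_field M i c) p"
  have "cov_deriv_20 M nab (metric_form g) X Y Z p = (\<Sum>b<n. \<Sum>c<n. \<Sum>a<n. ?C a b c)"
    unfolding cov_deriv_metric_expand_right[OF U X Y Z i]
    by (simp add: cov_deriv_metric_expand_left[OF U X i] sum_distrib_left mult_ac)
  also have "\<dots> = (\<Sum>b<n. \<Sum>a<n. \<Sum>c<n. ?C a b c)" by (intro sum.cong refl sum.swap)
  also have "\<dots> = (\<Sum>a<n. \<Sum>b<n. \<Sum>c<n. ?C a b c)" by (rule sum.swap)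
  finally show ?thesis .
qed

lemma nabla_metric_vfield:
  assumes U: "openin (mtop M) U" "p \<in> U" and X: "vfield M U X" and Y: "vfield M U Y" and Z: "vfield M U Z"
  shows "C p (X p) (Y p) (Z p) =
    dirder M p (X p) (\<lambda>q. g q (Y q) (Z q)) - g p (nab X Y p) (Z p) - g p (Y p) (nab X Z p)"
proof -
  define i where "i = (SOME i. i \<in> charts_at M p)"
  have "i \<in> charts_at M p" unfolding i_def by (rule someI_ex[OF openin_ex_chart[OF U]])
  from cov_deriv_metric_expand[OF U X Y Z this] show ?thesis
    by (simp add: nabla_metric_def i_def[symmetric] Let_def cov_deriv_metric_form)
qed

lemma nabla_metric_trilinear: "trilinear_at p (C p)"
  by (simp add: trilinear_at_def bilinear_at_def linear_at_def nabla_metric_def Let_def tscale_apply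
      distrib_left distrib_right sum.distrib sum_distrib_left mult_ac)

lemma nabla_metric_commute:
  assumes p: "p \<in> topspace (mtop M)"
    and u: "u \<in> tangent_space M p" and v: "v \<in> tangent_space M p" and w: "w \<in> tangent_space M p"
  shows "C p u v w = C p u w v"
proof -
  obtain i where i: "i \<in> charts_at M p" using p topspace_iff_charts_at by blast
  have U: "openin (mtop M) (cdom M i)" "p \<in> cdom M i" using i by (auto simp: charts_at_iff openin_cdom)
  obtain X where X: "vfield M (cdom M i) X" "X p = u" by (rule tangent_extend[OF u i])
  obtain Y where Y: "vfield M (cdom M i) Y" "Y p = v" by (rule tangent_extend[OF v i])
  obtain Z where Z: "vfield M (cdom M i) Z" "Z p = w" by (rule tangent_extend[OF w i])
  have "dirder M p u (\<lambda>q. g q (Y q) (Z q)) = dirder M p u (\<lambda>q. g q (Z q) (Y q))"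
    by (intro dirder_cong[OF eventually_nhdsinI[OF U] p] g_commute openin_imp_topspace[OF U(1)]
        vfield_tangent[OF Y(1)] vfield_tangent[OF Z(1)])
  moreover have "nab X Y p \<in> tangent_space M p" "nab X Z p \<in> tangent_space M p"
    by (intro vfield_tangent[OF nab_vfield[OF U(1) X(1)] U(2)] Y Z)+
  ultimately show ?thesis
    using nabla_metric_vfield[OF U X(1) Y(1) Z(1)] nabla_metric_vfield[OF U X(1) Z(1) Y(1)]
      g_commute[OF p, of "nab X Y p" w] g_commute[OF p, of v "nab X Z p"] v w by (simp add: X Y Z)
qed

lemma smooth_at_nabla_metric:
  assumes U: "openin (mtop M) U" and X: "vfield M U X" and Y: "vfield M U Y" and Z: "vfield M U Z"
    and p: "p \<in> U"
  shows "smooth_at M (\<lambda>q. C q (X q) (Y q) (Z q)) p"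
proof -
  have "smooth_at M (\<lambda>q. dirder M q (X q) (\<lambda>q. g q (Y q) (Z q)) - g q (nab X Y q) (Z q)
      - g q (Y q) (nab X Z q)) p"
    by (intro smooth_at_diff smooth_at_dirder[OF U X _ p] g_smooth_at[OF U _ _ p] g_smooth_at[OF U Y Z]
        nab_vfield[OF U X] Y Z)
  then show ?thesis
    by (rule smooth_at_cong[rotated])
       (rule eventually_nhdsinI[OF U p], simp add: nabla_metric_vfield[OF U _ X Y Z])
qed


subsection \<open>The Levi-Civita connection\<close>

definition lc_tensor :: "'p \<Rightarrow> 'i tvec \<Rightarrow> 'i tvec \<Rightarrow> 'i tvec" where
  "lc_tensor p u v = sharp p (\<lambda>w. (C p u v w + C p v u w - C p w u v) / 2)"

context
  fixes p assumes p: "p \<in> topspace (mtop M)"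
begin

lemma nabla_metric_linear:
  assumes "v \<in> tangent_space M p" "w \<in> tangent_space M p"
  shows "linear_at p (\<lambda>u. C p u v w)" "linear_at p (\<lambda>u. C p v u w)" "linear_at p (C p v w)"
  using nabla_metric_trilinear[of p] assms by (auto simp: trilinear_at_def bilinear_at_def)

lemma
  assumes u: "u \<in> tangent_space M p" and v: "v \<in> tangent_space M p"
  shows lc_tensor_tangent: "lc_tensor p u v \<in> tangent_space M p"
    and g_lc_tensor: "w \<in> tangent_space M p \<Longrightarrow> g p (lc_tensor p u v) w =
      (C p u v w + C p v u w - C p w u v) / 2"
proof -
  note linear = nabla_metric_linear[OF u v] nabla_metric_linear[OF v u]
  have "linear_at p (\<lambda>w. (C p u v w + C p v u w - C p w u v) / 2)"
    using linear by (simp add: linear_at_def add_divide_distrib diff_divide_distrib algebra_simps)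
  then show "lc_tensor p u v \<in> tangent_space M p"
    "w \<in> tangent_space M p \<Longrightarrow> g p (lc_tensor p u v) w = (C p u v w + C p v u w - C p w u v) / 2"
    unfolding lc_tensor_def by (rule sharp_tangent[OF p], rule g_sharp[OF p])
qed

lemma lc_tensor_commute:
  assumes u: "u \<in> tangent_space M p" and v: "v \<in> tangent_space M p"
  shows "lc_tensor p u v = lc_tensor p v u"
  by (rule g_eqI[OF p lc_tensor_tangent[OF u v] lc_tensor_tangent[OF v u]])
     (simp add: g_lc_tensor u v nabla_metric_commute[OF p _ u v])

lemma lc_tensor_skew_part:
  assumes "u \<in> tangent_space M p" "v \<in> tangent_space M p" "w \<in> tangent_space M p"
  shows "g p (lc_tensor p u v) w + g p v (lc_tensor p u w) = C p u v w"
  using assms g_commute[OF p _ lc_tensor_tangent[of u w], of v]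
  by (simp add: g_lc_tensor nabla_metric_commute[OF p, of _ u] nabla_metric_commute[OF p, of _ w v]
      field_simps)

lemma lc_tensor_add_right:
  assumes u: "u \<in> tangent_space M p" and v: "v \<in> tangent_space M p" and w: "w \<in> tangent_space M p"
  shows "lc_tensor p u (v + w) = lc_tensor p u v + lc_tensor p u w"
proof (rule g_eqI[OF p])
  fix z assume z: "z \<in> tangent_space M p"
  show "g p (lc_tensor p u (v + w)) z = g p (lc_tensor p u v + lc_tensor p u w) z"
    using nabla_metric_linear[OF u z] nabla_metric_linear[OF z u] z
    by (simp add: linear_at_add[OF g_linear_left[OF p z]] g_lc_tensor lc_tensor_tangent tangent_add u v w
        linear_at_add[OF nabla_metric_linear(1)] linear_at_add[OF nabla_metric_linear(2)]
        linear_at_add[OF nabla_metric_linear(3)] field_simps)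
qed (intro lc_tensor_tangent tangent_add u v w)+

lemma lc_tensor_scale_right:
  assumes u: "u \<in> tangent_space M p" and v: "v \<in> tangent_space M p"
  shows "lc_tensor p u (tscale r v) = tscale r (lc_tensor p u v)"
proof (rule g_eqI[OF p])
  fix z assume z: "z \<in> tangent_space M p"
  show "g p (lc_tensor p u (tscale r v)) z = g p (tscale r (lc_tensor p u v)) z"
    using z
    by (simp add: linear_at_scale[OF g_linear_left[OF p z]] g_lc_tensor lc_tensor_tangent tangent_scale u v
        linear_at_scale[OF nabla_metric_linear(1)] linear_at_scale[OF nabla_metric_linear(2)]
        linear_at_scale[OF nabla_metric_linear(3)] field_simps)
qed (intro lc_tensor_tangent tangent_scale u v)+

end

lemma lc_tensor_vfield:
  assumes U: "openin (mtop M) U" and X: "vfield M U X" and Y: "vfield M U Y"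
  shows "vfield M U (\<lambda>p. lc_tensor p (X p) (Y p))"
  unfolding lc_tensor_def
proof (rule sharp_vfield[OF U])
  fix p assume p: "p \<in> U"
  note linear = nabla_metric_linear[OF openin_imp_topspace[OF U p]]
  show "linear_at p (\<lambda>w. (C p (X p) (Y p) w + C p (Y p) (X p) w - C p w (X p) (Y p)) / 2)"
    using linear[OF vfield_tangent[OF X p] vfield_tangent[OF Y p]]
        linear[OF vfield_tangent[OF Y p] vfield_tangent[OF X p]]
    by (simp add: linear_at_def algebra_simps add_divide_distrib diff_divide_distrib)
next
  fix V Z p assume V: "openin (mtop M) V" "V \<subseteq> U" and Z: "vfield M V Z" and p: "p \<in> V"
  note X' = vfield_subset[OF V(2) X] and Y' = vfield_subset[OF V(2) Y]
  have "smooth_at M (\<lambda>q. (C q (X q) (Y q) (Z q) + C q (Y q) (X q) (Z q) - C q (Z q) (X q) (Y q)) * (1/2)) p"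
    by (intro smooth_at_mult smooth_at_diff smooth_at_add smooth_at_const openin_imp_topspace[OF V(1) p]
        smooth_at_nabla_metric[OF V(1) _ _ _ p] X' Y' Z)
  then show "smooth_at M (\<lambda>q. (C q (X q) (Y q) (Z q) + C q (Y q) (X q) (Z q) - C q (Z q) (X q) (Y q)) / 2)
      p"
    by simp
qed

definition lc_conn :: "('p, 'i) conn" where
  "lc_conn X Y = (\<lambda>p. nab X Y p + lc_tensor p (X p) (Y p))"

lemma connection_lc_conn: "connection M lc_conn"
proof (rule connectionI)
  fix U X Y assume U: "openin (mtop M) U" and X: "vfield M U X" and Y: "vfield M U Y"
  have "lc_conn X Y = nab X Y + (\<lambda>p. lc_tensor p (X p) (Y p))" by (simp add: lc_conn_def fun_eq_iff)
  then show "vfield M U (lc_conn X Y)" by (simp add: vfield_add[OF U] nab_vfield lc_tensor_vfield U X Y)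
next
  fix U X X' Y p assume "openin (mtop M) U" "vfield M U X" "vfield M U X'" "vfield M U Y" "p \<in> U"
  then show "lc_conn (X + X') Y p = lc_conn X Y p + lc_conn X' Y p"
    using lc_tensor_add_right[of p "Y p" "X p" "X' p"] lc_tensor_commute[of p] openin_imp_topspace[of U p]
    by (simp add: lc_conn_def nab_add_left[of U] vfield_tangent tangent_add)
next
  fix U X Y f p assume "openin (mtop M) U" "vfield M U X" "vfield M U Y" "smooth_fun M U f" "p \<in> U"
  then show "lc_conn (fscale f X) Y p = tscale (f p) (lc_conn X Y p)"
    using lc_tensor_scale_right[of p "Y p" "X p" "f p"] lc_tensor_commute[of p] openin_imp_topspace[of U p]
    by (simp add: lc_conn_def nab_scale_left[of U] vfield_tangent tangent_scale fscale_apply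
        tvec.scale_right_distrib)
next
  fix U X Y Y' p assume "openin (mtop M) U" "vfield M U X" "vfield M U Y" "vfield M U Y'" "p \<in> U"
  then show "lc_conn X (Y + Y') p = lc_conn X Y p + lc_conn X Y' p"
    using lc_tensor_add_right[of p "X p" "Y p" "Y' p"] openin_imp_topspace[of U p]
    by (simp add: lc_conn_def nab_add_right[of U] vfield_tangent)
next
  fix U X Y f p assume "openin (mtop M) U" "vfield M U X" "vfield M U Y" "smooth_fun M U f" "p \<in> U"
  then show "lc_conn X (fscale f Y) p = tscale (dirder M p (X p) f) (Y p) + tscale (f p) (lc_conn X Y p)"
    using openin_imp_topspace[of U p]
    by (simp add: lc_conn_def nab_leibniz[of U] lc_tensor_scale_right vfield_tangent fscale_apply
        tvec.scale_right_distrib)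
next
  fix U X X' Y Y' p
  assume "openin (mtop M) U" "vfield M U X" "vfield M U X'" "vfield M U Y" "vfield M U Y'"
    "\<And>q. q \<in> U \<Longrightarrow> X q = X' q" "\<And>q. q \<in> U \<Longrightarrow> Y q = Y' q" "p \<in> U"
  then show "lc_conn X Y p = lc_conn X' Y' p"
    using nab_cong[of U X X' Y Y' p] by (simp add: lc_conn_def)
qed

lemma levi_civita_lc_conn: "levi_civita M g lc_conn"
  unfolding levi_civita_def torsionless_def metric_connection_def
proof (intro conjI connection_lc_conn allI impI ballI)
  fix U X Y p assume "openin (mtop M) U \<and> vfield M U X \<and> vfield M U Y" and p: "p \<in> U"
  then have U: "openin (mtop M) U" and X: "vfield M U X" and Y: "vfield M U Y" by auto
  show "lc_conn X Y p - lc_conn Y X p = bracket M X Y p"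
    unfolding bracket_eq_nab[OF U X Y p] lc_conn_def
    using lc_tensor_commute[OF openin_imp_topspace[OF U p] vfield_tangent[OF X p] vfield_tangent[OF Y p]]
    by (simp add: algebra_simps del: plus_fun_apply)
next
  fix U X Y Z p assume "openin (mtop M) U \<and> vfield M U X \<and> vfield M U Y \<and> vfield M U Z" and p: "p \<in> U"
  then have U: "openin (mtop M) U" and X: "vfield M U X" and Y: "vfield M U Y" and Z: "vfield M U Z" by auto
  note top = openin_imp_topspace[OF U p]
  note tangent = vfield_tangent[OF X p] vfield_tangent[OF Y p] vfield_tangent[OF Z p]
  note nab_tangent = vfield_tangent[OF nab_vfield[OF U X] p]
  have "g p (lc_conn X Y p) (Z p) + g p (Y p) (lc_conn X Z p) =
      g p (nab X Y p) (Z p) + g p (Y p) (nab X Z p) + C p (X p) (Y p) (Z p)"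
    unfolding lc_tensor_skew_part[OF top tangent, symmetric] lc_conn_def
    by (simp add: linear_at_add[OF g_linear_left[OF top]] linear_at_add[OF g_linear_right[OF top]]
        lc_tensor_tangent[OF top] nab_tangent tangent Y Z)
  then show "dirder M p (X p) (\<lambda>q. g q (Y q) (Z q)) = g p (lc_conn X Y p) (Z p) + g p (Y p) (lc_conn X Z p)"
    using nabla_metric_vfield[OF U p X Y Z] by simp
qed

end


section \<open>Closed one-forms\<close>

context smooth_mfd
begin

definition one_form :: "('p \<Rightarrow> 'i tvec \<Rightarrow> real) \<Rightarrow> bool" where
  "one_form \<alpha> \<longleftrightarrow> (\<forall>p\<in>topspace (mtop M). linear_at p (\<alpha> p)) \<and>
     (\<forall>U X. openin (mtop M) U \<and> vfield M U X \<longrightarrow> (\<forall>p\<in>U. smooth_at M (\<lambda>q. \<alpha> q (X q)) p))"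

definition closed_form :: "('p \<Rightarrow> 'i tvec \<Rightarrow> real) \<Rightarrow> bool" where
  "closed_form \<alpha> \<longleftrightarrow> one_form \<alpha> \<and> closed_1form M (\<lambda>X p. \<alpha> p (X p))"

lemma one_form_linear: "one_form \<alpha> \<Longrightarrow> p \<in> topspace (mtop M) \<Longrightarrow> linear_at p (\<alpha> p)"
  by (simp add: one_form_def)

lemma one_form_smooth_at:
  "one_form \<alpha> \<Longrightarrow> openin (mtop M) U \<Longrightarrow> vfield M U X \<Longrightarrow> p \<in> U \<Longrightarrow> smooth_at M (\<lambda>q. \<alpha> q (X q)) p"
  unfolding one_form_def by blast

lemma one_form_component:
  assumes \<alpha>: "one_form \<alpha>" and i: "i \<in> charts_at M p" and "a < n"
  shows "smooth_at M (\<lambda>q. \<alpha> q (coord_field M i a q)) p"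
proof -
  have ic: "i \<in> charts M" "p \<in> cdom M i" using i by (simp_all add: charts_at_iff)
  show ?thesis by (rule one_form_smooth_at[OF \<alpha> openin_cdom[OF ic(1)] coord_field_vfield[OF ic(1) \<open>a < n\<close>]
      ic(2)])
qed

lemma eventually_linear_form_chart:
  assumes linear: "\<And>q. q \<in> topspace (mtop M) \<Longrightarrow> linear_at q (\<alpha> q)"
    and U: "openin (mtop M) U" and X: "vfield M U X" and p: "p \<in> U" and i: "i \<in> charts_at M p"
  shows "\<forall>\<^sub>F q in near p. (\<Sum>a<n. X q i a * \<alpha> q (coord_field M i a q)) = \<alpha> q (X q)"
proof -
  have "\<forall>\<^sub>F q in near p. q \<in> U" by (rule eventually_nhdsinI[OF U p])
  then show ?thesis
    using eventually_near_charts_at[OF i]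
    by eventually_elim (simp add: linear_at_chart[OF linear vfield_tangent[OF X]] openin_imp_topspace[OF U])
qed

lemma one_formI:
  assumes linear: "\<And>p. p \<in> topspace (mtop M) \<Longrightarrow> linear_at p (\<alpha> p)"
    and component: "\<And>p i a. i \<in> charts_at M p \<Longrightarrow> a < n \<Longrightarrow> smooth_at M (\<lambda>q. \<alpha> q (coord_field M i a q)) p"
  shows "one_form \<alpha>"
  unfolding one_form_def
proof (intro conjI ballI allI impI linear)
  fix U X p assume "openin (mtop M) U \<and> vfield M U X" and p: "p \<in> U"
  then have U: "openin (mtop M) U" and X: "vfield M U X" by auto
  obtain i where i: "i \<in> charts_at M p" using openin_ex_chart[OF U p] ..
  show "smooth_at M (\<lambda>q. \<alpha> q (X q)) p"
    by (rule smooth_at_cong[OF eventually_linear_form_chart[OF linear U X p i]])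
       (auto intro!: smooth_at_sum charts_at_imp_topspace[OF i] smooth_at_mult vfield_smooth_at[OF U X p i]
       component[OF i])
qed

lemma dirder_one_form:
  assumes \<alpha>: "one_form \<alpha>" and U: "openin (mtop M) U" and X: "vfield M U X" and Y: "vfield M U Y"
    and p: "p \<in> U" and i: "i \<in> charts_at M p"
  shows "dirder M p (X p) (\<lambda>q. \<alpha> q (Y q)) =
    (\<Sum>b<n. dirder M p (X p) (\<lambda>q. Y q i b) * \<alpha> p (coord_field M i b p))
    + (\<Sum>b<n. \<Sum>a<n. X p i a * Y p i b * chart_pderiv M i a (\<lambda>q. \<alpha> q (coord_field M i b q)) p)"
proof -
  note top = charts_at_imp_topspace[OF i]
  have "dirder M p (X p) (\<lambda>q. \<alpha> q (Y q)) = dirder M p (X p) (\<lambda>q. \<Sum>b<n. Y q i b * \<alpha> q (coord_field M i b q))"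
    by (rule dirder_cong[OF eventually_linear_form_chart[OF one_form_linear[OF \<alpha>] U Y p i] top, symmetric])
  also have "\<dots> = (\<Sum>b<n. dirder M p (X p) (\<lambda>q. Y q i b) * \<alpha> p (coord_field M i b p))
      + (\<Sum>b<n. Y p i b * dirder M p (X p) (\<lambda>q. \<alpha> q (coord_field M i b q)))"
    by (rule dirder_sum_mult[OF top])
       (simp_all add: vfield_smooth_at[OF U Y p i] one_form_component[OF \<alpha> i])
  finally show ?thesis
    by (simp add: dirder_chart[OF vfield_tangent[OF X p] one_form_component[OF \<alpha> i] i] sum_distrib_left
        mult_ac)
qed

lemma ext_deriv1_one_form:
  assumes \<alpha>: "one_form \<alpha>" and U: "openin (mtop M) U" and X: "vfield M U X" and Y: "vfield M U Y"
    and p: "p \<in> U" and i: "i \<in> charts_at M p"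
  shows "ext_deriv1 M (\<lambda>X p. \<alpha> p (X p)) X Y p = (\<Sum>b<n. \<Sum>a<n. X p i a * Y p i b *
    (chart_pderiv M i a (\<lambda>q. \<alpha> q (coord_field M i b q)) p
    - chart_pderiv M i b (\<lambda>q. \<alpha> q (coord_field M i a q)) p))"
proof -
  have "\<alpha> p (bracket M X Y p) =
      (\<Sum>b<n. (dirder M p (X p) (\<lambda>q. Y q i b) - dirder M p (Y p) (\<lambda>q. X q i b)) * \<alpha> p (coord_field M i b p))"
    by (simp add: linear_at_chart[OF one_form_linear[OF \<alpha> charts_at_imp_topspace[OF i]]
          vfield_tangent[OF bracket_vfield[OF U X Y] p] i] bracket_apply[OF i])
  moreover have "(\<Sum>b<n. \<Sum>a<n. Y p i a * X p i b * chart_pderiv M i a (\<lambda>q. \<alpha> q (coord_field M i b q)) p)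
      = (\<Sum>b<n. \<Sum>a<n. X p i a * Y p i b * chart_pderiv M i b (\<lambda>q. \<alpha> q (coord_field M i a q)) p)"
    by (subst sum.swap) (simp add: mult_ac)
  ultimately show ?thesis
    by (simp add: ext_deriv1_def dirder_one_form[OF \<alpha> U X Y p i] dirder_one_form[OF \<alpha> U Y X p i]
        sum_subtractf left_diff_distrib right_diff_distrib)
qed

lemma closed_form_iff_chart:
  "closed_form \<alpha> \<longleftrightarrow> one_form \<alpha> \<and> (\<forall>p i a b. i \<in> charts_at M p \<longrightarrow> a < n \<longrightarrow> b < n \<longrightarrow>
     chart_pderiv M i a (\<lambda>q. \<alpha> q (coord_field M i b q)) p =
     chart_pderiv M i b (\<lambda>q. \<alpha> q (coord_field M i a q)) p)"
  (is "_ \<longleftrightarrow> _ \<and> ?symmetric")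
proof (intro iffI conjI allI impI)
  assume closed: "closed_form \<alpha>"
  then show \<alpha>: "one_form \<alpha>" by (simp add: closed_form_def)
  fix p i a b assume i: "i \<in> charts_at M p" and a: "a < n" and b: "b < n"
  then have ic: "i \<in> charts M" "p \<in> cdom M i" by (simp_all add: charts_at_iff)
  note U = openin_cdom[OF ic(1)] and E = coord_field_vfield[OF ic(1)]
  have "ext_deriv1 M (\<lambda>X p. \<alpha> p (X p)) (coord_field M i a) (coord_field M i b) p = 0"
    using closed U E[OF a] E[OF b] ic(2) unfolding closed_form_def closed_1form_def by blast
  then show "chart_pderiv M i a (\<lambda>q. \<alpha> q (coord_field M i b q)) p =
      chart_pderiv M i b (\<lambda>q. \<alpha> q (coord_field M i a q)) p"
    using linear_at_zero[OF one_form_linear[OF \<alpha> charts_at_imp_topspace[OF i]]]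
    by (simp add: ext_deriv1_def bracket_coord_field[OF i a b]
        dirder_coord_field[OF one_form_component[OF \<alpha> i] i] a b)
next
  assume "one_form \<alpha> \<and> ?symmetric"
  then have \<alpha>: "one_form \<alpha>" and symmetric: "?symmetric" by blast+
  show "closed_form \<alpha>"
    unfolding closed_form_def closed_1form_def
  proof (intro conjI \<alpha> allI impI ballI)
    fix U X Y p assume "openin (mtop M) U \<and> vfield M U X \<and> vfield M U Y" and p: "p \<in> U"
    then have U: "openin (mtop M) U" and X: "vfield M U X" and Y: "vfield M U Y" by auto
    obtain i where i: "i \<in> charts_at M p" using openin_ex_chart[OF U p] ..
    show "ext_deriv1 M (\<lambda>X p. \<alpha> p (X p)) X Y p = 0"
      unfolding ext_deriv1_one_form[OF \<alpha> U X Y p i] using symmetric i by (intro sum.neutral ballI) simp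
  qed
qed

lemma closed_form_cong:
  assumes \<alpha>: "closed_form \<alpha>"
    and eq: "\<And>p u. p \<in> topspace (mtop M) \<Longrightarrow> u \<in> tangent_space M p \<Longrightarrow> \<alpha> p u = \<beta> p u"
  shows "closed_form \<beta>"
proof -
  have one_form: "one_form \<alpha>" using \<alpha> by (simp add: closed_form_iff_chart)
  have component: "\<forall>\<^sub>F q in near p. \<alpha> q (coord_field M i a q) = \<beta> q (coord_field M i a q)"
    if "i \<in> charts_at M p" "a < n" for p i a
    using eventually_near_charts_at[OF that(1)]
    by eventually_elim (simp add: eq charts_at_imp_topspace coord_field_tangent that)
  have "one_form \<beta>"
  proof (rule one_formI)
    show "linear_at p (\<beta> p)" if "p \<in> topspace (mtop M)" for p
      using one_form_linear[OF one_form that]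
      by (simp add: linear_at_def eq[OF that, symmetric] tangent_add tangent_scale)
    show "smooth_at M (\<lambda>q. \<beta> q (coord_field M i a q)) p" if "i \<in> charts_at M p" "a < n" for p i a
      by (rule smooth_at_cong[OF component[OF that] one_form_component[OF one_form that]])
  qed
  then show ?thesis
    using \<alpha> by (auto simp: closed_form_iff_chart chart_pderiv_cong[OF component, symmetric])
qed

lemma one_form_scale: "one_form \<alpha> \<Longrightarrow> one_form (\<lambda>p u. r * \<alpha> p u)"
  by (intro one_formI linear_at_times_fun smooth_at_mult smooth_at_const)
     (simp_all add: one_form_linear one_form_component charts_at_imp_topspace)

lemma closed_form_scale:
  assumes "closed_form \<alpha>"
  shows "closed_form (\<lambda>p u. r * \<alpha> p u)"
  using assms
  by (simp add: closed_form_iff_chart one_form_scale chart_pderiv_mult smooth_at_const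
      charts_at_imp_topspace
      one_form_component chart_pderiv_const)

lemma closed_form_add:
  assumes "closed_form \<alpha>" "closed_form \<beta>"
  shows "closed_form (\<lambda>p u. \<alpha> p u + \<beta> p u)"
proof -
  have "one_form \<alpha>" "one_form \<beta>" using assms by (auto simp: closed_form_iff_chart)
  then have "one_form (\<lambda>p u. \<alpha> p u + \<beta> p u)"
    by (intro one_formI) (simp_all add: linear_at_plus_fun one_form_linear smooth_at_add one_form_component)
  with assms show ?thesis by (simp add: closed_form_iff_chart chart_pderiv_add one_form_component)
qed

lemma closed_form_diff:
  "closed_form \<alpha> \<Longrightarrow> closed_form \<beta> \<Longrightarrow> closed_form (\<lambda>p u. \<alpha> p u - \<beta> p u)"
  using closed_form_add[OF _ closed_form_scale[of _ "-1"]] by simp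

lemma closed_1form_cong:
  assumes \<theta>: "closed_1form M \<theta>"
    and eq: "\<And>U X p. openin (mtop M) U \<Longrightarrow> vfield M U X \<Longrightarrow> p \<in> U \<Longrightarrow> \<theta> X p = \<theta>' X p"
  shows "closed_1form M \<theta>'"
  unfolding closed_1form_def
proof (intro allI impI ballI)
  fix U X Y p assume "openin (mtop M) U \<and> vfield M U X \<and> vfield M U Y" and p: "p \<in> U"
  then have U: "openin (mtop M) U" and X: "vfield M U X" and Y: "vfield M U Y" by auto
  have "dirder M p u (\<theta> Z) = dirder M p u (\<theta>' Z)" if "vfield M U Z" for u Z
    by (intro dirder_cong[OF eventually_nhdsinI[OF U p]] eq[OF U that] openin_imp_topspace[OF U p])
  then have "ext_deriv1 M \<theta>' X Y p = ext_deriv1 M \<theta> X Y p"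
    by (simp add: ext_deriv1_def X Y eq[OF U bracket_vfield[OF U X Y] p])
  also have "\<dots> = 0" using \<theta> U X Y p unfolding closed_1form_def by blast
  finally show "ext_deriv1 M \<theta>' X Y p = 0" .
qed

end

lemma (in torsionless_mfd) parallel_one_form_closed:
  assumes \<alpha>: "one_form \<alpha>"
    and parallel: "\<And>U X Y p. openin (mtop M) U \<Longrightarrow> vfield M U X \<Longrightarrow> vfield M U Y \<Longrightarrow> p \<in> U \<Longrightarrow>
      dirder M p (X p) (\<lambda>q. \<alpha> q (Y q)) = \<alpha> p (nab X Y p)"
  shows "closed_form \<alpha>"
  unfolding closed_form_def closed_1form_def
proof (intro conjI \<alpha> allI impI ballI)
  fix U X Y p assume "openin (mtop M) U \<and> vfield M U X \<and> vfield M U Y" and p: "p \<in> U"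
  then have U: "openin (mtop M) U" and X: "vfield M U X" and Y: "vfield M U Y" by auto
  have "\<alpha> p (bracket M X Y p) = \<alpha> p (nab X Y p) - \<alpha> p (nab Y X p)"
    unfolding bracket_eq_nab[OF U X Y p]
    by (rule linear_at_diff[OF one_form_linear[OF \<alpha> openin_imp_topspace[OF U p]]])
       (rule vfield_tangent[OF nab_vfield[OF U] p] X Y)+
  then show "ext_deriv1 M (\<lambda>X p. \<alpha> p (X p)) X Y p = 0"
    by (simp add: ext_deriv1_def parallel[OF U _ _ p] X Y)
qed


section \<open>The Lee form\<close>

locale hermitian_mfd = riemannian_mfd M g for M :: "('p, 'i) manifold" and g :: "('p, 'i) metric" +
  fixes J :: "('p, 'i) endo"
  assumes hermitian: "hermitian_manifold M J g"
begin

lemma almost_complex: "almost_complex M J"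
  using hermitian by (simp add: hermitian_manifold_def complex_structure_def)

lemma J_vfield: "openin (mtop M) U \<Longrightarrow> vfield M U X \<Longrightarrow> vfield M U (apply_endo J X)"
  using almost_complex unfolding almost_complex_def by blast

context
  fixes p assumes p: "p \<in> topspace (mtop M)"
begin

lemma J_tangent: "u \<in> tangent_space M p \<Longrightarrow> J p u \<in> tangent_space M p"
  and J_square: "u \<in> tangent_space M p \<Longrightarrow> J p (J p u) = - u"
  and J_scale: "u \<in> tangent_space M p \<Longrightarrow> J p (tscale c u) = tscale c (J p u)"
  using almost_complex p unfolding almost_complex_def by blast+

lemma J_add: "u \<in> tangent_space M p \<Longrightarrow> v \<in> tangent_space M p \<Longrightarrow> J p (u + v) = J p u + J p v"
  using almost_complex p unfolding almost_complex_def by blast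

lemma J_isometry: "u \<in> tangent_space M p \<Longrightarrow> v \<in> tangent_space M p \<Longrightarrow> g p (J p u) (J p v) = g p u v"
  using hermitian p unfolding hermitian_manifold_def by blast

lemma orthonormal_J: "orthonormal p m e \<Longrightarrow> orthonormal p m (\<lambda>a. J p (e a))"
  by (simp add: orthonormal_def J_tangent J_isometry)

end

end

context affine_metric_mfd
begin

definition koszul_form :: "'p \<Rightarrow> 'i tvec \<Rightarrow> real" where
  "koszul_form p u = metric_trace p (C p u) / 2"

definition divergence_form :: "'p \<Rightarrow> 'i tvec \<Rightarrow> real" where
  "divergence_form p u = metric_trace p (\<lambda>v w. C p v w u)"

lemma koszul_form_eq:
  "p \<in> topspace (mtop M) \<Longrightarrow> u \<in> tangent_space M p \<Longrightarrow> orthonormal p n e \<Longrightarrow>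
   koszul_form p u = (\<Sum>a<n. C p u (e a) (e a)) / 2"
  by (simp add: koszul_form_def metric_trace_eq trilinear_atD(1)[OF nabla_metric_trilinear])

lemma divergence_form_eq:
  "p \<in> topspace (mtop M) \<Longrightarrow> u \<in> tangent_space M p \<Longrightarrow> orthonormal p n e \<Longrightarrow>
   divergence_form p u = (\<Sum>a<n. C p (e a) (e a) u)"
  by (simp add: divergence_form_def metric_trace_eq trilinear_atD(2)[OF nabla_metric_trilinear])

lemma trace_lc_tensor:
  assumes p: "p \<in> topspace (mtop M)" and e: "orthonormal p n e" and w: "w \<in> tangent_space M p"
  shows "(\<Sum>a<n. g p (lc_tensor p (e a) (e a)) w) = divergence_form p w - koszul_form p w"
  by (simp add: koszul_form_eq[OF p w e] divergence_form_eq[OF p w e] g_lc_tensor[OF p _ _ w]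
      orthonormalD(1)[OF e]
      sum_subtractf sum_divide_distrib diff_divide_distrib)

end

locale parallel_hermitian_mfd = affine_metric_mfd M nab g + hermitian_mfd M g J
  for M :: "('p, 'i) manifold" and nab g J +
  assumes parallel: "parallel_endo M nab J"
begin

lemma nab_J:
  "openin (mtop M) U \<Longrightarrow> vfield M U X \<Longrightarrow> vfield M U Y \<Longrightarrow> p \<in> U \<Longrightarrow> nab X (apply_endo J Y) p = J p (nab X Y p)"
  using parallel unfolding parallel_endo_def by blast

lemma cov_deriv_fundamental_form:
  assumes U: "openin (mtop M) U" and X: "vfield M U X" and Y: "vfield M U Y" and Z: "vfield M U Z"
    and p: "p \<in> U"
  shows "cov_deriv_20 M lc_conn (fundamental_form J g) X Y Z p =
    g p (lc_tensor p (X p) (J p (Y p))) (Z p) - g p (J p (lc_tensor p (X p) (Y p))) (Z p)"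
proof -
  note top = openin_imp_topspace[OF U p] and JY = J_vfield[OF U Y]
  note nab_tangent = vfield_tangent[OF nab_vfield[OF U X Y] p]
    and tangent = vfield_tangent[OF X p] vfield_tangent[OF Y p]
  note lc_tangent = lc_tensor_tangent[OF top tangent]
    lc_tensor_tangent[OF top tangent(1) J_tangent[OF top tangent(2)]]
  note g_add = linear_at_add[OF g_linear_left[OF top vfield_tangent[OF Z p]]]
  have "metric_connection M g lc_conn" using levi_civita_lc_conn by (simp add: levi_civita_def)
  then have "dirder M p (X p) (\<lambda>q. g q (apply_endo J Y q) (Z q)) =
      g p (lc_conn X (apply_endo J Y) p) (Z p) + g p (apply_endo J Y p) (lc_conn X Z p)"
    using U X JY Z p unfolding metric_connection_def by blast
  then have "cov_deriv_20 M lc_conn (fundamental_form J g) X Y Z p =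
      g p (lc_conn X (apply_endo J Y) p) (Z p) - g p (J p (lc_conn X Y p)) (Z p)"
    by (simp add: cov_deriv_20_def fundamental_form_def apply_endo_apply)
  also have "g p (lc_conn X (apply_endo J Y) p) (Z p) =
      g p (J p (nab X Y p)) (Z p) + g p (lc_tensor p (X p) (J p (Y p))) (Z p)"
    unfolding lc_conn_def nab_J[OF U X Y p] apply_endo_apply
    by (rule g_add[OF J_tangent[OF top nab_tangent] lc_tangent(2)])
  also have "g p (J p (lc_conn X Y p)) (Z p) =
      g p (J p (nab X Y p)) (Z p) + g p (J p (lc_tensor p (X p) (Y p))) (Z p)"
    unfolding lc_conn_def J_add[OF top nab_tangent lc_tangent(1)]
    by (rule g_add[OF J_tangent[OF top nab_tangent] J_tangent[OF top lc_tangent(1)]])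
  finally show ?thesis by simp
qed

text \<open>\<open>J\<close> maps orthonormal bases to orthonormal bases, and \<open>\<gamma>(J e, J J e) = - \<gamma>(e, J e)\<close> by symmetry.\<close>

lemma trace_lc_tensor_J:
  assumes p: "p \<in> topspace (mtop M)" and e: "orthonormal p n e" and w: "w \<in> tangent_space M p"
  shows "(\<Sum>a<n. g p (lc_tensor p (e a) (J p (e a))) w) = 0"
proof -
  define b where "b u v = g p (lc_tensor p u (J p v)) w" for u v
  note g_linear = g_linear_left[OF p w]
  have "linear_at p (\<lambda>u. b u v)" if "v \<in> tangent_space M p" for v
    by (simp add: linear_at_def b_def lc_tensor_commute[OF p _ J_tangent[OF p that]]
        lc_tensor_add_right[OF p]
        lc_tensor_scale_right[OF p] linear_at_add[OF g_linear] linear_at_scale[OF g_linear]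
        lc_tensor_tangent[OF p]
        J_tangent[OF p] that tangent_add tangent_scale)
  moreover have "linear_at p (b u)" if "u \<in> tangent_space M p" for u
    by (simp add: linear_at_def b_def J_add[OF p] J_scale[OF p] lc_tensor_add_right[OF p]
        lc_tensor_scale_right[OF p] linear_at_add[OF g_linear] linear_at_scale[OF g_linear]
        lc_tensor_tangent[OF p]
        J_tangent[OF p] that)
  ultimately have "bilinear_at p b" by (simp add: bilinear_at_def)
  from trace_orthonormal_unique[OF p this e orthonormal_J[OF p e]]
  have "(\<Sum>a<n. b (e a) (e a)) = (\<Sum>a<n. b (J p (e a)) (J p (e a)))" by simp
  also have "\<dots> = (\<Sum>a<n. - b (e a) (e a))"
  proof (intro sum.cong refl)
    fix a assume "a \<in> {..<n}"
    then have t: "e a \<in> tangent_space M p" by (simp add: orthonormalD(1)[OF e])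
    have "lc_tensor p (J p (e a)) (- e a) = - lc_tensor p (e a) (J p (e a))"
      using lc_tensor_scale_right[OF p J_tangent[OF p t] t, of "-1"]
          lc_tensor_commute[OF p t J_tangent[OF p t]] by simp
    then show "b (J p (e a)) (J p (e a)) = - b (e a) (e a)"
      by (simp add: b_def J_square[OF p t] linear_at_minus[OF g_linear] lc_tensor_tangent[OF p] t
          J_tangent[OF p])
  qed
  finally show ?thesis by (simp add: b_def sum_negf)
qed

lemma lee_form_eq:
  assumes U: "openin (mtop M) U" and X: "vfield M U X" and p: "p \<in> U"
  shows "lee_form M J g lc_conn X p = koszul_form p (X p) - divergence_form p (X p)"
proof -
  note top = openin_imp_topspace[OF U p]
  define E where "E = (SOME E. \<exists>U. p \<in> U \<and> orthonormal_frame M g U E)"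
  obtain W F where "p \<in> W" "orthonormal_frame M g W F" by (rule orthonormal_frame_near[OF U p])
  then have "\<exists>F W. p \<in> W \<and> orthonormal_frame M g W F" by blast
  then have "\<exists>W. p \<in> W \<and> orthonormal_frame M g W E" unfolding E_def by (rule someI_ex)
  then obtain V where V: "p \<in> V" "orthonormal_frame M g V E" by blast
  define e where "e a = E a p" for a
  have e: "orthonormal p n e" unfolding e_def by (rule orthonormal_frame_imp_orthonormal[OF V(2,1)])
  have UV: "openin (mtop M) (U \<inter> V)" "p \<in> U \<inter> V" using U V p by (auto simp: orthonormal_frame_def)
  have E: "vfield M (U \<inter> V) (E a)" if "a < n" for a
    by (rule vfield_subset[OF Int_lower2]) (use V(2) that in \<open>simp add: orthonormal_frame_def\<close>)
  have Xt: "X p \<in> tangent_space M p" by (rule vfield_tangent[OF X p])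
  have "cov_deriv_20 M lc_conn (fundamental_form J g) (E a) (E a) (apply_endo J X) p =
      g p (lc_tensor p (e a) (J p (e a))) (J p (X p))
      - g p (lc_tensor p (e a) (e a)) (X p)" if "a < n" for a
  proof -
    have "e a \<in> tangent_space M p" by (rule orthonormalD(1)[OF e that])
    then show ?thesis
      using cov_deriv_fundamental_form[OF UV(1) E[OF that] E[OF that]
          J_vfield[OF UV(1) vfield_subset[OF Int_lower1 X]] UV(2)]
      by (simp add: apply_endo_apply e_def[symmetric] J_isometry[OF top] lc_tensor_tangent[OF top] Xt)
  qed
  then have "lee_form M J g lc_conn X p = (\<Sum>a<n. g p (lc_tensor p (e a) (J p (e a))) (J p (X p)))
      - (\<Sum>a<n. g p (lc_tensor p (e a) (e a)) (X p))"
    by (simp add: lee_form_def codifferential_def E_def[symmetric] sum_subtractf)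
  then show ?thesis by (simp add: trace_lc_tensor_J[OF top e J_tangent[OF top Xt]]
      trace_lc_tensor[OF top e Xt])
qed

lemma closed_trace_forms_imp_balanced:
  assumes "closed_form koszul_form" "closed_form divergence_form"
  shows "locally_conformally_balanced M J g"
  unfolding locally_conformally_balanced_def
proof (intro conjI hermitian exI[of _ lc_conn] levi_civita_lc_conn)
  have "closed_1form M (\<lambda>X p. koszul_form p (X p) - divergence_form p (X p))"
    using closed_form_diff[OF assms] by (simp add: closed_form_def)
  then show "closed_1form M (lee_form M J g lc_conn)" by (rule closed_1form_cong) (simp add: lee_form_eq)
qed

end


section \<open>Metrics with parallel difference tensor\<close>

lemma sum_skew_symmetric:
  fixes w s :: "nat \<Rightarrow> nat \<Rightarrow> real"
  assumes "\<And>a c. a < n \<Longrightarrow> c < n \<Longrightarrow> w a c = - w c a" "\<And>a c. a < n \<Longrightarrow> c < n \<Longrightarrow> s a c = s c a"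
  shows "(\<Sum>a<n. \<Sum>c<n. w a c * s a c) = 0"
proof -
  have "(\<Sum>a<n. \<Sum>c<n. w a c * s a c) = (\<Sum>a<n. \<Sum>c<n. w c a * s c a)" by (rule sum.swap)
  also have "\<dots> = (\<Sum>a<n. \<Sum>c<n. - (w a c * s a c))"
  proof (intro sum.cong refl)
    fix a c assume "a \<in> {..<n}" "c \<in> {..<n}"
    then show "w c a * s c a = - (w a c * s a c)" using assms(1)[of c a] assms(2)[of c a] by simp
  qed
  finally show ?thesis by (simp add: sum_negf)
qed

locale levi_civita_mfd = torsionless_mfd M D + riemannian_mfd M g
  for M :: "('p, 'i) manifold" and D :: "('p, 'i) conn" and g :: "('p, 'i) metric" +
  assumes metric_connection: "metric_connection M g D"
begin

lemma dirder_metric: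
  "openin (mtop M) U \<Longrightarrow> vfield M U X \<Longrightarrow> vfield M U Y \<Longrightarrow> vfield M U Z \<Longrightarrow> p \<in> U \<Longrightarrow>
   dirder M p (X p) (\<lambda>q. g q (Y q) (Z q)) = g p (D X Y p) (Z p) + g p (Y p) (D X Z p)"
  using metric_connection unfolding metric_connection_def by blast

lemma trace_frame_derivative:
  assumes E: "orthonormal_frame M g U E" and X: "vfield M U X" and p: "p \<in> U" and b: "bilinear_at p b"
  shows "(\<Sum>a<n. b (D X (E a) p) (E a p) + b (E a p) (D X (E a) p)) = 0"
proof -
  have U: "openin (mtop M) U" and Ev: "\<And>a. a < n \<Longrightarrow> vfield M U (E a)"
    using E by (auto simp: orthonormal_frame_def)
  note top = openin_imp_topspace[OF U p] and e = orthonormal_frame_imp_orthonormal[OF E p]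
  note et = orthonormalD(1)[OF e] and Dt = vfield_tangent[OF nab_vfield[OF U X Ev] p]
  define w where "w a c = g p (D X (E a) p) (E c p)" for a c
  have skew: "w a c = - w c a" if a: "a < n" and c: "c < n" for a c
  proof -
    have "dirder M p (X p) (\<lambda>q. g q (E a q) (E c q)) = dirder M p (X p) (\<lambda>q. if a = c then 1 else 0)"
      by (rule dirder_cong[OF eventually_nhdsinI[OF U p] top])
         (use E a c in \<open>auto simp: orthonormal_frame_def\<close>)
    then show ?thesis
      by (simp add: dirder_metric[OF U X Ev[OF a] Ev[OF c] p] w_def dirder_const
          g_commute[OF top et[OF a] Dt[OF c]])
  qed
  have "b (D X (E a) p) (E a p) + b (E a p) (D X (E a) p) =
      (\<Sum>c<n. w a c * (b (E c p) (E a p) + b (E a p) (E c p)))"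
    if a: "a < n" for a
  proof -
    have expand: "D X (E a) p = (\<Sum>c<n. tscale (w a c) (E c p))"
      unfolding w_def by (rule orthonormal_expand[OF top e Dt[OF a]])
    have "b (D X (E a) p) (E a p) = (\<Sum>c<n. w a c * b (E c p) (E a p))"
      unfolding expand by (rule linear_at_comb[OF bilinear_atD(1)[OF b et[OF a]]]) (simp add: et)
    moreover have "b (E a p) (D X (E a) p) = (\<Sum>c<n. w a c * b (E a p) (E c p))"
      unfolding expand by (rule linear_at_comb[OF bilinear_atD(2)[OF b et[OF a]]]) (simp add: et)
    ultimately show ?thesis by (simp add: distrib_left sum.distrib)
  qed
  then have "(\<Sum>a<n. b (D X (E a) p) (E a p) + b (E a p) (D X (E a) p)) =
      (\<Sum>a<n. \<Sum>c<n. w a c * (b (E c p) (E a p) + b (E a p) (E c p)))" by simp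
  also have "\<dots> = 0" by (rule sum_skew_symmetric[OF skew]) simp_all
  finally show ?thesis .
qed

definition parallel_trilinear :: "('p \<Rightarrow> 'i tvec \<Rightarrow> 'i tvec \<Rightarrow> 'i tvec \<Rightarrow> real) \<Rightarrow> bool" where
  "parallel_trilinear T \<longleftrightarrow> (\<forall>p\<in>topspace (mtop M). trilinear_at p (T p)) \<and>
     (\<forall>U X A B Z. openin (mtop M) U \<and> vfield M U X \<and> vfield M U A \<and> vfield M U B \<and> vfield M U Z \<longrightarrow>
        (\<forall>p\<in>U. smooth_at M (\<lambda>q. T q (A q) (B q) (Z q)) p \<and>
           dirder M p (X p) (\<lambda>q. T q (A q) (B q) (Z q)) =
             T p (D X A p) (B p) (Z p) + T p (A p) (D X B p) (Z p) + T p (A p) (B p) (D X Z p)))"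

context
  fixes T assumes T: "parallel_trilinear T"
begin

lemma parallel_trilinear_at: "p \<in> topspace (mtop M) \<Longrightarrow> trilinear_at p (T p)"
  using T by (simp add: parallel_trilinear_def)

lemma parallel_trilinear_smooth_at:
  "openin (mtop M) U \<Longrightarrow> vfield M U A \<Longrightarrow> vfield M U B \<Longrightarrow> vfield M U Z \<Longrightarrow> p \<in> U \<Longrightarrow>
   smooth_at M (\<lambda>q. T q (A q) (B q) (Z q)) p"
  using T unfolding parallel_trilinear_def by blast

lemma parallel_trilinear_dirder:
  "openin (mtop M) U \<Longrightarrow> vfield M U X \<Longrightarrow> vfield M U A \<Longrightarrow> vfield M U B \<Longrightarrow> vfield M U Z \<Longrightarrow> p \<in> U \<Longrightarrow>
   dirder M p (X p) (\<lambda>q. T q (A q) (B q) (Z q)) =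
     T p (D X A p) (B p) (Z p) + T p (A p) (D X B p) (Z p) + T p (A p) (B p) (D X Z p)"
  using T unfolding parallel_trilinear_def by blast

lemma metric_trace_frame:
  assumes E: "orthonormal_frame M g U E" and Z: "vfield M U Z" and q: "q \<in> U"
  shows "(\<Sum>a<n. T q (Z q) (E a q) (E a q)) = metric_trace q (T q (Z q))"
proof -
  have "q \<in> topspace (mtop M)" using E q by (auto simp: orthonormal_frame_def openin_imp_topspace)
  then show ?thesis
    by (intro metric_trace_eq[symmetric] trilinear_atD(1)[OF parallel_trilinear_at] vfield_tangent[OF Z q]
        orthonormal_frame_imp_orthonormal[OF E q])
qed

lemma closed_form_metric_trace: "closed_form (\<lambda>p u. metric_trace p (T p u))"
proof (rule parallel_one_form_closed)
  show "one_form (\<lambda>p u. metric_trace p (T p u))"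
    unfolding one_form_def
  proof (intro conjI ballI allI impI)
    show "linear_at p (\<lambda>u. metric_trace p (T p u))" if "p \<in> topspace (mtop M)" for p
      by (rule linear_at_metric_trace(1)[OF that parallel_trilinear_at[OF that]])
    fix U Z p assume "openin (mtop M) U \<and> vfield M U Z" and p: "p \<in> U"
    then have U: "openin (mtop M) U" and Z: "vfield M U Z" by auto
    obtain V E where V: "p \<in> V" "V \<subseteq> U" and E: "orthonormal_frame M g V E"
      by (rule orthonormal_frame_near[OF U p])
    have V_open: "openin (mtop M) V" and Ev: "\<And>a. a < n \<Longrightarrow> vfield M V (E a)"
      using E by (auto simp: orthonormal_frame_def)
    note ZV = vfield_subset[OF V(2) Z]
    have "smooth_at M (\<lambda>q. \<Sum>a<n. T q (Z q) (E a q) (E a q)) p"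
      by (intro smooth_at_sum[OF openin_imp_topspace[OF U p]]
          parallel_trilinear_smooth_at[OF V_open ZV Ev Ev V(1)]) auto
    then show "smooth_at M (\<lambda>q. metric_trace q (T q (Z q))) p"
      by (rule smooth_at_cong[rotated])
         (rule eventually_nhdsinI[OF V_open V(1) metric_trace_frame[OF E ZV]])
  qed
next
  fix U X Z p assume U: "openin (mtop M) U" and X: "vfield M U X" and Z: "vfield M U Z" and p: "p \<in> U"
  note top = openin_imp_topspace[OF U p]
  obtain V E where V: "p \<in> V" "V \<subseteq> U" and E: "orthonormal_frame M g V E"
    by (rule orthonormal_frame_near[OF U p])
  have V_open: "openin (mtop M) V" and Ev: "\<And>a. a < n \<Longrightarrow> vfield M V (E a)"
    using E by (auto simp: orthonormal_frame_def)
  note XV = vfield_subset[OF V(2) X] and ZV = vfield_subset[OF V(2) Z]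
  have "dirder M p (X p) (\<lambda>q. metric_trace q (T q (Z q))) =
      dirder M p (X p) (\<lambda>q. \<Sum>a<n. T q (Z q) (E a q) (E a q))"
    by (rule dirder_cong[OF eventually_nhdsinI[OF V_open V(1) metric_trace_frame[OF E ZV, symmetric]] top])
  also have "\<dots> = (\<Sum>a<n. dirder M p (X p) (\<lambda>q. T q (Z q) (E a q) (E a q)))"
    by (rule dirder_sum[OF top]) (auto intro: parallel_trilinear_smooth_at[OF V_open ZV Ev Ev V(1)])
  also have "\<dots> = (\<Sum>a<n. T p (D X Z p) (E a p) (E a p)
      + (T p (Z p) (D X (E a) p) (E a p) + T p (Z p) (E a p) (D X (E a) p)))"
    by (simp add: parallel_trilinear_dirder[OF V_open XV ZV Ev Ev V(1)] add.assoc)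
  also have "\<dots> = (\<Sum>a<n. T p (D X Z p) (E a p) (E a p))"
    using trace_frame_derivative[OF E XV V(1)
        trilinear_atD(1)[OF parallel_trilinear_at[OF top] vfield_tangent[OF Z p]]]
    by (simp add: sum.distrib)
  also have "\<dots> = metric_trace p (T p (D X Z p))"
    by (rule metric_trace_frame[OF E nab_vfield[OF V_open XV ZV] V(1)])
  finally show "dirder M p (X p) (\<lambda>q. metric_trace q (T q (Z q))) = metric_trace p (T p (D X Z p))" .
qed

end

lemma parallel_trilinear_rotate:
  assumes T: "parallel_trilinear T"
  shows "parallel_trilinear (\<lambda>p u v w. T p v w u)"
  unfolding parallel_trilinear_def
proof (intro conjI ballI allI impI)
  show "trilinear_at p (\<lambda>u v w. T p v w u)" if "p \<in> topspace (mtop M)" for p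
    using parallel_trilinear_at[OF T that] by (simp add: trilinear_at_def bilinear_at_def)
qed (auto simp: parallel_trilinear_dirder[OF T] intro: parallel_trilinear_smooth_at[OF T])

end

locale parallel_difference_mfd = affine_metric_mfd M nab g + D: levi_civita_mfd M D g
  for M :: "('p, 'i) manifold" and nab D g +
  assumes parallel_difference: "parallel_21 M D (difference_tensor D nab)"
begin

abbreviation "S \<equiv> difference_tensor D nab"

lemma difference_tensor_vfield: "openin (mtop M) U \<Longrightarrow> vfield M U X \<Longrightarrow> vfield M U Y \<Longrightarrow> vfield M U (S X Y)"
  unfolding difference_tensor_def by (intro vfield_diff D.nab_vfield nab_vfield)

lemma D_difference_tensor:
  assumes "openin (mtop M) U" "vfield M U X" "vfield M U Y" "vfield M U Z" "p \<in> U"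
  shows "D X (S Y Z) p = S (D X Y) Z p + S Y (D X Z) p"
proof -
  have "cov_deriv_21 D S X Y Z p = 0" using parallel_difference assms unfolding parallel_21_def by blast
  then have "D X (S Y Z) p - S (D X Y) Z p - S Y (D X Z) p = 0" by (simp add: cov_deriv_21_def)
  then show ?thesis by (simp only: diff_diff_eq right_minus_eq)
qed

lemma nabla_metric_difference_tensor:
  assumes U: "openin (mtop M) U" and X: "vfield M U X" and Y: "vfield M U Y" and Z: "vfield M U Z"
    and p: "p \<in> U"
  shows "C p (X p) (Y p) (Z p) = g p (S X Y p) (Z p) + g p (Y p) (S X Z p)"
proof -
  note top = openin_imp_topspace[OF U p] and tangent = vfield_tangent[OF _ p]
  have S: "S X W p = D X W p - nab X W p" for W by (simp add: difference_tensor_def)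
  have "g p (S X Y p) (Z p) = g p (D X Y p) (Z p) - g p (nab X Y p) (Z p)"
    unfolding S by (rule linear_at_diff[OF g_linear_left[OF top tangent[OF Z]]
        tangent[OF D.nab_vfield[OF U X Y]]
        tangent[OF nab_vfield[OF U X Y]]])
  moreover have "g p (Y p) (S X Z p) = g p (Y p) (D X Z p) - g p (Y p) (nab X Z p)"
    unfolding S by (rule linear_at_diff[OF g_linear_right[OF top tangent[OF Y]]
        tangent[OF D.nab_vfield[OF U X Z]]
        tangent[OF nab_vfield[OF U X Z]]])
  ultimately show ?thesis by (simp add: nabla_metric_vfield[OF U p X Y Z] D.dirder_metric[OF U X Y Z p])
qed

lemma parallel_nabla_metric: "D.parallel_trilinear C"
  unfolding D.parallel_trilinear_def
proof (intro conjI ballI nabla_metric_trilinear allI impI)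
  fix U X A B Z p
  assume "openin (mtop M) U \<and> vfield M U X \<and> vfield M U A \<and> vfield M U B \<and> vfield M U Z" and p: "p \<in> U"
  then have U: "openin (mtop M) U" and X: "vfield M U X" and A: "vfield M U A" and B: "vfield M U B"
  and Z: "vfield M U Z"
    by auto
  show "smooth_at M (\<lambda>q. C q (A q) (B q) (Z q)) p" by (rule smooth_at_nabla_metric[OF U A B Z p])
  note top = openin_imp_topspace[OF U p] and S_vfield = difference_tensor_vfield[OF U]
    and D_vfield = D.nab_vfield[OF U X]
  note tangent = vfield_tangent[OF _ p] and nabla = nabla_metric_difference_tensor[OF U _ _ _ p]
  have "dirder M p (X p) (\<lambda>q. C q (A q) (B q) (Z q)) =
      dirder M p (X p) (\<lambda>q. g q (S A B q) (Z q) + g q (B q) (S A Z q))"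
    by (intro dirder_cong[OF eventually_nhdsinI[OF U p] top] nabla_metric_difference_tensor[OF U A B Z])
  also have "\<dots> = dirder M p (X p) (\<lambda>q. g q (S A B q) (Z q)) + dirder M p (X p) (\<lambda>q. g q (B q) (S A Z q))"
    by (intro dirder_add g_smooth_at[OF U _ _ p] S_vfield A B Z)
  also have "\<dots> = g p (D X (S A B) p) (Z p) + g p (S A B p) (D X Z p)
      + (g p (D X B p) (S A Z p) + g p (B p) (D X (S A Z) p))"
    by (simp only: D.dirder_metric[OF U X _ _ p] S_vfield A B Z)
  also have "g p (D X (S A B) p) (Z p) = g p (S (D X A) B p) (Z p) + g p (S A (D X B) p) (Z p)"
    unfolding D_difference_tensor[OF U X A B p]
    by (intro linear_at_add[OF g_linear_left[OF top tangent[OF Z]]] tangent S_vfield D_vfield A B)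
  also have "g p (B p) (D X (S A Z) p) = g p (B p) (S (D X A) Z p) + g p (B p) (S A (D X Z) p)"
    unfolding D_difference_tensor[OF U X A Z p]
    by (intro linear_at_add[OF g_linear_right[OF top tangent[OF B]]] tangent S_vfield D_vfield A Z)
  finally show "dirder M p (X p) (\<lambda>q. C q (A q) (B q) (Z q)) =
      C p (D X A p) (B p) (Z p) + C p (A p) (D X B p) (Z p) + C p (A p) (B p) (D X Z p)"
    by (simp add: nabla[OF D_vfield[OF A] B Z] nabla[OF A D_vfield[OF B] Z] nabla[OF A B D_vfield[OF Z]])
qed

lemma closed_trace_forms: "closed_form koszul_form" "closed_form divergence_form"
proof -
  have "closed_form (\<lambda>p u. metric_trace p (C p u))"
    by (rule D.closed_form_metric_trace[OF parallel_nabla_metric])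
  then show "closed_form koszul_form"
    using closed_form_scale[of "\<lambda>p u. metric_trace p (C p u)" "1/2"] by (simp add: koszul_form_def[abs_def])
  show "closed_form divergence_form"
    using D.closed_form_metric_trace[OF D.parallel_trilinear_rotate[OF parallel_nabla_metric]]
    by (simp add: divergence_form_def[abs_def])
qed

end


section \<open>The tangent bundle as a smooth manifold\<close>

subsection \<open>Second countable spaces\<close>

lemma second_countable_space_iff: "second_countable_space X \<longleftrightarrow> second_countable X"
  by (simp add: second_countable_space_def second_countable_def)

lemma second_countable_Euclidean_space: "second_countable (Euclidean_space n)"
proof -
  obtain \<B> :: "(nat \<Rightarrow> real) set set" where "countable \<B>" "topological_basis \<B>"
    using ex_countable_basis by blast
  then have "second_countable (euclidean :: (nat \<Rightarrow> real) topology)"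
    unfolding second_countable_def by (metis open_openin topological_basis_def topological_basisE)
  then show ?thesis unfolding Euclidean_space_eq_top_of_set by (rule second_countable_subtopology)
qed

lemma second_countable_countable_cover:
  assumes "countable \<U>" and cover: "topspace X \<subseteq> \<Union>\<U>"
    and open_sets: "\<And>U. U \<in> \<U> \<Longrightarrow> openin X U" and "\<And>U. U \<in> \<U> \<Longrightarrow> second_countable (subtopology X U)"
  shows "second_countable X"
proof -
  have "\<exists>\<B>. countable \<B> \<and> (\<forall>V\<in>\<B>. openin X V) \<and> (\<forall>W x. openin X W \<and> x \<in> W \<and> x \<in> U \<longrightarrow> (\<exists>V\<in>\<B>. x \<in> V \<and> V \<subseteq> W))"
    if U: "U \<in> \<U>" for U
  proof -
    obtain \<B> where \<B>: "countable \<B>" "\<And>V. V \<in> \<B> \<Longrightarrow> openin (subtopology X U) V"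
      "\<And>W x. openin (subtopology X U) W \<Longrightarrow> x \<in> W \<Longrightarrow> \<exists>V\<in>\<B>. x \<in> V \<and> V \<subseteq> W"
      using assms(4)[OF U] unfolding second_countable_def by metis
    have "\<exists>V\<in>\<B>. x \<in> V \<and> V \<subseteq> W" if "openin X W" "x \<in> W" "x \<in> U" for W x
      using \<B>(3)[of "W \<inter> U" x] that by (auto simp: openin_subtopology)
    with \<B>(1,2) open_sets[OF U] show ?thesis by (metis openin_trans_full)
  qed
  then obtain \<B> where \<B>: "\<And>U. U \<in> \<U> \<Longrightarrow> countable (\<B> U)" "\<And>U V. U \<in> \<U> \<Longrightarrow> V \<in> \<B> U \<Longrightarrow> openin X V"
    "\<And>U W x. U \<in> \<U> \<Longrightarrow> openin X W \<Longrightarrow> x \<in> W \<Longrightarrow> x \<in> U \<Longrightarrow> \<exists>V\<in>\<B> U. x \<in> V \<and> V \<subseteq> W"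
    by metis
  show ?thesis
    unfolding second_countable_def
  proof (intro exI[of _ "\<Union>U\<in>\<U>. \<B> U"] conjI allI impI)
    fix W x assume W: "openin X W \<and> x \<in> W"
    then obtain U where "U \<in> \<U>" "x \<in> U" using cover openin_subset by blast
    with W show "\<exists>V\<in>\<Union>U\<in>\<U>. \<B> U. x \<in> V \<and> V \<subseteq> W" using \<B>(3)[of U W x] by blast
  qed (use assms(1) \<B>(1,2) in auto)
qed


subsection \<open>Induced charts\<close>

lemma tangent_bundle_simps [simp]:
  "mdim (tangent_bundle M) = 2 * mdim M" "charts (tangent_bundle M) = charts M"
  "cdom (tangent_bundle M) i = bundle_over M (cdom M i)" "coord (tangent_bundle M) = tcoord M"
  by (simp_all add: tangent_bundle_def)

lemma bundle_over_iff:
  "\<xi> \<in> bundle_over M U \<longleftrightarrow> tbase \<xi> \<in> U \<and> tfib \<xi> \<in> tangent_space M (tbase \<xi>) \<and> \<xi> = Tan (tbase \<xi>) (tfib \<xi>)"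
  by (cases \<xi>) (auto simp: bundle_over_def)

lemma bundle_over_Int: "bundle_over M (U \<inter> V) = bundle_over M U \<inter> bundle_over M V"
  by (auto simp: bundle_over_iff)

definition trunc :: "nat \<Rightarrow> (nat \<Rightarrow> real) \<Rightarrow> nat \<Rightarrow> real" where
  "trunc n x = (\<lambda>k. if k < n then x k else 0)"

definition cylinder :: "nat \<Rightarrow> (nat \<Rightarrow> real) set \<Rightarrow> (nat \<Rightarrow> real) set" where
  "cylinder n W = {x. (\<forall>k\<ge>2 * n. x k = 0) \<and> trunc n x \<in> W}"

lemma openin_cylinder:
  assumes W: "openin (Euclidean_space n) W"
  shows "openin (Euclidean_space (2 * n)) (cylinder n W)"
  unfolding openin_Euclidean_space_iff_cube
proof (intro conjI ballI)
  fix x assume "x \<in> cylinder n W"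
  then obtain d where d: "d > 0" "cube n (trunc n x) d \<subseteq> W"
    using openin_contains_cube[OF W, of "trunc n x"] by (auto simp: cylinder_def)
  have "cube (2 * n) x d \<subseteq> cylinder n W"
    using d(2) by (auto simp: cylinder_def cube_def trunc_def subset_eq)
  with d(1) show "\<exists>d>0. cube (2 * n) x d \<subseteq> cylinder n W" by blast
qed (auto simp: cylinder_def)

lemma smooth_real_on_cylinder:
  assumes W: "openin (Euclidean_space n) W" and f: "smooth_real_on n W f"
  shows "smooth_real_on (2 * n) (cylinder n W) (\<lambda>x. f (trunc n x))"
proof (rule smooth_real_on_comp[OF W openin_cylinder[OF W] f])
  show "smooth_real_on (2 * n) (cylinder n W) (\<lambda>x. trunc n x a)" for a
    unfolding trunc_def smooth_real_on_def
    by (cases "a < n") (auto intro: Ck_on_coordinate Ck_on_const openin_cylinder[OF W])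
qed (auto simp: trunc_def cylinder_def)

locale tangent_bundle_mfd = smooth_mfd M for M :: "('a, 'i) tmanifold"
begin

abbreviation "TM \<equiv> tangent_bundle M"

lemma tcoord_eq_0: "k \<ge> 2 * n \<Longrightarrow> tcoord M i \<xi> k = 0"
  by (simp add: tcoord_def)

lemma tcoord_in_topspace: "tcoord M i \<xi> \<in> topspace (Euclidean_space (2 * n))"
  by (simp add: topspace_Euclidean_space tcoord_eq_0)

lemma tcoord_base: "k < n \<Longrightarrow> tcoord M i \<xi> k = coord M i (tbase \<xi>) k"
  by (simp add: tcoord_def)

lemma tcoord_fibre: "k < n \<Longrightarrow> tcoord M i \<xi> (n + k) = tfib \<xi> i k"
  by (simp add: tcoord_def)

lemma trunc_tcoord: "i \<in> charts_at M (tbase \<xi>) \<Longrightarrow> trunc n (tcoord M i \<xi>) = coord M i (tbase \<xi>)"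
  by (auto simp: trunc_def tcoord_base fun_eq_iff coord_eq_0)

lemma charts_at_TM:
  "i \<in> charts_at TM \<xi> \<longleftrightarrow> i \<in> charts_at M (tbase \<xi>) \<and> tfib \<xi> \<in> tangent_space M (tbase \<xi>) \<and> \<xi> =
  Tan (tbase \<xi>) (tfib \<xi>)"
  by (auto simp: charts_at_def bundle_over_iff)

lemma charts_at_TM_base: "i \<in> charts_at TM \<xi> \<Longrightarrow> i \<in> charts_at M (tbase \<xi>)"
  and charts_at_TM_fibre: "i \<in> charts_at TM \<xi> \<Longrightarrow> tfib \<xi> \<in> tangent_space M (tbase \<xi>)"
  by (simp_all add: charts_at_TM)

lemma tcoord_image:
  assumes i: "i \<in> charts M" and U: "U \<subseteq> cdom M i"
  shows "tcoord M i ` bundle_over M U = cylinder n (coord M i ` U)"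
proof (intro set_eqI iffI)
  fix x assume "x \<in> tcoord M i ` bundle_over M U"
  then obtain \<xi> where \<xi>: "x = tcoord M i \<xi>" "tbase \<xi> \<in> U" by (auto simp: bundle_over_iff)
  then have "trunc n x = coord M i (tbase \<xi>)" using trunc_tcoord[of i \<xi>] U i by (auto simp: charts_at_iff)
  with \<xi> show "x \<in> cylinder n (coord M i ` U)" by (simp add: cylinder_def tcoord_eq_0)
next
  fix x assume x: "x \<in> cylinder n (coord M i ` U)"
  then obtain p where p: "p \<in> U" "trunc n x = coord M i p" by (auto simp: cylinder_def)
  have ip: "i \<in> charts_at M p" using p U i by (auto simp: charts_at_iff)
  define v where "v = (\<Sum>a<n. tscale (x (n + a)) (coord_field M i a p))"
  note v = coord_field_comb[OF ip, where c="\<lambda>a. x (n + a)", folded v_def]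
  have "tcoord M i (Tan p v) k = x k" for k
  proof -
    consider "k < n" | "n \<le> k" "k < 2 * n" | "k \<ge> 2 * n" by linarith
    then show ?thesis
    proof cases
      case 1
      then show ?thesis using fun_cong[OF p(2), of k] by (simp add: tcoord_base trunc_def)
    next
      case 2
      then show ?thesis using v(2)[of "k - n"] by (simp add: tcoord_def)
    next
      case 3
      then show ?thesis using x by (simp add: tcoord_eq_0 cylinder_def)
    qed
  qed
  then have "x = tcoord M i (Tan p v)" by auto
  with p(1) v(1) show "x \<in> tcoord M i ` bundle_over M U" by (auto simp: bundle_over_iff)
qed

lemma inj_on_tcoord:
  assumes i: "i \<in> charts M"
  shows "inj_on (tcoord M i) (bundle_over M (cdom M i))"
proof (rule inj_onI)
  fix \<xi> \<eta> assume \<xi>\<eta>: "\<xi> \<in> bundle_over M (cdom M i)" "\<eta> \<in> bundle_over M (cdom M i)"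
    and eq: "tcoord M i \<xi> = tcoord M i \<eta>"
  then have charts: "i \<in> charts_at M (tbase \<xi>)" "i \<in> charts_at M (tbase \<eta>)"
    using i by (auto simp: bundle_over_iff charts_at_iff)
  then have "coord M i (tbase \<xi>) = coord M i (tbase \<eta>)" using eq by (simp add: trunc_tcoord[symmetric])
  then have base: "tbase \<xi> = tbase \<eta>" using cinv_coord[OF charts(1)] cinv_coord[OF charts(2)] by metis
  have "tfib \<xi> \<in> tangent_space M (tbase \<xi>)" "tfib \<eta> \<in> tangent_space M (tbase \<xi>)"
    using \<xi>\<eta> base by (auto simp: bundle_over_iff)
  then have "tfib \<xi> = tfib \<eta>" by (rule tangent_eqI[OF _ _ charts(1)]) (simp add: tcoord_fibre[symmetric] eq)
  with base \<xi>\<eta> show "\<xi> = \<eta>" by (metis bundle_over_iff)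
qed

lemma cinv_TM_tcoord: "i \<in> charts_at TM \<xi> \<Longrightarrow> cinv TM i (tcoord M i \<xi>) = \<xi>"
  unfolding cinv_def using inv_into_f_f[OF inj_on_tcoord] by (simp add: charts_at_def)


subsection \<open>Transition maps\<close>

definition tangent_transition :: "'i \<Rightarrow> 'i \<Rightarrow> (nat \<Rightarrow> real) \<Rightarrow> nat \<Rightarrow> real" where
  "tangent_transition i j x k =
     (if k < n then transition i j (trunc n x) k
      else if k < 2 * n then \<Sum>a<n. pderiv_at a (\<lambda>y. transition i j y (k - n)) (trunc n x) * x (n + a) else
      0)"

abbreviation overlap :: "'i \<Rightarrow> 'i \<Rightarrow> (nat \<Rightarrow> real) set" where
  "overlap i j \<equiv> cylinder n (coord M i ` (cdom M i \<inter> cdom M j))"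

lemma openin_coord_overlap: "i \<in> charts M \<Longrightarrow> j \<in> charts M \<Longrightarrow>
    openin (Euclidean_space n) (coord M i ` (cdom M i \<inter> cdom M j))"
  using openin_coord_Int[of i "cdom M j"] openin_cdom by (simp add: Int_commute)

lemma openin_overlap: "i \<in> charts M \<Longrightarrow> j \<in> charts M \<Longrightarrow> openin (Euclidean_space (2 * n)) (overlap i j)"
  by (rule openin_cylinder[OF openin_coord_overlap])

lemma tcoord_overlap: "i \<in> charts M \<Longrightarrow> tcoord M i ` (bundle_over M (cdom M i) \<inter> bundle_over M (cdom M j)) =
    overlap i j"
  using tcoord_image[of i "cdom M i \<inter> cdom M j"] by (simp add: bundle_over_Int)

lemma tangent_transition_tcoord:
  assumes i: "i \<in> charts_at TM \<xi>" and j: "j \<in> charts_at TM \<xi>"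
  shows "tangent_transition i j (tcoord M i \<xi>) = tcoord M j \<xi>"
proof
  fix k
  note charts = charts_at_TM_base[OF i] charts_at_TM_base[OF j]
  consider "k < n" | "n \<le> k" "k < 2 * n" | "k \<ge> 2 * n" by linarith
  then show "tangent_transition i j (tcoord M i \<xi>) k = tcoord M j \<xi> k"
  proof cases
    case 1
    then show ?thesis
      by (simp add: tangent_transition_def transition_def trunc_tcoord charts cinv_coord tcoord_base)
  next
    case 2
    then have "k - n < n" by linarith
    then have "tfib \<xi> j (k - n) = (\<Sum>a<n. jacobian M i j (tbase \<xi>) (k - n) a * tfib \<xi> i a)"
      by (rule tangent_transform[OF charts_at_TM_fibre[OF i] charts])
    with 2 \<open>k - n < n\<close> show ?thesis
      by (simp add: tangent_transition_def transition_def trunc_tcoord charts jacobian_def tcoord_fibre)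
         (simp add: tcoord_def)
  next
    case 3
    then show ?thesis by (simp add: tangent_transition_def tcoord_eq_0)
  qed
qed

lemma smooth_tangent_transition:
  assumes i: "i \<in> charts M" and j: "j \<in> charts M"
  shows "smooth_real_on (2 * n) (overlap i j) (\<lambda>x. tangent_transition i j x k)"
proof -
  note W = openin_coord_overlap[OF i j] and V = openin_overlap[OF i j]
  have "smooth_real_on (2 * n) (overlap i j) (\<lambda>x. pderiv_at a (\<lambda>y. transition i j y l) (trunc n x))"
    if "a < n" for a l
    by (rule smooth_real_on_cylinder[OF W smooth_real_on_pderiv[OF smooth_transition[OF i j] that]])
  then have "smooth_real_on (2 * n) (overlap i j)
      (\<lambda>x. \<Sum>a<n. pderiv_at a (\<lambda>y. transition i j y l) (trunc n x) * x (n + a))" for l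
    unfolding smooth_real_on_def by (auto intro!: Ck_on_sum[OF V] Ck_on_mult[OF V] Ck_on_coordinate[OF V])
  moreover have "smooth_real_on (2 * n) (overlap i j) (\<lambda>x. transition i j (trunc n x) k)"
    by (rule smooth_real_on_cylinder[OF W smooth_transition[OF i j]])
  moreover have "smooth_real_on (2 * n) (overlap i j) (\<lambda>x. 0)"
    by (simp add: smooth_real_on_def Ck_on_const[OF V])
  ultimately show ?thesis unfolding tangent_transition_def by (cases "k < n"; cases "k < 2 * n") simp_all
qed


subsection \<open>The topology of the tangent bundle\<close>

lemma mtop_TM:
  "mtop TM = topology_generated_by {{\<xi> \<in> bundle_over M (cdom M i). tcoord M i \<xi> \<in> V} | i V.
     i \<in> charts M \<and> openin (Euclidean_space (2 * n)) V}"
  by (simp add: tangent_bundle_def)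

lemma openin_tcoord_preimage:
  "i \<in> charts M \<Longrightarrow> openin (Euclidean_space (2 * n)) V \<Longrightarrow>
  openin (mtop TM) {\<xi> \<in> bundle_over M (cdom M i). tcoord M i \<xi> \<in> V}"
  unfolding mtop_TM by (auto intro!: topology_generated_by_Basis)

lemma openin_tcoord_image_preimage:
  assumes i: "i \<in> charts M" and j: "j \<in> charts M" and V: "openin (Euclidean_space (2 * n)) V"
  shows "openin (Euclidean_space (2 * n))
    (tcoord M i ` ({\<xi> \<in> bundle_over M (cdom M j). tcoord M j \<xi> \<in> V} \<inter> bundle_over M (cdom M i)))"
proof -
  note W = openin_overlap[OF i j]
  have transition: "tangent_transition i j (tcoord M i \<xi>) = tcoord M j \<xi>"
    if "\<xi> \<in> bundle_over M (cdom M i) \<inter> bundle_over M (cdom M j)" for \<xi>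
    using that i j by (intro tangent_transition_tcoord) (auto simp: charts_at_def)
  obtain T where T: "open T" "V = {x. \<forall>k\<ge>2 * n. x k = 0} \<inter> T"
    using V by (auto simp: Euclidean_space_eq_top_of_set openin_open)
  have "continuous_on (overlap i j) (tangent_transition i j)"
  proof (rule continuous_on_coordinatewise_then_product)
    show "continuous_on (overlap i j) (\<lambda>x. tangent_transition i j x k)" for k
      by (rule Ck_on_continuous[OF W smooth_real_on_Ck[OF smooth_tangent_transition[OF i j], of 0]])
  qed
  then have "openin (top_of_set (overlap i j)) (overlap i j \<inter> tangent_transition i j -` T)"
    using T(1) by (rule continuous_openin_preimage_gen)
  then have "openin (Euclidean_space (2 * n)) (overlap i j \<inter> tangent_transition i j -` T)"
    using W openin_trans_full subtopology_Euclidean_space[OF W] by metis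
  moreover have "tangent_transition i j x \<in> V \<longleftrightarrow> tangent_transition i j x \<in> T" for x
    by (simp add: T(2) tangent_transition_def)
  moreover have "tcoord M i ` ({\<xi> \<in> bundle_over M (cdom M j). tcoord M j \<xi> \<in> V} \<inter> bundle_over M (cdom M i))
      =
      overlap i j \<inter> tangent_transition i j -` V"
    unfolding tcoord_overlap[OF i, symmetric] using transition by force
  ultimately show ?thesis by (simp add: vimage_def)
qed

lemma openin_tcoord_image:
  assumes i: "i \<in> charts M" and U: "openin (mtop TM) U"
  shows "openin (Euclidean_space (2 * n)) (tcoord M i ` (U \<inter> bundle_over M (cdom M i)))"
  using U unfolding mtop_TM openin_topology_generated_by_iff
proof (induction rule: generate_topology_on.induct)
  case (Int a b)
  have "tcoord M i ` (a \<inter> b \<inter> bundle_over M (cdom M i)) =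
      tcoord M i ` (a \<inter> bundle_over M (cdom M i)) \<inter> tcoord M i ` (b \<inter> bundle_over M (cdom M i))"
    using inj_on_image_Int[OF inj_on_tcoord[OF i], of "a \<inter> bundle_over M (cdom M i)"
        "b \<inter> bundle_over M (cdom M i)"]
    by (simp add: Int_ac)
  with Int show ?case by (simp add: openin_Int)
next
  case (UN K)
  have "tcoord M i ` (\<Union> K \<inter> bundle_over M (cdom M i)) = (\<Union>k\<in>K. tcoord M i ` (k \<inter> bundle_over M (cdom M i)))"
    by blast
  with UN show ?case by (auto intro: openin_Union)
qed (auto intro: openin_tcoord_image_preimage[OF i])

lemma topspace_TM: "topspace (mtop TM) = (\<Union>i\<in>charts M. bundle_over M (cdom M i))"
  unfolding mtop_TM topology_generated_by_topspace
  using tcoord_in_topspace by blast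

lemma openin_bundle_over:
  assumes U: "openin (mtop M) U"
  shows "openin (mtop TM) (bundle_over M U)"
proof (subst openin_subopen, intro ballI)
  fix \<xi> assume \<xi>: "\<xi> \<in> bundle_over M U"
  then obtain i where i: "i \<in> charts_at M (tbase \<xi>)"
    using openin_ex_chart[OF U] by (auto simp: bundle_over_iff)
  then have ic: "i \<in> charts M" by (simp add: charts_at_iff)
  let ?T = "{\<eta> \<in> bundle_over M (cdom M i). tcoord M i \<eta> \<in> cylinder n (coord M i ` (U \<inter> cdom M i))}"
  have image: "tcoord M i ` bundle_over M (U \<inter> cdom M i) = cylinder n (coord M i ` (U \<inter> cdom M i))"
    by (rule tcoord_image[OF ic Int_lower2])
  have "openin (mtop TM) ?T"
    by (rule openin_tcoord_preimage[OF ic openin_cylinder[OF openin_coord_Int[OF ic U]]])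
  moreover have "\<xi> \<in> ?T" using \<xi> i by (auto simp: image[symmetric] bundle_over_iff charts_at_iff)
  moreover have "?T \<subseteq> bundle_over M U"
    using inj_on_image_mem_iff[OF inj_on_tcoord[OF ic], of _ "bundle_over M (U \<inter> cdom M i)"]
    by (auto simp: image[symmetric] bundle_over_Int)
  ultimately show "\<exists>T. openin (mtop TM) T \<and> \<xi> \<in> T \<and> T \<subseteq> bundle_over M U" by blast
qed

lemma homeomorphic_map_tcoord:
  assumes i: "i \<in> charts M"
  shows "homeomorphic_map (subtopology (mtop TM) (bundle_over M (cdom M i)))
    (subtopology (Euclidean_space (2 * n)) (tcoord M i ` bundle_over M (cdom M i))) (tcoord M i)"
    (is "homeomorphic_map (subtopology _ ?B) (subtopology ?E ?W) _")
proof (rule bijective_open_imp_homeomorphic_map)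
  have B: "openin (mtop TM) ?B" by (rule openin_bundle_over[OF openin_cdom[OF i]])
  have W: "openin ?E ?W"
    unfolding tcoord_image[OF i order_refl] by (rule openin_cylinder[OF openin_coord_cdom[OF i]])
  have top: "topspace (subtopology (mtop TM) ?B) = ?B" using openin_subset[OF B] by auto
  show "continuous_map (subtopology (mtop TM) ?B) (subtopology ?E ?W) (tcoord M i)"
    unfolding continuous_map_in_subtopology unfolding continuous_map_def top
    using openin_tcoord_preimage[OF i] tcoord_in_topspace B by (auto simp: openin_open_subtopology)
  show "open_map (subtopology (mtop TM) ?B) (subtopology ?E ?W) (tcoord M i)"
    unfolding open_map_def openin_open_subtopology[OF B] openin_open_subtopology[OF W]
    using openin_tcoord_image[OF i] by (metis Int_absorb2 image_mono)
  show "tcoord M i ` topspace (subtopology (mtop TM) ?B) = topspace (subtopology ?E ?W)"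
    unfolding top using openin_subset[OF W] by auto
  show "inj_on (tcoord M i) (topspace (subtopology (mtop TM) ?B))"
    unfolding top by (rule inj_on_tcoord[OF i])
qed

lemma Hausdorff_TM: "Hausdorff_space (mtop TM)"
  unfolding Hausdorff_space_def
proof (intro allI impI)
  fix \<xi> \<eta> assume \<xi>\<eta>: "\<xi> \<in> topspace (mtop TM) \<and> \<eta> \<in> topspace (mtop TM) \<and> \<xi> \<noteq> \<eta>"
  then obtain i j where i: "i \<in> charts M" "\<xi> \<in> bundle_over M (cdom M i)"
  and j: "j \<in> charts M" "\<eta> \<in> bundle_over M (cdom M j)"
    unfolding topspace_TM by blast
  show "\<exists>U V. openin (mtop TM) U \<and> openin (mtop TM) V \<and> \<xi> \<in> U \<and> \<eta> \<in> V \<and> disjnt U V"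
  proof (cases "tbase \<xi> = tbase \<eta>")
    case False
    have "tbase \<xi> \<in> topspace (mtop M)" "tbase \<eta> \<in> topspace (mtop M)"
      using i j by (auto simp: bundle_over_iff intro: openin_imp_topspace[OF openin_cdom])
    moreover have "Hausdorff_space (mtop M)" using smooth by (simp add: smooth_manifold_def)
    ultimately obtain U V
    where UV: "openin (mtop M) U" "openin (mtop M) V" "tbase \<xi> \<in> U" "tbase \<eta> \<in> V" "disjnt U V"
      using False unfolding Hausdorff_space_def by blast
    have "disjnt (bundle_over M U) (bundle_over M V)" using UV(5) by (auto simp: disjnt_iff bundle_over_iff)
    moreover have "\<xi> \<in> bundle_over M U" "\<eta> \<in> bundle_over M V"
      using UV(3,4) i j by (auto simp: bundle_over_iff)
    ultimately show ?thesis using openin_bundle_over UV(1,2) by blast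
  next
    case True
    then have \<eta>: "\<eta> \<in> bundle_over M (cdom M i)" using i j by (auto simp: bundle_over_iff)
    then have "tcoord M i \<xi> \<noteq> tcoord M i \<eta>" using inj_on_tcoord[OF i(1)] i(2) \<xi>\<eta> by (auto simp: inj_on_def)
    then obtain U V where UV: "openin (Euclidean_space (2 * n)) U" "openin (Euclidean_space (2 * n)) V"
        "tcoord M i \<xi> \<in> U" "tcoord M i \<eta> \<in> V" "disjnt U V"
      using Hausdorff_Euclidean_space tcoord_in_topspace unfolding Hausdorff_space_def by metis
    let ?B = "\<lambda>W. {\<zeta> \<in> bundle_over M (cdom M i). tcoord M i \<zeta> \<in> W}"
    have "disjnt (?B U) (?B V)" "\<xi> \<in> ?B U" "\<eta> \<in> ?B V" using UV i(2) \<eta> by (auto simp: disjnt_iff)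
    then show ?thesis using openin_tcoord_preimage[OF i(1) UV(1)] openin_tcoord_preimage[OF i(1) UV(2)]
      by blast
  qed
qed

lemma second_countable_TM: "second_countable (mtop TM)"
proof -
  have "second_countable (mtop M)"
    using smooth by (simp add: smooth_manifold_def second_countable_space_iff)
  then have "Lindelof_space (mtop M)" by (rule second_countable_imp_Lindelof_space)
  moreover have "\<forall>U\<in>cdom M ` charts M. openin (mtop M) U" by (simp add: openin_cdom)
  moreover have top: "\<Union>(cdom M ` charts M) = topspace (mtop M)"
    using smooth by (simp add: smooth_manifold_def)
  ultimately obtain \<V> where \<V>: "countable \<V>" "\<V> \<subseteq> cdom M ` charts M" "\<Union>\<V> = topspace (mtop M)"
    unfolding Lindelof_space_def by metis
  show ?thesis
  proof (rule second_countable_countable_cover)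
    show "countable (bundle_over M ` \<V>)" using \<V>(1) by (rule countable_image)
    show "topspace (mtop TM) \<subseteq> \<Union> (bundle_over M ` \<V>)"
    proof
      fix \<xi> assume "\<xi> \<in> topspace (mtop TM)"
      then obtain i where i: "i \<in> charts M" "\<xi> \<in> bundle_over M (cdom M i)" unfolding topspace_TM by blast
      then have "tbase \<xi> \<in> \<Union>\<V>" unfolding \<V>(3) top[symmetric] by (auto simp: bundle_over_iff)
      with i(2) show "\<xi> \<in> \<Union> (bundle_over M ` \<V>)" by (auto simp: bundle_over_iff)
    qed
    fix B assume "B \<in> bundle_over M ` \<V>"
    then obtain i where i: "i \<in> charts M" "B = bundle_over M (cdom M i)" using \<V>(2) by blast
    show "openin (mtop TM) B" unfolding i(2) by (rule openin_bundle_over[OF openin_cdom[OF i(1)]])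
    have "subtopology (mtop TM) B homeomorphic_space
        subtopology (Euclidean_space (2 * n)) (tcoord M i ` bundle_over M (cdom M i))"
      unfolding i(2) by (rule homeomorphic_map_imp_homeomorphic_space[OF homeomorphic_map_tcoord[OF i(1)]])
    then show "second_countable (subtopology (mtop TM) B)"
      by (simp add: homeomorphic_space_second_countability second_countable_subtopology
          second_countable_Euclidean_space)
  qed
qed

lemma smooth_manifold_TM: "smooth_manifold TM"
  unfolding smooth_manifold_def second_countable_space_iff tangent_bundle_simps
proof (intro conjI ballI allI impI Hausdorff_TM second_countable_TM topspace_TM)
  fix i assume i: "i \<in> charts M"
  show "openin (mtop TM) (bundle_over M (cdom M i))" by (rule openin_bundle_over[OF openin_cdom[OF i]])
  show "openin (Euclidean_space (2 * n)) (tcoord M i ` bundle_over M (cdom M i))"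
    unfolding tcoord_image[OF i order_refl] by (rule openin_cylinder[OF openin_coord_cdom[OF i]])
  show "homeomorphic_map (subtopology (mtop TM) (bundle_over M (cdom M i)))
      (subtopology (Euclidean_space (2 * n)) (tcoord M i ` bundle_over M (cdom M i))) (tcoord M i)"
    by (rule homeomorphic_map_tcoord[OF i])
  fix j k assume j: "j \<in> charts M"
  show "smooth_real_on (2 * n) (tcoord M i ` (bundle_over M (cdom M i) \<inter> bundle_over M (cdom M j)))
      (\<lambda>x. tcoord M j (cinv TM i x) k)"
    unfolding tcoord_overlap[OF i]
  proof (rule smooth_real_on_cong[OF openin_overlap[OF i j] smooth_tangent_transition[OF i j]])
    fix x assume "x \<in> overlap i j"
    then obtain \<xi> where \<xi>: "i \<in> charts_at TM \<xi>" "j \<in> charts_at TM \<xi>" "x = tcoord M i \<xi>"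
      unfolding tcoord_overlap[OF i, symmetric] using i j by (auto simp: charts_at_def)
    show "tangent_transition i j x k = tcoord M j (cinv TM i x) k"
      by (simp add: \<xi>(3) tangent_transition_tcoord[OF \<xi>(1,2)] cinv_TM_tcoord[OF \<xi>(1)])
  qed
qed

sublocale T: smooth_mfd "tangent_bundle M"
  by unfold_locales (rule smooth_manifold_TM)

end


section \<open>Vector fields on the tangent bundle\<close>

subsection \<open>Functions on the tangent bundle\<close>

lemma sum_lessThan_add: "(\<Sum>a<m + n. f a) = (\<Sum>a<m. f a) + (\<Sum>a<n. f (m + a))"
  for f :: "nat \<Rightarrow> 'b::comm_monoid_add"
  by (induction n) (simp_all add: add.assoc)

lemma hor_part_apply: "k < mdim M \<Longrightarrow> hor_part M w i k = w i k"
  by (simp add: hor_part_def)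

lemma hor_part_add: "hor_part M (w + w') = hor_part M w + hor_part M w'"
  by (simp add: hor_part_def fun_eq_iff)

lemma hor_part_scale: "hor_part M (tscale c w) = tscale c (hor_part M w)"
  by (simp add: hor_part_def tscale_def fun_eq_iff)

lemma gamma_at_conn_matrix: "gamma_at M nab i p u v k = (\<Sum>b<mdim M. conn_matrix M nab i p u k b * v i b)"
  unfolding gamma_at_def conn_matrix_def sum_distrib_right by (rule sum.swap)

context tangent_bundle_mfd
begin

lemma charts_at_TM_eq: "\<xi> \<in> topspace (mtop TM) \<Longrightarrow> charts_at TM \<xi> = charts_at M (tbase \<xi>)"
  unfolding T.topspace_iff_charts_at by (auto simp: charts_at_TM)

lemma tbase_in_topspace: "\<xi> \<in> topspace (mtop TM) \<Longrightarrow> tbase \<xi> \<in> topspace (mtop M)"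
  unfolding T.topspace_iff_charts_at by (auto simp: charts_at_TM charts_at_imp_topspace)

lemma bundle_over_in_topspace: "openin (mtop M) U \<Longrightarrow> \<xi> \<in> bundle_over M U \<Longrightarrow> \<xi> \<in> topspace (mtop TM)"
  by (rule T.openin_imp_topspace[OF openin_bundle_over])

lemma in_bundle_over_iff: "\<xi> \<in> topspace (mtop TM) \<Longrightarrow> \<xi> \<in> bundle_over M U \<longleftrightarrow> tbase \<xi> \<in> U"
  unfolding T.topspace_iff_charts_at by (auto simp: charts_at_TM bundle_over_iff)

lemma tbase_cinv_TM:
  assumes i: "i \<in> charts M" and x: "x \<in> cylinder n (coord M i ` cdom M i)"
  shows "tbase (cinv TM i x) = cinv M i (trunc n x)"
proof -
  obtain \<xi> where \<xi>: "i \<in> charts_at TM \<xi>" "x = tcoord M i \<xi>"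
    using x i unfolding tcoord_image[OF i order_refl, symmetric] by (auto simp: charts_at_def)
  note base = charts_at_TM_base[OF \<xi>(1)]
  show ?thesis by (simp add: \<xi> cinv_TM_tcoord trunc_tcoord[OF base] cinv_coord[OF base])
qed

lemma smooth_at_tbase:
  assumes f: "smooth_at M f (tbase \<xi>)" and \<xi>: "\<xi> \<in> topspace (mtop TM)"
  shows "smooth_at TM (\<lambda>\<eta>. f (tbase \<eta>)) \<xi>"
proof -
  obtain i where i: "i \<in> charts_at TM \<xi>" using \<xi> T.topspace_iff_charts_at by blast
  note base = charts_at_TM_base[OF i]
  obtain W where W: "openin (Euclidean_space n) W" "coord M i (tbase \<xi>) \<in> W" "W \<subseteq> coord M i ` cdom M i"
    "smooth_real_on n W (\<lambda>x. f (cinv M i x))" by (rule smooth_atD_chart[OF f base])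
  have W': "openin (Euclidean_space (2 * n)) (cylinder n W)" by (rule openin_cylinder[OF W(1)])
  show ?thesis
  proof (rule T.smooth_atI_chart[OF i])
    show "openin (Euclidean_space (mdim TM)) (cylinder n W)" using W' by simp
    show "coord TM i \<xi> \<in> cylinder n W" by (simp add: cylinder_def tcoord_eq_0 trunc_tcoord[OF base] W(2))
    have "x \<in> cylinder n (coord M i ` cdom M i)" if "x \<in> cylinder n W" for x
      using that W(3) by (auto simp: cylinder_def)
    then have "f (cinv M i (trunc n x)) = f (tbase (cinv TM i x))" if "x \<in> cylinder n W" for x
      using that base by (simp add: tbase_cinv_TM charts_at_iff)
    from smooth_real_on_cong[OF W' smooth_real_on_cylinder[OF W(1,4)] this]
    show "smooth_real_on (mdim TM) (cylinder n W) (\<lambda>x. f (tbase (cinv TM i x)))" by simp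
  qed
qed

lemma chart_pderiv_tbase:
  assumes i: "i \<in> charts_at TM \<xi>" and a: "a < 2 * n"
  shows "chart_pderiv TM i a (\<lambda>\<eta>. f (tbase \<eta>)) \<xi> = (if a < n then chart_pderiv M i a f (tbase \<xi>) else 0)"
proof -
  note base = charts_at_TM_base[OF i]
  then have ic: "i \<in> charts M" by (simp add: charts_at_iff)
  let ?W = "cylinder n (coord M i ` cdom M i)"
  have "tcoord M i \<xi> \<in> ?W" using base by (simp add: cylinder_def tcoord_eq_0 trunc_tcoord charts_at_iff)
  then have "chart_pderiv TM i a (\<lambda>\<eta>. f (tbase \<eta>)) \<xi> =
      pderiv_at a (\<lambda>x. f (cinv M i (trunc n x))) (tcoord M i \<xi>)"
    unfolding chart_pderiv_def tangent_bundle_simps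
    by (rule pderiv_at_cong[OF openin_cylinder[OF openin_coord_cdom[OF ic]] _ a])
       (simp add: tbase_cinv_TM[OF ic])
  also have "\<dots> = (if a < n then chart_pderiv M i a f (tbase \<xi>) else 0)"
  proof (cases "a < n")
    case True
    then have "trunc n ((tcoord M i \<xi>)(a := t)) = (coord M i (tbase \<xi>))(a := t)" for t
      unfolding trunc_tcoord[OF base, symmetric] by (auto simp: trunc_def)
    with True show ?thesis by (simp add: pderiv_at_def chart_pderiv_def tcoord_base)
  next
    case False
    then have "trunc n ((tcoord M i \<xi>)(a := t)) = trunc n (tcoord M i \<xi>)" for t by (auto simp: trunc_def)
    with False show ?thesis by (simp add: pderiv_at_def)
  qed
  finally show ?thesis .
qed

lemma smooth_at_tfib: "i \<in> charts_at TM \<xi> \<Longrightarrow> k < n \<Longrightarrow> smooth_at TM (\<lambda>\<eta>. tfib \<eta> i k) \<xi>"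
  using T.smooth_at_coord[of i \<xi> "n + k"] by (simp add: tcoord_fibre)

lemma dirder_tfib:
  "w \<in> tangent_space TM \<xi> \<Longrightarrow> i \<in> charts_at TM \<xi> \<Longrightarrow> k < n \<Longrightarrow> dirder TM \<xi> w (\<lambda>\<eta>. tfib \<eta> i k) = w i (n + k)"
  using T.dirder_coord[of w \<xi> i "n + k"] by (simp add: tcoord_fibre)

lemma dirder_tbase_chart:
  assumes w: "w \<in> tangent_space TM \<xi>" and i: "i \<in> charts_at TM \<xi>" and f: "smooth_at M f (tbase \<xi>)"
  shows "dirder TM \<xi> w (\<lambda>\<eta>. f (tbase \<eta>)) = (\<Sum>a<n. w i a * chart_pderiv M i a f (tbase \<xi>))"
  unfolding T.dirder_chart[OF w smooth_at_tbase[OF f T.charts_at_imp_topspace[OF i]] i] tangent_bundle_simps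
      mult_2
    sum_lessThan_add
  by (simp add: chart_pderiv_tbase[OF i])

lemma hor_part_tangent:
  assumes w: "w \<in> tangent_space TM \<xi>" and \<xi>: "\<xi> \<in> topspace (mtop TM)"
  shows "hor_part M w \<in> tangent_space M (tbase \<xi>)"
proof (rule tangent_spaceI)
  fix i j k assume ij: "i \<in> charts_at M (tbase \<xi>)" "j \<in> charts_at M (tbase \<xi>)" and k: "k < n"
  then have charts: "i \<in> charts_at TM \<xi>" "j \<in> charts_at TM \<xi>" by (simp_all add: charts_at_TM_eq[OF \<xi>])
  have "w j k = dirder TM \<xi> w (\<lambda>\<eta>. coord M j (tbase \<eta>) k)"
    using T.dirder_coord[OF w charts(2), of k] k by (simp add: tcoord_base)
  also have "\<dots> = (\<Sum>a<n. w i a * chart_pderiv M i a (\<lambda>q. coord M j q k) (tbase \<xi>))"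
    by (rule dirder_tbase_chart[OF w charts(1) smooth_at_coord[OF ij(2)]])
  finally show "hor_part M w j k = (\<Sum>a<n. jacobian M i j (tbase \<xi>) k a * hor_part M w i a)"
    using k by (simp add: hor_part_apply jacobian_eq_chart_pderiv mult.commute)
qed (use w in \<open>auto simp: hor_part_def T.tangent_outside charts_at_TM_eq[OF \<xi>] fun_eq_iff\<close>)

lemma dirder_tbase:
  assumes w: "w \<in> tangent_space TM \<xi>" and \<xi>: "\<xi> \<in> topspace (mtop TM)" and f: "smooth_at M f (tbase \<xi>)"
  shows "dirder TM \<xi> w (\<lambda>\<eta>. f (tbase \<eta>)) = dirder M (tbase \<xi>) (hor_part M w) f"
proof -
  obtain i where i: "i \<in> charts_at TM \<xi>" using \<xi> T.topspace_iff_charts_at by blast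
  show ?thesis
    unfolding dirder_tbase_chart[OF w i f]
        dirder_chart[OF hor_part_tangent[OF w \<xi>] f charts_at_TM_base[OF i]]
    by (simp add: hor_part_apply)
qed

lemma hor_part_coord_field:
  assumes i: "i \<in> charts_at TM \<xi>" and a: "a < 2 * n"
  shows "hor_part M (coord_field TM i a \<xi>) = (if a < n then coord_field M i a (tbase \<xi>) else 0)"
proof (rule tangent_eqI[OF hor_part_tangent _ charts_at_TM_base[OF i]])
  show "coord_field TM i a \<xi> \<in> tangent_space TM \<xi>" using T.coord_field_tangent[OF i] a by simp
  show "(if a < n then coord_field M i a (tbase \<xi>) else 0) \<in> tangent_space M (tbase \<xi>)"
    by (simp add: coord_field_tangent[OF charts_at_TM_base[OF i]] tangent_space_zero)
  fix k assume "k < n"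
  then show "hor_part M (coord_field TM i a \<xi>) i k = (if a < n then coord_field M i a (tbase \<xi>) else 0) i k"
    using a by (auto simp: hor_part_apply T.coord_field_self[OF i]
        coord_field_self[OF charts_at_TM_base[OF i]])
qed (rule T.charts_at_imp_topspace[OF i])

lemma closed_form_pullback:
  assumes \<alpha>: "closed_form \<alpha>"
  shows "T.closed_form (\<lambda>\<xi> w. \<alpha> (tbase \<xi>) (hor_part M w))"
proof -
  have one_form: "one_form \<alpha>" using \<alpha> by (simp add: closed_form_iff_chart)
  note component_smooth = one_form_component[OF one_form]
  let ?\<beta> = "\<lambda>\<xi> w. \<alpha> (tbase \<xi>) (hor_part M w)"
  let ?c = "\<lambda>i a \<xi>. if a < n then \<alpha> (tbase \<xi>) (coord_field M i a (tbase \<xi>)) else 0"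
  have component: "?\<beta> \<xi> (coord_field TM i a \<xi>) = ?c i a \<xi>" if "i \<in> charts_at TM \<xi>" "a < 2 * n" for i a \<xi>
    using linear_at_zero[OF one_form_linear[OF one_form
        tbase_in_topspace[OF T.charts_at_imp_topspace[OF that(1)]]]]
    by (simp add: hor_part_coord_field that)
  have near_component: "\<forall>\<^sub>F \<eta> in T.near \<xi>. ?c i a \<eta> = ?\<beta> \<eta> (coord_field TM i a \<eta>)"
    if "i \<in> charts_at TM \<xi>" "a < 2 * n" for i a \<xi>
    by (rule eventually_mono[OF T.eventually_near_charts_at[OF that(1)]]) (simp add: component that(2))
  have smooth: "smooth_at TM (?c i a) \<xi>" if i: "i \<in> charts_at TM \<xi>" for i a \<xi>
    using smooth_at_tbase[OF component_smooth[OF charts_at_TM_base[OF i]] T.charts_at_imp_topspace[OF i]]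
      T.smooth_at_const[OF T.charts_at_imp_topspace[OF i]] by (cases "a < n") simp_all
  have "T.one_form ?\<beta>"
  proof (rule T.one_formI)
    show "T.linear_at \<xi> (?\<beta> \<xi>)" if \<xi>: "\<xi> \<in> topspace (mtop TM)" for \<xi>
      using one_form_linear[OF one_form tbase_in_topspace[OF \<xi>]]
      by (simp add: T.linear_at_def linear_at_def hor_part_add hor_part_scale hor_part_tangent \<xi>)
    show "smooth_at TM (\<lambda>\<eta>. ?\<beta> \<eta> (coord_field TM i a \<eta>)) \<xi>" if "i \<in> charts_at TM \<xi>" "a < mdim TM" for \<xi> i a
      using that by (intro T.smooth_at_cong[OF near_component smooth]) simp_all
  qed
  moreover have "chart_pderiv TM i a (?c i b) \<xi> = chart_pderiv TM i b (?c i a) \<xi>"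
    if "i \<in> charts_at TM \<xi>" "a < 2 * n" "b < 2 * n" for \<xi> i a b
    using that \<alpha> chart_pderiv_tbase[OF that(1), of a "\<lambda>q. \<alpha> q (coord_field M i b q)"]
      chart_pderiv_tbase[OF that(1), of b "\<lambda>q. \<alpha> q (coord_field M i a q)"] charts_at_TM_base[OF that(1)]
    by (cases "a < n"; cases "b < n") (auto simp: closed_form_iff_chart T.chart_pderiv_const)
  ultimately show ?thesis
    unfolding T.closed_form_iff_chart by (auto simp: T.chart_pderiv_cong[OF near_component, symmetric])
qed

end


subsection \<open>Vector fields along the projection\<close>

definition section_on :: "('a, 'i) tmanifold \<Rightarrow> ('a, 'i) tpoint set \<Rightarrow> ('a, 'i) tfield \<Rightarrow> bool" where
  "section_on M U W \<longleftrightarrow> (\<forall>\<xi>\<in>U. W \<xi> \<in> tangent_space M (tbase \<xi>) \<and>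
     (\<forall>i\<in>charts_at (tangent_bundle M) \<xi>. \<forall>k<mdim M. smooth_at (tangent_bundle M) (\<lambda>\<eta>. W \<eta> i k) \<xi>))"

definition pull_deriv ::
  "('a, 'i) tmanifold \<Rightarrow> ('a, 'i) tconn \<Rightarrow> ('a, 'i) tpoint \<Rightarrow> 'i tvec \<Rightarrow> ('a, 'i) tfield \<Rightarrow> 'i tvec" where
  "pull_deriv M nab \<xi> w W = (\<lambda>i k.
     if i \<in> charts_at (tangent_bundle M) \<xi> \<and> k < mdim M
     then dirder (tangent_bundle M) \<xi> w (\<lambda>\<eta>. W \<eta> i k)
       + (\<Sum>b<mdim M. conn_matrix M nab i (tbase \<xi>) (hor_part M w) k b * W \<xi> i b) else 0)"

lemma section_on_tangent: "section_on M U W \<Longrightarrow> \<xi> \<in> U \<Longrightarrow> W \<xi> \<in> tangent_space M (tbase \<xi>)"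
  by (simp add: section_on_def)

lemma section_on_smooth_at:
  "section_on M U W \<Longrightarrow> \<xi> \<in> U \<Longrightarrow> i \<in> charts_at (tangent_bundle M) \<xi> \<Longrightarrow> k < mdim M \<Longrightarrow>
   smooth_at (tangent_bundle M) (\<lambda>\<eta>. W \<eta> i k) \<xi>"
  by (simp add: section_on_def)

lemma section_on_subset: "V \<subseteq> U \<Longrightarrow> section_on M U W \<Longrightarrow> section_on M V W"
  by (auto simp: section_on_def)

locale tangent_bundle_connection = tangent_bundle_mfd M + connection_mfd M nab
  for M :: "('a, 'i) tmanifold" and nab
begin

abbreviation pullback_nabla (\<open>\<nabla>\<close>) where "\<nabla> \<equiv> pull_deriv M nab"

lemma pull_deriv_apply:
  "i \<in> charts_at TM \<xi> \<Longrightarrow> k < n \<Longrightarrow> \<nabla> \<xi> w W i k =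
     dirder TM \<xi> w (\<lambda>\<eta>. W \<eta> i k) + (\<Sum>b<n. conn_matrix M nab i (tbase \<xi>) (hor_part M w) k b * W \<xi> i b)"
  by (simp add: pull_deriv_def)

lemma pull_deriv_add_vec: "\<nabla> \<xi> (w + w') W = \<nabla> \<xi> w W + \<nabla> \<xi> w' W"
  by (simp add: pull_deriv_def fun_eq_iff T.dirder_plus_vec hor_part_add conn_matrix_add distrib_right
      sum.distrib)

lemma pull_deriv_scale_vec: "\<nabla> \<xi> (tscale c w) W = tscale c (\<nabla> \<xi> w W)"
  by (simp add: pull_deriv_def fun_eq_iff tscale_apply T.dirder_scale_vec hor_part_scale conn_matrix_scale
      distrib_left sum_distrib_left mult_ac)

lemma pull_deriv_cong:
  assumes eq: "\<forall>\<^sub>F \<eta> in T.near \<xi>. W \<eta> = W' \<eta>" and \<xi>: "\<xi> \<in> topspace (mtop TM)"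
  shows "\<nabla> \<xi> w W = \<nabla> \<xi> w W'"
proof -
  have "W \<xi> = W' \<xi>" by (rule eventually_nhdsinE[OF eq \<xi>])
  moreover have "dirder TM \<xi> w (\<lambda>\<eta>. W \<eta> i k) = dirder TM \<xi> w (\<lambda>\<eta>. W' \<eta> i k)" for i k
    by (rule T.dirder_cong[OF eventually_mono[OF eq] \<xi>]) simp
  ultimately show ?thesis by (intro ext) (simp add: pull_deriv_def)
qed

lemma pull_deriv_comb:
  assumes \<xi>: "\<xi> \<in> U" "\<xi> \<in> topspace (mtop TM)"
    and f: "\<And>b. b \<in> B \<Longrightarrow> smooth_at TM (f b) \<xi>" and V: "\<And>b. b \<in> B \<Longrightarrow> section_on M U (V b)"
    and comb: "\<forall>\<^sub>F \<eta> in T.near \<xi>. W \<eta> = (\<Sum>b\<in>B. tscale (f b \<eta>) (V b \<eta>))"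
  shows "\<nabla> \<xi> w W = (\<Sum>b\<in>B. tscale (dirder TM \<xi> w (f b)) (V b \<xi>) + tscale (f b \<xi>) (\<nabla> \<xi> w (V b)))"
proof (intro ext)
  fix i k
  show "\<nabla> \<xi> w W i k = (\<Sum>b\<in>B. tscale (dirder TM \<xi> w (f b)) (V b \<xi>) + tscale (f b \<xi>) (\<nabla> \<xi> w (V b))) i k"
  proof (cases "i \<in> charts_at TM \<xi> \<and> k < n")
    case True
    then have i: "i \<in> charts_at TM \<xi>" and k: "k < n" by simp_all
    have "\<nabla> \<xi> w W i k = \<nabla> \<xi> w (\<lambda>\<eta>. \<Sum>b\<in>B. tscale (f b \<eta>) (V b \<eta>)) i k"
      by (simp only: pull_deriv_cong[OF comb \<xi>(2)])
    also have "\<dots> = dirder TM \<xi> w (\<lambda>\<eta>. \<Sum>b\<in>B. f b \<eta> * V b \<eta> i k)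
        + (\<Sum>c<n. conn_matrix M nab i (tbase \<xi>) (hor_part M w) k c * (\<Sum>b\<in>B. f b \<xi> * V b \<xi> i c))"
      by (simp add: pull_deriv_apply[OF i k] sum_fun_apply tscale_apply)
    also have "(\<Sum>c<n. conn_matrix M nab i (tbase \<xi>) (hor_part M w) k c * (\<Sum>b\<in>B. f b \<xi> * V b \<xi> i c)) =
        (\<Sum>b\<in>B. f b \<xi> * (\<Sum>c<n. conn_matrix M nab i (tbase \<xi>) (hor_part M w) k c * V b \<xi> i c))"
      unfolding sum_distrib_left by (subst sum.swap) (simp add: mult_ac)
    also have "dirder TM \<xi> w (\<lambda>\<eta>. \<Sum>b\<in>B. f b \<eta> * V b \<eta> i k) =
        (\<Sum>b\<in>B. dirder TM \<xi> w (f b) * V b \<xi> i k) + (\<Sum>b\<in>B. f b \<xi> * dirder TM \<xi> w (\<lambda>\<eta>. V b \<eta> i k))"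
      by (intro T.dirder_sum_mult[OF \<xi>(2)] f section_on_smooth_at[OF V \<xi>(1) i k])
    finally show ?thesis
      by (simp add: sum_fun_apply tscale_apply pull_deriv_apply[OF i k] distrib_left sum.distrib)
  next
    case False
    have "V b \<xi> i k = 0" if "b \<in> B" for b
      using False section_on_tangent[OF V[OF that] \<xi>(1)]
      by (auto simp: charts_at_TM_eq[OF \<xi>(2)] tangent_outside tangent_beyond not_less)
    then show ?thesis using False by (auto simp: sum_fun_apply tscale_apply pull_deriv_def)
  qed
qed

lemma section_on_tbase:
  assumes U: "openin (mtop M) U" and Y: "vfield M U Y"
  shows "section_on M (bundle_over M U) (\<lambda>\<eta>. Y (tbase \<eta>))"
  unfolding section_on_def
proof (intro ballI conjI allI impI)
  fix \<xi> assume "\<xi> \<in> bundle_over M U"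
  then have \<xi>: "\<xi> \<in> topspace (mtop TM)" "tbase \<xi> \<in> U"
    by (auto simp: bundle_over_in_topspace[OF U] bundle_over_iff)
  show "Y (tbase \<xi>) \<in> tangent_space M (tbase \<xi>)" by (rule vfield_tangent[OF Y \<xi>(2)])
  show "smooth_at TM (\<lambda>\<eta>. Y (tbase \<eta>) i k) \<xi>" if "i \<in> charts_at TM \<xi>" "k < n" for i k
    by (rule smooth_at_tbase[OF vfield_smooth_at[OF U Y \<xi>(2) charts_at_TM_base[OF that(1)] that(2)] \<xi>(1)])
qed

lemma pull_deriv_tbase:
  assumes U: "openin (mtop M) U" and A: "vfield M U A" and Y: "vfield M U Y" and \<xi>: "\<xi> \<in> bundle_over M U"
    and w: "w \<in> tangent_space TM \<xi>" "hor_part M w = A (tbase \<xi>)"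
  shows "\<nabla> \<xi> w (\<lambda>\<eta>. Y (tbase \<eta>)) = nab A Y (tbase \<xi>)"
proof (intro ext)
  fix i k
  note top = bundle_over_in_topspace[OF U \<xi>]
  have p: "tbase \<xi> \<in> U" using \<xi> by (simp add: bundle_over_iff)
  show "\<nabla> \<xi> w (\<lambda>\<eta>. Y (tbase \<eta>)) i k = nab A Y (tbase \<xi>) i k"
  proof (cases "i \<in> charts_at TM \<xi> \<and> k < n")
    case True
    then have i: "i \<in> charts_at TM \<xi>" and k: "k < n" by simp_all
    note base = charts_at_TM_base[OF i]
    show ?thesis
      unfolding pull_deriv_apply[OF i k] dirder_tbase[OF w(1) top vfield_smooth_at[OF U Y p base k]]
        nab_apply[OF U p A Y base k] w(2) ..
  next
    case False
    then show ?thesis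
      using vfield_tangent[OF nab_vfield[OF U A Y] p]
      by (auto simp: pull_deriv_def charts_at_TM_eq[OF top] tangent_outside tangent_beyond not_less)
  qed
qed

lemma section_on_expand:
  assumes U: "openin (mtop TM) U" "\<xi> \<in> U" and W: "section_on M U W" and i: "i \<in> charts_at TM \<xi>"
  shows "\<forall>\<^sub>F \<eta> in T.near \<xi>. W \<eta> = (\<Sum>b<n. tscale (W \<eta> i b) (coord_field M i b (tbase \<eta>)))"
proof -
  have "\<forall>\<^sub>F \<eta> in T.near \<xi>. \<eta> \<in> U" by (rule eventually_nhdsinI[OF U])
  then show ?thesis
    using T.eventually_near_charts_at[OF i]
    by eventually_elim (rule tangent_expand[OF section_on_tangent[OF W] charts_at_TM_base])
qed

lemma pull_deriv_expand:
  assumes U: "openin (mtop TM) U" "\<xi> \<in> U" and W: "section_on M U W" and i: "i \<in> charts_at TM \<xi>"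
    and w: "w \<in> tangent_space TM \<xi>" "hor_part M w = A (tbase \<xi>)" and A: "vfield M (cdom M i) A"
  shows "\<nabla> \<xi> w W = (\<Sum>b<n. tscale (dirder TM \<xi> w (\<lambda>\<eta>. W \<eta> i b)) (coord_field M i b (tbase \<xi>))
      + tscale (W \<xi> i b) (nab A (coord_field M i b) (tbase \<xi>)))"
proof -
  have ic: "i \<in> charts M" and \<xi>: "\<xi> \<in> bundle_over M (cdom M i)" using i by (simp_all add: charts_at_def)
  note E = coord_field_vfield[OF ic] and V = openin_cdom[OF ic]
  have "\<nabla> \<xi> w W = (\<Sum>b<n. tscale (dirder TM \<xi> w (\<lambda>\<eta>. W \<eta> i b)) (coord_field M i b (tbase \<xi>))
      + tscale (W \<xi> i b) (\<nabla> \<xi> w (\<lambda>\<eta>. coord_field M i b (tbase \<eta>))))"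
    by (rule pull_deriv_comb[OF \<xi> T.charts_at_imp_topspace[OF i] _ _ section_on_expand[OF U W i]])
       (simp_all add: section_on_smooth_at[OF W U(2) i] section_on_tbase[OF V E])
  then show ?thesis by (simp add: pull_deriv_tbase[OF V A E \<xi> w])
qed

lemma pull_deriv_tangent:
  assumes U: "openin (mtop TM) U" "\<xi> \<in> U" and W: "section_on M U W" and w: "w \<in> tangent_space TM \<xi>"
  shows "\<nabla> \<xi> w W \<in> tangent_space M (tbase \<xi>)"
proof -
  obtain i where i: "i \<in> charts_at TM \<xi>" using T.openin_ex_chart[OF U] ..
  note base = charts_at_TM_base[OF i]
  then have V: "openin (mtop M) (cdom M i)" "tbase \<xi> \<in> cdom M i" and ic: "i \<in> charts M"
    by (simp_all add: charts_at_iff openin_cdom)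
  obtain A where A: "vfield M (cdom M i) A" "A (tbase \<xi>) = hor_part M w"
    by (rule tangent_extend[OF hor_part_tangent[OF w T.charts_at_imp_topspace[OF i]] base])
  have "nab A (coord_field M i b) (tbase \<xi>) \<in> tangent_space M (tbase \<xi>)" if "b < n" for b
    by (rule vfield_tangent[OF nab_vfield[OF V(1) A(1) coord_field_vfield[OF ic that]] V(2)])
  then show ?thesis
    unfolding pull_deriv_expand[OF U W i w A(2)[symmetric] A(1)]
    by (intro tangent_sum tangent_add tangent_scale) (simp_all add: coord_field_tangent[OF base])
qed

lemma smooth_at_conn_matrix:
  assumes i: "i \<in> charts_at TM \<xi>" and kb: "k < n" "b < n" and A: "\<And>a. a < n \<Longrightarrow> smooth_at TM (\<lambda>\<eta>. A \<eta> i a) \<xi>"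
  shows "smooth_at TM (\<lambda>\<eta>. conn_matrix M nab i (tbase \<eta>) (A \<eta>) k b) \<xi>"
  unfolding conn_matrix_def
  by (intro T.smooth_at_sum T.smooth_at_mult smooth_at_tbase smooth_at_christoffel charts_at_TM_base A
      T.charts_at_imp_topspace[OF i] i kb) simp_all

lemma section_on_pull_deriv:
  assumes U: "openin (mtop TM) U" and X: "vfield TM U X" and W: "section_on M U W"
  shows "section_on M U (\<lambda>\<eta>. \<nabla> \<eta> (X \<eta>) W)"
  unfolding section_on_def
proof (intro ballI conjI allI impI)
  fix \<xi> assume \<xi>: "\<xi> \<in> U"
  show "\<nabla> \<xi> (X \<xi>) W \<in> tangent_space M (tbase \<xi>)"
    by (rule pull_deriv_tangent[OF U \<xi> W vfield_tangent[OF X \<xi>]])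
  fix i k assume i: "i \<in> charts_at TM \<xi>" and k: "k < n"
  note top = T.charts_at_imp_topspace[OF i]
  have charts: "i \<in> charts TM" using i by (simp add: charts_at_def)
  have V: "openin (mtop TM) (U \<inter> cdom TM i)" using U T.openin_cdom[OF charts] by blast
  have "smooth_at TM (\<lambda>\<eta>. dirder TM \<eta> (X \<eta>) (\<lambda>\<eta>. W \<eta> i k)
      + (\<Sum>b<n. conn_matrix M nab i (tbase \<eta>) (hor_part M (X \<eta>)) k b * W \<eta> i b)) \<xi>"
  proof (intro T.smooth_at_add T.smooth_at_sum[OF top] T.smooth_at_mult smooth_at_conn_matrix[OF i k])
    show "smooth_at TM (\<lambda>\<eta>. dirder TM \<eta> (X \<eta>) (\<lambda>\<eta>. W \<eta> i k)) \<xi>"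
      by (rule T.smooth_at_dirder[OF V vfield_subset[OF Int_lower1 X]])
         (use \<xi> i k charts in \<open>auto intro!: section_on_smooth_at[OF W] simp: charts_at_def\<close>)
    show "smooth_at TM (\<lambda>\<eta>. hor_part M (X \<eta>) i a) \<xi>" if "a < n" for a
      using T.vfield_smooth_at[OF U X \<xi> i, of a] that by (simp add: hor_part_apply)
  qed (simp_all add: section_on_smooth_at[OF W \<xi> i])
  then show "smooth_at TM (\<lambda>\<eta>. \<nabla> \<eta> (X \<eta>) W i k) \<xi>"
    by (rule T.smooth_at_cong[rotated])
       (rule eventually_mono[OF T.eventually_near_charts_at[OF i]], simp add: pull_deriv_apply k)
qed

lemma pull_deriv_leibniz:
  assumes "\<xi> \<in> U" "\<xi> \<in> topspace (mtop TM)" "smooth_at TM f \<xi>" "section_on M U W"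
  shows "\<nabla> \<xi> w (\<lambda>\<eta>. tscale (f \<eta>) (W \<eta>)) = tscale (dirder TM \<xi> w f) (W \<xi>) + tscale (f \<xi>) (\<nabla> \<xi> w W)"
  using pull_deriv_comb[of \<xi> U "{()}" "\<lambda>_. f" "\<lambda>_. W"] assms by simp

lemma pull_deriv_add:
  assumes "\<xi> \<in> U" "\<xi> \<in> topspace (mtop TM)" "section_on M U W" "section_on M U W'"
  shows "\<nabla> \<xi> w (\<lambda>\<eta>. W \<eta> + W' \<eta>) = \<nabla> \<xi> w W + \<nabla> \<xi> w W'"
  using pull_deriv_comb[of \<xi> U UNIV "\<lambda>_ _. 1" "\<lambda>b. if b then W else W'"] assms
  by (simp add: UNIV_bool T.smooth_at_const T.dirder_const add.commute del: plus_fun_apply)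

lemma pull_deriv_zero: "\<nabla> \<xi> w (\<lambda>\<eta>. 0) = 0"
  by (simp add: pull_deriv_def T.dirder_const fun_eq_iff)


subsection \<open>Curvature of the pulled back connection\<close>

definition pull_curvature :: "('a, 'i) tfield \<Rightarrow> ('a, 'i) tfield \<Rightarrow> ('a, 'i) tfield \<Rightarrow> ('a, 'i) tfield" where
  "pull_curvature X Y W \<xi> =
     \<nabla> \<xi> (X \<xi>) (\<lambda>\<eta>. \<nabla> \<eta> (Y \<eta>) W) - \<nabla> \<xi> (Y \<xi>) (\<lambda>\<eta>. \<nabla> \<eta> (X \<eta>) W) - \<nabla> \<xi> (bracket TM X Y \<xi>) W"

lemma pull_deriv_second:
  assumes U: "openin (mtop TM) U" "\<xi> \<in> U" and Y: "vfield TM U Y" and "finite B"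
    and f: "\<And>b \<eta>. b \<in> B \<Longrightarrow> \<eta> \<in> U \<Longrightarrow> smooth_at TM (f b) \<eta>" and V: "\<And>b. b \<in> B \<Longrightarrow> section_on M U (V b)"
    and comb: "\<And>\<eta>. \<eta> \<in> U \<Longrightarrow> W \<eta> = (\<Sum>b\<in>B. tscale (f b \<eta>) (V b \<eta>))"
  shows "\<nabla> \<xi> (X \<xi>) (\<lambda>\<eta>. \<nabla> \<eta> (Y \<eta>) W) =
    (\<Sum>b\<in>B. tscale (dirder TM \<xi> (X \<xi>) (\<lambda>\<eta>. dirder TM \<eta> (Y \<eta>) (f b))) (V b \<xi>)
       + tscale (dirder TM \<xi> (Y \<xi>) (f b)) (\<nabla> \<xi> (X \<xi>) (V b)))
    + (\<Sum>b\<in>B. tscale (dirder TM \<xi> (X \<xi>) (f b)) (\<nabla> \<xi> (Y \<xi>) (V b))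
       + tscale (f b \<xi>) (\<nabla> \<xi> (X \<xi>) (\<lambda>\<eta>. \<nabla> \<eta> (Y \<eta>) (V b))))"
proof -
  let ?f = "case_sum (\<lambda>b \<eta>. dirder TM \<eta> (Y \<eta>) (f b)) f" and ?V = "case_sum V (\<lambda>b \<eta>. \<nabla> \<eta> (Y \<eta>) (V b))"
  have "\<nabla> \<eta> (Y \<eta>) W = (\<Sum>b\<in>B <+> B. tscale (?f b \<eta>) (?V b \<eta>))" if \<eta>: "\<eta> \<in> U" for \<eta>
  proof -
    have "\<nabla> \<eta> (Y \<eta>) W = (\<Sum>b\<in>B. tscale (dirder TM \<eta> (Y \<eta>) (f b)) (V b \<eta>) + tscale (f b \<eta>) (\<nabla> \<eta> (Y \<eta>) (V b)))"
      by (rule pull_deriv_comb[OF \<eta> T.openin_imp_topspace[OF U(1) \<eta>] f V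
          eventually_nhdsinI[OF U(1) \<eta> comb]]) (use \<eta> in auto)
    then show ?thesis using \<open>finite B\<close> by (simp only: sum.Plus sum.case sum.distrib comp_def)
  qed
  from eventually_nhdsinI[OF U this]
  have "\<nabla> \<xi> (X \<xi>) (\<lambda>\<eta>. \<nabla> \<eta> (Y \<eta>) W) =
      (\<Sum>b\<in>B <+> B. tscale (dirder TM \<xi> (X \<xi>) (?f b)) (?V b \<xi>) + tscale (?f b \<xi>) (\<nabla> \<xi> (X \<xi>) (?V b)))"
    by (rule pull_deriv_comb[OF U(2) T.openin_imp_topspace[OF U], rotated 2])
       (auto intro!: T.smooth_at_dirder[OF U(1) Y f U(2)] f U(2) V section_on_pull_deriv[OF U(1) Y])
  then show ?thesis using \<open>finite B\<close> by (simp only: sum.Plus sum.case comp_def)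
qed

lemma pull_curvature_comb:
  assumes U: "openin (mtop TM) U" "\<xi> \<in> U" and X: "vfield TM U X" and Y: "vfield TM U Y" and B: "finite B"
    and f: "\<And>b \<eta>. b \<in> B \<Longrightarrow> \<eta> \<in> U \<Longrightarrow> smooth_at TM (f b) \<eta>" and V: "\<And>b. b \<in> B \<Longrightarrow> section_on M U (V b)"
    and comb: "\<And>\<eta>. \<eta> \<in> U \<Longrightarrow> W \<eta> = (\<Sum>b\<in>B. tscale (f b \<eta>) (V b \<eta>))"
  shows "pull_curvature X Y W \<xi> = (\<Sum>b\<in>B. tscale (f b \<xi>) (pull_curvature X Y (V b) \<xi>))"
proof -
  have "\<nabla> \<xi> (bracket TM X Y \<xi>) W = (\<Sum>b\<in>B. tscale (dirder TM \<xi> (bracket TM X Y \<xi>) (f b)) (V b \<xi>)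
      + tscale (f b \<xi>) (\<nabla> \<xi> (bracket TM X Y \<xi>) (V b)))"
    by (rule pull_deriv_comb[OF U(2) T.openin_imp_topspace[OF U] f V eventually_nhdsinI[OF U comb]])
       (use U(2) in auto)
  also have "\<dots> = (\<Sum>b\<in>B. tscale (dirder TM \<xi> (X \<xi>) (\<lambda>\<eta>. dirder TM \<eta> (Y \<eta>) (f b))
      - dirder TM \<xi> (Y \<xi>) (\<lambda>\<eta>. dirder TM \<eta> (X \<eta>) (f b))) (V b \<xi>)
      + tscale (f b \<xi>) (\<nabla> \<xi> (bracket TM X Y \<xi>) (V b)))"
    by (intro sum.cong refl) (simp add: T.dirder_bracket[OF U(1) X Y f U(2)])
  finally show ?thesis
    by (simp add: pull_curvature_def pull_deriv_second[OF U Y B f V comb]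
        pull_deriv_second[OF U X B f V comb]
        fun_eq_iff sum_fun_apply tscale_apply sum.distrib sum_subtractf algebra_simps)
qed

lemma pull_deriv_tbase_chart:
  assumes i: "i \<in> charts_at TM \<xi>" and Z: "vfield M (cdom M i) Z" and w: "w \<in> tangent_space TM \<xi>"
  shows "\<nabla> \<xi> w (\<lambda>\<eta>. Z (tbase \<eta>)) = (\<Sum>a<n. tscale (w i a) (nab (coord_field M i a) Z (tbase \<xi>)))"
proof -
  note top = T.charts_at_imp_topspace[OF i] and base = charts_at_TM_base[OF i]
  have U: "openin (mtop M) (cdom M i)" "tbase \<xi> \<in> cdom M i"
    using base by (simp_all add: charts_at_iff openin_cdom)
  obtain A where A: "vfield M (cdom M i) A" "A (tbase \<xi>) = hor_part M w"
    by (rule tangent_extend[OF hor_part_tangent[OF w top] base])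
  have "\<nabla> \<xi> w (\<lambda>\<eta>. Z (tbase \<eta>)) = nab A Z (tbase \<xi>)"
    by (rule pull_deriv_tbase[OF U(1) A(1) Z _ w A(2)[symmetric]])
       (simp add: in_bundle_over_iff[OF top] U(2))
  then show ?thesis by (simp add: nab_expand(1)[OF U A(1) Z base] A(2) hor_part_apply)
qed

end

locale affine_mfd = torsionless_mfd M nab for M :: "('p, 'i) manifold" and nab +
  assumes flat: "flat M nab"
begin

lemma nab_nab_coord_field_commute:
  assumes i: "i \<in> charts_at M p" and Z: "vfield M (cdom M i) Z" and "a < n" "b < n"
  shows "nab (coord_field M i a) (nab (coord_field M i b) Z) p =
      nab (coord_field M i b) (nab (coord_field M i a) Z) p"
proof -
  have ic: "i \<in> charts M" "p \<in> cdom M i" using i by (simp_all add: charts_at_iff)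
  note U = openin_cdom[OF ic(1)] and E = coord_field_vfield[OF ic(1)]
  have "nab (bracket M (coord_field M i a) (coord_field M i b)) Z p = nab 0 Z p"
    by (rule nab_cong[OF U bracket_vfield[OF U E E] vfield_zero[OF U] Z Z _ refl ic(2)])
       (use ic(1) assms(3,4) in \<open>simp_all add: bracket_coord_field charts_at_iff\<close>)
  also have "\<dots> = 0" by (rule nab_zero_left[OF U Z ic(2)])
  moreover have "nab (coord_field M i a) (nab (coord_field M i b) Z) p
      - nab (coord_field M i b) (nab (coord_field M i a) Z) p
      - nab (bracket M (coord_field M i a) (coord_field M i b)) Z p = 0"
    using flat U E[OF assms(3)] E[OF assms(4)] Z ic(2) unfolding flat_def by blast
  ultimately show ?thesis by simp
qed

end

locale tangent_bundle_affine = tangent_bundle_connection M nab + affine_mfd M nab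
  for M :: "('a, 'i) tmanifold" and nab
begin

lemma pull_curvature_coord_field:
  assumes U: "openin (mtop TM) U" "\<xi> \<in> U" "U \<subseteq> bundle_over M (cdom M i)" and X: "vfield TM U X"
    and Y: "vfield TM U Y"
    and i: "i \<in> charts M" and b: "b < n"
  shows "pull_curvature X Y (\<lambda>\<eta>. coord_field M i b (tbase \<eta>)) \<xi> = 0"
proof -
  let ?E = "coord_field M i" and ?V = "\<lambda>\<eta>. coord_field M i b (tbase \<eta>)"
  let ?nn = "\<lambda>c d. nab (?E d) (nab (?E c) (?E b)) (tbase \<xi>)"
  have charts: "i \<in> charts_at TM \<eta>" if "\<eta> \<in> U" for \<eta> using that U(3) i by (auto simp: charts_at_def)
  note \<xi> = charts[OF U(2)] and top = T.openin_imp_topspace[OF U(1,2)] and W = openin_cdom[OF i]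
    and E = coord_field_vfield[OF i]
  note nab_E = nab_vfield[OF W E E]
  have second: "\<nabla> \<xi> (X \<xi>) (\<lambda>\<eta>. \<nabla> \<eta> (Y \<eta>) ?V) =
      (\<Sum>c<n. tscale (dirder TM \<xi> (X \<xi>) (\<lambda>\<eta>. Y \<eta> i c)) (nab (?E c) (?E b) (tbase \<xi>)))
      + (\<Sum>c<n. \<Sum>d<n. tscale (Y \<xi> i c * X \<xi> i d) (?nn c d))"
    if X: "vfield TM U X" and Y: "vfield TM U Y" for X Y
  proof -
    have "\<nabla> \<xi> (X \<xi>) (\<lambda>\<eta>. \<nabla> \<eta> (Y \<eta>) ?V) =
        (\<Sum>c<n. tscale (dirder TM \<xi> (X \<xi>) (\<lambda>\<eta>. Y \<eta> i c)) (nab (?E c) (?E b) (tbase \<xi>))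
        + tscale (Y \<xi> i c) (\<nabla> \<xi> (X \<xi>) (\<lambda>\<eta>. nab (?E c) (?E b) (tbase \<eta>))))"
    proof (rule pull_deriv_comb[OF U(2) top])
      show "\<forall>\<^sub>F \<eta> in T.near \<xi>. \<nabla> \<eta> (Y \<eta>) ?V = (\<Sum>c<n. tscale (Y \<eta> i c) (nab (?E c) (?E b) (tbase \<eta>)))"
        by (rule eventually_nhdsinI[OF U(1,2)])
           (rule pull_deriv_tbase_chart[OF charts E[OF b] vfield_tangent[OF Y]])
      show "section_on M U (\<lambda>\<eta>. nab (?E c) (?E b) (tbase \<eta>))" if "c \<in> {..<n}" for c
        using section_on_subset[OF U(3) section_on_tbase[OF W nab_E[OF _ b]]] that by simp
    qed (use T.vfield_smooth_at[OF U(1) Y U(2) \<xi>] in simp)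
    also have "\<dots> = (\<Sum>c<n. tscale (dirder TM \<xi> (X \<xi>) (\<lambda>\<eta>. Y \<eta> i c)) (nab (?E c) (?E b) (tbase \<xi>))
        + tscale (Y \<xi> i c) (\<Sum>d<n. tscale (X \<xi> i d) (?nn c d)))"
      by (simp add: pull_deriv_tbase_chart[OF \<xi> nab_E[OF _ b] vfield_tangent[OF X U(2)]])
    finally show ?thesis by (simp only: sum.distrib tvec.scale_sum_right tvec.scale_scale)
  qed
  have "(\<Sum>c<n. \<Sum>d<n. tscale (X \<xi> i c * Y \<xi> i d) (?nn c d)) =
      (\<Sum>c<n. \<Sum>d<n. tscale (Y \<xi> i c * X \<xi> i d) (?nn c d))"
    by (subst sum.swap)
       (simp add: nab_nab_coord_field_commute[OF charts_at_TM_base[OF \<xi>] E[OF b]] mult.commute)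
  moreover have "\<nabla> \<xi> (bracket TM X Y \<xi>) ?V =
      (\<Sum>c<n. tscale (dirder TM \<xi> (X \<xi>) (\<lambda>\<eta>. Y \<eta> i c)) (nab (?E c) (?E b) (tbase \<xi>)))
      - (\<Sum>c<n. tscale (dirder TM \<xi> (Y \<xi>) (\<lambda>\<eta>. X \<eta> i c)) (nab (?E c) (?E b) (tbase \<xi>)))"
    unfolding pull_deriv_tbase_chart[OF \<xi> E[OF b] vfield_tangent[OF T.bracket_vfield[OF U(1) X Y] U(2)]]
    by (simp add: T.bracket_apply[OF \<xi>] tvec.scale_left_diff_distrib sum_subtractf)
  ultimately show ?thesis
    unfolding pull_curvature_def second[OF X Y] second[OF Y X] by (simp only:) simp
qed

lemma pull_deriv_commute:
  assumes U: "openin (mtop TM) U" "\<xi> \<in> U" and X: "vfield TM U X" and Y: "vfield TM U Y"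
    and W: "section_on M U W"
  shows "\<nabla> \<xi> (X \<xi>) (\<lambda>\<eta>. \<nabla> \<eta> (Y \<eta>) W) = \<nabla> \<xi> (Y \<xi>) (\<lambda>\<eta>. \<nabla> \<eta> (X \<eta>) W) + \<nabla> \<xi> (bracket TM X Y \<xi>) W"
proof -
  obtain i where i: "i \<in> charts_at TM \<xi>" using T.openin_ex_chart[OF U] ..
  let ?V = "U \<inter> bundle_over M (cdom M i)"
  have ic: "i \<in> charts M" using i by (simp add: charts_at_def)
  have V: "openin (mtop TM) ?V" "\<xi> \<in> ?V"
    using U openin_bundle_over[OF openin_cdom[OF ic]] i by (auto simp: charts_at_def)
  have charts: "i \<in> charts_at TM \<eta>" if "\<eta> \<in> ?V" for \<eta> using that ic by (auto simp: charts_at_def)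
  note XV = vfield_subset[OF Int_lower1 X] and YV = vfield_subset[OF Int_lower1 Y]
  have "pull_curvature X Y W \<xi> =
      (\<Sum>b<n. tscale (W \<xi> i b) (pull_curvature X Y (\<lambda>\<eta>. coord_field M i b (tbase \<eta>)) \<xi>))"
  proof (rule pull_curvature_comb[OF V XV YV])
    show "W \<eta> = (\<Sum>b<n. tscale (W \<eta> i b) (coord_field M i b (tbase \<eta>)))" if "\<eta> \<in> ?V" for \<eta>
      using that by (intro tangent_expand section_on_tangent[OF W] charts_at_TM_base charts) auto
    show "section_on M ?V (\<lambda>\<eta>. coord_field M i b (tbase \<eta>))" if "b \<in> {..<n}" for b
      using section_on_subset[OF Int_lower2
          section_on_tbase[OF openin_cdom[OF ic] coord_field_vfield[OF ic]]] that by simp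
    show "smooth_at TM (\<lambda>\<eta>. W \<eta> i b) \<eta>" if "b \<in> {..<n}" "\<eta> \<in> ?V" for b \<eta>
      using that by (intro section_on_smooth_at[OF W] charts) auto
  qed simp
  also have "\<dots> = 0" by (simp add: pull_curvature_coord_field[OF V Int_lower2 XV YV ic])
  finally show ?thesis by (simp add: pull_curvature_def diff_diff_eq del: fun_diff_def)
qed

end


section \<open>The canonical connection of the tangent bundle\<close>

subsection \<open>Horizontal and vertical parts\<close>

definition hor_vert_at ::
  "('a, 'i) tmanifold \<Rightarrow> ('a, 'i) tconn \<Rightarrow> ('a, 'i) tpoint \<Rightarrow> 'i tvec \<Rightarrow> 'i tvec \<Rightarrow> 'i tvec" where
  "hor_vert_at M nab \<xi> u v = hor_at M nab \<xi> u + vert_at M \<xi> v"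

lemma vert_part_add: "vert_part M nab \<xi> (w + w') = vert_part M nab \<xi> w + vert_part M nab \<xi> w'"
  by (simp add: vert_part_def gamma_at_conn_matrix hor_part_add conn_matrix_add distrib_right sum.distrib
      fun_eq_iff)

lemma vert_part_scale: "vert_part M nab \<xi> (tscale c w) = tscale c (vert_part M nab \<xi> w)"
  by (simp add: vert_part_def gamma_at_conn_matrix hor_part_scale conn_matrix_scale fun_eq_iff tscale_apply
      distrib_left sum_distrib_left mult_ac)

lemma hor_vert_at_add:
  "hor_vert_at M nab \<xi> (u + u') (v + v') = hor_vert_at M nab \<xi> u v + hor_vert_at M nab \<xi> u' v'"
  by (simp add: hor_vert_at_def hor_at_def vert_at_def gamma_at_conn_matrix conn_matrix_add distrib_right
      sum.distrib fun_eq_iff)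

lemma hor_vert_at_scale: "hor_vert_at M nab \<xi> (tscale c u) (tscale c v) =
    tscale c (hor_vert_at M nab \<xi> u v)"
  by (simp add: hor_vert_at_def hor_at_def vert_at_def gamma_at_conn_matrix conn_matrix_scale fun_eq_iff
      tscale_apply
      distrib_left sum_distrib_left mult_ac)

lemma hor_vert_at_zero: "hor_vert_at M nab \<xi> 0 0 = 0"
  by (simp add: hor_vert_at_def hor_at_def vert_at_def gamma_at_def fun_eq_iff)

lemma hor_vert_at_comb:
  "hor_vert_at M nab \<xi> (\<Sum>a\<in>A. tscale (c a) (u a)) (\<Sum>a\<in>A. tscale (c a) (v a)) =
     (\<Sum>a\<in>A. tscale (c a) (hor_vert_at M nab \<xi> (u a) (v a)))"
  by (induction A rule: infinite_finite_induct)
     (simp_all only: sum.infinite sum.empty sum.insert hor_vert_at_zero hor_vert_at_add hor_vert_at_scale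
     simp_thms)

lemma hor_lift_eq: "hor_lift M nab X = (\<lambda>\<xi>. hor_vert_at M nab \<xi> (X (tbase \<xi>)) 0)"
  by (simp add: hor_lift_def hor_vert_at_def vert_at_def fun_eq_iff)

lemma vert_lift_eq: "vert_lift M X = (\<lambda>\<xi>. hor_vert_at M nab \<xi> 0 (X (tbase \<xi>)))"
  by (simp add: vert_lift_def hor_vert_at_def hor_at_def gamma_at_def fun_eq_iff)

context tangent_bundle_connection
begin

lemma section_on_tfib: "section_on M (topspace (mtop TM)) tfib"
  unfolding section_on_def
proof (intro ballI conjI allI impI smooth_at_tfib)
  fix \<xi> assume "\<xi> \<in> topspace (mtop TM)"
  then show "tfib \<xi> \<in> tangent_space M (tbase \<xi>)" using T.topspace_iff_charts_at charts_at_TM_fibre by blast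
qed

lemma vert_part_eq_pull_deriv:
  assumes w: "w \<in> tangent_space TM \<xi>" and \<xi>: "\<xi> \<in> topspace (mtop TM)"
  shows "vert_part M nab \<xi> w = \<nabla> \<xi> w tfib"
  using dirder_tfib[OF w]
  by (intro ext) (simp add: vert_part_def pull_deriv_def gamma_at_conn_matrix charts_at_TM_eq[OF \<xi>])

lemma vert_part_tangent:
  "w \<in> tangent_space TM \<xi> \<Longrightarrow> \<xi> \<in> topspace (mtop TM) \<Longrightarrow> vert_part M nab \<xi> w \<in> tangent_space M (tbase \<xi>)"
  by (simp add: vert_part_eq_pull_deriv pull_deriv_tangent[OF openin_topspace _ section_on_tfib])

lemma hor_vert_at_parts:
  "w \<in> tangent_space TM \<xi> \<Longrightarrow> \<xi> \<in> topspace (mtop TM) \<Longrightarrow>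
   hor_vert_at M nab \<xi> (hor_part M w) (vert_part M nab \<xi> w) = w"
  unfolding hor_vert_at_def
  by (rule hor_vert_decomposition[symmetric])
     (simp_all add: T.tangent_outside T.tangent_beyond charts_at_TM_eq fun_eq_iff)

lemma tangent_TM_eqI:
  assumes "w \<in> tangent_space TM \<xi>" "w' \<in> tangent_space TM \<xi>" "\<xi> \<in> topspace (mtop TM)"
    and "hor_part M w = hor_part M w'" "vert_part M nab \<xi> w = vert_part M nab \<xi> w'"
  shows "w = w'"
  using assms hor_vert_at_parts by metis

lemma section_on_cong:
  assumes U: "openin (mtop TM) U" and W: "section_on M U W" and eq: "\<And>\<xi>. \<xi> \<in> U \<Longrightarrow> W \<xi> = W' \<xi>"
  shows "section_on M U W'"
  unfolding section_on_def
proof (intro ballI conjI allI impI)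
  fix \<xi> assume \<xi>: "\<xi> \<in> U"
  show "W' \<xi> \<in> tangent_space M (tbase \<xi>)" using section_on_tangent[OF W \<xi>] eq[OF \<xi>] by simp
  show "smooth_at TM (\<lambda>\<eta>. W' \<eta> i k) \<xi>" if "i \<in> charts_at TM \<xi>" "k < n" for i k
    by (rule T.smooth_at_cong[OF eventually_nhdsinI[OF U \<xi>] section_on_smooth_at[OF W \<xi> that]])
       (simp add: eq)
qed

lemma tangent_TM_expand:
  assumes w: "w \<in> tangent_space TM \<xi>" and i: "i \<in> charts_at TM \<xi>"
  shows "w = (\<Sum>a<n. tscale (hor_part M w i a) (hor_vert_at M nab \<xi> (coord_field M i a (tbase \<xi>)) 0))
    + (\<Sum>a<n. tscale (vert_part M nab \<xi> w i a) (hor_vert_at M nab \<xi> 0 (coord_field M i a (tbase \<xi>))))"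
proof -
  note top = T.charts_at_imp_topspace[OF i] and base = charts_at_TM_base[OF i]
  have "w = hor_vert_at M nab \<xi> (hor_part M w) 0 + hor_vert_at M nab \<xi> 0 (vert_part M nab \<xi> w)"
    using hor_vert_at_parts[OF w top] hor_vert_at_add[of M nab \<xi> "hor_part M w" 0 0 "vert_part M nab \<xi> w"]
    by simp
  then show ?thesis
    using tangent_expand[OF hor_part_tangent[OF w top] base]
        tangent_expand[OF vert_part_tangent[OF w top] base]
      hor_vert_at_comb[of M nab \<xi> "\<lambda>a. hor_part M w i a" "\<lambda>a. coord_field M i a (tbase \<xi>)" "{..<n}" "\<lambda>a. 0"]
      hor_vert_at_comb[of M nab \<xi> "\<lambda>a. vert_part M nab \<xi> w i a" "\<lambda>a. 0" "{..<n}"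
      "\<lambda>a. coord_field M i a (tbase \<xi>)"]
    by simp
qed

context
  fixes \<xi> u v
  assumes u: "u \<in> tangent_space M (tbase \<xi>)" and v: "v \<in> tangent_space M (tbase \<xi>)"
begin

lemma hor_part_hor_vert_at: "hor_part M (hor_vert_at M nab \<xi> u v) = u"
  and vert_part_hor_vert_at: "vert_part M nab \<xi> (hor_vert_at M nab \<xi> u v) = v"
  unfolding hor_vert_at_def hor_part_add vert_part_add parts_hor_at[OF u] parts_vert_at[OF v] by simp_all

lemma hor_vert_at_tangent:
  assumes \<xi>: "\<xi> \<in> topspace (mtop TM)"
  shows "hor_vert_at M nab \<xi> u v \<in> tangent_space TM \<xi>"
proof -
  obtain i where i: "i \<in> charts_at TM \<xi>" using \<xi> T.topspace_iff_charts_at by blast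
  note base = charts_at_TM_base[OF i]
  define w where "w = (\<Sum>a<mdim TM. tscale (hor_vert_at M nab \<xi> u v i a) (coord_field TM i a \<xi>))"
  have w: "w \<in> tangent_space TM \<xi>" unfolding w_def by (rule T.coord_field_comb(1)[OF i])
  have w_apply: "w i k = hor_vert_at M nab \<xi> u v i k" if "k < 2 * n" for k
    unfolding w_def using that by (intro T.coord_field_comb(2)[OF i]) simp
  have hor: "hor_part M w = u"
    by (rule tangent_eqI[OF hor_part_tangent[OF w \<xi>] u base])
       (simp add: hor_part_apply w_apply hor_vert_at_def hor_at_def vert_at_def base)
  have vert: "vert_part M nab \<xi> w = v"
    by (rule tangent_eqI[OF vert_part_tangent[OF w \<xi>] v base])
       (simp add: vert_part_def hor base w_apply hor_vert_at_def hor_at_def vert_at_def)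
  have "hor_vert_at M nab \<xi> u v = w" using hor_vert_at_parts[OF w \<xi>] by (simp add: hor vert)
  with w show ?thesis by simp
qed

end

lemma section_on_hor_part:
  assumes U: "openin (mtop TM) U" and X: "vfield TM U X"
  shows "section_on M U (\<lambda>\<xi>. hor_part M (X \<xi>))"
  unfolding section_on_def
  using hor_part_tangent[OF vfield_tangent[OF X] T.openin_imp_topspace[OF U]] T.vfield_smooth_at[OF U X]
  by (auto simp: hor_part_apply)

lemma section_on_vert_part:
  assumes U: "openin (mtop TM) U" and X: "vfield TM U X"
  shows "section_on M U (\<lambda>\<xi>. vert_part M nab \<xi> (X \<xi>))"
proof -
  have "section_on M U tfib" by (rule section_on_subset[OF openin_subset[OF U] section_on_tfib])
  from section_on_pull_deriv[OF U X this] show ?thesis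
  proof (rule section_on_cong[OF U])
    show "\<nabla> \<xi> (X \<xi>) tfib = vert_part M nab \<xi> (X \<xi>)" if "\<xi> \<in> U" for \<xi>
      by (rule vert_part_eq_pull_deriv[OF vfield_tangent[OF X that] T.openin_imp_topspace[OF U that],
          symmetric])
  qed
qed

lemma vfield_hor_vert_at:
  assumes U: "openin (mtop TM) U" and A: "section_on M U A" and B: "section_on M U B"
  shows "vfield TM U (\<lambda>\<xi>. hor_vert_at M nab \<xi> (A \<xi>) (B \<xi>))"
proof (rule T.vfield_pointwise[OF U])
  fix \<xi> assume \<xi>: "\<xi> \<in> U"
  note top = T.openin_imp_topspace[OF U \<xi>]
  show "hor_vert_at M nab \<xi> (A \<xi>) (B \<xi>) \<in> tangent_space TM \<xi>"
    by (rule hor_vert_at_tangent[OF section_on_tangent[OF A \<xi>] section_on_tangent[OF B \<xi>] top])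
  fix i k assume i: "i \<in> charts_at TM \<xi>" and k: "k < mdim TM"
  have "smooth_at TM (\<lambda>\<eta>. if k < n then A \<eta> i k
      else B \<eta> i (k - n) - (\<Sum>b<n. conn_matrix M nab i (tbase \<eta>) (A \<eta>) (k - n) b * tfib \<eta> i b)) \<xi>"
  proof (cases "k < n")
    case False
    then have "k - n < n" using k by simp
    with False show ?thesis
      by (auto intro!: T.smooth_at_diff T.smooth_at_sum[OF top] T.smooth_at_mult smooth_at_conn_matrix[OF i]
          smooth_at_tfib[OF i] section_on_smooth_at[OF A \<xi> i] section_on_smooth_at[OF B \<xi> i])
  qed (simp add: section_on_smooth_at[OF A \<xi> i])
  then show "smooth_at TM (\<lambda>\<eta>. hor_vert_at M nab \<eta> (A \<eta>) (B \<eta>) i k) \<xi>"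
  proof (rule T.smooth_at_cong[rotated])
    show "\<forall>\<^sub>F \<eta> in T.near \<xi>. (if k < n then A \<eta> i k
        else B \<eta> i (k - n) - (\<Sum>b<n. conn_matrix M nab i (tbase \<eta>) (A \<eta>) (k - n) b * tfib \<eta> i b)) =
        hor_vert_at M nab \<eta> (A \<eta>) (B \<eta>) i k"
      using k by (intro eventually_mono[OF T.eventually_near_charts_at[OF i]])
        (simp add: hor_vert_at_def hor_at_def vert_at_def gamma_at_conn_matrix charts_at_TM)
  qed
qed

lemma vfield_lifts:
  assumes U: "openin (mtop M) U" and X: "vfield M U X"
  shows "vfield TM (bundle_over M U) (hor_lift M nab X)" "vfield TM (bundle_over M U) (vert_lift M X)"
proof -
  have zero: "section_on M (bundle_over M U) (\<lambda>\<xi>. 0)"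
    using section_on_tbase[OF U vfield_zero[OF U]] by simp
  note lift = vfield_hor_vert_at[OF openin_bundle_over[OF U]] and section_X = section_on_tbase[OF U X]
  show "vfield TM (bundle_over M U) (hor_lift M nab X)"
    unfolding hor_lift_eq by (rule lift[OF section_X zero])
  show "vfield TM (bundle_over M U) (vert_lift M X)"
    unfolding vert_lift_eq[of M X nab] by (rule lift[OF zero section_X])
qed


subsection \<open>The canonical connection\<close>

definition pull_conn :: "('a, 'i) tconn" where
  "pull_conn X Y \<xi> =
     hor_vert_at M nab \<xi> (\<nabla> \<xi> (X \<xi>) (\<lambda>\<eta>. hor_part M (Y \<eta>))) (\<nabla> \<xi> (X \<xi>) (\<lambda>\<eta>. vert_part M nab \<eta> (Y \<eta>)))"

lemma connection_pull_conn: "connection TM pull_conn"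
proof (rule connectionI)
  fix U X Y assume U: "openin (mtop TM) U" and X: "vfield TM U X" and Y: "vfield TM U Y"
  show "vfield TM U (pull_conn X Y)"
    unfolding pull_conn_def[abs_def]
    by (intro vfield_hor_vert_at U section_on_pull_deriv X section_on_hor_part section_on_vert_part Y)
next
  fix U X X' Y \<xi> assume "vfield TM U X" "vfield TM U X'" "vfield TM U Y"
  show "pull_conn (X + X') Y \<xi> = pull_conn X Y \<xi> + pull_conn X' Y \<xi>"
    unfolding pull_conn_def plus_fun_apply[of X X' \<xi>] pull_deriv_add_vec hor_vert_at_add ..
next
  fix U X Y f \<xi> assume "vfield TM U X" "vfield TM U Y"
  show "pull_conn (fscale f X) Y \<xi> = tscale (f \<xi>) (pull_conn X Y \<xi>)"
    unfolding pull_conn_def fscale_apply pull_deriv_scale_vec hor_vert_at_scale ..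
next
  fix U X Y Y' \<xi>
  assume "vfield TM U X" and U: "openin (mtop TM) U" and Y: "vfield TM U Y" "vfield TM U Y'" and \<xi>: "\<xi> \<in> U"
  note add = pull_deriv_add[OF \<xi> T.openin_imp_topspace[OF U \<xi>]]
  show "pull_conn X (Y + Y') \<xi> = pull_conn X Y \<xi> + pull_conn X Y' \<xi>"
    unfolding pull_conn_def plus_fun_apply[of Y Y'] hor_part_add vert_part_add
      add[OF section_on_hor_part[OF U Y(1)] section_on_hor_part[OF U Y(2)]]
      add[OF section_on_vert_part[OF U Y(1)] section_on_vert_part[OF U Y(2)]] hor_vert_at_add ..
next
  fix U X Y f \<xi>
  assume "vfield TM U X" and U: "openin (mtop TM) U" and Y: "vfield TM U Y" and f: "smooth_fun TM U f"
  and \<xi>: "\<xi> \<in> U"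
  note top = T.openin_imp_topspace[OF U \<xi>]
  have "smooth_at TM f \<xi>" using f \<xi> T.smooth_fun_iff_smooth_at[OF U] by blast
  note leibniz = pull_deriv_leibniz[OF \<xi> top this]
  show "pull_conn X (fscale f Y) \<xi> = tscale (dirder TM \<xi> (X \<xi>) f) (Y \<xi>) + tscale (f \<xi>) (pull_conn X Y \<xi>)"
    unfolding pull_conn_def fscale_apply hor_part_scale vert_part_scale
      leibniz[OF section_on_hor_part[OF U Y]] leibniz[OF section_on_vert_part[OF U Y]]
      hor_vert_at_add hor_vert_at_scale hor_vert_at_parts[OF vfield_tangent[OF Y \<xi>] top] ..
next
  fix U X X' Y Y' \<xi>
  assume "vfield TM U X" "vfield TM U X'" "vfield TM U Y" "vfield TM U Y'" and U: "openin (mtop TM) U"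
    and eq: "\<And>\<eta>. \<eta> \<in> U \<Longrightarrow> X \<eta> = X' \<eta>" "\<And>\<eta>. \<eta> \<in> U \<Longrightarrow> Y \<eta> = Y' \<eta>" and \<xi>: "\<xi> \<in> U"
  have parts: "\<nabla> \<xi> w (\<lambda>\<eta>. F \<eta> (Y \<eta>)) = \<nabla> \<xi> w (\<lambda>\<eta>. F \<eta> (Y' \<eta>))" for w F
    by (rule pull_deriv_cong[OF eventually_nhdsinI[OF U \<xi>] T.openin_imp_topspace[OF U \<xi>]]) (simp add: eq)
  show "pull_conn X Y \<xi> = pull_conn X' Y' \<xi>"
    unfolding pull_conn_def eq(1)[OF \<xi>] parts[of _ "\<lambda>\<eta>. hor_part M"] parts[of _ "vert_part M nab"] ..
qed

lemma pull_conn_lifts: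
  assumes U: "openin (mtop M) U" and A: "vfield M U A" and Y: "vfield M U Y" and \<xi>: "\<xi> \<in> bundle_over M U"
    and w: "X \<xi> \<in> tangent_space TM \<xi>" "hor_part M (X \<xi>) = A (tbase \<xi>)"
  shows "pull_conn X (hor_lift M nab Y) \<xi> = hor_lift M nab (nab A Y) \<xi>"
    and "pull_conn X (vert_lift M Y) \<xi> = vert_lift M (nab A Y) \<xi>"
proof -
  note V = openin_bundle_over[OF U]
  note cong = pull_deriv_cong[OF eventually_nhdsinI[OF V \<xi>] T.openin_imp_topspace[OF V \<xi>]]
  have tangent: "Y (tbase \<eta>) \<in> tangent_space M (tbase \<eta>)" if "\<eta> \<in> bundle_over M U" for \<eta>
    using that by (auto simp: bundle_over_iff vfield_tangent[OF Y])
  note hor_parts = parts_hor_at[OF tangent] and vert_parts = parts_vert_at[OF tangent]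
  have Y_deriv: "\<nabla> \<xi> (X \<xi>) (\<lambda>\<eta>. Y (tbase \<eta>)) = nab A Y (tbase \<xi>)" by (rule pull_deriv_tbase[OF U A Y \<xi> w])
  have "\<nabla> \<xi> (X \<xi>) (\<lambda>\<eta>. hor_part M (hor_lift M nab Y \<eta>)) = nab A Y (tbase \<xi>)"
    "\<nabla> \<xi> (X \<xi>) (\<lambda>\<eta>. vert_part M nab \<eta> (vert_lift M Y \<eta>)) = nab A Y (tbase \<xi>)"
    by (rule trans[OF cong Y_deriv]; simp add: hor_lift_def vert_lift_def hor_parts vert_parts)+
  moreover have "\<nabla> \<xi> (X \<xi>) (\<lambda>\<eta>. vert_part M nab \<eta> (hor_lift M nab Y \<eta>)) = 0"
    "\<nabla> \<xi> (X \<xi>) (\<lambda>\<eta>. hor_part M (vert_lift M Y \<eta>)) = 0"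
    by (rule trans[OF cong pull_deriv_zero]; simp add: hor_lift_def vert_lift_def hor_parts vert_parts)+
  ultimately show "pull_conn X (hor_lift M nab Y) \<xi> = hor_lift M nab (nab A Y) \<xi>"
    "pull_conn X (vert_lift M Y) \<xi> = vert_lift M (nab A Y) \<xi>"
    by (simp_all only: pull_conn_def hor_lift_eq vert_lift_eq[of M _ nab])
qed

lemma canonical_pull_conn: "canonical_conn M nab pull_conn"
  unfolding canonical_conn_def
proof (intro conjI connection_pull_conn allI impI ballI)
  fix U X Y \<xi> assume "openin (mtop M) U \<and> vfield M U X \<and> vfield M U Y" and \<xi>: "\<xi> \<in> bundle_over M U"
  then have U: "openin (mtop M) U" and X: "vfield M U X" and Y: "vfield M U Y" by auto
  have base: "tbase \<xi> \<in> U" using \<xi> by (simp add: bundle_over_iff)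
  note lifts = vfield_tangent[OF vfield_lifts(1)[OF U X] \<xi>] vfield_tangent[OF vfield_lifts(2)[OF U X] \<xi>]
  have "hor_part M (hor_lift M nab X \<xi>) = X (tbase \<xi>)" "hor_part M (vert_lift M X \<xi>) =
      (0 :: ('a, 'i) tfield) (tbase \<xi>)"
    using parts_hor_at parts_vert_at vfield_tangent[OF X base] by (simp_all add: hor_lift_def vert_lift_def)
  from pull_conn_lifts[where X = "hor_lift M nab X", OF U X Y \<xi> lifts(1) this(1)]
    pull_conn_lifts[where X = "vert_lift M X", OF U vfield_zero[OF U] Y \<xi> lifts(2) this(2)]
  show "pull_conn (hor_lift M nab X) (hor_lift M nab Y) \<xi> = hor_lift M nab (nab X Y) \<xi>"
    "pull_conn (hor_lift M nab X) (vert_lift M Y) \<xi> = vert_lift M (nab X Y) \<xi>"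
    "pull_conn (vert_lift M X) (hor_lift M nab Y) \<xi> = 0" "pull_conn (vert_lift M X) (vert_lift M Y) \<xi> = 0"
    by (simp_all only: hor_lift_eq vert_lift_eq[of M _ nab] nab_zero_left[OF U Y base] hor_vert_at_zero)
qed

lemma vfield_generators_lifts:
  assumes i: "i \<in> charts M" and V: "openin (mtop TM) V" "V \<subseteq> bundle_over M (cdom M i)"
  shows "vfield_generators TM V (2 * n)
    (\<lambda>a. if a < n then hor_lift M nab (coord_field M i a) else vert_lift M (coord_field M i (a - n)))"
    (is "vfield_generators TM _ _ ?E")
  unfolding vfield_generators_def
proof (intro conjI allI impI)
  show "vfield TM V (?E a)" if "a < 2 * n" for a
    using vfield_lifts[OF openin_cdom[OF i] coord_field_vfield[OF i]] that
    by (auto intro: vfield_subset[OF V(2)])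
  fix X assume X: "vfield TM V X"
  let ?f = "\<lambda>a \<xi>. if a < n then hor_part M (X \<xi>) i a else vert_part M nab \<xi> (X \<xi>) i (a - n)"
  have charts: "i \<in> charts_at TM \<xi>" if "\<xi> \<in> V" for \<xi> using that i V(2) by (auto simp: charts_at_def)
  have "smooth_fun TM V (?f a)" if "a < 2 * n" for a
    unfolding T.smooth_fun_iff_smooth_at[OF V(1)]
    using section_on_smooth_at[OF section_on_hor_part[OF V(1) X] _ charts]
      section_on_smooth_at[OF section_on_vert_part[OF V(1) X] _ charts] that by (cases "a < n") auto
  moreover have "X \<xi> = (\<Sum>a<2 * n. tscale (?f a \<xi>) (?E a \<xi>))" if \<xi>: "\<xi> \<in> V" for \<xi>
    unfolding mult_2 sum_lessThan_add
    using tangent_TM_expand[OF vfield_tangent[OF X \<xi>] charts[OF \<xi>]]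
    by (simp add: hor_lift_eq vert_lift_eq[of M _ nab])
  ultimately show "\<exists>f. (\<forall>a<2 * n. smooth_fun TM V (f a)) \<and> (\<forall>\<xi>\<in>V. X \<xi> =
      (\<Sum>a<2 * n. tscale (f a \<xi>) (?E a \<xi>)))"
    by (intro exI[of _ ?f]) blast
qed

lemma canonical_conn_eq_pull_conn:
  assumes nab': "canonical_conn M nab nab'" and U: "openin (mtop TM) U" "\<xi> \<in> U"
    and X: "vfield TM U X" and Y: "vfield TM U Y"
  shows "nab' X Y \<xi> = pull_conn X Y \<xi>"
proof -
  obtain i where i: "i \<in> charts_at TM \<xi>" using T.openin_ex_chart[OF U] ..
  then have ic: "i \<in> charts M" "\<xi> \<in> bundle_over M (cdom M i)" by (simp_all add: charts_at_def)
  have V: "openin (mtop TM) (U \<inter> bundle_over M (cdom M i))" "\<xi> \<in> U \<inter> bundle_over M (cdom M i)"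
    using U openin_bundle_over[OF openin_cdom[OF ic(1)]] ic(2) by auto
  interpret connection_mfd TM nab' by unfold_locales (use nab' in \<open>simp add: canonical_conn_def\<close>)
  let ?E = "\<lambda>a. if a < n then hor_lift M nab (coord_field M i a) else vert_lift M (coord_field M i (a - n))"
  show ?thesis
  proof (rule connection_eq_on_generators[OF connection_pull_conn V
    vfield_generators_lifts[OF ic(1) V(1) Int_lower2]])
    fix a b assume "a < 2 * n" "b < 2 * n"
    define c d where "c = (if a < n then a else a - n)" and "d = (if b < n then b else b - n)"
    have "vfield M (cdom M i) (coord_field M i c)" "vfield M (cdom M i) (coord_field M i d)"
      using \<open>a < 2 * n\<close> \<open>b < 2 * n\<close> by (auto simp: c_def d_def intro: coord_field_vfield[OF ic(1)])
    then show "nab' (?E a) (?E b) \<xi> = pull_conn (?E a) (?E b) \<xi>"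
      using nab' canonical_pull_conn openin_cdom[OF ic(1)] ic(2)
      unfolding canonical_conn_def by (cases "a < n"; cases "b < n") (simp_all add: c_def d_def)
  qed (intro vfield_subset[OF Int_lower1] X Y)+
qed

lemma canonical_lift_conn: "canonical_conn M nab (lift_conn M nab)"
  unfolding lift_conn_def by (rule someI[of "canonical_conn M nab"]) (rule canonical_pull_conn)

sublocale T: connection_mfd "tangent_bundle M" "lift_conn M nab"
  by unfold_locales (use canonical_lift_conn in \<open>simp add: canonical_conn_def\<close>)

lemma parts_lift_conn:
  assumes U: "openin (mtop TM) U" and X: "vfield TM U X" and Y: "vfield TM U Y" and \<xi>: "\<xi> \<in> U"
  shows "hor_part M (lift_conn M nab X Y \<xi>) = \<nabla> \<xi> (X \<xi>) (\<lambda>\<eta>. hor_part M (Y \<eta>))"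
    and "vert_part M nab \<xi> (lift_conn M nab X Y \<xi>) = \<nabla> \<xi> (X \<xi>) (\<lambda>\<eta>. vert_part M nab \<eta> (Y \<eta>))"
proof -
  have "\<nabla> \<xi> (X \<xi>) (\<lambda>\<eta>. hor_part M (Y \<eta>)) \<in> tangent_space M (tbase \<xi>)"
    "\<nabla> \<xi> (X \<xi>) (\<lambda>\<eta>. vert_part M nab \<eta> (Y \<eta>)) \<in> tangent_space M (tbase \<xi>)"
    by (rule pull_deriv_tangent[OF U \<xi> section_on_hor_part[OF U Y] vfield_tangent[OF X \<xi>]],
        rule pull_deriv_tangent[OF U \<xi> section_on_vert_part[OF U Y] vfield_tangent[OF X \<xi>]])
  then show "hor_part M (lift_conn M nab X Y \<xi>) = \<nabla> \<xi> (X \<xi>) (\<lambda>\<eta>. hor_part M (Y \<eta>))"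
    "vert_part M nab \<xi> (lift_conn M nab X Y \<xi>) = \<nabla> \<xi> (X \<xi>) (\<lambda>\<eta>. vert_part M nab \<eta> (Y \<eta>))"
    unfolding canonical_conn_eq_pull_conn[OF canonical_lift_conn U \<xi> X Y] pull_conn_def
    by (rule hor_part_hor_vert_at, rule vert_part_hor_vert_at)
qed

lemma lift_conn_eqI:
  assumes U: "openin (mtop TM) U" "\<xi> \<in> U" and X: "vfield TM U X" and Y: "vfield TM U Y"
    and w: "w \<in> tangent_space TM \<xi>"
    and "\<nabla> \<xi> (X \<xi>) (\<lambda>\<eta>. hor_part M (Y \<eta>)) = hor_part M w"
    and "\<nabla> \<xi> (X \<xi>) (\<lambda>\<eta>. vert_part M nab \<eta> (Y \<eta>)) = vert_part M nab \<xi> w"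
  shows "lift_conn M nab X Y \<xi> = w"
  by (rule tangent_TM_eqI[OF vfield_tangent[OF T.nab_vfield[OF U(1) X Y] U(2)] w
      T.openin_imp_topspace[OF U]])
     (simp_all add: parts_lift_conn[OF U(1) X Y U(2)] assms(6,7))

end

context tangent_bundle_affine
begin

lemma pull_deriv_hor_part_torsionless:
  assumes U: "openin (mtop TM) U" "\<xi> \<in> U" and X: "vfield TM U X" and Y: "vfield TM U Y"
  shows "\<nabla> \<xi> (X \<xi>) (\<lambda>\<eta>. hor_part M (Y \<eta>)) =
      \<nabla> \<xi> (Y \<xi>) (\<lambda>\<eta>. hor_part M (X \<eta>)) + hor_part M (bracket TM X Y \<xi>)"
proof -
  obtain i where i: "i \<in> charts_at TM \<xi>" using T.openin_ex_chart[OF U] ..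
  have "hor_part M (bracket TM X Y \<xi>) \<in> tangent_space M (tbase \<xi>)"
    by (rule hor_part_tangent[OF vfield_tangent[OF T.bracket_vfield[OF U(1) X Y] U(2)]
        T.openin_imp_topspace[OF U]])
  moreover have "\<nabla> \<xi> (A \<xi>) (\<lambda>\<eta>. hor_part M (B \<eta>)) \<in> tangent_space M (tbase \<xi>)"
    if "vfield TM U A" "vfield TM U B" for A B
    by (rule pull_deriv_tangent[OF U section_on_hor_part[OF U(1) that(2)] vfield_tangent[OF that(1) U(2)]])
  ultimately show ?thesis
    using conn_matrix_commute[OF charts_at_TM_base[OF i], of "hor_part M (X \<xi>)" _ "hor_part M (Y \<xi>)"]
    by (intro tangent_eqI[OF _ _ charts_at_TM_base[OF i]] tangent_add X Y)
       (simp_all add: X Y pull_deriv_apply[OF i] hor_part_apply T.bracket_apply[OF i])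
qed

lemma torsionless_lift_conn: "torsionless TM (lift_conn M nab)"
  unfolding torsionless_def
proof (intro allI impI ballI)
  fix U X Y \<xi> assume "openin (mtop TM) U \<and> vfield TM U X \<and> vfield TM U Y" and \<xi>: "\<xi> \<in> U"
  then have U: "openin (mtop TM) U" and X: "vfield TM U X" and Y: "vfield TM U Y" by auto
  note top = T.openin_imp_topspace[OF U] and bracket = vfield_tangent[OF T.bracket_vfield[OF U X Y] \<xi>]
  have vert: "\<nabla> \<xi> (X \<xi>) (\<lambda>\<eta>. vert_part M nab \<eta> (Z \<eta>)) = \<nabla> \<xi> (X \<xi>) (\<lambda>\<eta>. \<nabla> \<eta> (Z \<eta>) tfib)" if "vfield TM U Z"
    for X Z
    by (rule pull_deriv_cong[OF eventually_nhdsinI[OF U \<xi>] top[OF \<xi>]])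
       (rule vert_part_eq_pull_deriv[OF vfield_tangent[OF that] top])
  have "lift_conn M nab X Y \<xi> = lift_conn M nab Y X \<xi> + bracket TM X Y \<xi>"
  proof (rule lift_conn_eqI[OF U \<xi> X Y])
    show "lift_conn M nab Y X \<xi> + bracket TM X Y \<xi> \<in> tangent_space TM \<xi>"
      by (rule T.tangent_add[OF vfield_tangent[OF T.nab_vfield[OF U Y X] \<xi>] bracket])
    show "\<nabla> \<xi> (X \<xi>) (\<lambda>\<eta>. hor_part M (Y \<eta>)) = hor_part M (lift_conn M nab Y X \<xi> + bracket TM X Y \<xi>)"
      unfolding hor_part_add parts_lift_conn[OF U Y X \<xi>]
      by (rule pull_deriv_hor_part_torsionless[OF U \<xi> X Y])
    show "\<nabla> \<xi> (X \<xi>) (\<lambda>\<eta>. vert_part M nab \<eta> (Y \<eta>)) =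
        vert_part M nab \<xi> (lift_conn M nab Y X \<xi> + bracket TM X Y \<xi>)"
      unfolding vert_part_add parts_lift_conn[OF U Y X \<xi>] vert[OF X] vert[OF Y]
          vert_part_eq_pull_deriv[OF bracket top[OF \<xi>]]
      by (rule pull_deriv_commute[OF U \<xi> X Y section_on_subset[OF openin_subset[OF U] section_on_tfib]])
  qed
  then show "lift_conn M nab X Y \<xi> - lift_conn M nab Y X \<xi> = bracket TM X Y \<xi>" by simp
qed

lemma flat_lift_conn: "flat TM (lift_conn M nab)"
  unfolding flat_def
proof (intro allI impI ballI)
  fix U X Y Z \<xi> assume "openin (mtop TM) U \<and> vfield TM U X \<and> vfield TM U Y \<and> vfield TM U Z" and \<xi>: "\<xi> \<in> U"
  then have U: "openin (mtop TM) U" and X: "vfield TM U X" and Y: "vfield TM U Y" and Z: "vfield TM U Z"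
    by auto
  note top = T.openin_imp_topspace[OF U \<xi>] and bracket = T.bracket_vfield[OF U X Y]
  note near = pull_deriv_cong[OF eventually_nhdsinI[OF U \<xi>] top]
  have hor: "\<nabla> \<xi> w (\<lambda>\<eta>. hor_part M (lift_conn M nab Y Z \<eta>)) = \<nabla> \<xi> w (\<lambda>\<eta>. \<nabla> \<eta> (Y \<eta>) (\<lambda>\<zeta>. hor_part M (Z \<zeta>)))"
    if "vfield TM U Y" for w Y
    by (rule near) (rule parts_lift_conn(1)[OF U that Z])
  have vert: "\<nabla> \<xi> w (\<lambda>\<eta>. vert_part M nab \<eta> (lift_conn M nab Y Z \<eta>)) =
      \<nabla> \<xi> w (\<lambda>\<eta>. \<nabla> \<eta> (Y \<eta>) (\<lambda>\<zeta>. vert_part M nab \<zeta> (Z \<zeta>)))"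
    if "vfield TM U Y" for w Y
    by (rule near) (rule parts_lift_conn(2)[OF U that Z])
  note nab_Z = T.nab_vfield[OF U _ Z]
  have "lift_conn M nab X (lift_conn M nab Y Z) \<xi> =
      lift_conn M nab Y (lift_conn M nab X Z) \<xi> + lift_conn M nab (bracket TM X Y) Z \<xi>" (is "_ = ?w")
  proof (rule lift_conn_eqI[OF U \<xi> X nab_Z[OF Y]])
    show "?w \<in> tangent_space TM \<xi>"
      by (intro T.tangent_add vfield_tangent[OF T.nab_vfield[OF U] \<xi>] nab_Z X Y Z bracket)
    show "\<nabla> \<xi> (X \<xi>) (\<lambda>\<eta>. hor_part M (lift_conn M nab Y Z \<eta>)) = hor_part M ?w"
      unfolding hor_part_add parts_lift_conn[OF U Y nab_Z[OF X] \<xi>] parts_lift_conn[OF U bracket Z \<xi>]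
          hor[OF X] hor[OF Y]
      by (rule pull_deriv_commute[OF U \<xi> X Y section_on_hor_part[OF U Z]])
    show "\<nabla> \<xi> (X \<xi>) (\<lambda>\<eta>. vert_part M nab \<eta> (lift_conn M nab Y Z \<eta>)) = vert_part M nab \<xi> ?w"
      unfolding vert_part_add parts_lift_conn[OF U Y nab_Z[OF X] \<xi>] parts_lift_conn[OF U bracket Z \<xi>]
          vert[OF X] vert[OF Y]
      by (rule pull_deriv_commute[OF U \<xi> X Y section_on_vert_part[OF U Z]])
  qed
  then show "lift_conn M nab X (lift_conn M nab Y Z) \<xi> - lift_conn M nab Y (lift_conn M nab X Z) \<xi>
      - lift_conn M nab (bracket TM X Y) Z \<xi> = 0"
    by simp
qed

sublocale T: affine_mfd "tangent_bundle M" "lift_conn M nab"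
  by unfold_locales (rule torsionless_lift_conn, rule flat_lift_conn)

end


section \<open>The metric of the tangent bundle\<close>

locale tangent_bundle_metric = tangent_bundle_affine M nab + affine_metric_mfd M nab g
  for M :: "('a, 'i) tmanifold" and nab g
begin

abbreviation "G \<equiv> lift_metric M nab g"

lemma metric_section_chart:
  assumes U: "openin (mtop TM) U" "\<xi> \<in> U" and A: "section_on M U A" and B: "section_on M U B"
    and i: "i \<in> charts_at TM \<xi>"
  shows "\<forall>\<^sub>F \<eta> in T.near \<xi>. (\<Sum>b<n. \<Sum>c<n. A \<eta> i b * B \<eta> i c *
    g (tbase \<eta>) (coord_field M i b (tbase \<eta>)) (coord_field M i c (tbase \<eta>))) = g (tbase \<eta>) (A \<eta>) (B \<eta>)"
proof -
  have "\<forall>\<^sub>F \<eta> in T.near \<xi>. \<eta> \<in> U" by (rule eventually_nhdsinI[OF U])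
  then show ?thesis
    using T.eventually_near_charts_at[OF i]
    by eventually_elim (rule g_expand[symmetric, OF charts_at_TM_base section_on_tangent[OF A]
        section_on_tangent[OF B]])
qed

lemma smooth_at_g_coord_field_tbase:
  "i \<in> charts_at TM \<xi> \<Longrightarrow> b < n \<Longrightarrow> c < n \<Longrightarrow>
   smooth_at TM (\<lambda>\<eta>. g (tbase \<eta>) (coord_field M i b (tbase \<eta>)) (coord_field M i c (tbase \<eta>))) \<xi>"
  by (rule smooth_at_tbase[OF smooth_at_g_coord_field[OF charts_at_TM_base] T.charts_at_imp_topspace])

lemma smooth_at_metric_section:
  assumes U: "openin (mtop TM) U" "\<xi> \<in> U" and A: "section_on M U A" and B: "section_on M U B"
  shows "smooth_at TM (\<lambda>\<eta>. g (tbase \<eta>) (A \<eta>) (B \<eta>)) \<xi>"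
proof -
  obtain i where i: "i \<in> charts_at TM \<xi>" using T.openin_ex_chart[OF U] ..
  show ?thesis
    by (rule T.smooth_at_cong[OF metric_section_chart[OF U A B i]])
       (intro T.smooth_at_sum T.smooth_at_mult smooth_at_g_coord_field_tbase[OF i]
       section_on_smooth_at[OF A U(2) i]
         section_on_smooth_at[OF B U(2) i] T.charts_at_imp_topspace[OF i], simp_all)
qed

lemma dirder_metric_section_chart:
  assumes U: "openin (mtop TM) U" "\<xi> \<in> U" and A: "section_on M U A" and B: "section_on M U B"
    and i: "i \<in> charts_at TM \<xi>"
  shows "dirder TM \<xi> w (\<lambda>\<eta>. g (tbase \<eta>) (A \<eta>) (B \<eta>)) = (\<Sum>b<n. \<Sum>c<n.
    dirder TM \<xi> w (\<lambda>\<eta>. A \<eta> i b) * B \<xi> i c * g (tbase \<xi>) (coord_field M i b (tbase \<xi>))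
    (coord_field M i c (tbase \<xi>))
    + A \<xi> i b * dirder TM \<xi> w (\<lambda>\<eta>. B \<eta> i c) * g (tbase \<xi>) (coord_field M i b (tbase \<xi>))
    (coord_field M i c (tbase \<xi>))
    + A \<xi> i b * B \<xi> i c *
      dirder TM \<xi> w (\<lambda>\<eta>. g (tbase \<eta>) (coord_field M i b (tbase \<eta>)) (coord_field M i c (tbase \<eta>))))"
  unfolding T.dirder_cong[OF metric_section_chart[OF U A B i] T.charts_at_imp_topspace[OF i], symmetric]
  by (rule T.dirder_sum_sum_mult[OF T.charts_at_imp_topspace[OF i]])
     (simp_all add: section_on_smooth_at[OF A U(2) i] section_on_smooth_at[OF B U(2) i]
     smooth_at_g_coord_field_tbase[OF i])

lemma dirder_metric_section:
  assumes U: "openin (mtop TM) U" "\<xi> \<in> U" and A: "section_on M U A" and B: "section_on M U B"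
    and w: "w \<in> tangent_space TM \<xi>"
  shows "dirder TM \<xi> w (\<lambda>\<eta>. g (tbase \<eta>) (A \<eta>) (B \<eta>)) =
    g (tbase \<xi>) (\<nabla> \<xi> w A) (B \<xi>) + g (tbase \<xi>) (A \<xi>) (\<nabla> \<xi> w B) + C (tbase \<xi>) (hor_part M w) (A \<xi>) (B \<xi>)"
proof -
  obtain i where i: "i \<in> charts_at TM \<xi>" using T.openin_ex_chart[OF U] ..
  note top = T.charts_at_imp_topspace[OF i] and base = charts_at_TM_base[OF i]
  let ?p = "tbase \<xi>" and ?E = "coord_field M i"
  have p: "openin (mtop M) (cdom M i)" "?p \<in> cdom M i" and ic: "i \<in> charts M"
    using base by (simp_all add: charts_at_iff openin_cdom)
  note E = coord_field_vfield[OF ic] and Et = coord_field_tangent[OF base]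
  obtain X where X: "vfield M (cdom M i) X" "X ?p = hor_part M w"
    by (rule tangent_extend[OF hor_part_tangent[OF w top] base])
  have nab_E: "nab X (?E b) ?p \<in> tangent_space M ?p" if "b < n" for b
    by (rule vfield_tangent[OF nab_vfield[OF p(1) X(1) E[OF that]] p(2)])
  have nabla_metric: "dirder TM \<xi> w (\<lambda>\<eta>. g (tbase \<eta>) (?E b (tbase \<eta>)) (?E c (tbase \<eta>)))
      - g ?p (nab X (?E b) ?p) (?E c ?p)
      - g ?p (?E b ?p) (nab X (?E c) ?p) =
      C ?p (hor_part M w) (?E b ?p) (?E c ?p)" if "b < n" "c < n" for b c
    using nabla_metric_vfield[OF p X(1) E[OF that(1)] E[OF that(2)]]
        dirder_tbase[OF w top smooth_at_g_coord_field[OF base that]]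
    by (simp add: X(2))
  have "dirder TM \<xi> w (\<lambda>\<eta>. g (tbase \<eta>) (A \<eta>) (B \<eta>)) - g ?p (\<nabla> \<xi> w A) (\<Sum>c<n. tscale (B \<xi> i c) (?E c ?p))
      - g ?p (\<Sum>b<n. tscale (A \<xi> i b) (?E b ?p)) (\<nabla> \<xi> w B) =
      (\<Sum>b<n. \<Sum>c<n. A \<xi> i b * B \<xi> i c * (dirder TM \<xi> w (\<lambda>\<eta>. g (tbase \<eta>) (?E b (tbase \<eta>)) (?E c (tbase \<eta>)))
        - g ?p (nab X (?E b) ?p) (?E c ?p) - g ?p (?E b ?p) (nab X (?E c) ?p)))"
    unfolding dirder_metric_section_chart[OF U A B i] pull_deriv_expand[OF U A i w X(2)[symmetric] X(1)]
      pull_deriv_expand[OF U B i w X(2)[symmetric] X(1)]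
    by (rule bilinear_at_product_rule[OF g_bilinear[OF tbase_in_topspace[OF top]]]) (simp_all add: Et nab_E)
  also have "\<dots> = (\<Sum>b<n. \<Sum>c<n. A \<xi> i b * B \<xi> i c * C ?p (hor_part M w) (?E b ?p) (?E c ?p))"
    by (simp add: nabla_metric)
  also have "\<dots> = C ?p (hor_part M w) (\<Sum>b<n. tscale (A \<xi> i b) (?E b ?p)) (\<Sum>c<n. tscale (B \<xi> i c) (?E c ?p))"
    by (rule bilinear_at_comb[OF trilinear_atD(1)[OF nabla_metric_trilinear hor_part_tangent[OF w top]],
        symmetric])
       (simp_all add: Et)
  finally show ?thesis
    using tangent_expand[OF section_on_tangent[OF A U(2)] base]
        tangent_expand[OF section_on_tangent[OF B U(2)] base] by simp
qed

lemma riemannian_lift_metric: "riemannian_metric TM G"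
  unfolding riemannian_metric_def
proof (intro conjI ballI allI impI)
  fix \<xi> u assume \<xi>: "\<xi> \<in> topspace (mtop TM)" and u: "u \<in> tangent_space TM \<xi>"
  note p = tbase_in_topspace[OF \<xi>] and parts = hor_part_tangent[OF _ \<xi>] vert_part_tangent[OF _ \<xi>]
  show "G \<xi> u u > 0" if "u \<noteq> 0"
  proof -
    have nonneg: "g (tbase \<xi>) v v \<ge> 0" if "v \<in> tangent_space M (tbase \<xi>)" for v
      using g_pos[OF p that] linear_at_zero[OF g_linear_left[OF p that]] by (cases "v = 0") auto
    have "hor_part M u \<noteq> 0 \<or> vert_part M nab \<xi> u \<noteq> 0"
      using hor_vert_at_parts[OF u \<xi>] that hor_vert_at_zero by metis
    then show ?thesis
      using g_pos[OF p parts(1)[OF u]] g_pos[OF p parts(2)[OF u]] nonneg[OF parts(1)[OF u]]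
          nonneg[OF parts(2)[OF u]]
      by (auto simp: lift_metric_def intro: add_pos_nonneg add_nonneg_pos)
  qed
  fix v assume v: "v \<in> tangent_space TM \<xi>"
  show "G \<xi> u v = G \<xi> v u" by (simp add: lift_metric_def g_commute[OF p parts(1)[OF u] parts(1)[OF v]]
        g_commute[OF p parts(2)[OF u] parts(2)[OF v]])
  show "G \<xi> (tscale c u) v = c * G \<xi> u v" for c
    by (simp add: lift_metric_def hor_part_scale vert_part_scale linear_at_scale[OF g_linear_left[OF p]]
        parts u v distrib_left)
  show "G \<xi> (u + v) w = G \<xi> u w + G \<xi> v w" if "w \<in> tangent_space TM \<xi>" for w
    by (simp add: lift_metric_def hor_part_add vert_part_add linear_at_add[OF g_linear_left[OF p]] parts u v
        that
        del: plus_fun_apply)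
next
  fix U X Y assume "openin (mtop TM) U \<and> vfield TM U X \<and> vfield TM U Y"
  then have U: "openin (mtop TM) U" and X: "vfield TM U X" and Y: "vfield TM U Y" by auto
  show "smooth_fun TM U (\<lambda>\<xi>. G \<xi> (X \<xi>) (Y \<xi>))"
    unfolding T.smooth_fun_iff_smooth_at[OF U] lift_metric_def
    by (intro ballI T.smooth_at_add smooth_at_metric_section[OF U] section_on_hor_part[OF U]
        section_on_vert_part[OF U] X Y)
qed

sublocale T: affine_metric_mfd "tangent_bundle M" "lift_conn M nab" "lift_metric M nab g"
  by unfold_locales (rule riemannian_lift_metric)


subsection \<open>Trace forms of the lifted metric\<close>

lemma nabla_metric_lift:
  assumes \<xi>: "\<xi> \<in> topspace (mtop TM)"
    and u: "u \<in> tangent_space TM \<xi>" and v: "v \<in> tangent_space TM \<xi>" and w: "w \<in> tangent_space TM \<xi>"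
  shows "T.C \<xi> u v w = C (tbase \<xi>) (hor_part M u) (hor_part M v) (hor_part M w)
    + C (tbase \<xi>) (hor_part M u) (vert_part M nab \<xi> v) (vert_part M nab \<xi> w)"
proof -
  obtain i where i: "i \<in> charts_at TM \<xi>" using \<xi> T.topspace_iff_charts_at by blast
  have U: "openin (mtop TM) (cdom TM i)" "\<xi> \<in> cdom TM i"
    using i T.openin_cdom[of i] by (auto simp: T.charts_at_iff)
  obtain X where X: "vfield TM (cdom TM i) X" "X \<xi> = u" by (rule T.tangent_extend[OF u i])
  obtain Y where Y: "vfield TM (cdom TM i) Y" "Y \<xi> = v" by (rule T.tangent_extend[OF v i])
  obtain Z where Z: "vfield TM (cdom TM i) Z" "Z \<xi> = w" by (rule T.tangent_extend[OF w i])
  note hor = section_on_hor_part[OF U(1) Y(1)] section_on_hor_part[OF U(1) Z(1)]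
  note vert = section_on_vert_part[OF U(1) Y(1)] section_on_vert_part[OF U(1) Z(1)]
  have "dirder TM \<xi> u (\<lambda>\<eta>. G \<eta> (Y \<eta>) (Z \<eta>)) =
      dirder TM \<xi> u (\<lambda>\<eta>. g (tbase \<eta>) (hor_part M (Y \<eta>)) (hor_part M (Z \<eta>)))
      + dirder TM \<xi> u (\<lambda>\<eta>. g (tbase \<eta>) (vert_part M nab \<eta> (Y \<eta>)) (vert_part M nab \<eta> (Z \<eta>)))"
    unfolding lift_metric_def
    by (rule T.dirder_add[OF smooth_at_metric_section[OF U hor] smooth_at_metric_section[OF U vert]])
  then show ?thesis
    using T.nabla_metric_vfield[OF U X(1) Y(1) Z(1)] parts_lift_conn[OF U(1) X(1) Y(1) U(2)]
        parts_lift_conn[OF U(1) X(1) Z(1) U(2)]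
    by (simp add: X Y Z dirder_metric_section[OF U hor u] dirder_metric_section[OF U vert u]
        lift_metric_def)
qed

context
  fixes \<xi> e
  assumes e: "orthonormal (tbase \<xi>) n e"
begin

definition lifted_basis :: "nat \<Rightarrow> 'i tvec" where
  "lifted_basis a = (if a < n then hor_vert_at M nab \<xi> (e a) 0 else hor_vert_at M nab \<xi> 0 (e (a - n)))"

lemma lifted_basis_parts:
  "a < n \<Longrightarrow> hor_part M (lifted_basis a) = e a" "a < n \<Longrightarrow> vert_part M nab \<xi> (lifted_basis a) = 0"
  "a < n \<Longrightarrow> hor_part M (lifted_basis (n + a)) = 0" "a < n \<Longrightarrow> vert_part M nab \<xi> (lifted_basis (n + a)) = e a"
  by (simp_all add: lifted_basis_def hor_part_hor_vert_at vert_part_hor_vert_at orthonormalD(1)[OF e]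
      tangent_space_zero)

context
  assumes \<xi>: "\<xi> \<in> topspace (mtop TM)"
begin

lemma lifted_basis_tangent: "a < 2 * n \<Longrightarrow> lifted_basis a \<in> tangent_space TM \<xi>"
  unfolding lifted_basis_def
  by (cases "a < n") (auto intro!: hor_vert_at_tangent[OF _ _ \<xi>] orthonormalD(1)[OF e] tangent_space_zero)

lemma orthonormal_lifted_basis: "T.orthonormal \<xi> (2 * n) lifted_basis"
proof -
  have "g (tbase \<xi>) 0 0 = 0"
    by (rule linear_at_zero[OF g_linear_left[OF tbase_in_topspace[OF \<xi>] tangent_space_zero]])
  moreover have "g (tbase \<xi>) 0 (e a) = 0" "g (tbase \<xi>) (e a) 0 = 0" if "a < n" for a
    using orthonormalD(1)[OF e that] linear_at_zero[OF g_linear_left[OF tbase_in_topspace[OF \<xi>]]]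
      linear_at_zero[OF g_linear_right[OF tbase_in_topspace[OF \<xi>]]] by blast+
  moreover have "a = n + (a - n) \<and> a - n < n" if "\<not> a < n" "a < 2 * n" for a using that by simp
  ultimately have "G \<xi> (lifted_basis a) (lifted_basis b) = (if a = b then 1 else 0)"
    if "a < 2 * n" "b < 2 * n" for a b
    using that lifted_basis_parts[of a] lifted_basis_parts[of b] lifted_basis_parts[of "a - n"]
        lifted_basis_parts[of "b - n"]
    by (cases "a < n"; cases "b < n") (auto simp: lift_metric_def orthonormalD(2)[OF e])
  then show ?thesis by (simp add: T.orthonormal_def lifted_basis_tangent)
qed

end

end

lemma trace_forms_lift:
  assumes \<xi>: "\<xi> \<in> topspace (mtop TM)" and w: "w \<in> tangent_space TM \<xi>"
  shows "T.koszul_form \<xi> w = 2 * koszul_form (tbase \<xi>) (hor_part M w)"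
    and "T.divergence_form \<xi> w = divergence_form (tbase \<xi>) (hor_part M w)"
proof -
  note p = tbase_in_topspace[OF \<xi>] and hw = hor_part_tangent[OF w \<xi>]
  obtain e where e: "orthonormal (tbase \<xi>) n e" using ex_orthonormal[OF p] ..
  let ?f = "lifted_basis \<xi> e"
  have f: "T.orthonormal \<xi> (mdim TM) ?f" using orthonormal_lifted_basis[OF e \<xi>] by simp
  note lift = nabla_metric_lift[OF \<xi>] and ft = lifted_basis_tangent[OF e \<xi>]
    and parts = lifted_basis_parts[OF e]
  note et = orthonormalD(1)[OF e] and vw = vert_part_tangent[OF w \<xi>]
  have C_zero: "C (tbase \<xi>) u v 0 = 0" "C (tbase \<xi>) u 0 v = 0" "C (tbase \<xi>) 0 u v = 0"
    if "u \<in> tangent_space M (tbase \<xi>)" "v \<in> tangent_space M (tbase \<xi>)" for u v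
    using nabla_metric_linear[OF p that] linear_at_zero by blast+
  show "T.koszul_form \<xi> w = 2 * koszul_form (tbase \<xi>) (hor_part M w)"
    unfolding T.koszul_form_eq[OF \<xi> w f] koszul_form_eq[OF p hw e] tangent_bundle_simps mult_2
        sum_lessThan_add
    by (simp add: lift ft w parts C_zero et hw tangent_space_zero)
  show "T.divergence_form \<xi> w = divergence_form (tbase \<xi>) (hor_part M w)"
    unfolding T.divergence_form_eq[OF \<xi> w f] divergence_form_eq[OF p hw e] tangent_bundle_simps mult_2
        sum_lessThan_add
    by (simp add: lift ft w parts C_zero et hw vw tangent_space_zero)
qed

lemma closed_trace_forms_lift:
  assumes "closed_form koszul_form" "closed_form divergence_form"
  shows "T.closed_form T.koszul_form" "T.closed_form T.divergence_form"
  using T.closed_form_cong[OF T.closed_form_scale[OF closed_form_pullback[OF assms(1)], of 2]]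
    T.closed_form_cong[OF closed_form_pullback[OF assms(2)]]
  by (simp_all add: trace_forms_lift)


subsection \<open>The complex structure of the tangent bundle\<close>

abbreviation "J \<equiv> lift_J M nab"

lemma lift_J_eq: "J \<xi> w = hor_vert_at M nab \<xi> (- vert_part M nab \<xi> w) (hor_part M w)"
  by (simp add: lift_J_def hor_vert_at_def hor_at_def gamma_at_def sum_negf fun_eq_iff)

context
  fixes \<xi> w
  assumes \<xi>: "\<xi> \<in> topspace (mtop TM)" and w: "w \<in> tangent_space TM \<xi>"
begin

lemma parts_lift_J: "hor_part M (J \<xi> w) = - vert_part M nab \<xi> w" "vert_part M nab \<xi> (J \<xi> w) = hor_part M w"
  unfolding lift_J_eq
  by (intro hor_part_hor_vert_at vert_part_hor_vert_at tangent_minus vert_part_tangent hor_part_tangent w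
      \<xi>)+

lemma lift_J_tangent: "J \<xi> w \<in> tangent_space TM \<xi>"
  unfolding lift_J_eq by (intro hor_vert_at_tangent tangent_minus vert_part_tangent hor_part_tangent w \<xi>)

end

lemma section_on_minus:
  assumes "openin (mtop TM) U" "section_on M U W"
  shows "section_on M U (\<lambda>\<xi>. - W \<xi>)"
  using assms by (auto simp: section_on_def tangent_minus T.smooth_at_minus)

lemma almost_complex_lift_J: "almost_complex TM J"
  unfolding almost_complex_def
proof (intro conjI ballI allI impI)
  fix \<xi> u assume \<xi>: "\<xi> \<in> topspace (mtop TM)" and u: "u \<in> tangent_space TM \<xi>"
  show "J \<xi> u \<in> tangent_space TM \<xi>" by (rule lift_J_tangent[OF \<xi> u])
  have "J \<xi> (J \<xi> u) = hor_vert_at M nab \<xi> (tscale (-1) (hor_part M u)) (tscale (-1) (vert_part M nab \<xi> u))"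
    by (simp add: lift_J_eq[of \<xi> "J \<xi> u"] parts_lift_J[OF \<xi> u])
  then show "J \<xi> (J \<xi> u) = - u" unfolding hor_vert_at_scale hor_vert_at_parts[OF u \<xi>] by simp
  have "J \<xi> (tscale c u) = hor_vert_at M nab \<xi> (tscale c (- vert_part M nab \<xi> u)) (tscale c (hor_part M u))"
    for c
    by (simp add: lift_J_eq hor_part_scale vert_part_scale)
  then show "J \<xi> (tscale c u) = tscale c (J \<xi> u)" for c unfolding hor_vert_at_scale lift_J_eq[of \<xi> u] .
  show "J \<xi> (u + v) = J \<xi> u + J \<xi> v" for v
    unfolding lift_J_eq hor_part_add vert_part_add hor_vert_at_add[symmetric] by simp
next
  fix U X assume "openin (mtop TM) U \<and> vfield TM U X"
  then have U: "openin (mtop TM) U" and X: "vfield TM U X" by auto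
  show "vfield TM U (apply_endo J X)"
    unfolding apply_endo_def lift_J_eq
    by (intro vfield_hor_vert_at U section_on_minus section_on_vert_part section_on_hor_part X)
qed

lemma parallel_lift_J: "parallel_endo TM (lift_conn M nab) J"
  unfolding parallel_endo_def
proof (intro allI impI ballI)
  fix U X Y \<xi> assume "openin (mtop TM) U \<and> vfield TM U X \<and> vfield TM U Y" and \<xi>: "\<xi> \<in> U"
  then have U: "openin (mtop TM) U" and X: "vfield TM U X" and Y: "vfield TM U Y" by auto
  note top = T.openin_imp_topspace[OF U]
  note near = pull_deriv_cong[OF eventually_nhdsinI[OF U \<xi>] top[OF \<xi>]]
  have JY: "vfield TM U (apply_endo J Y)" using almost_complex_lift_J U Y
    unfolding almost_complex_def by blast
  note nab_Y = vfield_tangent[OF T.nab_vfield[OF U X Y] \<xi>]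
  show "lift_conn M nab X (apply_endo J Y) \<xi> = J \<xi> (lift_conn M nab X Y \<xi>)"
  proof (rule lift_conn_eqI[OF U \<xi> X JY lift_J_tangent[OF top[OF \<xi>] nab_Y]])
    have "\<nabla> \<xi> (X \<xi>) (\<lambda>\<eta>. hor_part M (apply_endo J Y \<eta>)) =
        \<nabla> \<xi> (X \<xi>) (\<lambda>\<eta>. tscale (-1) (vert_part M nab \<eta> (Y \<eta>)))"
      by (rule near) (simp add: apply_endo_apply parts_lift_J[OF top vfield_tangent[OF Y]])
    also have "\<dots> = tscale (-1) (\<nabla> \<xi> (X \<xi>) (\<lambda>\<eta>. vert_part M nab \<eta> (Y \<eta>)))"
      by (simp only: pull_deriv_leibniz[OF \<xi> top[OF \<xi>] T.smooth_at_const[OF top[OF \<xi>]]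
          section_on_vert_part[OF U Y]]
          T.dirder_const tvec.scale_zero_left add_0_left)
    finally show "\<nabla> \<xi> (X \<xi>) (\<lambda>\<eta>. hor_part M (apply_endo J Y \<eta>)) = hor_part M (J \<xi> (lift_conn M nab X Y \<xi>))"
      by (simp add: parts_lift_J[OF top[OF \<xi>] nab_Y] parts_lift_conn[OF U X Y \<xi>])
    have "\<nabla> \<xi> (X \<xi>) (\<lambda>\<eta>. vert_part M nab \<eta> (apply_endo J Y \<eta>)) = \<nabla> \<xi> (X \<xi>) (\<lambda>\<eta>. hor_part M (Y \<eta>))"
      by (rule near) (simp add: apply_endo_apply parts_lift_J[OF top vfield_tangent[OF Y]])
    then show "\<nabla> \<xi> (X \<xi>) (\<lambda>\<eta>. vert_part M nab \<eta> (apply_endo J Y \<eta>)) =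
        vert_part M nab \<xi> (J \<xi> (lift_conn M nab X Y \<xi>))"
      by (simp add: parts_lift_J[OF top[OF \<xi>] nab_Y] parts_lift_conn[OF U X Y \<xi>])
  qed
qed

lemma hermitian_manifold_lift: "hermitian_manifold TM J G"
  unfolding hermitian_manifold_def
proof (intro conjI ballI smooth_manifold_TM riemannian_lift_metric)
  show "complex_structure TM J"
    by (rule T.parallel_imp_complex_structure[OF almost_complex_lift_J parallel_lift_J])
  fix \<xi> u v assume \<xi>: "\<xi> \<in> topspace (mtop TM)" and u: "u \<in> tangent_space TM \<xi>"
    and v: "v \<in> tangent_space TM \<xi>"
  note p = tbase_in_topspace[OF \<xi>] and vert = vert_part_tangent[OF u \<xi>] vert_part_tangent[OF v \<xi>]
  show "G \<xi> (J \<xi> u) (J \<xi> v) = G \<xi> u v"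
    by (simp add: lift_metric_def parts_lift_J[OF \<xi>] u v linear_at_minus[OF g_linear_left[OF p]]
        linear_at_minus[OF g_linear_right[OF p]] vert tangent_minus)
qed

sublocale T: parallel_hermitian_mfd "tangent_bundle M" "lift_conn M nab" "lift_metric M nab g"
"lift_J M nab"
  by unfold_locales (rule hermitian_manifold_lift, rule parallel_lift_J)

end


section \<open>The canonical sequence\<close>

definition closed_trace_forms :: "('p, 'i) manifold \<Rightarrow> ('p, 'i) conn \<Rightarrow> ('p, 'i) metric \<Rightarrow> bool" where
  "closed_trace_forms M nab g \<longleftrightarrow> affine_riemann_manifold M nab g \<and>
     smooth_mfd.closed_form M (affine_metric_mfd.koszul_form M nab g) \<and>
     smooth_mfd.closed_form M (affine_metric_mfd.divergence_form M nab g)"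

lemma parallel_difference_imp_closed_trace_forms:
  assumes M: "affine_riemann_manifold M nab g" and "levi_civita M g D"
    and "parallel_21 M D (difference_tensor D nab)"
  shows "closed_trace_forms M nab g"
proof -
  interpret parallel_difference_mfd M nab D g
    by unfold_locales (use assms in \<open>simp_all add: affine_riemann_manifold_def levi_civita_def\<close>)
  show ?thesis using M closed_trace_forms by (simp add: closed_trace_forms_def)
qed

lemma
  assumes "closed_trace_forms M nab g"
  shows closed_trace_forms_tangent_bundle:
      "closed_trace_forms (tangent_bundle M) (lift_conn M nab) (lift_metric M nab g)"
    and tangent_bundle_locally_conformally_balanced:
      "locally_conformally_balanced (tangent_bundle M) (lift_J M nab) (lift_metric M nab g)"
proof -
  have closed: "smooth_mfd.closed_form M (affine_metric_mfd.koszul_form M nab g)"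
    "smooth_mfd.closed_form M (affine_metric_mfd.divergence_form M nab g)"
    using assms by (simp_all add: closed_trace_forms_def)
  interpret tangent_bundle_metric M nab g
    by unfold_locales (use assms in \<open>simp_all add: closed_trace_forms_def affine_riemann_manifold_def\<close>)
  note closed_lift = closed_trace_forms_lift[OF closed]
  show "closed_trace_forms (tangent_bundle M) (lift_conn M nab) (lift_metric M nab g)"
    using closed_lift smooth_manifold_TM T.connection flat_lift_conn torsionless_lift_conn
        riemannian_lift_metric
    by (simp add: closed_trace_forms_def affine_riemann_manifold_def)
  show "locally_conformally_balanced (tangent_bundle M) (lift_J M nab) (lift_metric M nab g)"
    by (rule T.closed_trace_forms_imp_balanced[OF closed_lift])
qed

theorem proposition7p1:
  fixes M :: "('a, 'i) tmanifold"
    and nab D :: "('a, 'i) tconn"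
    and g :: "('a, 'i) tmetric"
  assumes "affine_riemann_manifold M nab g"
    and "levi_civita M g D"
    and "parallel_21 M D (difference_tensor D nab)"
  shows "\<forall>k\<ge>1. locally_conformally_balanced
           (iter_tangent M k) (iter_J M nab k) (iter_metric M nab g k)"
proof (intro allI impI)
  have closed: "closed_trace_forms (iter_tangent M k) (iter_conn M nab k) (iter_metric M nab g k)" for k
    by (induction k)
       (simp_all add: parallel_difference_imp_closed_trace_forms[OF assms]
       closed_trace_forms_tangent_bundle)
  fix k :: nat assume "k \<ge> 1"
  then obtain l where k: "k = Suc l" by (cases k) simp_all
  show "locally_conformally_balanced (iter_tangent M k) (iter_J M nab k) (iter_metric M nab g k)"
    unfolding k using tangent_bundle_locally_conformally_balanced[OF closed[of l]] by (simp add: iter_J_def)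
qed

end
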